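(* Let $\Delta$ be a tropical surface which is locally connected through codimension~$1$. Then the $\mathbb R$-span of the image of $H^0(\Delta, \mathcal{D})$ in $H^1(\Delta, \mathbb R)$ has codimension at most~$1$. Moreover, if there exists a divisor on~$\Delta$ with positive self-intersection, then the $\mathbb R$-span is all of $H^1(\Delta, \mathbb R)$.
   Context: A weak tropical surface $\Delta$ is a finite connected $\Delta$-complex of dimension at most $2$ with integers $\alpha(v,e)$ for endpoints $v$ of edges $e$ satisfying $\alpha(v,e)+\alpha(w,e)=\#\operatorname{link}_\Delta(e)$ for endpoints $v,w$ of $e$. Its local intersection matrix $M_v$ at a vertex $v$ is indexed by vertices of $\operatorname{link}_\Delta(v)$, with off-diagonal entries the number of edges between the two link vertices and diagonal entry $-\alpha(w,e)+2\cdot\#\{\text{loops}\}$ at the link vertex corresponding to $e$ ($w$ the other endpoint of $e$). It is a tropical surface if every $M_v$ has exactly one positive eigenvalue, and locally connected through codimension $1$ if every vertex link is connected. PL functions are continuous, piecewise linear with integral slopes on facets identified with unimodular simplices; each has a divisor (formal sum of segments), and linear functions are PL functions with trivial divisor. Let $\mathcal A$ be the sheaf of linear functions, $\mathbb R$ the sheaf of locally constant real functions and $\mathcal{D}=\mathcal A/\mathbb R$; the map $H^0(\Delta,\mathcal{D})\to H^1(\Delta,\mathbb R)$ is the connecting map of the long exact cohomology sequence of $0\to\mathbb R\to\mathcal A\to\mathcal{D}\to 0$. Divisors are formal sums of segments locally equal to a rational multiple of the divisor of a PL function; self-intersection is the degree of $D\cdot D$, computed locally as the sum over segments of $D$ of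 coefficient times outgoing slope of a local defining function of $D$. *)

theory Defs
  imports
    "HOL-Analysis.Analysis"
    "HOL-Library.Function_Algebras"
    "HOL-Library.Extended_Nat"
    "HOL-Library.Poly_Mapping"
    "Jordan_Normal_Form.Char_Poly"
begin

section \<open>Real-valued functions as a real vector space\<close>

instantiation "fun" :: (type, real_vector) real_vector
begin

definition scaleR_fun_def: "r *\<^sub>R f = (\<lambda>x. r *\<^sub>R f x)"

instance
  by standard
    (simp_all add: scaleR_fun_def fun_eq_iff scaleR_add_right scaleR_add_left)

end

section \<open>First cohomology and quotient sheaves\<close>

text \<open>
  All sheaves occurring here are sheaves of real-valued functions. A section over an open set
  is represented by a total function whose values outside of the open set are irrelevant.
\<close>

definition locally_constant_on :: "'p topology \<Rightarrow> 'p set \<Rightarrow> ('p \<Rightarrow> real) \<Rightarrow> bool" where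
  "locally_constant_on X W g \<longleftrightarrow>
     (\<forall>z\<in>W. \<exists>V. openin X V \<and> z \<in> V \<and> (\<forall>y\<in>V \<inter> W. g y = g z))"

text \<open>
  Open covers indexed by the points of the space, the member with index \<open>x\<close> containing \<open>x\<close>.
  Every open cover is refined by such a cover, so these suffice for computing Cech cohomology
  as a colimit over all open covers.
\<close>

definition pointed_cover :: "'p topology \<Rightarrow> ('p \<Rightarrow> 'p set) \<Rightarrow> bool" where
  "pointed_cover X U \<longleftrightarrow> (\<forall>x\<in>topspace X. openin X (U x) \<and> x \<in> U x)"

text \<open>
  Cech 1-cocycles and 1-coboundaries with values in the constant sheaf, for an unspecified
  pointed cover: \<open>c x y\<close> is the component of the cochain on \<open>U x \<inter> U y\<close>.
  The colimit of the groups $H^1(U, \mathbb R)$ over all pointed covers, which is the sheaf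
  cohomology group $H^1(X, \mathbb R)$, is the quotient of the vector space of all cocycles by
  that of all coboundaries: cocycles that agree on some common refinement differ by a
  coboundary, because a cochain that vanishes on some pointed cover is a coboundary.
\<close>

definition cech_Z1 :: "'p topology \<Rightarrow> ('p \<Rightarrow> 'p \<Rightarrow> 'p \<Rightarrow> real) set" where
  "cech_Z1 X = {c. \<exists>U. pointed_cover X U \<and>
     (\<forall>x\<in>topspace X. \<forall>y\<in>topspace X. locally_constant_on X (U x \<inter> U y) (c x y)) \<and>
     (\<forall>x\<in>topspace X. \<forall>y\<in>topspace X. \<forall>w\<in>topspace X. \<forall>z\<in>U x \<inter> U y \<inter> U w.
        c x y z + c y w z = c x w z)}"

definition cech_B1 :: "'p topology \<Rightarrow> ('p \<Rightarrow> 'p \<Rightarrow> 'p \<Rightarrow> real) set" where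
  "cech_B1 X = {c. \<exists>U b. pointed_cover X U \<and>
     (\<forall>x\<in>topspace X. locally_constant_on X (U x) (b x)) \<and>
     (\<forall>x\<in>topspace X. \<forall>y\<in>topspace X. \<forall>z\<in>U x \<inter> U y. c x y z = b y z - b x z)}"

definition cech_class ::
    "'p topology \<Rightarrow> ('p \<Rightarrow> 'p \<Rightarrow> 'p \<Rightarrow> real) \<Rightarrow> ('p \<Rightarrow> 'p \<Rightarrow> 'p \<Rightarrow> real) set" where
  "cech_class X c = {c' \<in> cech_Z1 X. c' - c \<in> cech_B1 X}"

definition H1 :: "'p topology \<Rightarrow> ('p \<Rightarrow> 'p \<Rightarrow> 'p \<Rightarrow> real) set set" where
  "H1 X = cech_class X ` cech_Z1 X"

text \<open>The span of a set of classes consists of the classes of all real linear combinations of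
  representatives.\<close>

definition H1_span ::
    "'p topology \<Rightarrow> ('p \<Rightarrow> 'p \<Rightarrow> 'p \<Rightarrow> real) set set \<Rightarrow> ('p \<Rightarrow> 'p \<Rightarrow> 'p \<Rightarrow> real) set set" where
  "H1_span X \<Gamma> = cech_class X ` span (\<Union>\<Gamma>)"

text \<open>Codimension of a subspace: the least number of classes that span \<^term>\<open>H1 X\<close> together
  with the subspace, i.e. the dimension of the quotient (\<open>\<infinity>\<close> if there is no finite number).\<close>

definition H1_codim :: "'p topology \<Rightarrow> ('p \<Rightarrow> 'p \<Rightarrow> 'p \<Rightarrow> real) set set \<Rightarrow> enat" where
  "H1_codim X W = (INF T\<in>{T. T \<subseteq> H1 X \<and> finite T \<and> H1_span X (W \<union> T) = H1 X}. enat (card T))"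

text \<open>
  Let \<open>F\<close> be a sheaf of real functions that contains the locally constant ones. The stalk of the
  quotient sheaf of \<open>F\<close> by the locally constant functions at \<open>x\<close> consists of the classes of pairs
  \<open>(U, f)\<close>, with \<open>f\<close> a section of \<open>F\<close> over the open neighbourhood \<open>U\<close> of \<open>x\<close>, modulo locally
  constant functions near \<open>x\<close>. A global section of the quotient sheaf is a choice of an element in
  every stalk that is locally induced by sections of \<open>F\<close>.
\<close>

definition quotient_germ ::
    "'p topology \<Rightarrow> ('p set \<Rightarrow> ('p \<Rightarrow> real) set) \<Rightarrow> 'p set \<Rightarrow> ('p \<Rightarrow> real) \<Rightarrow> 'p
      \<Rightarrow> ('p set \<times> ('p \<Rightarrow> real)) set" where
  "quotient_germ X F U f x = {(V, g). openin X V \<and> x \<in> V \<and> g \<in> F V \<and>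
     (\<exists>W. openin X W \<and> x \<in> W \<and> W \<subseteq> U \<inter> V \<and> locally_constant_on X W (\<lambda>y. g y - f y))}"

definition quotient_global_sections ::
    "'p topology \<Rightarrow> ('p set \<Rightarrow> ('p \<Rightarrow> real) set) \<Rightarrow> ('p \<Rightarrow> ('p set \<times> ('p \<Rightarrow> real)) set) set" where
  "quotient_global_sections X F = {s.
     (\<forall>x\<in>topspace X. \<exists>U f. openin X U \<and> x \<in> U \<and> f \<in> F U \<and>
        (\<forall>y\<in>U. s y = quotient_germ X F U f y)) \<and>
     (\<forall>x. x \<notin> topspace X \<longrightarrow> s x = {})}"

text \<open>The connecting homomorphism: lift a section of the quotient locally to sections \<open>f x\<close> of
  \<open>F\<close> on an open cover; the differences of the lifts form a cocycle of locally constant functions,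
  whose class does not depend on choices.\<close>

definition connecting_map ::
    "'p topology \<Rightarrow> ('p set \<Rightarrow> ('p \<Rightarrow> real) set) \<Rightarrow> ('p \<Rightarrow> ('p set \<times> ('p \<Rightarrow> real)) set)
      \<Rightarrow> ('p \<Rightarrow> 'p \<Rightarrow> 'p \<Rightarrow> real) set" where
  "connecting_map X F s = (THE \<gamma>. \<exists>U f. pointed_cover X U \<and>
     (\<forall>x\<in>topspace X. f x \<in> F (U x) \<and> (\<forall>y\<in>U x. s y = quotient_germ X F (U x) (f x) y)) \<and>
     \<gamma> = cech_class X (\<lambda>x y z. f y z - f x z))"

section \<open>Weak tropical surfaces\<close>

text \<open>
  Combinatorial data of a 2-dimensional \<open>\<Delta>\<close>-complex. An edge \<open>e\<close> is ordered; it has the two ends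
  \<open>(e, False)\<close> (its tail) and \<open>(e, True)\<close> (its head), which lie at the vertices \<open>endpt S e False\<close>
  and \<open>endpt S e True\<close>. The ends are distinguished even if \<open>e\<close> is a loop, and \<open>alpha S e b\<close>
  is the structure constant $\alpha(v,e)$ for $v$ the end \<open>(e, b)\<close>.
  A triangle \<open>f\<close> has ordered vertices 0, 1, 2, and \<open>face S f i\<close> is its edge opposite to vertex
  \<open>i < 3\<close>, ordered compatibly.
\<close>

record ('v, 'e, 'f) surface_data =
  verts :: "'v set"
  edges :: "'e set"
  tris :: "'f set"
  endpt :: "'e \<Rightarrow> bool \<Rightarrow> 'v"
  face :: "'f \<Rightarrow> nat \<Rightarrow> 'e"
  alpha :: "'e \<Rightarrow> bool \<Rightarrow> int"

text \<open>The two edge ends that meet in the corner of a triangle at its vertex \<open>i\<close>.\<close>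

definition corner :: "('v,'e,'f) surface_data \<Rightarrow> 'f \<Rightarrow> nat \<Rightarrow> ('e \<times> bool) \<times> ('e \<times> bool)" where
  "corner S f i =
     (if i = 0 then ((face S f 2, False), (face S f 1, False))
      else if i = 1 then ((face S f 2, True), (face S f 0, False))
      else ((face S f 1, True), (face S f 0, True)))"

definition end_vertex :: "('v,'e,'f) surface_data \<Rightarrow> 'e \<times> bool \<Rightarrow> 'v" where
  "end_vertex S x = endpt S (fst x) (snd x)"

text \<open>The last condition states the simplicial identities of a \<open>\<Delta>\<close>-complex.\<close>

definition finite_delta_complex :: "('v,'e,'f) surface_data \<Rightarrow> bool" where
  "finite_delta_complex S \<longleftrightarrow>
     finite (verts S) \<and> finite (edges S) \<and> finite (tris S) \<and>
     (\<forall>e\<in>edges S. \<forall>b. endpt S e b \<in> verts S) \<and>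
     (\<forall>f\<in>tris S. \<forall>i<3. face S f i \<in> edges S) \<and>
     (\<forall>f\<in>tris S. \<forall>i<3. end_vertex S (fst (corner S f i)) = end_vertex S (snd (corner S f i)))"

text \<open>Geometric realization: points are recorded by the open cell that contains them, and the
  topology is the final one with respect to the characteristic maps of the cells. Edges are
  modelled on the unit interval and triangles on the standard unimodular triangle in the plane,
  with vertices 0, 1, 2 at \<open>(0,0)\<close>, \<open>(1,0)\<close>, \<open>(0,1)\<close>.\<close>

datatype ('v, 'e, 'f) point = VPoint 'v | EPoint 'e real | TPoint 'f "real \<times> real"

definition std_triangle :: "(real \<times> real) set" where
  "std_triangle = {(s, t). 0 \<le> s \<and> 0 \<le> t \<and> s + t \<le> 1}"

definition edge_map :: "('v,'e,'f) surface_data \<Rightarrow> 'e \<Rightarrow> real \<Rightarrow> ('v,'e,'f) point" where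
  "edge_map S e t =
     (if t = 0 then VPoint (endpt S e False)
      else if t = 1 then VPoint (endpt S e True)
      else EPoint e t)"

definition tri_map :: "('v,'e,'f) surface_data \<Rightarrow> 'f \<Rightarrow> real \<times> real \<Rightarrow> ('v,'e,'f) point" where
  "tri_map S f x =
     (if snd x = 0 then edge_map S (face S f 2) (fst x)
      else if fst x = 0 then edge_map S (face S f 1) (snd x)
      else if fst x + snd x = 1 then edge_map S (face S f 0) (snd x)
      else TPoint f x)"

definition points :: "('v,'e,'f) surface_data \<Rightarrow> ('v,'e,'f) point set" where
  "points S = VPoint ` verts S \<union> (\<Union>e\<in>edges S. edge_map S e ` {0..1})
     \<union> (\<Union>f\<in>tris S. tri_map S f ` std_triangle)"

definition realization_open :: "('v,'e,'f) surface_data \<Rightarrow> ('v,'e,'f) point set \<Rightarrow> bool" where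
  "realization_open S U \<longleftrightarrow> U \<subseteq> points S \<and>
     (\<forall>e\<in>edges S. openin (top_of_set {0..1}) {t \<in> {0..1}. edge_map S e t \<in> U}) \<and>
     (\<forall>f\<in>tris S. openin (top_of_set std_triangle) {x \<in> std_triangle. tri_map S f x \<in> U})"

definition realization :: "('v,'e,'f) surface_data \<Rightarrow> ('v,'e,'f) point topology" where
  "realization S = topology (realization_open S)"

lemma istopology_realization_open: "istopology (realization_open S)"
proof -
  have Int_eq: "{x \<in> A. h x \<in> U \<inter> V} = {x \<in> A. h x \<in> U} \<inter> {x \<in> A. h x \<in> V}"
    for A :: "'x set" and h :: "'x \<Rightarrow> ('a,'b,'c) point" and U V by auto
  have Union_eq: "{x \<in> A. h x \<in> \<Union>\<U>} = \<Union>((\<lambda>U. {x \<in> A. h x \<in> U}) ` \<U>)"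
    for A :: "'x set" and h :: "'x \<Rightarrow> ('a,'b,'c) point" and \<U> by auto
  have "realization_open S (U \<inter> V)" if "realization_open S U" "realization_open S V" for U V
    unfolding realization_open_def Int_eq
  proof (intro conjI ballI openin_Int)
    show "U \<inter> V \<subseteq> points S" using that unfolding realization_open_def by blast
  qed (use that in \<open>unfold realization_open_def, blast\<close>)+
  moreover have "realization_open S (\<Union>\<U>)" if "\<forall>U\<in>\<U>. realization_open S U" for \<U>
    unfolding realization_open_def Union_eq
  proof (intro conjI ballI openin_Union)
    show "\<Union>\<U> \<subseteq> points S" using that unfolding realization_open_def by blast
  qed (use that in \<open>unfold realization_open_def, blast\<close>)+
  ultimately show ?thesis unfolding istopology_def by blast
qed

lemma openin_realization: "openin (realization S) U \<longleftrightarrow> realization_open S U"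
  unfolding realization_def by (simp add: istopology_realization_open topology_inverse')

lemma topspace_realization [simp]: "topspace (realization S) = points S"
proof
  show "topspace (realization S) \<subseteq> points S"
    using openin_topspace[of "realization S"]
    unfolding openin_realization realization_open_def by blast
  have "edge_map S e t \<in> points S" if "e \<in> edges S" "t \<in> {0..1}" for e t
    using that unfolding points_def by blast
  then have e: "{t \<in> {0..1}. edge_map S e t \<in> points S} = {0..1}" if "e \<in> edges S" for e
    using that by blast
  have "tri_map S f x \<in> points S" if "f \<in> tris S" "x \<in> std_triangle" for f x
    using that unfolding points_def by blast
  then have f: "{x \<in> std_triangle. tri_map S f x \<in> points S} = std_triangle" if "f \<in> tris S" for f
    using that by blast
  have "openin (realization S) (points S)"
    unfolding openin_realization realization_open_def
    using openin_topspace[of "top_of_set {0..1::real}"] openin_topspace[of "top_of_set std_triangle"]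
    by (intro conjI ballI order_refl) (simp_all only: e f topspace_euclidean_subtopology)
  then show "points S \<subseteq> topspace (realization S)" by (rule openin_subset)
qed

text \<open>The link of an edge: pairs \<open>(f, i)\<close> such that \<open>e\<close> is the face of \<open>f\<close> opposite to vertex \<open>i\<close>,
  so a triangle is counted once for each of its sides glued to \<open>e\<close>.\<close>

definition edge_link :: "('v,'e,'f) surface_data \<Rightarrow> 'e \<Rightarrow> ('f \<times> nat) set" where
  "edge_link S e = {(f, i). f \<in> tris S \<and> i < 3 \<and> face S f i = e}"

definition weak_tropical_surface :: "('v,'e,'f) surface_data \<Rightarrow> bool" where
  "weak_tropical_surface S \<longleftrightarrow>
     finite_delta_complex S \<and> connected_space (realization S) \<and>
     (\<forall>e\<in>edges S. alpha S e False + alpha S e True = int (card (edge_link S e)))"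

text \<open>The link of a vertex is a multigraph with loops. Its vertices are the edge ends at \<open>v\<close>, and
  its edges are the triangle corners at \<open>v\<close>.\<close>

definition link_verts :: "('v,'e,'f) surface_data \<Rightarrow> 'v \<Rightarrow> ('e \<times> bool) set" where
  "link_verts S v = {x. fst x \<in> edges S \<and> end_vertex S x = v}"

definition link_edges :: "('v,'e,'f) surface_data \<Rightarrow> 'v \<Rightarrow> ('f \<times> nat) set" where
  "link_edges S v = {(f, i). f \<in> tris S \<and> i < 3 \<and> end_vertex S (fst (corner S f i)) = v}"

definition link_edges_between ::
    "('v,'e,'f) surface_data \<Rightarrow> 'v \<Rightarrow> 'e \<times> bool \<Rightarrow> 'e \<times> bool \<Rightarrow> ('f \<times> nat) set" where
  "link_edges_between S v x y =
     {(f, i) \<in> link_edges S v. {fst (corner S f i), snd (corner S f i)} = {x, y}}"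

definition link_connected :: "('v,'e,'f) surface_data \<Rightarrow> 'v \<Rightarrow> bool" where
  "link_connected S v \<longleftrightarrow>
     (\<forall>x\<in>link_verts S v. \<forall>y\<in>link_verts S v. (x, y) \<in> {(x, y). link_edges_between S v x y \<noteq> {}}\<^sup>*)"

definition locally_connected_through_codim_1 :: "('v,'e,'f) surface_data \<Rightarrow> bool" where
  "locally_connected_through_codim_1 S \<longleftrightarrow> (\<forall>v\<in>verts S. link_connected S v)"

definition local_intersection_entry ::
    "('v,'e,'f) surface_data \<Rightarrow> 'v \<Rightarrow> 'e \<times> bool \<Rightarrow> 'e \<times> bool \<Rightarrow> int" where
  "local_intersection_entry S v x y =
     (if x = y
      then - alpha S (fst x) (\<not> snd x) + 2 * int (card (link_edges_between S v x x))
      else int (card (link_edges_between S v x y)))"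

text \<open>An arbitrary enumeration of the link vertices is used to write the local intersection matrix
  as a matrix indexed by numbers; its characteristic polynomial does not depend on it.\<close>

definition link_enum :: "('v,'e,'f) surface_data \<Rightarrow> 'v \<Rightarrow> ('e \<times> bool) list" where
  "link_enum S v = (SOME l. distinct l \<and> set l = link_verts S v)"

definition local_intersection_matrix :: "('v,'e,'f) surface_data \<Rightarrow> 'v \<Rightarrow> real mat" where
  "local_intersection_matrix S v =
     Matrix.mat (length (link_enum S v)) (length (link_enum S v))
       (\<lambda>(i, j). of_int (local_intersection_entry S v (link_enum S v ! i) (link_enum S v ! j)))"

text \<open>Eigenvalues are counted with multiplicity.\<close>

definition num_positive_eigenvalues :: "real mat \<Rightarrow> nat" where
  "num_positive_eigenvalues A =
     (\<Sum>k\<in>{k. eigenvalue A k \<and> k > 0}. Polynomial.order k (char_poly A))"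

definition tropical_surface :: "('v,'e,'f) surface_data \<Rightarrow> bool" where
  "tropical_surface S \<longleftrightarrow> weak_tropical_surface S \<and>
     (\<forall>v\<in>verts S. num_positive_eigenvalues (local_intersection_matrix S v) = 1)"

section \<open>PL functions and their divisors\<close>

definition affine_function :: "('a::euclidean_space \<Rightarrow> real) \<Rightarrow> bool" where
  "affine_function L \<longleftrightarrow> (\<exists>c g. L = (\<lambda>x. c + g \<bullet> x))"

definition integral_affine_function :: "('a::euclidean_space \<Rightarrow> real) \<Rightarrow> bool" where
  "integral_affine_function L \<longleftrightarrow> (\<exists>c g. (\<forall>b\<in>Basis. g \<bullet> b \<in> \<int>) \<and> L = (\<lambda>x. c + g \<bullet> x))"

text \<open>Near \<open>x\<close>, the function \<open>h\<close> on \<open>A\<close> is affine with integral slopes on each of finitely many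
  polyhedral pieces.\<close>

definition integral_PL_at :: "'a::euclidean_space set \<Rightarrow> ('a \<Rightarrow> real) \<Rightarrow> 'a \<Rightarrow> bool" where
  "integral_PL_at A h x \<longleftrightarrow>
     (\<exists>N \<P>. open N \<and> x \<in> N \<and> finite \<P> \<and> A \<inter> N \<subseteq> \<Union>\<P> \<and>
        (\<forall>P\<in>\<P>. polyhedron P \<and>
           (\<exists>L. integral_affine_function L \<and> (\<forall>y\<in>P \<inter> A \<inter> N. h y = L y))))"

definition PL_on ::
    "('v,'e,'f) surface_data \<Rightarrow> ('v,'e,'f) point set \<Rightarrow> (('v,'e,'f) point \<Rightarrow> real) \<Rightarrow> bool" where
  "PL_on S U \<phi> \<longleftrightarrow>
     continuous_map (subtopology (realization S) U) euclideanreal \<phi> \<and>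
     (\<forall>e\<in>edges S. \<forall>t\<in>{0..1}. edge_map S e t \<in> U \<longrightarrow>
        integral_PL_at {0..1} (\<lambda>t. \<phi> (edge_map S e t)) t) \<and>
     (\<forall>f\<in>tris S. \<forall>x\<in>std_triangle. tri_map S f x \<in> U \<longrightarrow>
        integral_PL_at std_triangle (\<lambda>x. \<phi> (tri_map S f x)) x)"

definition tri_vertex :: "nat \<Rightarrow> real \<times> real" where
  "tri_vertex i = (if i = 0 then (0, 0) else if i = 1 then (1, 0) else (0, 1))"

text \<open>The point with parameter \<open>t\<close> on the side of the standard triangle opposite to vertex \<open>i\<close>.\<close>

definition side_point :: "nat \<Rightarrow> real \<Rightarrow> real \<times> real" where
  "side_point i t =
     (1 - t) *\<^sub>R tri_vertex (if i = 0 then 1 else 0) + t *\<^sub>R tri_vertex (if i = 2 then 1 else 2)"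

text \<open>
  \<open>div_mult S \<phi> p m\<close>: the divisor of the PL function \<open>\<phi>\<close> has multiplicity \<open>m\<close> at the point \<open>p\<close>.
  This holds for some, unique, \<open>m\<close> at all \<open>p\<close> outside of a discrete set, and for no \<open>m\<close> at the
  others (such as the vertices of \<open>S\<close>, and the points in open triangles where \<open>\<phi>\<close> bends along more
  than one line).

  In an open triangle, \<open>\<phi>\<close> is affine on both sides of a rational line through \<open>p\<close> (any line if
  there is no bend) with primitive direction \<open>d\<close>, which is completed to a lattice basis by \<open>w\<close>. The
  multiplicity is the sum of the slopes outgoing from the line, with respect to this basis.

  On an open edge \<open>e\<close>, \<open>\<phi>\<close> is affine near \<open>p\<close> in each triangle \<open>(f, i)\<close> containing \<open>e\<close>. Let \<open>K\<close> and
  \<open>L (f, i)\<close> denote its affine extensions to \<open>e\<close> and to the triangles. The multiplicity is the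
  sum of the values at the link vertices, minus the $\alpha$-weighted values at the endpoints of \<open>e\<close>.
\<close>

fun div_mult ::
    "('v,'e,'f) surface_data \<Rightarrow> (('v,'e,'f) point \<Rightarrow> real) \<Rightarrow> ('v,'e,'f) point \<Rightarrow> real \<Rightarrow> bool" where
  "div_mult S \<phi> (VPoint v) m \<longleftrightarrow> False"
| "div_mult S \<phi> (EPoint e t) m \<longleftrightarrow>
     (\<exists>K L. affine_function K \<and> (\<forall>\<^sub>F s in nhds t. \<phi> (edge_map S e s) = K s) \<and>
        (\<forall>(f, i)\<in>edge_link S e. affine_function (L (f, i)) \<and>
           (\<exists>N. open N \<and> side_point i t \<in> N \<and>
              (\<forall>x\<in>std_triangle \<inter> N. \<phi> (tri_map S f x) = L (f, i) x))) \<and>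
        m = (\<Sum>(f, i)\<in>edge_link S e. L (f, i) (tri_vertex i))
             - of_int (alpha S e False) * K 0 - of_int (alpha S e True) * K 1)"
| "div_mult S \<phi> (TPoint f p) m \<longleftrightarrow>
     (\<exists>(d1::int) (d2::int) (w1::int) (w2::int) c a b b'. d1 * w2 - d2 * w1 = 1 \<and>
        (\<forall>\<^sub>F (x, y) in nhds (0, 0).
           \<phi> (tri_map S f (p + x *\<^sub>R (of_int d1, of_int d2) + y *\<^sub>R (of_int w1, of_int w2)))
             = c + a * x + (if 0 \<le> y then b * y else b' * (- y))) \<and>
        m = b + b')"

text \<open>The sheaf of linear functions: PL functions with trivial divisor.\<close>

definition linear_functions ::
    "('v,'e,'f) surface_data \<Rightarrow> ('v,'e,'f) point set \<Rightarrow> (('v,'e,'f) point \<Rightarrow> real) set" where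
  "linear_functions S U = {\<phi>. PL_on S U \<phi> \<and> (\<forall>p\<in>U. \<forall>m. div_mult S \<phi> p m \<longrightarrow> m = 0)}"

section \<open>Divisors and self-intersection\<close>

text \<open>Segments in an edge or a triangle, given by their endpoints in the model cell. A formal sum
  of segments is a finitely supported function on them. The sums are considered up to subdivision,
  i.e. through their weights at all but finitely many points.\<close>

datatype ('e, 'f) segment = ESegment 'e real real | TSegment 'f "real \<times> real" "real \<times> real"

fun segment_path ::
    "('v,'e,'f) surface_data \<Rightarrow> ('e,'f) segment \<Rightarrow> real \<Rightarrow> ('v,'e,'f) point" where
  "segment_path S (ESegment e a b) \<tau> = edge_map S e ((1 - \<tau>) * a + \<tau> * b)"
| "segment_path S (TSegment f a b) \<tau> = tri_map S f ((1 - \<tau>) *\<^sub>R a + \<tau> *\<^sub>R b)"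

text \<open>The factor of a nonzero vector of rational slope over its primitive lattice vector.\<close>

definition lattice_length :: "real \<times> real \<Rightarrow> real" where
  "lattice_length u =
     (THE l. l > 0 \<and> (\<exists>m n::int. coprime m n \<and> u = l *\<^sub>R (of_int m, of_int n)))"

fun segment_length :: "('e,'f) segment \<Rightarrow> real" where
  "segment_length (ESegment e a b) = \<bar>b - a\<bar>"
| "segment_length (TSegment f a b) = lattice_length (b - a)"

fun valid_segment :: "('v,'e,'f) surface_data \<Rightarrow> ('e,'f) segment \<Rightarrow> bool" where
  "valid_segment S (ESegment e a b) \<longleftrightarrow> e \<in> edges S \<and> a \<in> {0..1} \<and> b \<in> {0..1} \<and> a \<noteq> b"
| "valid_segment S (TSegment f a b) \<longleftrightarrow>
     f \<in> tris S \<and> a \<in> std_triangle \<and> b \<in> std_triangle \<and> a \<noteq> b \<and>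
     (\<exists>l. \<exists>m n::int. b - a = l *\<^sub>R (of_int m, of_int n))"

text \<open>Coefficients are real; those of a divisor are rational, after combining overlapping segments,
  because of its local equations.\<close>

type_synonym ('e, 'f) segment_sum = "('e, 'f) segment \<Rightarrow>\<^sub>0 real"

definition weight ::
    "('v,'e,'f) surface_data \<Rightarrow> ('e,'f) segment_sum \<Rightarrow> ('v,'e,'f) point \<Rightarrow> real" where
  "weight S D p =
     (\<Sum>\<sigma>\<in>{\<sigma> \<in> Poly_Mapping.keys D. p \<in> segment_path S \<sigma> ` {0..1}}. Poly_Mapping.lookup D \<sigma>)"

text \<open>\<open>\<psi>\<close> is a rational multiple of a PL function, whose divisor near \<open>p\<close>, multiplied by the same
  factor, is \<open>D\<close>.\<close>

definition local_equation ::
    "('v,'e,'f) surface_data \<Rightarrow> ('e,'f) segment_sum \<Rightarrow> ('v,'e,'f) point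
      \<Rightarrow> (('v,'e,'f) point \<Rightarrow> real) \<Rightarrow> bool" where
  "local_equation S D p \<psi> \<longleftrightarrow>
     (\<exists>U \<phi> q E. openin (realization S) U \<and> p \<in> U \<and> PL_on S U \<phi> \<and> q \<in> \<rat> \<and>
        \<psi> = (\<lambda>x. q * \<phi> x) \<and> finite E \<and>
        (\<forall>x\<in>U - E. \<forall>m. div_mult S \<phi> x m \<longrightarrow> weight S D x = q * m))"

definition is_divisor :: "('v,'e,'f) surface_data \<Rightarrow> ('e,'f) segment_sum \<Rightarrow> bool" where
  "is_divisor S D \<longleftrightarrow> (\<forall>\<sigma>\<in>Poly_Mapping.keys D. valid_segment S \<sigma>) \<and>
     (\<forall>p\<in>points S. \<exists>\<psi>. local_equation S D p \<psi>)"

text \<open>Slope of \<open>\<psi>\<close> along \<open>\<sigma>\<close>, with respect to lattice length, outgoing from parameter \<open>\<tau>\<close> in the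
  forward (\<open>\<epsilon> = 1\<close>) or backward (\<open>\<epsilon> = -1\<close>) direction.\<close>

definition outgoing_slope ::
    "('v,'e,'f) surface_data \<Rightarrow> (('v,'e,'f) point \<Rightarrow> real) \<Rightarrow> ('e,'f) segment \<Rightarrow> real \<Rightarrow> real
      \<Rightarrow> real" where
  "outgoing_slope S \<psi> \<sigma> \<tau> \<epsilon> =
     Lim (at_right 0) (\<lambda>h. (\<psi> (segment_path S \<sigma> (\<tau> + \<epsilon> * h)) - \<psi> (segment_path S \<sigma> \<tau>))
                              / (h * segment_length \<sigma>))"

text \<open>Coefficient at \<open>p\<close> of the intersection of \<open>D\<close> with the divisor of \<open>\<psi>\<close>. A segment that passes
  through \<open>p\<close> contributes both of its directions at \<open>p\<close>, and one that starts or ends at \<open>p\<close>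
  contributes one.\<close>

definition local_intersection_degree ::
    "('v,'e,'f) surface_data \<Rightarrow> ('e,'f) segment_sum \<Rightarrow> (('v,'e,'f) point \<Rightarrow> real)
      \<Rightarrow> ('v,'e,'f) point \<Rightarrow> real" where
  "local_intersection_degree S D \<psi> p =
     (\<Sum>\<sigma>\<in>Poly_Mapping.keys D. Poly_Mapping.lookup D \<sigma> *
        (\<Sum>\<tau>\<in>{\<tau> \<in> {0..1}. segment_path S \<sigma> \<tau> = p}.
           (if \<tau> < 1 then outgoing_slope S \<psi> \<sigma> \<tau> 1 else 0) +
           (if \<tau> > 0 then outgoing_slope S \<psi> \<sigma> \<tau> (- 1) else 0)))"

text \<open>The coefficient at each point is independent of the local equation, and nonzero for only
  finitely many points.\<close>

definition self_intersection :: "('v,'e,'f) surface_data \<Rightarrow> ('e,'f) segment_sum \<Rightarrow> real" where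
  "self_intersection S D =
     (\<Sum>p\<in>{p \<in> points S. local_intersection_degree S D (SOME \<psi>. local_equation S D p \<psi>) p \<noteq> 0}.
        local_intersection_degree S D (SOME \<psi>. local_equation S D p \<psi>) p)"

section \<open>The image of the connecting map\<close>

definition D_sections ::
    "('v,'e,'f) surface_data \<Rightarrow>
      (('v,'e,'f) point \<Rightarrow> (('v,'e,'f) point set \<times> (('v,'e,'f) point \<Rightarrow> real)) set) set" where
  "D_sections S = quotient_global_sections (realization S) (linear_functions S)"

definition D_connecting where
  "D_connecting S = connecting_map (realization S) (linear_functions S)"

end

theory Submission imports Defs begin

text \<open>
 Classes in $H^1$ are represented by cochains on the edges that are closed on every triangle, and a
 closed cochain lies in the span of the image if it is harmonic: its outgoing slopes at every
 vertex $v$ are in the kernel of $M_v$. Outgoing slopes \<open>z\<close> of closed cochains satisfy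
 $\sum_v z_v^T M_v z_v = 0$. If they are orthogonal to the positive eigenvector of every $M_v$, all
 summands are nonpositive, hence zero, and the cochain is harmonic. Coboundaries change the pairings
 with these eigenvectors in a space of codimension 1, as a harmonic coboundary is zero.

 Given a divisor \<open>D\<close>, there is a global piecewise linear function whose difference from every local
 equation of \<open>D\<close> is affine on each triangle. The slopes \<open>p\<close> of these differences at the ends of
 the edges have the same Laplacian $M p$ at both ends of each edge, hence are orthogonal to the closed
 cochains, and $\sum_v p_v^T M_v p_v = D^2$. If this is positive, the Hodge index property forces
 all closed cochains to be harmonic up to coboundaries.
\<close>

unbundle no vec_syntax

notation scaleR (infixr "*R" 75) and iff (infixr "<->" 25)

abbreviation "spt \<equiv> side_point"
abbreviation "std \<equiv> std_triangle"
abbreviation "keys \<equiv> Poly_Mapping.keys"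
abbreviation "lookup \<equiv> Poly_Mapping.lookup"

section \<open>Symmetric matrices with one positive eigenvalue\<close>

lemma det_const_poly:
 fixes P :: "real mat"
 shows "Determinant.det (map_mat (%a. [:a:]) P) = [:Determinant.det P:]"
proof -
 interpret comm_ring_hom "%a::real. [:a:]"
  by unfold_locales (auto simp: one_pCons)
 show ?thesis by (rule hom_det)
qed

lemma double_eigenvalue_order:
 fixes A :: "real mat"
 assumes A: "A : carrier_mat n n"
  and u: "!!a. a < n ==> (SUM c<n. A $$ (a,c) * u c) = k * u a"
  and y: "!!a. a < n ==> (SUM c<n. A $$ (a,c) * y c) = k * y a"
  and i: "i < n" "u i ~= 0" "y i = 0" and j: "j < n" "y j ~= (0::real)"
 shows "Polynomial.order k (char_poly A) >= 2"
proof -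
 define pc where "pc = (%(a,b). if b = i then u a else if b = j then y a else if a = b then (1::real) else 0)"
 define P where "P = mat n n pc"
 have ij: "i ~= j" using i j by auto
 have Pc: "P : carrier_mat n n" by (simp add: P_def)
 have detP: "Determinant.det P ~= 0"
 proof
  assume "Determinant.det P = 0"
  then obtain v where v: "v : carrier_vec n" "v ~= 0\<^sub>v n" "P *\<^sub>v v = 0\<^sub>v n"
   using det_0_iff_vec_prod_zero[OF Pc] by auto
  have row: "(SUM c<n. pc (a,c) * v $ c) = 0" if "a < n" for a
  proof -
   have "(P *\<^sub>v v) $ a = (SUM c<n. pc (a,c) * v $ c)"
    using that v(1) by (simp add: P_def scalar_prod_def lessThan_atLeast0)
   then show ?thesis using v(3) that by simp
  qed
  have split: "(SUM c<n. pc (a,c) * v $ c) = u a * v $ i + y a * v $ j + (if a = i \<or> a = j then 0 else v $ a)"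
   if a: "a < n" for a
  proof -
   have "(SUM c<n. pc (a,c) * v $ c) = (SUM c<n. (if c = i then u a * v $ i else 0) + (if c = j then y a * v $ j else 0)
       + (if c = a then (if a = i \<or> a = j then 0 else v $ a) else 0))"
    using ij by (intro sum.cong) (auto simp: pc_def)
   also have "... = u a * v $ i + y a * v $ j + (if a = i \<or> a = j then 0 else v $ a)"
    using i j a by (simp add: sum.distrib)
   finally show ?thesis .
  qed
  have vi: "v $ i = 0" using row[OF i(1)] split[OF i(1)] i by simp
  then have vj: "v $ j = 0" using row[OF j(1)] split[OF j(1)] j by simp
  have "v $ a = 0" if "a < n" for a
   using row[OF that] split[OF that] vi vj by (auto split: if_splits)
  then have "v = 0\<^sub>v n" using v(1) by (intro eq_vecI) auto
  then show False using v(2) by simp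
 qed
 define M where "M = char_poly_matrix A"
 define L where "L = map_mat (%a. [:a:]) P"
 define d where "d = (%b. if b = i \<or> b = j then [:-k,1:] else (1 :: real poly))"
 define R where "R = mat n n (%(a,b). if b = i then [:u a:] else if b = j then [:y a:] else (M * L) $$ (a,b))"
 define D where "D = mat n n (%(a,b). if a = b then d b else 0)"
 have Mc: "M : carrier_mat n n" using A by (simp add: M_def)
 have Lc: "L : carrier_mat n n" using Pc by (simp add: L_def)
 have Rc: "R : carrier_mat n n" and Dc: "D : carrier_mat n n" by (auto simp: R_def D_def)
 have Ment: "M $$ (a,c) = (if a = c then [:0,1:] else 0) - [:A $$ (a,c):]" if "a < n" "c < n" for a c
  using A that by (auto simp: M_def char_poly_matrix_def)
 have MLent: "(M * L) $$ (a,b) = [:0,1:] * [:pc (a,b):] - [:SUM c<n. A $$ (a,c) * pc (c,b):]" if "a < n" "b < n" for a b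
 proof -
  have "(M * L) $$ (a,b) = (SUM c<n. M $$ (a,c) * L $$ (c,b))"
   using Mc Lc that by (simp add: scalar_prod_def lessThan_atLeast0)
  also have "... = (SUM c<n. (if c = a then [:0,1:] * [:pc (a,b):] else 0) - [:A $$ (a,c) * pc (c,b):])"
   using that by (intro sum.cong) (auto simp: Ment L_def P_def algebra_simps)
  also have "... = [:0,1:] * [:pc (a,b):] - (SUM c<n. [:A $$ (a,c) * pc (c,b):])"
   using that by (simp add: sum_subtractf)
  also have "(SUM c<n. [:A $$ (a,c) * pc (c,b):]) = [:SUM c<n. A $$ (a,c) * pc (c,b):]"
   by (induction n) (auto simp: )
  finally show ?thesis .
 qed
 have "M * L = R * D"
 proof (rule eq_matI)
  fix a b assume ab: "a < dim_row (R * D)" "b < dim_col (R * D)"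
  then have ab: "a < n" "b < n" using Rc Dc by auto
  have "(R * D) $$ (a,b) = (SUM c<n. R $$ (a,c) * D $$ (c,b))"
   using Rc Dc ab by (simp add: scalar_prod_def lessThan_atLeast0)
  also have "... = (SUM c<n. if c = b then R $$ (a,b) * d b else 0)"
   using ab by (intro sum.cong) (auto simp: D_def)
  also have "... = R $$ (a,b) * d b" using ab by simp
  also have "... = (M * L) $$ (a,b)"
  proof (cases "b = i \<or> b = j")
   case False
   then show ?thesis using ab by (simp add: R_def d_def)
  next
   case True
   have "(SUM c<n. A $$ (a,c) * pc (c,b)) = k * pc (a,b)"
    using True u[OF ab(1)] y[OF ab(1)] ij by (auto simp: pc_def)
   then have "(M * L) $$ (a,b) = [:pc (a,b):] * [:-k,1:]"
    by (simp add: MLent[OF ab] algebra_simps)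
   then show ?thesis using True ab ij by (auto simp: R_def d_def pc_def)
  qed
  finally show "(M * L) $$ (a,b) = (R * D) $$ (a,b)" by simp
 qed (use Mc Lc Rc Dc in auto)
 then have "Determinant.det M * Determinant.det L = Determinant.det R * Determinant.det D"
  using det_mult[OF Mc Lc] det_mult[OF Rc Dc] by simp
 moreover have "Determinant.det D = [:-k,1:]\<^sup>2"
 proof -
  have "Determinant.det D = prod_list (diag_mat D)"
   by (rule det_upper_triangular[OF _ Dc]) (auto simp: D_def upper_triangular_def)
  also have "diag_mat D = map d [0..<n]"
   by (auto simp: diag_mat_def D_def intro!: map_cong)
  also have "prod_list (map d [0..<n]) = (\<Prod>b<n. d b)"
   by (simp add: prod.list_conv_set_nth lessThan_atLeast0)
  also have "... = (\<Prod>b\<in>{i,j}. d b)"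
   using i j by (intro prod.mono_neutral_right) (auto simp: d_def)
  also have "... = [:-k,1:]\<^sup>2" using ij by (simp add: d_def power2_eq_square)
  finally show ?thesis .
 qed
 moreover have "Determinant.det L = [:Determinant.det P:]" unfolding L_def by (rule det_const_poly)
 ultimately have "Polynomial.smult (Determinant.det P) (char_poly A) = Determinant.det R * [:-k,1:]\<^sup>2"
  by (simp add: M_def char_poly_def)
 then have "[:-k,1:]^2 dvd Polynomial.smult (Determinant.det P) (char_poly A)" by simp
 then have "[:-k,1:]^2 dvd char_poly A"
  using detP by (simp add: dvd_smult_iff)
 moreover have "char_poly A ~= 0" using degree_monic_char_poly[OF A] by auto
 ultimately show ?thesis by (simp add: order_max)
qed

lemma rayleigh_eigenvector:
 fixes m :: "'i => 'i => real" and u :: "'i => real"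
 assumes fin: "finite I" and sym: "!!i j. i : I ==> j : I ==> m i j = m j i"
  and u: "!!i. i : I ==> (SUM j:I. m i j * u j) = k * u i"
  and x: "(SUM i:I. u i * x i) = 0" "(SUM i:I. SUM j:I. m i j * x i * x j) > 0"
 obtains y mm where "mm > 0" "EX i:I. y i ~= 0" "(SUM i:I. u i * y i) = 0"
  "!!i. i : I ==> (SUM j:I. m i j * y j) = mm * y i"
proof -
 define q where "q = (%x. SUM i:I. SUM j:I. m i j * x i * x j)"
 define K where "K = {x. (ALL i. i ~: I --> x i = 0) & (SUM i:I. x i * x i) = 1 & (SUM i:I. u i * x i) = 0}"
 have cc: "continuous_on UNIV (%x::'i => real. x i)" for i
  by simp
 have clo: "closed K"
 proof -
  have "K = (\<Inter>i\<in>-I. {x. x i = 0}) Int {x. (SUM i:I. x i * x i) = 1} Int {x. (SUM i:I. u i * x i) = 0}"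
   by (auto simp: K_def)
  moreover have "closed {x::'i => real. x i = 0}" for i
   by (intro closed_Collect_eq cc continuous_on_const)
  moreover have "closed {x::'i => real. (SUM i:I. x i * x i) = 1}"
   by (intro closed_Collect_eq continuous_on_sum continuous_on_mult cc continuous_on_const)
  moreover have "closed {x::'i => real. (SUM i:I. u i * x i) = 0}"
   by (intro closed_Collect_eq continuous_on_sum continuous_on_mult cc continuous_on_const)
  ultimately show ?thesis by (auto intro!: closed_INT closed_Int)
 qed
 have "compactin (product_topology (%i. euclidean) UNIV) (PiE UNIV (%i::'i. {-1..1::real}))"
  unfolding compactin_PiE by auto
 then have "compact (PiE UNIV (%i::'i. {-1..1::real}))"
  by (simp add: euclidean_product_topology)
 moreover have "K <= PiE UNIV (%i::'i. {-1..1::real})"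
 proof
  fix z assume z: "z : K"
  have "z i : {-1..1}" for i
  proof (cases "i : I")
   case True
   have "z i * z i <= (SUM i:I. z i * z i)"
    using fin True by (intro member_le_sum) auto
   then have "(z i)\<^sup>2 <= 1" using z by (simp add: K_def power2_eq_square)
   then show ?thesis by (auto simp: abs_square_le_1 abs_le_iff)
  qed (use z in \<open>auto simp: K_def\<close>)
  then show "z : PiE UNIV (%i::'i. {-1..1::real})" by auto
 qed
 ultimately have comp: "compact K" using clo by (metis compact_Int_closed inf.absorb_iff2)
 define ns where "ns = (%x. SUM i:I. x i * (x i :: real))"
 have qscale: "q (%i. c * z i) = c * c * q z" for c z
  by (simp add: q_def sum_distrib_left algebra_simps)
 have nscale: "ns (%i. c * z i) = c * c * ns z" for c z
  by (simp add: ns_def sum_distrib_left algebra_simps)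
 have nspos: "ns z > 0" if ne: "EX i:I. z i ~= 0" for z
 proof -
  obtain i where "i : I" "z i ~= 0" using ne by blast
  then show ?thesis unfolding ns_def using fin by (intro sum_pos2[of _ i]) (auto simp: zero_less_mult_iff linorder_neq_iff)
 qed
 have norm: "EX c>0. (%i. if i : I then c * z i else 0) : K & c * c * ns z = 1"
  if "EX i:I. z i ~= 0" "(SUM i:I. u i * z i) = 0" for z
 proof -
  define c where "c = 1 / sqrt (ns z)"
  have c: "c > 0" "c * c * ns z = 1"
   using nspos[OF that(1)] by (auto simp: c_def)
  have "(SUM i:I. u i * (if i : I then c * z i else 0)) = c * (SUM i:I. u i * z i)"
   by (simp add: sum_distrib_left algebra_simps cong: sum.cong)
  then have "(%i. if i : I then c * z i else 0) : K"
   using c(2) nscale[of c z] that(2) by (auto simp: K_def ns_def cong: sum.cong)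
  then show ?thesis using c by blast
 qed
 have x0: "EX i:I. x i ~= 0"
 proof (rule ccontr)
  assume "~ ?thesis"
  then have "(SUM i:I. SUM j:I. m i j * x i * x j) = 0" by (intro sum.neutral ballI) simp
  then show False using x(2) by simp
 qed
 obtain c where c: "c > 0" "(%i. if i : I then c * x i else 0) : K" using norm[OF x0 x(1)] by blast
 have "continuous_on K q"
  unfolding q_def
  by (rule continuous_on_subset[OF _ subset_UNIV]) (intro continuous_on_sum continuous_on_mult cc continuous_on_const)
 then obtain y where y: "y : K" "!!z. z : K ==> q z <= q y"
  using continuous_attains_sup[OF comp, of q] c(2) by blast
 define mm where "mm = q y"
 have qcong: "q z = q z'" if "!!i. i : I ==> z i = z' i" for z z'
  using that by (simp add: q_def cong: sum.cong)
 have "q (%i. if i : I then c * x i else 0) = c * c * q x"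
  using qcong[of "%i. if i : I then c * x i else 0" "%i. c * x i"] qscale[of c x] by simp
 then have "mm >= c * c * q x" using y(2)[OF c(2)] by (simp add: mm_def)
 then have mu: "mm > 0"
 proof -
  have "c * c * q x > 0" using c(1) x(2) unfolding q_def by (intro mult_pos_pos)
  then show ?thesis using \<open>mm >= c * c * q x\<close> by linarith
 qed
 have le: "q z <= mm * ns z" if z: "(SUM i:I. u i * z i) = 0" for z
 proof (cases "EX i:I. z i ~= 0")
  case True
  obtain c where c: "c > 0" "(%i. if i : I then c * z i else 0) : K" "c * c * ns z = 1" using norm[OF True z] by blast
  have "q (%i. if i : I then c * z i else 0) = c * c * q z"
   using qcong[of "%i. if i : I then c * z i else 0" "%i. c * z i"] qscale[of c z] by simp
  then have "c * c * q z <= mm" using y(2)[OF c(2)] by (simp add: mm_def)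
  moreover have "c * c * (mm * ns z) = mm * (c * c * ns z)" by (simp only: mult_ac)
  ultimately have "(c * c) * q z <= (c * c) * (mm * ns z)" by (simp only: c(3) mult_1_right)
  moreover have "c * c > 0" using c(1) by simp
  ultimately show ?thesis by (simp only: mult_le_cancel_left_pos)
 qed (simp add: q_def ns_def)
 have nsy: "ns y = 1" and uy: "(SUM i:I. u i * y i) = 0" using y(1) by (auto simp: K_def ns_def)
 define b where "b = (%z z'. SUM i:I. SUM j:I. m i j * z i * z' j)"
 have bsym: "b z z' = b z' z" for z z'
 proof -
  have "b z z' = (SUM j:I. SUM i:I. m i j * z i * z' j)" unfolding b_def by (rule sum.swap)
  also have "... = b z' z" unfolding b_def by (intro sum.cong refl) (simp add: sym)
  finally show ?thesis .
 qed
 have qadd: "q (%i. y i + t * z i) = q y + 2 * t * b z y + t * t * q z" for t z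
 proof -
  have "q (%i. y i + t * z i) = q y + t * b z y + t * b y z + t * t * q z"
   by (simp add: q_def b_def sum_distrib_left sum.distrib algebra_simps)
  then show ?thesis using bsym[of y z] by simp
 qed
 have nsadd: "ns (%i. y i + t * z i) = ns y + 2 * t * (SUM i:I. z i * y i) + t * t * ns z" for t z
  by (simp add: ns_def sum_distrib_left sum.distrib algebra_simps)
 have bz: "b z y = mm * (SUM i:I. z i * y i)" if z: "(SUM i:I. u i * z i) = 0" for z
 proof -
  define B where "B = mm * (SUM i:I. z i * y i) - b z y"
  define C where "C = mm * ns z - q z"
  have key: "0 <= 2 * t * B + t * t * C" for t
  proof -
   have "(SUM i:I. u i * (y i + t * z i)) = 0"
    using z uy by (simp add: distrib_left sum.distrib sum_distrib_left[symmetric] mult.left_commute[of _ t])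
   from le[OF this] have "q y + 2 * t * b z y + t * t * q z <= mm * (ns y + 2 * t * (SUM i:I. z i * y i) + t * t * ns z)"
    unfolding qadd nsadd .
   then show ?thesis using nsy by (simp add: B_def C_def mm_def[symmetric] algebra_simps)
  qed
  have "C >= 0" using le[OF z] by (simp add: C_def)
  have "B = 0"
  proof (rule ccontr)
   assume "B ~= 0"
   then have B2: "B * B > 0" by (metis not_real_square_gt_zero)
   define t where "t = - B / (C + 1)"
   have Bt: "B = - t * (C + 1)" using \<open>C >= 0\<close> by (simp add: t_def)
   have "0 <= 2 * t * B + t * t * C" by (rule key)
   also have "... = (t * t) * (- C - 2)" unfolding Bt by (simp add: algebra_simps)
   also have "... < 0" using \<open>B ~= 0\<close> Bt \<open>C >= 0\<close> by (intro mult_pos_neg) (auto simp: zero_less_mult_iff linorder_neq_iff)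
   finally show False by simp
  qed
  then show ?thesis by (simp add: B_def)
 qed
 have bu: "b u y = 0"
 proof -
  have "b u y = b y u" by (rule bsym)
  also have "... = (SUM i:I. y i * (SUM j:I. m i j * u j))"
   by (simp add: b_def sum_distrib_left algebra_simps)
  also have "... = (SUM i:I. k * (u i * y i))" by (intro sum.cong) (auto simp: u)
  also have "... = 0" using uy by (simp add: sum_distrib_left[symmetric])
  finally show ?thesis .
 qed
 have ball: "b z y = mm * (SUM i:I. z i * y i)" for z
 proof (cases "EX i:I. u i ~= 0")
  case True
  define t where "t = (SUM i:I. u i * z i) / ns u"
  have "ns u > 0" using nspos True by blast
  have "(SUM i:I. u i * (z i - t * u i)) = (SUM i:I. u i * z i) - t * ns u"
   by (simp add: ns_def right_diff_distrib sum_subtractf sum_distrib_left algebra_simps)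
  also have "... = 0" using \<open>ns u > 0\<close> by (simp add: t_def)
  finally have e: "b (%i. z i - t * u i) y = mm * (SUM i:I. (z i - t * u i) * y i)" by (rule bz)
  have "b (%i. z i - t * u i) y = b z y - t * b u y"
   by (simp add: b_def sum_distrib_left sum_subtractf algebra_simps)
  moreover have "(SUM i:I. (z i - t * u i) * y i) = (SUM i:I. z i * y i) - t * (SUM i:I. u i * y i)"
   by (simp add: sum_distrib_left sum_subtractf algebra_simps)
  ultimately show ?thesis using e bu uy by simp
 next
  case False
  then show ?thesis by (intro bz) simp
 qed
 show ?thesis
 proof (rule that[OF mu _ uy])
  show "EX i:I. y i ~= 0"
  proof (rule ccontr)
   assume "~ ?thesis"
   then have "ns y = 0" unfolding ns_def by (intro sum.neutral ballI) simp
   then show False using nsy by simp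
  qed
  fix i assume i: "i : I"
  have "b (%l. if l = i then 1 else 0) y = (SUM l:I. if l = i then (SUM j:I. m i j * y j) else 0)"
   unfolding b_def by (intro sum.cong) auto
  then have "b (%l. if l = i then 1 else 0) y = (SUM j:I. m i j * y j)" using i fin by simp
  moreover have "(SUM l:I. (if l = i then 1 else 0) * y l) = y i"
   using i fin by (simp add: if_distrib[of "%c. c * _"] cong: if_cong)
  ultimately show "(SUM j:I. m i j * y j) = mm * y i" using ball[of "%l. if l = i then 1 else 0"] by simp
 qed
qed

lemma one_positive_eigenvalue:
 fixes m :: "'i => 'i => real"
 assumes l: "distinct l" "set l = I"
  and sym: "!!i j. i : I ==> j : I ==> m i j = m j i"
  and one: "num_positive_eigenvalues
   (Matrix.mat (length l) (length l) (%(i, j). m (l ! i) (l ! j))) = 1"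
 obtains u k where "k > 0" "EX i:I. u i ~= 0"
  "!!i. i : I ==> (SUM j:I. m i j * u j) = k * u i"
  "!!x. (SUM i:I. u i * x i) = 0 ==> (SUM i:I. SUM j:I. m i j * x i * x j) <= 0"
proof -
 define n where "n = length l"
 define A where "A = Matrix.mat n n (%(i, j). m (l ! i) (l ! j))"
 have A: "A : carrier_mat n n" by (simp add: A_def)
 have fin: "finite I" using l by auto
 have cp0: "char_poly A ~= 0" using degree_monic_char_poly[OF A] by auto
 have evs: "{k. eigenvalue A k & k > 0} <= {k. poly (char_poly A) k = 0}"
  using eigenvalue_root_char_poly[OF A] by auto
 then have finE: "finite {k. eigenvalue A k & k > 0}"
  using poly_roots_finite[OF cp0] finite_subset by blast
 have num: "(SUM k:{k. eigenvalue A k & k > 0}. Polynomial.order k (char_poly A)) = 1"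
  using one by (simp add: num_positive_eigenvalues_def A_def n_def)
 have ord: "Polynomial.order k (char_poly A) >= 1" if "eigenvalue A k" for k
  using that eigenvalue_root_char_poly[OF A] cp0 order_root[of "char_poly A" k] by auto
 obtain k where k: "eigenvalue A k" "k > 0"
 proof -
  have "{k. eigenvalue A k & k > 0} ~= {}"
  proof
   assume "{k. eigenvalue A k & k > 0} = {}"
   then show False using num by (simp only: sum.empty)
  qed
  then show ?thesis using that by blast
 qed
 have bij: "bij_betw (%i. l ! i) {..<n} I"
  using bij_betw_nth[OF l(1), of "{..<n}"] l(2) by (simp add: n_def)
 have sumI: "(SUM i:I. g i) = (SUM a<n. g (l ! a))" for g :: "'i => real"
  using sum.reindex_bij_betw[OF bij, of g] by simp
 have lI: "l ! a : I" if "a < n" for a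
  using that l(2) by (auto simp: n_def)
 have uniq: "k' = k" if k': "eigenvalue A k'" "k' > 0" for k'
 proof (rule ccontr)
  assume "k' ~= k"
  have "(SUM k:{k,k'}. Polynomial.order k (char_poly A)) <= 1"
   unfolding num[symmetric] using finE k k' by (intro sum_mono2) auto
  then show False using \<open>k' ~= k\<close> ord[OF k(1)] ord[OF k'(1)] by simp
 qed
 have ord1: "Polynomial.order k (char_poly A) <= 1"
  unfolding num[symmetric] using finE k by (intro member_le_sum) auto
 have mulA: "(A *\<^sub>v w) $ a = (SUM b<n. m (l ! a) (l ! b) * w $ b)" if "a < n" "w : carrier_vec n" for w a
  using that by (simp add: A_def scalar_prod_def lessThan_atLeast0)
 obtain uv where uv: "uv : carrier_vec n" "uv ~= 0\<^sub>v n" "A *\<^sub>v uv = k \<cdot>\<^sub>v uv"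
  using k(1) A unfolding eigenvalue_def eigenvector_def by auto
 define u where "u = (%i. uv $ (the_inv_into {..<n} (%i. l ! i) i))"
 have ul: "u (l ! a) = uv $ a" if "a < n" for a
  using that bij by (simp add: u_def the_inv_into_f_f bij_betw_def)
 have u0: "EX i:I. u i ~= 0"
 proof (rule ccontr)
  assume "~ ?thesis"
  then have "uv $ a = 0" if "a < n" for a
   using that ul[OF that] l by (auto simp: n_def)
  then have "uv = 0\<^sub>v n" using uv(1) by (intro eq_vecI) auto
  then show False using uv(2) by simp
 qed
 have nth: "EX a<n. i = l ! a" if "i : I" for i
  using that l(2) by (metis in_set_conv_nth n_def)
 have ue: "(SUM j:I. m i j * u j) = k * u i" if i: "i : I" for i
 proof -
  obtain a where a: "a < n" "i = l ! a" using nth[OF i] by blast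
  have "(SUM j:I. m i j * u j) = (SUM b<n. m (l ! a) (l ! b) * uv $ b)"
   unfolding sumI a(2) by (intro sum.cong) (auto simp: ul)
  also have "... = (A *\<^sub>v uv) $ a" using mulA[OF a(1) uv(1)] by simp
  also have "... = k * u i" using uv(1,3) a ul by simp
  finally show ?thesis .
 qed
 show ?thesis
 proof (rule that[OF k(2) u0 ue])
  fix x :: "'i => real" assume x: "(SUM i:I. u i * x i) = 0"
  show "(SUM i:I. SUM j:I. m i j * x i * x j) <= 0"
  proof (rule ccontr)
   assume "~ ?thesis"
   then have pos: "(SUM i:I. SUM j:I. m i j * x i * x j) > 0" by simp
   obtain y mm where y: "mm > 0" "EX i:I. y i ~= 0" "(SUM i:I. u i * y i) = 0"
    "!!i. i : I ==> (SUM j:I. m i j * y j) = mm * y i"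
    by (rule rayleigh_eigenvector[OF fin sym ue x pos]) blast+
   define yv where "yv = vec n (%a. y (l ! a))"
   have "eigenvector A yv mm"
    unfolding eigenvector_def
   proof (intro conjI)
    have yvc: "yv : carrier_vec n" by (simp add: yv_def)
    show "yv : carrier_vec (dim_row A)" by (simp add: yv_def A_def)
    obtain i where "i : I" "y i ~= 0" using y(2) by blast
    then obtain a where "a < n" "y (l ! a) ~= 0" using nth by blast
    then show "yv ~= 0\<^sub>v (dim_row A)" by (auto simp: yv_def A_def vec_eq_iff)
    show "A *\<^sub>v yv = mm \<cdot>\<^sub>v yv"
    proof (rule eq_vecI)
     fix a assume "a < dim_vec (mm \<cdot>\<^sub>v yv)"
     then have a: "a < n" by (simp add: yv_def)
     have "(A *\<^sub>v yv) $ a = (SUM b<n. m (l ! a) (l ! b) * y (l ! b))"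
      unfolding mulA[OF a yvc] by (intro sum.cong) (auto simp: yv_def)
     also have "... = mm * y (l ! a)" using y(4)[OF lI[OF a]] unfolding sumI by simp
     finally show "(A *\<^sub>v yv) $ a = (mm \<cdot>\<^sub>v yv) $ a" using a by (simp add: yv_def)
    qed (simp add: A_def yv_def)
   qed
   then have mk: "mm = k" using uniq y(1) unfolding eigenvalue_def by blast
   obtain i0 where i0: "i0 : I" "u i0 ~= 0" using u0 by blast
   obtain i where i: "i < n" "u (l ! i) ~= 0" using i0 nth by blast
   define r where "r = y (l ! i) / u (l ! i)"
   define z where "z = (%a. y (l ! a) - r * u (l ! a))"
   have zi: "z i = 0" using i by (simp add: z_def r_def)
   have "EX j<n. z j ~= 0"
   proof (rule ccontr)
    assume "~ ?thesis"
    then have z0: "y (l ! a) = r * u (l ! a)" if "a < n" for a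
     using that by (simp add: z_def)
    have "0 = (SUM a<n. u (l ! a) * y (l ! a))" using y(3) unfolding sumI by simp
    also have "... = (SUM a<n. r * (u (l ! a) * u (l ! a)))"
     by (intro sum.cong) (auto simp: z0)
    also have "... = r * (SUM a<n. u (l ! a) * u (l ! a))"
     by (simp add: sum_distrib_left)
    finally have "r * (SUM a<n. u (l ! a) * u (l ! a)) = 0" by simp
    moreover have "(SUM a<n. u (l ! a) * u (l ! a)) > 0"
     using i by (intro sum_pos2[of _ i]) (auto simp: zero_less_mult_iff linorder_neq_iff)
    ultimately have "r = 0" by simp
    then have "ALL a<n. y (l ! a) = 0" using z0 by simp
    then show False using y(2) nth by metis
   qed
   then obtain j where j: "j < n" "z j ~= 0" by blast
   have "Polynomial.order k (char_poly A) >= 2"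
   proof (rule double_eigenvalue_order[OF A _ _ i(1) _ zi j])
    show "u (l ! i) ~= 0" using i by simp
    show U: "(SUM c<n. A $$ (a, c) * u (l ! c)) = k * u (l ! a)" if a: "a < n" for a
     using ue[OF lI[OF a]] a unfolding sumI by (simp add: A_def)
    fix a assume a: "a < n"
    have Y: "(SUM c<n. A $$ (a, c) * y (l ! c)) = k * y (l ! a)"
     using y(4)[OF lI[OF a]] a mk unfolding sumI by (simp add: A_def)
    have "(SUM c<n. A $$ (a, c) * z c) = (SUM c<n. A $$ (a, c) * y (l ! c)) - r * (SUM c<n. A $$ (a, c) * u (l ! c))"
     by (simp add: z_def right_diff_distrib sum_subtractf sum_distrib_left mult.left_commute)
    also have "... = k * z a" unfolding Y U[OF a] by (simp add: z_def algebra_simps)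
    finally show "(SUM c<n. A $$ (a, c) * z c) = k * z a" .
   qed
   then show False using ord1 by simp
  qed
 qed
qed

section \<open>The Laplacian on edge ends\<close>

definition outgoing :: "('e => real) => 'e \<times> bool => real" where
 "outgoing c x = (if snd x then - c (fst x) else c (fst x))"

text \<open>The other edge end in the corner of \<open>f\<close> at the end \<open>b\<close> of side \<open>i\<close>.\<close>

definition opp_end :: "('v,'e,'f) surface_data => 'f => nat => bool => 'e \<times> bool" where
 "opp_end S f i b =
   (if i = 0 then (if b then (face S f 1, True) else (face S f 2, True))
   else if i = 1 then (if b then (face S f 0, True) else (face S f 2, False))
   else (if b then (face S f 0, False) else (face S f 1, False)))"

definition lap :: "('v,'e,'f) surface_data => ('e \<times> bool => real) => 'e \<times> bool => real" where
 "lap S z x = (SUM (f, i):edge_link S (fst x). z (opp_end S f i (snd x)))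
   - of_int (alpha S (fst x) (~ snd x)) * z x"

definition cocycle :: "('v,'e,'f) surface_data => ('e => real) => bool" where
 "cocycle S c <-> (ALL f:tris S. c (face S f 1) = c (face S f 2) + c (face S f 0))"

definition harmonic :: "('v,'e,'f) surface_data => ('e => real) => bool" where
 "harmonic S c <-> (ALL e:edges S. ALL b. lap S (outgoing c) (e, b) = 0)"

definition coboundary :: "('v,'e,'f) surface_data => ('v => real) => 'e => real" where
 "coboundary S g e = g (endpt S e True) - g (endpt S e False)"

lemma finite_edge_link: "finite (tris S) ==> finite (edge_link S e)"
 by (rule finite_subset[of _ "tris S \<times> {..<3}"]) (auto simp: edge_link_def)

lemma sum_edge_link:
 assumes "finite (tris S)"
 shows "(SUM (f, i):edge_link S e. h f i) = (SUM f:tris S. SUM i<3. if face S f i = e then h f i else (0::real))"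
proof -
 have "(SUM (f, i):edge_link S e. h f i) = (SUM (f, i):tris S \<times> {..<3}. if face S f i = e then h f i else 0)"
  using assms by (intro sum.mono_neutral_cong_left) (auto simp: edge_link_def split: if_splits)
 then show ?thesis using assms by (simp add: sum.cartesian_product)
qed

lemma lap_outgoing_ends:
 assumes "finite (tris S)" and c: "cocycle S c"
  and al: "alpha S e False + alpha S e True = int (card (edge_link S e))"
 shows "lap S (outgoing c) (e, False) = lap S (outgoing c) (e, True)"
proof -
 have "outgoing c (opp_end S f i False) = outgoing c (opp_end S f i True) + c e"
  if "(f, i) : edge_link S e" for f i
 proof -
  from that have f: "f : tris S" "i < 3" "face S f i = e" by (auto simp: edge_link_def)
  then have "i = 0 \<or> i = 1 \<or> i = 2" by auto
  then show ?thesis using c f unfolding cocycle_def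
   by (auto simp: opp_end_def outgoing_def)
 qed
 then have "(SUM (f, i):edge_link S e. outgoing c (opp_end S f i False))
   = (SUM (f, i):edge_link S e. outgoing c (opp_end S f i True) + c e)"
  by (intro sum.cong) auto
 also have "... = (SUM (f, i):edge_link S e. outgoing c (opp_end S f i True)) + of_nat (card (edge_link S e)) * c e"
  by (simp add: case_prod_unfold sum.distrib)
 finally have *: "(SUM (f, i):edge_link S e. outgoing c (opp_end S f i False))
  = (SUM (f, i):edge_link S e. outgoing c (opp_end S f i True)) + of_nat (card (edge_link S e)) * c e" .
 have "real (card (edge_link S e)) = of_int (alpha S e False) + of_int (alpha S e True)"
  using al by (metis of_int_add of_int_of_nat_eq)
 moreover have "outgoing c (e, False) = c e" "outgoing c (e, True) = - c e" by (simp_all add: outgoing_def)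
 ultimately show ?thesis unfolding lap_def by (simp add: * algebra_simps)
qed

locale ct_surface =
 fixes S :: "('v, 'e, 'f) surface_data"
 assumes tropical: "tropical_surface S"
  and codim1: "locally_connected_through_codim_1 S"
begin

lemma weak: "weak_tropical_surface S" and delta: "finite_delta_complex S"
 using tropical by (auto simp: tropical_surface_def weak_tropical_surface_def)

lemma fin: "finite (verts S)" "finite (edges S)" "finite (tris S)"
 using delta by (auto simp: finite_delta_complex_def)

lemma endpt_verts: "e : edges S ==> endpt S e b : verts S"
 using delta by (auto simp: finite_delta_complex_def)

lemma face_edges: "f : tris S ==> i < 3 ==> face S f i : edges S"
 using delta by (auto simp: finite_delta_complex_def)

lemma corner_end: "f : tris S ==> i < 3 ==>
  end_vertex S (fst (corner S f i)) = end_vertex S (snd (corner S f i))"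
 using delta by (auto simp: finite_delta_complex_def)

lemma face_ends:
 assumes "f : tris S"
 shows "endpt S (face S f 1) False = endpt S (face S f 2) False"
  "endpt S (face S f 0) False = endpt S (face S f 2) True"
  "endpt S (face S f 0) True = endpt S (face S f 1) True"
 using corner_end[OF assms, of 0] corner_end[OF assms, of 1] corner_end[OF assms, of 2]
 by (auto simp: corner_def end_vertex_def)

lemma alpha_sum: "e : edges S ==> alpha S e False + alpha S e True = int (card (edge_link S e))"
 using weak by (auto simp: weak_tropical_surface_def)

lemma fin_link: "finite (edge_link S e)" by (rule finite_edge_link[OF fin(3)])

lemma finite_link_verts: "finite (link_verts S v)"
 by (rule finite_subset[of _ "edges S \<times> UNIV"]) (auto simp: link_verts_def fin)

lemma finite_link_edges: "finite (link_edges S v)"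
 by (rule finite_subset[of _ "tris S \<times> {..<3}"]) (auto simp: link_edges_def fin)

lemma entry_eq:
 "real_of_int (local_intersection_entry S v x y) =
  (SUM k:link_edges S v. (if fst (corner S (fst k) (snd k)) = x & snd (corner S (fst k) (snd k)) = y then 1 else 0)
   + (if snd (corner S (fst k) (snd k)) = x & fst (corner S (fst k) (snd k)) = y then 1 else 0))
  - (if x = y then of_int (alpha S (fst x) (~ snd x)) else 0)"
proof -
 have gen: "(if a = x & b = y then 1 else 0) + (if b = x & a = y then 1 else 0)
   = (if (a = x & b = y) \<or> (b = x & a = y) then (if x = y then 2 else 1) else (0::real))"
  for a b x y :: "'e \<times> bool" by (cases "x = y"; cases "a = x"; cases "b = y"; simp)
 have gen2: "{a, b} = {x, y} <-> (a = x & b = y) \<or> (b = x & a = y)" for a b x y :: "'e \<times> bool"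
  by (simp only: doubleton_eq_iff) metis
 have sum: "(SUM k:link_edges S v. (if fst (corner S (fst k) (snd k)) = x & snd (corner S (fst k) (snd k)) = y then 1 else 0)
   + (if snd (corner S (fst k) (snd k)) = x & fst (corner S (fst k) (snd k)) = y then 1 else 0))
  = (SUM k:link_edges S v. if k : link_edges_between S v x y then (if x = y then 2 else 1) else (0::real))"
 proof (intro sum.cong refl)
  fix k assume k: "k : link_edges S v"
  have "k : link_edges_between S v x y <->
   (fst (corner S (fst k) (snd k)) = x & snd (corner S (fst k) (snd k)) = y)
   \<or> (snd (corner S (fst k) (snd k)) = x & fst (corner S (fst k) (snd k)) = y)"
   unfolding gen2[symmetric] using k by (simp add: link_edges_between_def case_prod_unfold)
  then show "(if fst (corner S (fst k) (snd k)) = x & snd (corner S (fst k) (snd k)) = y then 1 else 0)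
   + (if snd (corner S (fst k) (snd k)) = x & fst (corner S (fst k) (snd k)) = y then 1 else 0)
   = (if k : link_edges_between S v x y then (if x = y then 2 else 1) else (0::real))"
   by (simp only: gen)
 qed
 also have "... = (SUM k:link_edges S v Int link_edges_between S v x y. if x = y then 2 else 1)"
  by (rule sum.inter_restrict[OF finite_link_edges, symmetric])
 also have "link_edges S v Int link_edges_between S v x y = link_edges_between S v x y"
  by (auto simp: link_edges_between_def)
 finally show ?thesis unfolding local_intersection_entry_def by (cases "x = y") simp_all
qed

lemma entry_sym: "local_intersection_entry S v x y = local_intersection_entry S v y x"
 by (simp add: local_intersection_entry_def link_edges_between_def insert_commute)

lemma entry_nonneg: "x ~= y ==> local_intersection_entry S v x y >= 0"
 by (simp add: local_intersection_entry_def)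

lemma corner_link_verts:
 assumes "k : link_edges S v"
 shows "fst (corner S (fst k) (snd k)) : link_verts S v" "snd (corner S (fst k) (snd k)) : link_verts S v"
proof -
 obtain f i where k: "k = (f, i)" by (cases k)
 with assms have f: "f : tris S" "i < 3" "end_vertex S (fst (corner S f i)) = v"
  by (auto simp: link_edges_def)
 have "fst (fst (corner S f i)) : edges S" "fst (snd (corner S f i)) : edges S"
  using face_edges[OF f(1)] by (simp_all add: corner_def)
 then show "fst (corner S (fst k) (snd k)) : link_verts S v" "snd (corner S (fst k) (snd k)) : link_verts S v"
  using f(3) corner_end[OF f(1,2)] by (simp_all add: k link_verts_def)
qed

lemma lap_matrix:
 assumes x: "x : link_verts S v"
 shows "(SUM y:link_verts S v. of_int (local_intersection_entry S v x y) * z y) = lap S z x"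
proof -
 let ?a = "%k. fst (corner S (fst k) (snd k))" and ?b = "%k. snd (corner S (fst k) (snd k))"
 let ?L = "link_verts S v" and ?C = "link_edges S v"
 obtain e b where xe: "x = (e, b)" by (cases x)
 have sum3: "(SUM i<3. g i) = g 0 + g 1 + g 2" for g :: "nat => real" by (simp add: eval_nat_numeral)
 have "(SUM y:?L. of_int (local_intersection_entry S v x y) * z y) =
  (SUM y:?L. SUM k:?C. (if y = ?b k then (if ?a k = x then z y else 0) else 0) + (if y = ?a k then (if ?b k = x then z y else 0) else 0))
  - (SUM y:?L. if y = x then of_int (alpha S (fst x) (~ snd x)) * z y else 0)"
  unfolding entry_eq sum_subtractf[symmetric]
  by (intro sum.cong refl) (auto simp: left_diff_distrib sum_distrib_right intro!: sum.cong)
 also have "(SUM y:?L. if y = x then of_int (alpha S (fst x) (~ snd x)) * z y else 0) = of_int (alpha S (fst x) (~ snd x)) * z x"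
  using x finite_link_verts by simp
 also have "(SUM y:?L. SUM k:?C. (if y = ?b k then (if ?a k = x then z y else 0) else 0) + (if y = ?a k then (if ?b k = x then z y else 0) else 0))
  = (SUM k:?C. (if ?a k = x then z (?b k) else 0) + (if ?b k = x then z (?a k) else 0))"
  by (subst sum.swap) (intro sum.cong refl, simp add: sum.distrib corner_link_verts finite_link_verts)
 also have "... = (SUM k:tris S \<times> {..<3}. (if ?a k = x then z (?b k) else 0) + (if ?b k = x then z (?a k) else 0))"
 proof (rule sum.mono_neutral_left)
  show "finite (tris S \<times> {..<3::nat})" using fin by auto
  show "?C <= tris S \<times> {..<3}" by (auto simp: link_edges_def)
  show "ALL k:tris S \<times> {..<3} - ?C. (if ?a k = x then z (?b k) else 0) + (if ?b k = x then z (?a k) else 0) = 0"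
  proof
   fix k assume k: "k : tris S \<times> {..<3} - ?C"
   then have "end_vertex S (?a k) ~= v" "end_vertex S (?b k) ~= v"
    using corner_end[of "fst k" "snd k"] by (auto simp: link_edges_def)
   then have "?a k ~= x" "?b k ~= x" using x by (auto simp: link_verts_def)
   then show "(if ?a k = x then z (?b k) else 0) + (if ?b k = x then z (?a k) else 0) = 0" by simp
  qed
 qed
 also have "... = (SUM f:tris S. SUM i<3. (if ?a (f,i) = x then z (?b (f,i)) else 0) + (if ?b (f,i) = x then z (?a (f,i)) else 0))"
  by (simp only: sum.cartesian_product case_prod_unfold fst_conv snd_conv)
 also have "... = (SUM f:tris S. SUM i<3. if face S f i = e then z (opp_end S f i b) else 0)"
  by (rule sum.cong[OF refl]) (cases b; simp add: xe sum3 corner_def opp_end_def add_ac)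
 also have "... = (SUM (f, i):edge_link S e. z (opp_end S f i b))"
  by (rule sum_edge_link[OF fin(3), symmetric])
 finally show ?thesis by (simp add: lap_def xe)
qed

lemma spectral:
 assumes v: "v : verts S"
 obtains u k where "k > 0" "EX x:link_verts S v. u x ~= 0"
  "!!x. x : link_verts S v ==> lap S u x = k * u x"
  "!!z. (SUM x:link_verts S v. u x * z x) = 0 ==> (SUM x:link_verts S v. z x * lap S z x) <= 0"
proof -
 define m where "m x y = real_of_int (local_intersection_entry S v x y)" for x y
 have ex: "EX l. distinct l & set l = link_verts S v"
  using finite_distinct_list[OF finite_link_verts] by blast
 then have l: "distinct (link_enum S v)" "set (link_enum S v) = link_verts S v"
  using someI_ex[OF ex] unfolding link_enum_def by auto
 have one: "num_positive_eigenvalues (Matrix.mat (length (link_enum S v)) (length (link_enum S v))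
   (%(i, j). m (link_enum S v ! i) (link_enum S v ! j))) = 1"
  using tropical v by (simp add: tropical_surface_def local_intersection_matrix_def m_def)
 have msym: "m x y = m y x" for x y unfolding m_def by (subst entry_sym) simp
 obtain u k where u: "k > 0" "EX i:link_verts S v. u i ~= 0"
  "!!i. i : link_verts S v ==> (SUM j:link_verts S v. m i j * u j) = k * u i"
  "!!x. (SUM i:link_verts S v. u i * x i) = 0 ==> (SUM i:link_verts S v. SUM j:link_verts S v. m i j * x i * x j) <= 0"
  by (rule one_positive_eigenvalue[OF l _ one]) (rule msym, blast)
 have lapm: "(SUM j:link_verts S v. m i j * z j) = lap S z i" if "i : link_verts S v" for z i
  unfolding m_def by (rule lap_matrix[OF that])
 show ?thesis
 proof (rule that[OF u(1,2)])
  show "lap S u x = k * u x" if "x : link_verts S v" for x using u(3)[OF that] lapm[OF that] by simp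
  fix z assume "(SUM x:link_verts S v. u x * z x) = 0"
  from u(4)[OF this] have "(SUM i:link_verts S v. z i * (SUM j:link_verts S v. m i j * z j)) <= 0"
   by (simp add: sum_distrib_left mult_ac)
  then show "(SUM x:link_verts S v. z x * lap S z x) <= 0" by (simp add: lapm)
 qed
qed

lemma lap_linear: "lap S (%x. a * z x + b * w x) x = a * lap S z x + b * lap S w x"
 by (simp add: lap_def case_prod_unfold sum.distrib sum_distrib_left algebra_simps)

lemma lap_selfadjoint:
 "(SUM x:link_verts S v. w x * lap S z x) = (SUM x:link_verts S v. z x * lap S w x)"
proof -
 have "(SUM x:link_verts S v. w x * lap S z x)
   = (SUM x:link_verts S v. SUM y:link_verts S v. w x * (of_int (local_intersection_entry S v x y) * z y))"
  by (intro sum.cong refl) (simp add: lap_matrix[symmetric] sum_distrib_left)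
 also have "... = (SUM y:link_verts S v. SUM x:link_verts S v. w x * (of_int (local_intersection_entry S v x y) * z y))"
  by (rule sum.swap)
 also have "... = (SUM y:link_verts S v. z y * lap S w y)"
  by (intro sum.cong refl) (simp add: lap_matrix[symmetric] sum_distrib_left entry_sym[of v _ ] mult_ac)
 finally show ?thesis .
qed

end

lemma lap_cong:
 assumes "!!y. fst y : edges S ==> z y = w y" "!!f i. f : tris S ==> i < 3 ==> face S f i : edges S"
  "fst x : edges S"
 shows "lap S z x = lap S w x"
proof -
 have "z (opp_end S f i b) = w (opp_end S f i b)" if "(f, i) : edge_link S (fst x)" for f i b
  using that assms(2)[of f] by (intro assms(1)) (auto simp: edge_link_def opp_end_def)
 then show ?thesis using assms(1)[of x] assms(3) by (auto simp: lap_def intro!: sum.cong)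
qed

lemma outgoing_linear: "outgoing (%e. a * c e + b * d e) = (%x. a * outgoing c x + b * outgoing d x)"
 by (auto simp: outgoing_def)

lemma cocycle_linear:
 "cocycle S c ==> cocycle S d ==> cocycle S (%e. a * c e + b * d e)"
 by (auto simp: cocycle_def algebra_simps)

context ct_surface
begin

lemma closed_coboundary: "cocycle S (coboundary S g)"
 using face_ends by (auto simp: cocycle_def coboundary_def)

lemma link_edge_verts:
 assumes "link_edges_between S v x y ~= {}"
 shows "x : link_verts S v" "y : link_verts S v" "edge_link S (fst x) ~= {}"
proof -
 obtain k where k: "k : link_edges_between S v x y" using assms by blast
 then have e: "k : link_edges S v" and k': "{fst (corner S (fst k) (snd k)), snd (corner S (fst k) (snd k))} = {x, y}"
  unfolding link_edges_between_def case_prod_unfold mem_Collect_eq prod.collapse by simp_all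
 have xy: "x : {fst (corner S (fst k) (snd k)), snd (corner S (fst k) (snd k))}"
  "y : {fst (corner S (fst k) (snd k)), snd (corner S (fst k) (snd k))}"
  unfolding k' by simp_all
 show "x : link_verts S v" "y : link_verts S v"
  using xy corner_link_verts[OF e] by blast+
 have "x = fst (corner S (fst k) (snd k)) \<or> x = snd (corner S (fst k) (snd k))"
  using xy(1) by blast
 then have "fst x = face S (fst k) 0 \<or> fst x = face S (fst k) 1 \<or> fst x = face S (fst k) 2"
  by (auto simp: corner_def split: if_splits)
 then have "EX i<3. fst x = face S (fst k) i"
  by (elim disjE) (rule exI[of _ 0], simp, rule exI[of _ 1], simp, rule exI[of _ 2], simp)
 then obtain i where "i < 3" "fst x = face S (fst k) i" by blast
 then have "(fst k, i) : edge_link S (fst x)" using e by (simp add: edge_link_def link_edges_def case_prod_unfold)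
 then show "edge_link S (fst x) ~= {}" by blast
qed

lemma link_connected:
 assumes "v : verts S" "x : link_verts S v" "y : link_verts S v"
 shows "(x, y) : {(x, y). link_edges_between S v x y ~= {}}\<^sup>*"
 using assms codim1 by (auto simp: locally_connected_through_codim_1_def link_connected_def)

text \<open>Every edge lies in a triangle: an isolated vertex of a connected link is the whole link, so
 both structure constants of an edge without triangles would be negative, but their sum is 0.\<close>

lemma edge_link_nonempty:
 assumes e: "e : edges S"
 shows "edge_link S e ~= {}"
proof
 assume em: "edge_link S e = {}"
 have neg: "alpha S e (~ b) < 0" for b
 proof -
  define v where "v = endpt S e b"
  have v: "v : verts S" using endpt_verts[OF e] by (simp add: v_def)
  have x: "(e, b) : link_verts S v" using e by (simp add: link_verts_def end_vertex_def v_def)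
  have "y = (e, b)" if "((e, b), y) : {(x, y). link_edges_between S v x y ~= {}}\<^sup>*" for y
   using that
  proof (induction rule: rtrancl_induct)
   case (step y z)
   then show ?case using link_edge_verts(3)[of v "(e, b)" z] em by auto
  qed simp
  then have L: "link_verts S v = {(e, b)}" using link_connected[OF v x] x by blast
  obtain u k where u: "k > 0" "EX x:link_verts S v. u x ~= 0"
   "!!x. x : link_verts S v ==> lap S u x = k * u x"
   by (rule spectral[OF v]) blast
  have "- of_int (alpha S e (~ b)) * u (e, b) = k * u (e, b)"
   using u(3)[OF x] em by (simp add: lap_def)
  then have "(- of_int (alpha S e (~ b)) - k) * u (e, b) = 0" by (simp add: left_diff_distrib)
  then have "- of_int (alpha S e (~ b)) = k" using u(2) L by simp
  then show ?thesis using u(1) by linarith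
 qed
 have "alpha S e False + alpha S e True = 0" using alpha_sum[OF e] em by simp
 then show False using neg[of True] neg[of False] by simp
qed

lemma link_verts_nonempty: "v : verts S ==> link_verts S v ~= {}"
 by (rule spectral[of v]) auto

lemma nonneg_kernel:
 assumes v: "v : verts S" and z: "!!x. x : link_verts S v ==> z x >= 0"
  and lap: "!!x. x : link_verts S v ==> lap S z x = 0" and x0: "x0 : link_verts S v"
 shows "z x0 = 0"
proof (rule ccontr)
 assume nz: "z x0 ~= 0"
 define m where "m x y = real_of_int (local_intersection_entry S v x y)" for x y
 let ?L = "link_verts S v"
 have lapm: "(SUM j:?L. m i j * w j) = lap S w i" if "i : ?L" for w i
  unfolding m_def by (rule lap_matrix[OF that])
 have spread: "z y = 0" if x: "x : ?L" "z x = 0" and xy: "(x, y) : {(x, y). link_edges_between S v x y ~= {}}\<^sup>*" for x y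
  using xy
 proof (induction rule: rtrancl_induct)
  case (step y w)
  then have yw: "link_edges_between S v y w ~= {}" by simp
  then have L: "y : ?L" "w : ?L" using link_edge_verts by blast+
  show ?case
  proof (cases "w = y")
   case False
   have nn: "m y j * z j >= 0" if "j : ?L" for j
    using entry_nonneg[of y j v] z[OF that] step.IH by (cases "j = y") (auto simp: m_def)
   have "(SUM j:?L. m y j * z j) = 0" using lapm[OF L(1)] lap[OF L(1)] by simp
   then have "m y w * z w = 0"
    using sum_nonneg_eq_0_iff[OF finite_link_verts, of v "%j. m y j * z j"] nn L(2) by blast
   moreover have "finite (link_edges_between S v y w)"
    by (rule finite_subset[OF _ finite_link_edges[of v]]) (auto simp: link_edges_between_def)
   then have "m y w ~= 0" using yw False by (simp add: m_def local_intersection_entry_def)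
   ultimately show ?thesis by simp
  qed (use step in simp)
 qed (use x in simp)
 have pos: "z x > 0" if x: "x : ?L" for x
 proof -
  have "z x ~= 0" using spread[OF x _ link_connected[OF v x x0]] nz by blast
  then show ?thesis using z[OF x] by simp
 qed
 have neg: "(SUM x:?L. w x * lap S w x) <= 0" for w
 proof -
  define t where "t x = w x / z x" for x
  have tz: "w x = t x * z x" if "x : ?L" for x using pos[OF that] by (simp add: t_def)
  have msym: "m x y = m y x" for x y unfolding m_def by (subst entry_sym) simp
  have "0 <= (SUM x:?L. SUM y:?L. m x y * z x * z y * (t x - t y)\<^sup>2)"
  proof (intro sum_nonneg)
   fix x y assume "x : ?L" "y : ?L"
   then show "0 <= m x y * z x * z y * (t x - t y)\<^sup>2"
    using pos[of x] pos[of y] entry_nonneg[of x y v] by (cases "x = y") (auto simp: m_def)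
  qed
  also have "... = (SUM x:?L. SUM y:?L. (t x)\<^sup>2 * z x * (m x y * z y)) + (SUM x:?L. SUM y:?L. (t y)\<^sup>2 * z y * (m y x * z x))
    - 2 * (SUM x:?L. SUM y:?L. w x * (m x y * w y))"
  proof -
   have "m x y * z x * z y * (t x - t y)\<^sup>2 = (t x)\<^sup>2 * z x * (m x y * z y) + (t y)\<^sup>2 * z y * (m y x * z x) - 2 * (w x * (m x y * w y))"
    if "x : ?L" "y : ?L" for x y
    unfolding tz[OF that(1)] tz[OF that(2)] msym[of y x] by (simp add: power2_eq_square algebra_simps)
   then show ?thesis by (simp add: sum.distrib sum_subtractf sum_distrib_left cong: sum.cong)
  qed
  also have "(SUM x:?L. SUM y:?L. (t y)\<^sup>2 * z y * (m y x * z x)) = (SUM y:?L. SUM x:?L. (t y)\<^sup>2 * z y * (m y x * z x))"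
   by (rule sum.swap)
  also have "(SUM x:?L. SUM y:?L. (t x)\<^sup>2 * z x * (m x y * z y)) = 0"
   using lap by (simp add: sum_distrib_left[symmetric] lapm)
  also have "(SUM x:?L. SUM y:?L. w x * (m x y * w y)) = (SUM x:?L. w x * lap S w x)"
   by (simp add: sum_distrib_left[symmetric] lapm)
  finally show ?thesis by simp
 qed
 obtain u k where u: "k > 0" "EX x:?L. u x ~= 0" "!!x. x : ?L ==> lap S u x = k * u x"
  by (rule spectral[OF v]) blast
 obtain x1 where x1: "x1 : ?L" "u x1 ~= 0" using u(2) by blast
 have "(SUM x:?L. u x * lap S u x) = k * (SUM x:?L. (u x)\<^sup>2)"
  by (simp add: u(3) sum_distrib_left power2_eq_square mult_ac)
 moreover have "(SUM x:?L. (u x)\<^sup>2) > 0"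
  using x1 by (intro sum_pos2[OF finite_link_verts, of x1]) auto
 ultimately show False using neg[of u] u(1) by (smt (verit) mult_pos_pos)
qed

lemma sum_link_verts:
 fixes h :: "'e \<times> bool => real"
 shows "(SUM v:verts S. SUM x:link_verts S v. h x) = (SUM e:edges S. h (e, False) + h (e, True))"
proof -
 have "(SUM v:verts S. SUM x:link_verts S v. h x) = (SUM v:verts S. sum h {x : edges S \<times> UNIV. end_vertex S x = v})"
  by (intro sum.cong refl arg_cong[of _ _ "sum h"]) (auto simp: link_verts_def)
 also have "... = sum h (edges S \<times> UNIV)"
  using fin endpt_verts by (intro sum.group) (auto simp: end_vertex_def)
 also have "... = (SUM e:edges S. h (e, False) + h (e, True))"
  by (simp add: sum.cartesian_product' UNIV_bool add.commute)
 finally show ?thesis .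
qed

lemma closed_orthogonal:
 assumes "!!e. e : edges S ==> lap S p (e, False) = lap S p (e, True)"
 shows "(SUM v:verts S. SUM x:link_verts S v. outgoing c x * lap S p x) = 0"
 unfolding sum_link_verts using assms by (simp add: outgoing_def)

definition eigvec :: "'v => 'e \<times> bool => real" where
 "eigvec v = (SOME u. (EX k>0. ALL x:link_verts S v. lap S u x = k * u x) &
  (ALL z. (SUM x:link_verts S v. u x * z x) = 0 --> (SUM x:link_verts S v. z x * lap S z x) <= 0))"

lemma eigvec:
 assumes "v : verts S"
 shows "EX k>0. ALL x:link_verts S v. lap S (eigvec v) x = k * eigvec v x"
  "(SUM x:link_verts S v. eigvec v x * z x) = 0 ==> (SUM x:link_verts S v. z x * lap S z x) <= 0"
proof -
 have "EX u. (EX k>0. ALL x:link_verts S v. lap S u x = k * u x) &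
  (ALL z. (SUM x:link_verts S v. u x * z x) = 0 --> (SUM x:link_verts S v. z x * lap S z x) <= 0)"
  by (rule spectral[OF assms]) blast
 from someI_ex[OF this, folded eigvec_def]
 show "EX k>0. ALL x:link_verts S v. lap S (eigvec v) x = k * eigvec v x"
  "(SUM x:link_verts S v. eigvec v x * z x) = 0 ==> (SUM x:link_verts S v. z x * lap S z x) <= 0"
  by blast+
qed

lemma isotropic_kernel:
 assumes v: "v : verts S" and z: "(SUM x:link_verts S v. eigvec v x * z x) = 0"
  and q: "(SUM x:link_verts S v. z x * lap S z x) = 0" and x: "x : link_verts S v"
 shows "lap S z x = 0"
proof -
 let ?L = "link_verts S v"
 obtain k where k: "k > 0" "!!x. x : ?L ==> lap S (eigvec v) x = k * eigvec v x"
  using eigvec(1)[OF v] by blast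
 define w where "w = lap S z"
 have "(SUM x:?L. eigvec v x * w x) = (SUM x:?L. z x * lap S (eigvec v) x)"
  unfolding w_def by (rule lap_selfadjoint)
 also have "... = k * (SUM x:?L. eigvec v x * z x)" by (simp add: k sum_distrib_left mult_ac)
 finally have uw: "(SUM x:?L. eigvec v x * w x) = 0" using z by simp
 define A where "A = (SUM x:?L. (w x)\<^sup>2)"
 define B where "B = (SUM x:?L. w x * lap S w x)"
 have key: "2 * t * A + t * t * B <= 0" for t
 proof -
  have "(SUM x:?L. eigvec v x * (1 * z x + t * w x)) = (SUM x:?L. eigvec v x * z x) + t * (SUM x:?L. eigvec v x * w x)"
   by (simp add: sum_distrib_left sum.distrib algebra_simps)
  then have "(SUM x:?L. (1 * z x + t * w x) * lap S (%x. 1 * z x + t * w x) x) <= 0"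
   using z uw by (intro eigvec(2)[OF v]) simp
  moreover have "(SUM x:?L. (1 * z x + t * w x) * lap S (%x. 1 * z x + t * w x) x)
    = (SUM x:?L. z x * lap S z x) + t * (SUM x:?L. z x * lap S w x) + t * (SUM x:?L. w x * lap S z x) + t * t * B"
   unfolding lap_linear B_def by (simp add: sum_distrib_left sum.distrib algebra_simps)
  moreover have "(SUM x:?L. z x * lap S w x) = A" unfolding lap_selfadjoint[of z w]
   by (simp add: A_def w_def power2_eq_square)
  moreover have "(SUM x:?L. w x * lap S z x) = A" by (simp add: A_def w_def power2_eq_square)
  ultimately show ?thesis using q by (simp add: mult_ac)
 qed
 have "A <= 0"
 proof (rule ccontr)
  assume "~ A <= 0"
  then have A: "A > 0" by simp
  define t where "t = A / (\<bar>B\<bar> + 1)"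
  have t: "t > 0" using A by (simp add: t_def add_nonneg_pos)
  have "t * \<bar>B\<bar> <= t * (\<bar>B\<bar> + 1)" using t by simp
  also have "... = A" by (simp add: t_def add_nonneg_pos)
  finally have "2 * A + t * B > 0" using A t by (smt (verit) abs_ge_minus_self mult_le_cancel_left_pos mult_minus_right)
  then have "t * (2 * A + t * B) > 0" using t by simp
  then show False using key[of t] by (simp add: algebra_simps)
 qed
 moreover have "(w x)\<^sup>2 <= A" unfolding A_def using x by (intro member_le_sum finite_link_verts) auto
 ultimately have "(w x)\<^sup>2 <= 0" by linarith
 then show ?thesis by (simp add: w_def)
qed

definition ell :: "('e \<times> bool => real) => 'v => real" where
 "ell z v = (if v : verts S then SUM x:link_verts S v. eigvec v x * z x else 0)"

lemma ell_linear: "ell (%x. a * z x + b * w x) = (%v. a * ell z v + b * ell w v)"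
 by (auto simp: ell_def sum.distrib sum_distrib_left algebra_simps)

lemma ell_kernel_harmonic:
 assumes c: "cocycle S c" and l: "!!v. ell (outgoing c) v = 0"
 shows "harmonic S c"
proof -
 define q where "q v = (SUM x:link_verts S v. outgoing c x * lap S (outgoing c) x)" for v
 have lv: "(SUM x:link_verts S v. eigvec v x * outgoing c x) = 0" if "v : verts S" for v
  using l[of v] that by (simp add: ell_def)
 have qn: "q v <= 0" if "v : verts S" for v
  unfolding q_def by (rule eigvec(2)[OF that lv[OF that]])
 have "(SUM v:verts S. q v) = 0"
  unfolding q_def by (rule closed_orthogonal) (rule lap_outgoing_ends[OF fin(3) c alpha_sum])
 then have q0: "q v = 0" if "v : verts S" for v
  using sum_nonneg_eq_0_iff[OF fin(1), of "%v. - q v"] qn that by (simp add: sum_negf)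
 show ?thesis unfolding harmonic_def
 proof (intro ballI allI)
  fix e b assume e: "e : edges S"
  have v: "endpt S e b : verts S" by (rule endpt_verts[OF e])
  have x: "(e, b) : link_verts S (endpt S e b)" using e by (simp add: link_verts_def end_vertex_def)
  show "lap S (outgoing c) (e, b) = 0"
   by (rule isotropic_kernel[OF v lv[OF v] q0[OF v, unfolded q_def] x])
 qed
qed

lemma verts_connected:
 assumes A: "A <= verts S" "a : A"
  and edge: "!!e. e : edges S ==> endpt S e False : A <-> endpt S e True : A"
 shows "A = verts S"
proof (rule ccontr)
 assume "A ~= verts S"
 then obtain b where b: "b : verts S" "b ~: A" using A by blast
 define lab :: "('v, 'e, 'f) point => bool" where "lab x = (case x of VPoint v => v : A
   | EPoint e t => endpt S e False : A | TPoint f z => endpt S (face S f 2) False : A)" for x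
 have lab_e: "lab (edge_map S e t) <-> endpt S e False : A" if "e : edges S" for e t
  using edge[OF that] by (auto simp: lab_def edge_map_def)
 have lab_f: "lab (tri_map S f z) <-> endpt S (face S f 2) False : A" if "f : tris S" for f z
 proof -
  have F: "face S f 2 : edges S" "face S f 1 : edges S" "face S f 0 : edges S" using face_edges[OF that] by auto
  have e1: "endpt S (face S f (Suc 0)) False : A <-> endpt S (face S f 2) False : A"
   using face_ends(1)[OF that] by simp
  have e0: "endpt S (face S f 0) False : A <-> endpt S (face S f 2) False : A"
   using face_ends(2)[OF that] edge[OF F(1)] by simp
  have T: "lab (TPoint f z) <-> endpt S (face S f 2) False : A" by (simp add: lab_def)
  show ?thesis unfolding tri_map_def One_nat_def
   by (simp add: lab_e F F[unfolded One_nat_def] e1 e0 T)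
 qed
 have op: "openin (realization S) {x : points S. lab x = B}" for B
  unfolding openin_realization realization_open_def
 proof (intro conjI ballI)
  fix e assume e: "e : edges S"
  have "edge_map S e t : points S" if "t : {0..1}" for t using e that unfolding points_def by blast
  then have "{t : {0..1}. edge_map S e t : {x : points S. lab x = B}} = (if (endpt S e False : A) = B then {0..1} else {})"
   using lab_e[OF e] by auto
  then show "openin (top_of_set {0..1}) {t : {0..1}. edge_map S e t : {x : points S. lab x = B}}" by simp
 next
  fix f assume f: "f : tris S"
  have "tri_map S f t : points S" if "t : std" for t using f that unfolding points_def by blast
  then have "{t : std. tri_map S f t : {x : points S. lab x = B}} = (if (endpt S (face S f 2) False : A) = B then std else {})"
   using lab_f[OF f] by auto
  then show "openin (top_of_set std) {t : std. tri_map S f t : {x : points S. lab x = B}}" by simp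
 qed auto
 have "connected_space (realization S)" using weak by (simp add: weak_tropical_surface_def)
 moreover have "points S <= {x : points S. lab x = True} Un {x : points S. lab x = False}" by auto
 moreover have "{x : points S. lab x = True} Int {x : points S. lab x = False} = {}" by auto
 moreover have "VPoint a : {x : points S. lab x = True}" "VPoint b : {x : points S. lab x = False}"
  using A b by (auto simp: points_def lab_def)
 ultimately show False using op[of True] op[of False] unfolding connected_space_def topspace_realization by blast
qed

lemma coboundary_kernel:
 assumes l: "!!v. ell (outgoing (coboundary S g)) v = 0" and v: "v : verts S" "w : verts S"
 shows "g v = g w"
proof -
 have h: "harmonic S (coboundary S g)" by (rule ell_kernel_harmonic[OF closed_coboundary l])
 define A where "A = {v : verts S. g v = Max (g ` verts S)}"
 have mx: "g v <= Max (g ` verts S)" if "v : verts S" for v using fin(1) that by simp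
 have "Max (g ` verts S) : g ` verts S" using v fin(1) by (intro Max_in) auto
 then obtain a where a: "a : A" by (auto simp: A_def)
 have out: "outgoing (coboundary S g) (e, b) = g (endpt S e (~ b)) - g (endpt S e b)" for e b
  by (simp add: outgoing_def coboundary_def)
 have nb: "endpt S e (~ b) : A" if e: "e : edges S" and eb: "endpt S e b : A" for e b
 proof -
  let ?v = "endpt S e b"
  define z where "z x = (-1) * outgoing (coboundary S g) x + 0 * 0" for x
  have "z (e, b) = 0"
  proof (rule nonneg_kernel[of ?v])
   show "?v : verts S" by (rule endpt_verts[OF e])
   show "(e, b) : link_verts S ?v" using e by (simp add: link_verts_def end_vertex_def)
   fix x assume x: "x : link_verts S ?v"
   obtain e' b' where x': "x = (e', b')" by (cases x)
   have e': "e' : edges S" "endpt S e' b' = ?v" using x by (auto simp: x' link_verts_def end_vertex_def)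
   show "z x >= 0" using eb mx[OF endpt_verts[OF e'(1), of "~ b'"]] e'(2) by (simp add: x' z_def out A_def)
   show "lap S z x = 0" unfolding z_def lap_linear using h e'(1) by (simp add: harmonic_def x')
  qed
  then show ?thesis using eb endpt_verts[OF e, of "~ b"] by (simp add: z_def out A_def)
 qed
 have "A = verts S"
 proof (rule verts_connected[OF _ a])
  show "A <= verts S" by (auto simp: A_def)
  show "endpt S e False : A <-> endpt S e True : A" if "e : edges S" for e
   using nb[OF that, of True] nb[OF that, of False] by auto
 qed
 then have "v : A" "w : A" using v by simp_all
 then show ?thesis by (simp add: A_def)
qed

end

section \<open>Harmonic cochains in cohomology\<close>

lemma range_codim_one:
 fixes T :: "('v => real) => 'v => real"
 assumes fin: "finite V" and v0: "v0 : V" and lin: "linear T"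
  and supp: "!!g v. v ~: V ==> T g v = 0"
  and ker: "!!g v. (!!v. T g v = 0) ==> v : V ==> g v = g v0"
  and w: "w ~: range T" "!!v. v ~: V ==> w v = 0" and x: "!!v. v ~: V ==> x v = 0"
 shows "EX g a. x = (%v. T g v + a * w v)"
proof -
 define ep :: "'v => 'v => real" where "ep v = (%u. if u = v then 1 else 0)" for v
 define W where "W = V - {v0}"
 define B where "B = T ` ep ` W"
 have scale: "(a *R g) = (%v. a * g v)" for a and g :: "'v => real" by (simp add: scaleR_fun_def)
 have inj: "inj ep" by (auto simp: inj_def ep_def fun_eq_iff split: if_splits)
 have sub: "subspace {g. ALL v:A. g v = 0}" for A :: "'v set"
  by (simp add: subspace_def scaleR_fun_def)
 have indW: "independent (ep ` W)"
  unfolding dependent_def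
 proof clarsimp
  fix v assume v: "v : W" "ep v : span (ep ` W - {ep v})"
  have "span (ep ` W - {ep v}) <= {g. ALL u:{v}. g u = 0}"
   by (rule span_minimal[OF _ sub]) (auto simp: ep_def fun_eq_iff)
  then show False using v(2) by (auto simp: ep_def)
 qed
 have spW: "span (ep ` W) <= {g. ALL u:-W. g u = 0}"
  by (rule span_minimal[OF _ sub]) (auto simp: ep_def fun_eq_iff)
 have injT: "inj_on T (span (ep ` W))"
 proof (rule inj_onI)
  fix g h assume gh: "g : span (ep ` W)" "h : span (ep ` W)" "T g = T h"
  have "T (g - h) v = 0" for v using linear_diff[OF lin, of g h] gh(3) by simp
  then have c: "(g - h) v = (g - h) v0" if "v : V" for v using ker[of "g - h" v] that by blast
  have "g - h : span (ep ` W)" using gh by (simp add: span_diff)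
  then have z: "(g - h) u = 0" if "u ~: W" for u using spW that by blast
  have "(g - h) u = 0" for u
  proof (cases "u : W")
   case True
   then show ?thesis using c[of u] z[of v0] by (simp add: W_def)
  qed (rule z)
  then show "g = h" by (simp add: fun_eq_iff)
 qed
 have indB: "independent B"
  unfolding B_def by (rule linear_independent_injective_image[OF lin indW injT])
 have cardB: "card B = card V - 1" "finite B"
 proof -
  have "card B = card (ep ` W)" unfolding B_def
   by (rule card_image) (rule inj_on_subset[OF injT span_superset])
  also have "... = card W" by (rule card_image) (rule inj_on_subset[OF inj subset_UNIV])
  finally show "card B = card V - 1" using fin v0 by (simp add: W_def)
  show "finite B" using fin by (simp add: B_def W_def)
 qed
 have spB: "span B <= range T"
  unfolding B_def using linear_span_image[OF lin, of "ep ` W"] by auto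
 have "card V > 0" using fin v0 by (auto simp: card_gt_0_iff)
 then have V1: "card V >= 1" by simp
 have sum_fun_apply: "(SUM v:A. F v) u = (SUM v:A. F v u)" for A :: "'v set" and F :: "'v => 'v => real" and u
  by (induction A rule: infinite_finite_induct) auto
 have wB: "w ~: span B" using w(1) spB by blast
 have indwB: "independent (insert w B)" by (rule independent_insertI[OF wB indB])
 have wnB: "w ~: B" using wB span_superset by blast
 have spV: "g : span (ep ` V)" if "!!v. v ~: V ==> g v = 0" for g
 proof -
  have "g = (SUM v:V. g v *R ep v)"
  proof
   fix u
   have "(SUM v:V. g v *R ep v) u = (SUM v:V. g v * ep v u)"
    unfolding sum_fun_apply by (simp add: scaleR_fun_def)
   also have "... = (SUM v:V. if v = u then g v else 0)" by (intro sum.cong) (auto simp: ep_def)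
   also have "... = g u" using fin that[of u] by simp
   finally show "g u = (SUM v:V. g v *R ep v) u" by simp
  qed
  also have "... : span (ep ` V)" by (intro span_sum span_scale span_base) auto
  finally show ?thesis .
 qed
 have "x : span (insert w B)"
 proof (rule ccontr)
  assume nx: "x ~: span (insert w B)"
  have ind: "independent (insert x (insert w B))" by (rule independent_insertI[OF nx indwB])
  have xn: "x ~: insert w B" using nx span_superset by blast
  have "insert x (insert w B) <= span (ep ` V)"
   using spV x w(2) supp by (auto simp: B_def)
  from independent_span_bound[OF _ ind this] fin
  have "card (insert x (insert w B)) <= card (ep ` V)" by auto
  also have "... <= card V" by (rule card_image_le[OF fin])
  finally show False using cardB V1 xn wnB by simp
 qed
 then obtain k where "x - k *R w : span B" unfolding span_breakdown_eq by blast
 then obtain g where g: "x - k *R w = T g" using spB by blast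
 have "x v = T g v + k * w v" for v using fun_cong[OF g, of v] by (simp add: scale)
 then show ?thesis by blast
qed

context ct_surface
begin

lemma coboundary_linear:
 "coboundary S (%v. a * g v + b * h v) = (%e. a * coboundary S g e + b * coboundary S h e)"
 by (auto simp: coboundary_def algebra_simps)

lemma closed_combination:
 assumes "cocycle S c" "cocycle S d"
 shows "cocycle S (%e. c e - coboundary S g e - a * d e)"
 using assms closed_coboundary[of g] by (auto simp: cocycle_def algebra_simps)

lemma ell_combination:
 "ell (outgoing (%e. c e - coboundary S g e - a * d e)) v
  = ell (outgoing c) v - ell (outgoing (coboundary S g)) v - a * ell (outgoing d) v"
proof -
 have "outgoing (%e. c e - coboundary S g e - a * d e)
   = (%x. 1 * (1 * outgoing c x + (-1) * outgoing (coboundary S g) x) + (- a) * outgoing d x)"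
  by (auto simp: outgoing_def)
 then show ?thesis by (simp only: ell_linear) simp
qed

lemma linear_ell_coboundary: "linear (%g. ell (outgoing (coboundary S g)))"
proof
 fix g h :: "'v => real" and r :: real
 show "ell (outgoing (coboundary S (g + h))) = ell (outgoing (coboundary S g)) + ell (outgoing (coboundary S h))"
  using coboundary_linear[of 1 g 1 h] outgoing_linear[of 1 "coboundary S g" 1 "coboundary S h"]
   ell_linear[of 1 "outgoing (coboundary S g)" 1 "outgoing (coboundary S h)"]
  by (simp add: plus_fun_def)
 show "ell (outgoing (coboundary S (r *R g))) = r *R ell (outgoing (coboundary S g))"
  using coboundary_linear[of r g 0 g] outgoing_linear[of r "coboundary S g" 0 "coboundary S g"]
   ell_linear[of r "outgoing (coboundary S g)" 0 "outgoing (coboundary S g)"]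
  by (simp add: scaleR_fun_def)
qed

lemma ell_codim_one:
 assumes d: "cocycle S d" "ell (outgoing d) ~: range (%g. ell (outgoing (coboundary S g)))"
  and x: "!!v. v ~: verts S ==> x v = 0"
 shows "EX g a. ALL v. x v = ell (outgoing (coboundary S g)) v + a * ell (outgoing d) v"
proof -
 have supp: "v ~: verts S ==> ell z v = 0" for z v by (simp add: ell_def)
 have "ell (outgoing d) ~= ell (outgoing (coboundary S (%_. 0)))" using d(2) by blast
 then obtain v0 where "v0 : verts S" using supp by (metis ext)
 note R = range_codim_one[OF fin(1) this linear_ell_coboundary supp _ d(2) supp x]
 have "EX g a. x = (%v. ell (outgoing (coboundary S g)) v + a * ell (outgoing d) v)"
  by (rule R) (use coboundary_kernel \<open>v0 : verts S\<close> in blast)+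
 then show ?thesis by metis
qed

lemma harmonic_complement:
 "EX d. cocycle S d & (ALL c. cocycle S c -->
   (EX g a. harmonic S (%e. c e - coboundary S g e - a * d e)))"
proof (cases "EX d. cocycle S d & ell (outgoing d) ~: range (%g. ell (outgoing (coboundary S g)))")
 case True
 then obtain d where d: "cocycle S d" "ell (outgoing d) ~: range (%g. ell (outgoing (coboundary S g)))" by blast
 have "EX g a. harmonic S (%e. c e - coboundary S g e - a * d e)" if c: "cocycle S c" for c
 proof -
  obtain g a where ga: "ALL v. ell (outgoing c) v = ell (outgoing (coboundary S g)) v + a * ell (outgoing d) v"
   using ell_codim_one[OF d, of "ell (outgoing c)"] by (auto simp: ell_def)
  have "harmonic S (%e. c e - coboundary S g e - a * d e)"
   by (rule ell_kernel_harmonic[OF closed_combination[OF c d(1)]]) (simp add: ell_combination ga)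
  then show ?thesis by blast
 qed
 then show ?thesis using d(1) by blast
next
 case False
 have z: "cocycle S (%_. 0)" by (simp add: cocycle_def)
 have "EX g a. harmonic S (%e. c e - coboundary S g e - a * 0)" if c: "cocycle S c" for c
 proof -
  obtain g where g: "ell (outgoing c) = ell (outgoing (coboundary S g))" using False c by blast
  have "harmonic S (%e. c e - coboundary S g e)"
   using ell_kernel_harmonic[OF closed_combination[OF c z, of g 0]] ell_combination[of c g 0 "%_. 0"] g by simp
  then show ?thesis by auto
 qed
 then show ?thesis using z by blast
qed

text \<open>A class with positive square orthogonal to the isotropic space of closed cochains leaves no
 room for a complement.\<close>

lemma positive_no_complement:
 assumes p: "!!e. e : edges S ==> lap S p (e, False) = lap S p (e, True)"
  and pos: "(SUM v:verts S. SUM x:link_verts S v. p x * lap S p x) > 0"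
  and c: "cocycle S c"
 shows "EX g. harmonic S (%e. c e - coboundary S g e)"
proof -
 have "ell (outgoing c) : range (%g. ell (outgoing (coboundary S g)))"
 proof (rule ccontr)
  assume n: "ell (outgoing c) ~: range (%g. ell (outgoing (coboundary S g)))"
  obtain g a where ga: "!!v. ell p v = ell (outgoing (coboundary S g)) v + a * ell (outgoing c) v"
   using ell_codim_one[OF c n, of "ell p"] by (auto simp: ell_def)
  define d where "d e = 1 * coboundary S g e + a * c e" for e
  have d: "cocycle S d" unfolding d_def by (rule cocycle_linear[OF closed_coboundary c])
  have ld: "ell (outgoing d) = ell p" unfolding d_def outgoing_linear ell_linear using ga by auto
  define z where "z x = 1 * p x + (-1) * outgoing d x" for x
  have ez: "ell z v = 0" for v unfolding z_def ell_linear ld by simp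
  have uz: "(SUM x:link_verts S v. eigvec v x * z x) = 0" if "v : verts S" for v
   using ez[of v] that by (simp add: ell_def)
  have "(SUM v:verts S. SUM x:link_verts S v. z x * lap S z x) <= 0"
   by (intro sum_nonpos eigvec(2) uz)
  moreover have "(SUM v:verts S. SUM x:link_verts S v. z x * lap S z x)
   = (SUM v:verts S. SUM x:link_verts S v. p x * lap S p x)
   - (SUM v:verts S. SUM x:link_verts S v. outgoing d x * lap S p x)
   - (SUM v:verts S. SUM x:link_verts S v. p x * lap S (outgoing d) x)
   + (SUM v:verts S. SUM x:link_verts S v. outgoing d x * lap S (outgoing d) x)"
   unfolding z_def lap_linear by (simp add: sum_subtractf[symmetric] sum.distrib[symmetric] algebra_simps)
  moreover have "(SUM v:verts S. SUM x:link_verts S v. outgoing d x * lap S p x) = 0"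
   by (rule closed_orthogonal[OF p])
  moreover have "(SUM v:verts S. SUM x:link_verts S v. p x * lap S (outgoing d) x) = 0"
   unfolding lap_selfadjoint[of p] by (rule closed_orthogonal[OF p])
  moreover have "(SUM v:verts S. SUM x:link_verts S v. outgoing d x * lap S (outgoing d) x) = 0"
   by (rule closed_orthogonal) (rule lap_outgoing_ends[OF fin(3) d alpha_sum])
  ultimately show False using pos by linarith
 qed
 then obtain g where g: "ell (outgoing c) = ell (outgoing (coboundary S g))" by blast
 have z: "cocycle S (%_. 0)" by (simp add: cocycle_def)
 have "harmonic S (%e. c e - coboundary S g e)"
  using ell_kernel_harmonic[OF closed_combination[OF c z, of g 0]] ell_combination[of c g 0 "%_. 0"] g by simp
 then show ?thesis by auto
qed

end

subsection \<open>Integral harmonic cochains\<close>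

interpretation rat_real: vector_space "%q x. real_of_rat q * x"
 by unfold_locales (simp_all add: algebra_simps of_rat_add of_rat_mult)

lemma rat_coordinates:
 obtains ph :: "real => real => real"
 where "!!b x y. ph b (x + y) = ph b x + ph b y" "!!b x. ph b x : \<rat>" "!!x. finite {b. ph b x ~= 0}"
  "!!x I. finite I ==> {b. ph b x ~= 0} <= I ==> x = (SUM b:I. ph b x * b)"
proof -
 define B where "B = rat_real.extend_basis {}"
 have ind: "rat_real.independent B" and sp: "rat_real.span B = UNIV"
  unfolding B_def by (auto intro!: rat_real.independent_extend_basis rat_real.span_extend_basis rat_real.independent_empty)
 define r where "r = rat_real.representation B"
 show ?thesis
 proof (rule that[of "%b x. real_of_rat (r x b)"])
  show "real_of_rat (r (x + y) b) = real_of_rat (r x b) + real_of_rat (r y b)" for b x y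
   using rat_real.representation_add[OF ind, of y x] sp by (simp add: r_def of_rat_add add.commute)
  show "real_of_rat (r x b) : \<rat>" for x b by simp
  show "finite {b. real_of_rat (r x b) ~= 0}" for x
   using rat_real.finite_representation[of B x] by (simp add: r_def)
  fix x and I :: "real set" assume I: "finite I" "{b. real_of_rat (r x b) ~= 0} <= I"
  have "x = (SUM b | r x b ~= 0. real_of_rat (r x b) * b)"
   using rat_real.sum_nonzero_representation_eq[OF ind, of x] sp by (simp add: r_def)
  also have "... = (SUM b:I. real_of_rat (r x b) * b)"
   using I by (intro sum.mono_neutral_left) auto
  finally show "x = (SUM b:I. real_of_rat (r x b) * b)" .
 qed
qed

lemma common_denominator:
 assumes "finite A" "!!a. a : A ==> q a : \<rat>"
 shows "EX N::int. N > 0 & (ALL a:A. of_int N * q a : (\<int> :: real set))"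
 using assms
proof (induction A rule: finite_induct)
 case empty
 then show ?case by (auto intro: exI[of _ 1])
next
 case (insert a A)
 then obtain N :: int where N: "N > 0" "ALL a:A. of_int N * q a : (\<int> :: real set)" by auto
 have "q a : \<rat>" using insert.prems by simp
 then obtain m n :: int where mn: "n > 0" "q a = of_int m / of_int n" by (rule Rats_cases') blast
 have "of_int (N * n) * q b : \<int>" if "b : insert a A" for b
 proof (cases "b = a")
  case True
  then have "of_int (N * n) * q b = of_int (N * m)" using mn by simp
  then show ?thesis by (metis Ints_of_int)
 next
  case False
  then have "of_int N * q b : \<int>" using N(2) that by blast
  then have "of_int n * (of_int N * q b) : \<int>" by (rule Ints_mult[OF Ints_of_int])
  moreover have "of_int (N * n) * q b = of_int n * (of_int N * q b)" by simp
  ultimately show ?thesis by (simp only:)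
 qed
 then show ?case using N(1) mn(1) by (intro exI[of _ "N * n"]) auto
qed

context ct_surface
begin

lemma lap_additive:
 assumes add: "!!x y. ph (x + y) = ph x + (ph y :: real)"
 shows "lap S (outgoing (%e. ph (c e))) x = ph (lap S (outgoing c) x)"
proof -
 interpret additive ph by unfold_locales (rule add)
 have nat: "ph (of_nat n * y) = of_nat n * ph y" for n y
  by (induction n) (simp_all add: zero add algebra_simps)
 have int: "ph (of_int n * y) = of_int n * ph y" for n y
  by (cases n) (simp_all add: nat minus del: of_nat_Suc)
 have out: "outgoing (%e. ph (c e)) = (%y. ph (outgoing c y))" by (auto simp: outgoing_def minus)
 show ?thesis unfolding lap_def out by (simp add: diff int sum case_prod_unfold)
qed

lemma harmonic_cong: "(!!e. e : edges S ==> c e = d e) ==> harmonic S c ==> harmonic S d"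
 unfolding harmonic_def using face_edges
 by (intro ballI allI) (subst lap_cong[of S _ "outgoing c"], auto simp: outgoing_def)

lemma closed_cong: "(!!e. e : edges S ==> c e = d e) ==> cocycle S c ==> cocycle S d"
 using face_edges by (auto simp: cocycle_def)

lemma harmonic_span_integral:
 assumes c: "cocycle S c" "harmonic S c"
 obtains I :: "real set" and r :: "real => real" and h :: "real => 'e => int"
 where "finite I" "!!i. i : I ==> cocycle S (%e. of_int (h i e))"
  "!!i. i : I ==> harmonic S (%e. of_int (h i e))"
  "!!e. e : edges S ==> c e = (SUM i:I. r i * of_int (h i e))"
proof -
 obtain ph :: "real => real => real" where add: "!!b x y. ph b (x + y) = ph b x + ph b y"
  and rat: "!!b x. ph b x : \<rat>" and f: "!!x. finite {b. ph b x ~= 0}"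
  and s: "!!x I. finite I ==> {b. ph b x ~= 0} <= I ==> x = (SUM b:I. ph b x * b)"
  by (rule rat_coordinates) blast
 define I where "I = (\<Union>e\<in>edges S. {b. ph b (c e) ~= 0})"
 have I: "finite I" using fin f by (simp add: I_def)
 have "EX N::int. N > 0 & (ALL e:edges S. of_int N * ph b (c e) : (\<int> :: real set))" for b
  by (rule common_denominator[OF fin(2) rat])
 then obtain N :: "real => int" where N: "!!b. N b > 0" "!!b e. e : edges S ==> of_int (N b) * ph b (c e) : \<int>"
  by metis
 define h where "h b e = \<lfloor>of_int (N b) * ph b (c e)\<rfloor>" for b e
 have h: "of_int (h b e) = of_int (N b) * ph b (c e)" if "e : edges S" for b e
  unfolding h_def using N(2)[OF that, of b] by (auto elim: Ints_cases)
 have ph0: "ph b 0 = 0" for b using add[of b 0 0] by simp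
 have add': "of_int (N b) * ph b (x + y) = of_int (N b) * ph b x + of_int (N b) * ph b y" for b x y
  by (simp add: add distrib_left)
 show ?thesis
 proof (rule that[OF I, of h "%b. b / of_int (N b)"])
  fix b
  show "cocycle S (%e. of_int (h b e))"
   by (rule closed_cong[of "%e. of_int (N b) * ph b (c e)"])
    (use c(1) in \<open>auto simp: h cocycle_def add distrib_left\<close>)
  have "harmonic S (%e. of_int (N b) * ph b (c e))"
   unfolding harmonic_def lap_additive[of "%x. of_int (N b) * ph b x", OF add']
   using c(2) by (simp add: harmonic_def ph0)
  then show "harmonic S (%e. of_int (h b e))" by (rule harmonic_cong[rotated]) (simp add: h)
 next
  fix e assume e: "e : edges S"
  have "c e = (SUM b:I. ph b (c e) * b)" by (rule s[OF I]) (use e in \<open>auto simp: I_def\<close>)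
  also have "... = (SUM b:I. b / of_int (N b) * of_int (h b e))"
   using N(1) by (intro sum.cong refl) (simp add: h[OF e] less_imp_neq[THEN not_sym])
  finally show "c e = (SUM b:I. b / of_int (N b) * of_int (h b e))" .
 qed
qed

end

section \<open>Cech classes\<close>

lemma locally_constant_on_subset:
 "locally_constant_on X W g ==> W' <= W ==> locally_constant_on X W' g"
 unfolding locally_constant_on_def by (meson IntD1 IntD2 IntI subsetD)

lemma locally_constant_on_linear:
 assumes "locally_constant_on X W g" "locally_constant_on X W h"
 shows "locally_constant_on X W (%z. a * g z + b * h z)"
 unfolding locally_constant_on_def
proof
 fix z assume z: "z : W"
 obtain V where V: "openin X V" "z : V" "ALL y:V Int W. g y = g z"
  using assms(1) z unfolding locally_constant_on_def by blast
 obtain V' where V': "openin X V'" "z : V'" "ALL y:V' Int W. h y = h z"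
  using assms(2) z unfolding locally_constant_on_def by blast
 have "openin X (V Int V')" using V(1) V'(1) by blast
 moreover have "z : V Int V'" using V(2) V'(2) by blast
 moreover have "a * g y + b * h y = a * g z + b * h z" if "y : (V Int V') Int W" for y
  using V(3) V'(3) that by auto
 ultimately show "EX V. openin X V & z : V & (ALL y:V Int W. a * g y + b * h y = a * g z + b * h z)"
  by blast
qed

lemma pointed_cover_Int:
 "pointed_cover X U ==> pointed_cover X V ==> pointed_cover X (%x. U x Int V x)"
 by (auto simp: pointed_cover_def)

lemma cech_Z1_I:
 assumes "pointed_cover X U"
  "!!x y. x : topspace X ==> y : topspace X ==> locally_constant_on X (U x Int U y) (c x y)"
  "!!x y w z. x : topspace X ==> y : topspace X ==> w : topspace X ==> z : U x Int U y Int U w ==>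
    c x y z + c y w z = c x w z"
 shows "c : cech_Z1 X"
 using assms unfolding cech_Z1_def by blast

lemma cech_B1_I:
 assumes "pointed_cover X U" "!!x. x : topspace X ==> locally_constant_on X (U x) (b x)"
  "!!x y z. x : topspace X ==> y : topspace X ==> z : U x Int U y ==> c x y z = b y z - b x z"
 shows "c : cech_B1 X"
 using assms unfolding cech_B1_def by blast

lemma scaleR_cochain: "(r *R c) x y z = r * c x y z" for c :: "'p => 'p => 'p => real"
 by (simp add: scaleR_fun_def)

lemma pointed_cover_top: "pointed_cover X (%x. topspace X)"
 by (simp add: pointed_cover_def)

lemma subspace_cech_Z1: "subspace (cech_Z1 X)"
 unfolding subspace_def
proof (intro conjI ballI allI)
 show "0 : cech_Z1 X"
  by (rule cech_Z1_I[OF pointed_cover_top]) (auto simp: locally_constant_on_def)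
next
 fix c d :: "'a => 'a => 'a => real"
 assume c: "c : cech_Z1 X" and d: "d : cech_Z1 X"
 obtain U where U: "pointed_cover X U"
   "!!x y. x : topspace X ==> y : topspace X ==> locally_constant_on X (U x Int U y) (c x y)"
   "!!x y w z. x : topspace X ==> y : topspace X ==> w : topspace X ==> z : U x Int U y Int U w ==> c x y z + c y w z = c x w z"
  using c unfolding cech_Z1_def by blast
 obtain V where V: "pointed_cover X V"
   "!!x y. x : topspace X ==> y : topspace X ==> locally_constant_on X (V x Int V y) (d x y)"
   "!!x y w z. x : topspace X ==> y : topspace X ==> w : topspace X ==> z : V x Int V y Int V w ==> d x y z + d y w z = d x w z"
  using d unfolding cech_Z1_def by blast
 show "c + d : cech_Z1 X"
 proof (rule cech_Z1_I[OF pointed_cover_Int[OF U(1) V(1)]])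
  fix x y assume xy: "x : topspace X" "y : topspace X"
  have "locally_constant_on X ((U x Int V x) Int (U y Int V y)) (%z. 1 * c x y z + 1 * d x y z)"
   by (intro locally_constant_on_linear locally_constant_on_subset[OF U(2)[OF xy]] locally_constant_on_subset[OF V(2)[OF xy]]) auto
  then show "locally_constant_on X ((U x Int V x) Int (U y Int V y)) ((c + d) x y)"
   by (simp add: plus_fun_def)
 next
  fix x y w z assume xy: "x : topspace X" "y : topspace X" "w : topspace X"
   and z: "z : U x Int V x Int (U y Int V y) Int (U w Int V w)"
  show "(c + d) x y z + (c + d) y w z = (c + d) x w z"
   using U(3)[OF xy, of z] V(3)[OF xy, of z] z by simp
 qed
next
 fix r :: real and c :: "'a => 'a => 'a => real"
 assume "c : cech_Z1 X"
 then obtain U where U: "pointed_cover X U"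
   "!!x y. x : topspace X ==> y : topspace X ==> locally_constant_on X (U x Int U y) (c x y)"
   "!!x y w z. x : topspace X ==> y : topspace X ==> w : topspace X ==> z : U x Int U y Int U w ==> c x y z + c y w z = c x w z"
  unfolding cech_Z1_def by blast
 show "r *R c : cech_Z1 X"
 proof (rule cech_Z1_I[OF U(1)])
  fix x y assume xy: "x : topspace X" "y : topspace X"
  show "locally_constant_on X (U x Int U y) ((r *R c) x y)"
   using locally_constant_on_linear[OF U(2)[OF xy] U(2)[OF xy], of r 0] by (simp add: scaleR_fun_def)
 next
  fix x y w z assume xy: "x : topspace X" "y : topspace X" "w : topspace X"
   and z: "z : U x Int U y Int U w"
  show "(r *R c) x y z + (r *R c) y w z = (r *R c) x w z"
   unfolding scaleR_cochain U(3)[OF xy z, symmetric] by (simp add: distrib_left)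
 qed
qed

lemma subspace_cech_B1: "subspace (cech_B1 X)"
 unfolding subspace_def
proof (intro conjI ballI allI)
 show "0 : cech_B1 X"
  by (rule cech_B1_I[OF pointed_cover_top, of _ "%_ _. 0"]) (auto simp: locally_constant_on_def)
next
 fix c d :: "'a => 'a => 'a => real"
 assume c: "c : cech_B1 X" and d: "d : cech_B1 X"
 obtain U b where U: "pointed_cover X U" "!!x. x : topspace X ==> locally_constant_on X (U x) (b x)"
   "!!x y z. x : topspace X ==> y : topspace X ==> z : U x Int U y ==> c x y z = b y z - b x z"
  using c unfolding cech_B1_def by blast
 obtain V b' where V: "pointed_cover X V" "!!x. x : topspace X ==> locally_constant_on X (V x) (b' x)"
   "!!x y z. x : topspace X ==> y : topspace X ==> z : V x Int V y ==> d x y z = b' y z - b' x z"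
  using d unfolding cech_B1_def by blast
 show "c + d : cech_B1 X"
 proof (rule cech_B1_I[OF pointed_cover_Int[OF U(1) V(1)]])
  fix x assume x: "x : topspace X"
  show "locally_constant_on X (U x Int V x) (%z. 1 * b x z + 1 * b' x z)"
   by (intro locally_constant_on_linear locally_constant_on_subset[OF U(2)[OF x]] locally_constant_on_subset[OF V(2)[OF x]]) auto
 next
  fix x y z assume xy: "x : topspace X" "y : topspace X" and z: "z : U x Int V x Int (U y Int V y)"
  show "(c + d) x y z = (1 * b y z + 1 * b' y z) - (1 * b x z + 1 * b' x z)"
   using U(3)[OF xy, of z] V(3)[OF xy, of z] z by simp
 qed
next
 fix r :: real and c :: "'a => 'a => 'a => real"
 assume "c : cech_B1 X"
 then obtain U b where U: "pointed_cover X U" "!!x. x : topspace X ==> locally_constant_on X (U x) (b x)"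
   "!!x y z. x : topspace X ==> y : topspace X ==> z : U x Int U y ==> c x y z = b y z - b x z"
  unfolding cech_B1_def by blast
 show "r *R c : cech_B1 X"
 proof (rule cech_B1_I[OF U(1)])
  fix x assume x: "x : topspace X"
  show "locally_constant_on X (U x) (%z. r * b x z + 0 * b x z)"
   by (rule locally_constant_on_linear[OF U(2)[OF x] U(2)[OF x]])
 next
  fix x y z assume xy: "x : topspace X" "y : topspace X" and z: "z : U x Int U y"
  show "(r *R c) x y z = (r * b y z + 0 * b y z) - (r * b x z + 0 * b x z)"
   unfolding scaleR_cochain U(3)[OF xy z] by (simp add: right_diff_distrib)
 qed
qed

lemma cech_class_subset: "cech_class X c <= cech_Z1 X"
 by (auto simp: cech_class_def)

lemma cech_class_self: "c : cech_Z1 X ==> c : cech_class X c"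
 using subspace_0[OF subspace_cech_B1] by (auto simp: cech_class_def)

lemma cech_class_eq:
 assumes "c - d : cech_B1 X"
 shows "cech_class X c = cech_class X d"
proof -
 have "e - c : cech_B1 X <-> e - d : cech_B1 X" for e
 proof
  assume "e - c : cech_B1 X"
  from subspace_add[OF subspace_cech_B1 this assms] show "e - d : cech_B1 X" by simp
 next
  assume "e - d : cech_B1 X"
  from subspace_diff[OF subspace_cech_B1 this assms] show "e - c : cech_B1 X" by simp
 qed
 then show ?thesis by (auto simp: cech_class_def)
qed

lemma H1_span_subset:
 assumes "!!gx. gx : Ga ==> gx <= cech_Z1 X"
 shows "span (\<Union>Ga) <= cech_Z1 X" "H1_span X Ga <= H1 X"
proof -
 show s: "span (\<Union>Ga) <= cech_Z1 X" by (rule span_minimal[OF _ subspace_cech_Z1]) (use assms in blast)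
 then show "H1_span X Ga <= H1 X" by (auto simp: H1_span_def H1_def)
qed

lemma H1_span_full:
 assumes "!!gx. gx : Ga ==> gx <= cech_Z1 X"
  and "!!c. c : cech_Z1 X ==> EX d:span (\<Union>Ga). c - d : cech_B1 X"
 shows "H1_span X Ga = H1 X"
proof
 show "H1_span X Ga <= H1 X" by (rule H1_span_subset[OF assms(1)])
 show "H1 X <= H1_span X Ga"
 proof
  fix gx assume "gx : H1 X"
  then obtain c where c: "c : cech_Z1 X" "gx = cech_class X c" by (auto simp: H1_def)
  obtain d where d: "d : span (\<Union>Ga)" "c - d : cech_B1 X" using assms(2)[OF c(1)] by blast
  show "gx : H1_span X Ga" unfolding H1_span_def c(2) cech_class_eq[OF d(2)] using d(1) by blast
 qed
qed

lemma H1_codim_le_1: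
 assumes Ga: "!!gx. gx : Ga ==> gx <= cech_Z1 X" and d: "d : cech_Z1 X"
  and ex: "!!c. c : cech_Z1 X ==> EX s:span (\<Union>Ga). EX a. c - (s + a *R d) : cech_B1 X"
 shows "H1_codim X (H1_span X Ga) <= 1"
proof -
 let ?T = "{cech_class X d}"
 have "H1_span X (H1_span X Ga Un ?T) = H1 X"
 proof (rule H1_span_full)
  fix gx assume "gx : H1_span X Ga Un ?T"
  then show "gx <= cech_Z1 X" using cech_class_subset by (auto simp: H1_span_def)
 next
  fix c assume "c : cech_Z1 X"
  from ex[OF this] obtain s a where s: "s : span (\<Union>Ga)" "c - (s + a *R d) : cech_B1 X" by blast
  have "s : cech_class X s" using s(1) H1_span_subset(1)[OF Ga] by (intro cech_class_self) blast
  then have "s : \<Union>(H1_span X Ga Un ?T)" using s(1) by (auto simp: H1_span_def)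
  moreover have "d : \<Union>(H1_span X Ga Un ?T)" using cech_class_self[OF d] by blast
  ultimately have "s + a *R d : span (\<Union>(H1_span X Ga Un ?T))"
   by (intro span_add span_scale span_base)
  then show "EX e:span (\<Union>(H1_span X Ga Un ?T)). c - e : cech_B1 X" using s(2) by blast
 qed
 moreover have "?T <= H1 X" using d by (auto simp: H1_def)
 ultimately have "?T : {T. T <= H1 X & finite T & H1_span X (H1_span X Ga Un T) = H1 X}" by simp
 then have "H1_codim X (H1_span X Ga) <= enat (card ?T)" unfolding H1_codim_def by (rule INF_lower)
 then show ?thesis by (simp add: one_enat_def)
qed

lemma quotient_germ_diff:
 assumes F: "g : F V" "openin X V" "z : V" and eq: "quotient_germ X F U f z = quotient_germ X F V g z"
 shows "EX W. openin X W & z : W & W <= U Int V & (ALL y:W. g y - f y = g z - f z)"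
proof -
 have "locally_constant_on X V (%y. g y - g y)" using F(2,3) by (auto simp: locally_constant_on_def)
 then have "(V, g) : quotient_germ X F V g z"
  unfolding quotient_germ_def using F by blast
 then have "(V, g) : quotient_germ X F U f z" using eq by simp
 then obtain W where W: "openin X W" "z : W" "W <= U Int V" "locally_constant_on X W (%y. g y - f y)"
  unfolding quotient_germ_def by blast
 then obtain V' where V': "openin X V'" "z : V'" "ALL y:V' Int W. g y - f y = g z - f z"
  unfolding locally_constant_on_def by blast
 have "openin X (V' Int W)" using W(1) V'(1) by blast
 moreover have "z : V' Int W" "V' Int W <= U Int V" using W(2,3) V'(2) by blast+
 ultimately show ?thesis using V'(3) by blast
qed

lemma germ_diff_locally_constant:
 assumes U: "pointed_cover X U"
   "!!x. x : topspace X ==> f x : F (U x)"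
   "!!x y. x : topspace X ==> y : U x ==> s y = quotient_germ X F (U x) (f x) y"
  and V: "pointed_cover X V"
   "!!x. x : topspace X ==> g x : F (V x)"
   "!!x y. x : topspace X ==> y : V x ==> s y = quotient_germ X F (V x) (g x) y"
  and xy: "x : topspace X" "y : topspace X"
 shows "locally_constant_on X (U x Int V y) (%z. g y z - f x z)"
 unfolding locally_constant_on_def
proof
 fix z assume z: "z : U x Int V y"
 have "openin X (V y)" using V(1) xy by (simp add: pointed_cover_def)
 have "quotient_germ X F (U x) (f x) z = quotient_germ X F (V y) (g y) z"
  using z U(3)[OF xy(1), of z] V(3)[OF xy(2), of z] by (metis IntD1 IntD2)
 from quotient_germ_diff[of "g y" F "V y" X z "U x" "f x", OF V(2)[OF xy(2)] \<open>openin X (V y)\<close> _ this] z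
 obtain W where "openin X W" "z : W" "ALL w:W. g y w - f x w = g y z - f x z" by blast
 then show "EX W. openin X W & z : W & (ALL w:W Int (U x Int V y). g y w - f x w = g y z - f x z)" by blast
qed

lemma connecting_map_eq:
 assumes U: "pointed_cover X U"
   "!!x. x : topspace X ==> f x : F (U x)"
   "!!x y. x : topspace X ==> y : U x ==> s y = quotient_germ X F (U x) (f x) y"
 shows "connecting_map X F s = cech_class X (%x y z. f y z - f x z)"
  "(%x y z. f y z - f x z) : cech_Z1 X"
proof -
 have D: "(%x y z. g y z - g x z) - (%x y z. f y z - f x z) : cech_B1 X"
  if V: "pointed_cover X V"
   "!!x. x : topspace X ==> g x : F (V x)"
   "!!x y. x : topspace X ==> y : V x ==> s y = quotient_germ X F (V x) (g x) y" for V g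
 proof (rule cech_B1_I[OF pointed_cover_Int[OF U(1) V(1)], where b = "%x z. g x z - f x z"])
  fix x assume x: "x : topspace X"
  show "locally_constant_on X (U x Int V x) (%z. g x z - f x z)"
   by (rule germ_diff_locally_constant[of X U f F s V g x x, OF U V x x])
 qed (simp add: algebra_simps)
 show "connecting_map X F s = cech_class X (%x y z. f y z - f x z)"
  unfolding connecting_map_def
 proof (rule the_equality)
  show "EX U fa. pointed_cover X U &
    (ALL x:topspace X. fa x : F (U x) & (ALL y:U x. s y = quotient_germ X F (U x) (fa x) y)) &
    cech_class X (%x y z. f y z - f x z) = cech_class X (%x y z. fa y z - fa x z)"
   by (intro exI[of _ U] exI[of _ f] conjI ballI refl U) assumption+
 next
  fix gx assume "EX U f. pointed_cover X U &
    (ALL x:topspace X. f x : F (U x) & (ALL y:U x. s y = quotient_germ X F (U x) (f x) y)) &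
    gx = cech_class X (%x y z. f y z - f x z)"
  then obtain V g where V: "pointed_cover X V" and
   Vg: "ALL x:topspace X. g x : F (V x) & (ALL y:V x. s y = quotient_germ X F (V x) (g x) y)"
   and gx: "gx = cech_class X (%x y z. g y z - g x z)" by (elim exE conjE)
  show "gx = cech_class X (%x y z. f y z - f x z)"
   unfolding gx by (rule cech_class_eq[OF D[OF V]]) (use Vg in simp_all)
 qed
 show "(%x y z. f y z - f x z) : cech_Z1 X"
 proof (rule cech_Z1_I[OF U(1)])
  fix x y assume xy: "x : topspace X" "y : topspace X"
  show "locally_constant_on X (U x Int U y) (%z. f y z - f x z)"
   by (rule germ_diff_locally_constant[OF U(1) _ _ U(1) _ _ xy, of f F s f]) (use U in simp_all)
 qed simp
qed

lemma connecting_map_subset_Z1: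
 assumes "s : quotient_global_sections X F"
 shows "connecting_map X F s <= cech_Z1 X"
proof -
 have "ALL x. EX U f. x : topspace X --> openin X U & x : U & f : F U & (ALL y:U. s y = quotient_germ X F U f y)"
  using assms unfolding quotient_global_sections_def by blast
 then obtain U f where "ALL x. x : topspace X --> openin X (U x) & x : U x & f x : F (U x)
   & (ALL y:U x. s y = quotient_germ X F (U x) (f x) y)"
  by metis
 then have "connecting_map X F s = cech_class X (%x y z. f y z - f x z)"
  by (intro connecting_map_eq(1)[of X U f F s]) (simp_all add: pointed_cover_def)
 then show ?thesis using cech_class_subset by simp
qed

section \<open>Charts of the realization\<close>

lemma mem_std: "z : std <-> 0 <= fst z & 0 <= snd z & fst z + snd z <= 1"
 by (cases z) (simp add: std_triangle_def)

lemma side_simps: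
 "spt 0 t = (1 - t, t)" "spt (Suc 0) t = (0, t)" "spt 2 t = (t, 0)"
 by (simp_all add: side_point_def tri_vertex_def)

lemma vertex_simps:
 "tri_vertex 0 = (0, 0)" "tri_vertex (Suc 0) = (1, 0)" "tri_vertex 2 = (0, 1)"
 by (simp_all add: tri_vertex_def)

lemma less_3_cases:
 fixes i :: nat
 assumes "i < 3"
 obtains "i = 0" | "i = Suc 0" | "i = 2"
 using assms by linarith

lemma convex_std: "convex std"
proof -
 have eq: "std = {z. (- 1, 0) \<bullet> z <= 0} Int {z. (0, - 1) \<bullet> z <= 0} Int {z. (1, 1) \<bullet> z <= (1::real)}"
  by (auto simp: mem_std)
 show ?thesis unfolding eq by (intro convex_Int convex_halfspace_le)
qed

lemma side_point_std: "i < 3 ==> t : {0..1} ==> spt i t : std"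
 by (erule less_3_cases) (auto simp: side_simps mem_std)

lemma tendsto_side_point: "(spt i \<longlongrightarrow> spt i t) (nhds t)"
 unfolding side_point_def by (intro tendsto_intros filterlim_ident)

lemma nhds_compose:
 assumes "(h \<longlongrightarrow> l) F" "eventually P (nhds l)"
 shows "\<forall>\<^sub>F x in F. P (h x)"
 using assms by (simp add: filterlim_iff)

lemma nhds_less:
 fixes f g :: "'a::topological_space => real"
 assumes "continuous_on UNIV f" "continuous_on UNIV g" "f y < g y"
 shows "\<forall>\<^sub>F z in nhds y. f z < g z"
 using open_Collect_less[OF assms(1,2)] assms(3) unfolding eventually_nhds by blast

lemma openin_top_of_set_eventually:
 "openin (top_of_set T) {x : T. P x} <-> (ALL x:T. P x --> (\<forall>\<^sub>F z in nhds x. z : T --> P z))"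
proof
 assume "openin (top_of_set T) {x : T. P x}"
 then obtain U where U: "open U" "{x : T. P x} = T Int U" unfolding openin_open by blast
 show "ALL x:T. P x --> (\<forall>\<^sub>F z in nhds x. z : T --> P z)"
 proof (intro ballI impI)
  fix x assume "x : T" "P x"
  then have "x : U" using U(2) by blast
  moreover have "ALL z:U. z : T --> P z" using U(2) by blast
  ultimately show "\<forall>\<^sub>F z in nhds x. z : T --> P z" using U(1) unfolding eventually_nhds by blast
 qed
next
 assume R: "ALL x:T. P x --> (\<forall>\<^sub>F z in nhds x. z : T --> P z)"
 define U where "U = \<Union>{V. open V & (ALL z:V. z : T --> P z)}"
 have "open U" unfolding U_def by (rule open_Union) simp
 moreover have "{x : T. P x} = T Int U"
 proof
  show "T Int U <= {x : T. P x}" by (auto simp: U_def)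
  show "{x : T. P x} <= T Int U"
  proof
   fix x assume x: "x : {x : T. P x}"
   then obtain V where "open V" "x : V" "ALL z:V. z : T --> P z" using R unfolding eventually_nhds by blast
   then show "x : T Int U" using x by (auto simp: U_def)
  qed
 qed
 ultimately show "openin (top_of_set T) {x : T. P x}" unfolding openin_open by blast
qed

lemma affine_function_line:
 assumes "affine_function L"
 shows "L (x + s *R v) = L x + s * (L (x + v) - L x)"
 using assms by (auto simp: affine_function_def inner_add_right)

lemma affine_function_prod:
 assumes "affine_function (L :: real \<times> real => real)"
 shows "L z = L (0,0) + fst z * (L (1,0) - L (0,0)) + snd z * (L (0,1) - L (0,0))"
proof -
 obtain c g where "L = (%x. c + g \<bullet> x)" using assms by (auto simp: affine_function_def)
 then show ?thesis by (cases z; cases g) simp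
qed

lemma affine_functionI: "affine_function (%z::real \<times> real. k + a * fst z + b * snd z)"
 unfolding affine_function_def
 by (rule exI[of _ k], rule exI[of _ "(a, b)"]) (auto simp: fun_eq_iff)

lemma affine_eq_on_triangle:
 assumes L: "affine_function L" "affine_function L'" and y: "y : std"
  and ev: "\<forall>\<^sub>F z in nhds y. z : std --> L z = L' z"
 shows "L = L'"
proof -
 have at: "L v = L' v" if v: "v : std" for v
 proof -
  have "((%s. y + s *R (v - y)) \<longlongrightarrow> y + 0 *R (v - y)) (at_right 0)"
   by (intro tendsto_intros)
  then have lim: "((%s. y + s *R (v - y)) \<longlongrightarrow> y) (at_right 0)" by simp
  have "\<forall>\<^sub>F s in at_right 0. y + s *R (v - y) : std --> L (y + s *R (v - y)) = L' (y + s *R (v - y))"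
   by (rule nhds_compose[OF lim ev])
  moreover have "\<forall>\<^sub>F s in at_right 0. s < (1::real)"
   by (rule order_tendstoD(2)[OF tendsto_ident_at]) simp
  ultimately have "\<forall>\<^sub>F s in at_right (0::real). L v = L' v"
   using eventually_at_right_less[of 0]
  proof eventually_elim
   case (elim s)
   have "y + s *R (v - y) = (1 - s) *R y + s *R v" by (simp add: algebra_simps)
   moreover have "(1 - s) *R y + s *R v : std"
    using y v elim by (intro convexD[OF convex_std]) auto
   ultimately have "L (y + s *R (v - y)) = L' (y + s *R (v - y))" using elim by simp
   moreover have "L y = L' y" using ev y eventually_nhds_x_imp_x by blast
   ultimately show ?case using elim by (simp add: affine_function_line L)
  qed
  then show ?thesis by (simp add: eventually_const_iff trivial_limit_at_right_real)
 qed
 have "L z = L' z" for z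
  using affine_function_prod[OF L(1), of z] affine_function_prod[OF L(2), of z] at[of "(0,0)"] at[of "(1,0)"] at[of "(0,1)"]
  by (simp add: mem_std)
 then show ?thesis by blast
qed


definition afn :: "('v,'e,'f) surface_data => ('e => real) => 'f => real \<times> real => real" where
 "afn S c f z = c (face S f 2) * fst z + c (face S f 1) * snd z"

definition has_slope ::
  "('v,'e,'f) surface_data => ('e => real) => ('v,'e,'f) point set => (('v,'e,'f) point => real) => bool" where
 "has_slope S c U ph <-> (ALL f:tris S. ALL y:std. tri_map S f y : U -->
   (EX k. \<forall>\<^sub>F z in nhds y. z : std --> ph (tri_map S f z) = k + afn S c f z))"

lemma afn_side:
 assumes "cocycle S c" "f : tris S" "i < 3"
 shows "afn S c f (spt i t) = afn S c f (spt i 0) + c (face S f i) * t"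
 using assms(3) assms(1,2) by (cases rule: less_3_cases)
  (auto simp: afn_def side_simps cocycle_def algebra_simps)

lemma afn_opp:
 assumes "i < 3"
 shows "afn S c f (tri_vertex i) - afn S c f (spt i 0) = outgoing c (opp_end S f i False)"
 using assms by (cases rule: less_3_cases)
  (auto simp: afn_def side_simps vertex_simps outgoing_def opp_end_def)

lemma afn_affine: "affine_function (%z. k + afn S c f z)"
 unfolding afn_def using affine_functionI[of k "c (face S f 2)" "c (face S f 1)"] by (simp add: add.assoc)

lemma continuous_afn: "continuous_on A (afn S c f)"
 unfolding afn_def[abs_def] by (intro continuous_intros)

context ct_surface
begin

lemma tri_map_side:
 assumes f: "f : tris S" and i: "i < 3" and t: "t : {0..1}"
 shows "tri_map S f (spt i t) = edge_map S (face S f i) t"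
 using i t face_ends[OF f] by (cases rule: less_3_cases) (auto simp: side_simps tri_map_def edge_map_def)

lemma tri_map_points: "f : tris S ==> z : std ==> tri_map S f z : points S"
 unfolding points_def by blast

lemma edge_map_points: "e : edges S ==> t : {0..1} ==> edge_map S e t : points S"
 unfolding points_def by blast

lemma edge_chart:
 assumes "e : edges S"
 obtains f i where "f : tris S" "i < 3" "face S f i = e" "(f, i) : edge_link S e"
proof -
 obtain p where p: "p : edge_link S e" using edge_link_nonempty[OF assms] by blast
 show ?thesis by (rule that[of "fst p" "snd p"]) (use p in \<open>auto simp: edge_link_def\<close>)
qed

lemma point_chart:
 assumes "p : points S"
 obtains f z where "f : tris S" "z : std" "p = tri_map S f z"
proof -
 note main = that
 have edge: thesis if e: "e : edges S" "t : {0..1}" "p = edge_map S e t" for e t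
 proof -
  obtain f i where fi: "f : tris S" "i < 3" "face S f i = e" by (rule edge_chart[OF e(1)])
  show thesis
   by (rule main[OF fi(1) side_point_std[OF fi(2) e(2)]]) (simp add: tri_map_side[OF fi(1,2) e(2)] fi(3) e(3))
 qed
 from assms consider v where "v : verts S" "p = VPoint v"
  | e t where "e : edges S" "t : {0..1}" "p = edge_map S e t"
  | f z where "f : tris S" "z : std" "p = tri_map S f z"
  unfolding points_def by blast
 then show thesis
 proof cases
  case (1 v)
  obtain x where x: "x : link_verts S v" using link_verts_nonempty[OF 1(1)] by blast
  then have e: "fst x : edges S" "endpt S (fst x) (snd x) = v" by (auto simp: link_verts_def end_vertex_def)
  show thesis by (rule edge[OF e(1), of "if snd x then 1 else 0"]) (use e(2) 1 in \<open>auto simp: edge_map_def\<close>)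
 qed (use edge main in blast)+
qed

lemma points_EPoint:
 assumes "EPoint e t : points S"
 shows "e : edges S" "0 < t" "t < 1"
proof -
 have E: "edge_map S e' t' = EPoint e t ==> t' : {0..1} ==> e' = e & 0 < t & t < 1" for e' t'
  by (auto simp: edge_map_def split: if_splits)
 obtain f z where fz: "f : tris S" "z : std" "EPoint e t = tri_map S f z" by (rule point_chart[OF assms])
 have F: "face S f 2 : edges S" "face S f 1 : edges S" "face S f 0 : edges S"
  using face_edges[OF fz(1)] by auto
 have zz: "0 <= fst z" "0 <= snd z" "fst z + snd z <= 1" using fz(2) by (auto simp: mem_std)
 have "EX e':edges S. EX t':{0..1}. edge_map S e' t' = EPoint e t"
 proof (cases "snd z = 0")
  case True
  then have "edge_map S (face S f 2) (fst z) = EPoint e t" using fz(3) by (simp add: tri_map_def)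
  then show ?thesis using F(1) zz True by (intro bexI[of _ "face S f 2"] bexI[of _ "fst z"]) auto
 next
  case False
  show ?thesis
  proof (cases "fst z = 0")
   case True
   then have "edge_map S (face S f 1) (snd z) = EPoint e t" using fz(3) False by (simp add: tri_map_def)
   then show ?thesis using F(2) zz True by (intro bexI[of _ "face S f 1"] bexI[of _ "snd z"]) auto
  next
   case F0: False
   then have "edge_map S (face S f 0) (snd z) = EPoint e t" using fz(3) False
    by (simp add: tri_map_def split: if_splits)
   then show ?thesis using F(3) zz by (intro bexI[of _ "face S f 0"] bexI[of _ "snd z"]) auto
  qed
 qed
 then obtain e' t' where "e' : edges S" "t' : {0..1}" "edge_map S e' t' = EPoint e t" by blast
 with E[of e' t'] show "e : edges S" "0 < t" "t < 1" by auto
qed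

lemma points_TPoint:
 assumes "TPoint f z : points S"
 shows "f : tris S" "0 < fst z" "0 < snd z" "fst z + snd z < 1"
proof -
 have E: "edge_map S e' t' ~= TPoint f z" for e' t' by (simp add: edge_map_def)
 obtain f' z' where fz: "f' : tris S" "z' : std" "TPoint f z = tri_map S f' z'" by (rule point_chart[OF assms])
 then have "snd z' ~= 0 & fst z' ~= 0 & fst z' + snd z' ~= 1 & f = f' & z = z'"
  using E by (auto simp: tri_map_def split: if_splits)
 then show "f : tris S" "0 < fst z" "0 < snd z" "fst z + snd z < 1" using fz by (auto simp: mem_std)
qed

lemma openin_charts:
 "openin (realization S) U <-> U <= points S &
   (ALL f:tris S. ALL y:std. tri_map S f y : U -->
    (\<forall>\<^sub>F z in nhds y. z : std --> tri_map S f z : U))" (is "_ <-> ?R")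
proof
 assume "openin (realization S) U"
 then show ?R unfolding openin_realization realization_open_def openin_top_of_set_eventually by blast
next
 assume R: ?R
 show "openin (realization S) U"
  unfolding openin_realization realization_open_def openin_top_of_set_eventually
 proof (intro conjI ballI impI)
  fix e t assume e: "e : edges S" and t: "t : {0..1}" "edge_map S e t : U"
  obtain f i where fi: "f : tris S" "i < 3" "face S f i = e" by (rule edge_chart[OF e])
  have "\<forall>\<^sub>F z in nhds (spt i t). z : std --> tri_map S f z : U"
   using R fi(1) side_point_std[OF fi(2) t(1)] t(2) tri_map_side[OF fi(1,2) t(1)] fi(3) by simp
  then have "\<forall>\<^sub>F s in nhds t. spt i s : std --> tri_map S f (spt i s) : U"
   by (rule nhds_compose[OF tendsto_side_point])
  then show "\<forall>\<^sub>F s in nhds t. s : {0..1} --> edge_map S e s : U"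
   by (rule eventually_mono) (use side_point_std[OF fi(2)] tri_map_side[OF fi(1,2)] fi(3) in auto)
 qed (use R in blast)+
qed

lemma locally_constant_on_charts:
 assumes U: "openin (realization S) U"
  and b: "!!f y. f : tris S ==> y : std ==> tri_map S f y : U ==>
   EX k. \<forall>\<^sub>F z in nhds y. z : std --> b (tri_map S f z) = k"
 shows "locally_constant_on (realization S) U b"
 unfolding locally_constant_on_def
proof
 fix x assume x: "x : U"
 have "openin (realization S) {p : U. b p = b x}"
  unfolding openin_charts
 proof (intro conjI ballI impI)
  show "{p : U. b p = b x} <= points S" using U by (auto simp: openin_charts)
  fix f y assume f: "f : tris S" and y: "y : std" "tri_map S f y : {p : U. b p = b x}"
  obtain k where k: "\<forall>\<^sub>F z in nhds y. z : std --> b (tri_map S f z) = k" using b[OF f y(1)] y(2) by blast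
  have "b (tri_map S f y) = k" using k y(1) eventually_nhds_x_imp_x by blast
  then have kb: "k = b x" using y by simp
  have "\<forall>\<^sub>F z in nhds y. z : std --> tri_map S f z : U"
   using U f y unfolding openin_charts by blast
  then show "\<forall>\<^sub>F z in nhds y. z : std --> tri_map S f z : {p : U. b p = b x}"
   using k by eventually_elim (simp add: kb)
 qed
 then show "EX V. openin (realization S) V & x : V & (ALL y:V Int U. b y = b x)" using x by blast
qed

lemma has_slope_edge:
 assumes c: "cocycle S c" and sl: "has_slope S c U ph" and e: "e : edges S" and t: "t : {0..1}"
  and U: "edge_map S e t : U"
 shows "EX k. \<forall>\<^sub>F s in nhds t. s : {0..1} --> ph (edge_map S e s) = k + c e * s"
proof -
 obtain f i where fi: "f : tris S" "i < 3" "face S f i = e" by (rule edge_chart[OF e])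
 have "tri_map S f (spt i t) : U" using U tri_map_side[OF fi(1,2) t] fi(3) by simp
 then obtain k where "\<forall>\<^sub>F z in nhds (spt i t). z : std --> ph (tri_map S f z) = k + afn S c f z"
  using sl fi(1) side_point_std[OF fi(2) t] unfolding has_slope_def by blast
 then have "\<forall>\<^sub>F s in nhds t. spt i s : std --> ph (tri_map S f (spt i s)) = k + afn S c f (spt i s)"
  by (rule nhds_compose[OF tendsto_side_point])
 then have "\<forall>\<^sub>F s in nhds t. s : {0..1} --> ph (edge_map S e s) = (k + afn S c f (spt i 0)) + c e * s"
 proof eventually_elim
  case (elim s)
  then show ?case
   using side_point_std[OF fi(2), of s] tri_map_side[OF fi(1,2), of s] fi(3) afn_side[OF c fi(1,2), of s] by auto
 qed
 then show ?thesis by blast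
qed

lemma has_slope_diff_locally_constant:
 assumes "openin (realization S) U" "openin (realization S) V" "has_slope S c U ph" "has_slope S c V ps"
 shows "locally_constant_on (realization S) (U Int V) (%x. ps x - ph x)"
proof (rule locally_constant_on_charts)
 show "openin (realization S) (U Int V)" using assms(1,2) by blast
 fix f y assume f: "f : tris S" "y : std" "tri_map S f y : U Int V"
 obtain k where k: "\<forall>\<^sub>F z in nhds y. z : std --> ph (tri_map S f z) = k + afn S c f z"
  using assms(3) f unfolding has_slope_def by blast
 obtain l where l: "\<forall>\<^sub>F z in nhds y. z : std --> ps (tri_map S f z) = l + afn S c f z"
  using assms(4) f unfolding has_slope_def by blast
 have "\<forall>\<^sub>F z in nhds y. z : std --> ps (tri_map S f z) - ph (tri_map S f z) = l - k"
  using k l by eventually_elim simp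
 then show "EX k. \<forall>\<^sub>F z in nhds y. z : std --> ps (tri_map S f z) - ph (tri_map S f z) = k" by blast
qed

lemma has_slope_PL:
 assumes h: "cocycle S (%e. of_int (h e))" and U: "openin (realization S) U"
  and sl: "has_slope S (%e. of_int (h e)) U ph"
 shows "PL_on S U ph"
 unfolding PL_on_def
proof (intro conjI ballI impI)
 have "openin (realization S) {x : U. ph x : W}" if W: "open W" for W
  unfolding openin_charts
 proof (intro conjI ballI impI)
  show "{x : U. ph x : W} <= points S" using U by (auto simp: openin_charts)
  fix f y assume f: "f : tris S" "y : std" "tri_map S f y : {x : U. ph x : W}"
  then obtain k where k: "\<forall>\<^sub>F z in nhds y. z : std --> ph (tri_map S f z) = k + afn S (%e. of_int (h e)) f z"
   using sl unfolding has_slope_def by blast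
  then have "ph (tri_map S f y) = k + afn S (%e. of_int (h e)) f y" using f(2) eventually_nhds_x_imp_x by blast
  then have y: "k + afn S (%e. of_int (h e)) f y : W" using f(3) by simp
  have "open ((%z. k + afn S (%e. of_int (h e)) f z) -` W)"
   by (rule open_vimage[OF W]) (intro continuous_intros continuous_afn)
  then have "\<forall>\<^sub>F z in nhds y. k + afn S (%e. of_int (h e)) f z : W"
   using y unfolding eventually_nhds by blast
  moreover have "\<forall>\<^sub>F z in nhds y. z : std --> tri_map S f z : U"
   using U f unfolding openin_charts by blast
  ultimately show "\<forall>\<^sub>F z in nhds y. z : std --> tri_map S f z : {x : U. ph x : W}"
   using k by eventually_elim simp
 qed
 then show "continuous_map (subtopology (realization S) U) euclideanreal ph"
  using U openin_subset[OF U] unfolding continuous_map_def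
  by (simp add: openin_open_subtopology Int_absorb1 topspace_subtopology_subset)
next
 fix e t assume e: "e : edges S" "t : {0..1}" "edge_map S e t : U"
 obtain k where "\<forall>\<^sub>F s in nhds t. s : {0..1} --> ph (edge_map S e s) = k + of_int (h e) * s"
  using has_slope_edge[OF h sl e] by blast
 then obtain N where N: "open N" "t : N" "ALL s:N. s : {0..1} --> ph (edge_map S e s) = k + of_int (h e) * s"
  unfolding eventually_nhds by blast
 have "integral_affine_function (%s. k + real_of_int (h e) * s)"
  unfolding integral_affine_function_def by (rule exI[of _ k], rule exI[of _ "of_int (h e)"]) auto
 then show "integral_PL_at {0..1} (%t. ph (edge_map S e t)) t"
  unfolding integral_PL_at_def using N by (intro exI[of _ N] exI[of _ "{UNIV}"]) auto
next
 fix f y assume f: "f : tris S" "y : std" "tri_map S f y : U"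
 then obtain k where "\<forall>\<^sub>F z in nhds y. z : std --> ph (tri_map S f z) = k + afn S (%e. of_int (h e)) f z"
  using sl unfolding has_slope_def by blast
 then obtain N where N: "open N" "y : N" "ALL z:N. z : std --> ph (tri_map S f z) = k + afn S (%e. of_int (h e)) f z"
  unfolding eventually_nhds by blast
 have "integral_affine_function (%z. k + afn S (%e. of_int (h e)) f z)"
  unfolding integral_affine_function_def
  by (rule exI[of _ k], rule exI[of _ "(of_int (h (face S f 2)), of_int (h (face S f 1)))"])
   (auto simp: afn_def Basis_prod_def fun_eq_iff)
 then show "integral_PL_at std (%x. ph (tri_map S f x)) y"
  unfolding integral_PL_at_def using N by (intro exI[of _ N] exI[of _ "{UNIV}"]) auto
qed

lemma has_slope_div_mult_EPoint:
 assumes c: "cocycle S c" "harmonic S c" and sl: "has_slope S c U ph"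
  and p: "EPoint e t : U" "EPoint e t : points S" and m: "div_mult S ph (EPoint e t) m"
 shows "m = 0"
proof -
 have e: "e : edges S" and t: "0 < t" "t < 1" using points_EPoint[OF p(2)] by auto
 have t01: "t : {0..1}" using t by simp
 have pt: "edge_map S e t = EPoint e t" using t by (simp add: edge_map_def)
 obtain K L where K: "affine_function K" "\<forall>\<^sub>F s in nhds t. ph (edge_map S e s) = K s"
  and L: "ALL (f, i):edge_link S e. affine_function (L (f, i)) &
    (EX N. open N & spt i t : N & (ALL x:std Int N. ph (tri_map S f x) = L (f, i) x))"
  and m': "m = (SUM (f, i):edge_link S e. L (f, i) (tri_vertex i))
       - of_int (alpha S e False) * K 0 - of_int (alpha S e True) * K 1"
  using m by auto
 obtain k where k: "\<forall>\<^sub>F s in nhds t. s : {0..1} --> ph (edge_map S e s) = k + c e * s"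
  using has_slope_edge[OF c(1) sl e t01] p(1) pt by auto
 have ev01: "\<forall>\<^sub>F s in nhds t. s : {0<..<1}" using t by (intro eventually_nhds_in_open) auto
 have Ks: "K s = k + c e * s" for s
 proof -
  have "\<forall>\<^sub>F s in nhds t. K s = k + c e * s"
   using k K(2) ev01 by eventually_elim auto
  then obtain d where d: "d > 0" "!!s. \<bar>s - t\<bar> < d ==> K s = k + c e * s"
   unfolding eventually_nhds_metric dist_real_def by blast
  obtain a b where ab: "K = (%s. a + b * s)" using K(1) by (auto simp: affine_function_def)
  have "a + b * t = k + c e * t" "a + b * (t + d/2) = k + c e * (t + d/2)"
   using d(2)[of t] d(2)[of "t + d/2"] d(1) by (auto simp: ab)
  then have "b * (d/2) = c e * (d/2)" unfolding distrib_left by linarith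
  then have "b = c e" using d(1) by simp
  then show ?thesis using \<open>a + b * t = k + c e * t\<close> by (simp add: ab)
 qed
 have Lv: "L (f, i) (tri_vertex i) = K 0 + outgoing c (opp_end S f i False)" if fi: "(f, i) : edge_link S e" for f i
 proof -
  have f: "f : tris S" "i < 3" "face S f i = e" using fi by (auto simp: edge_link_def)
  have y: "spt i t : std" by (rule side_point_std[OF f(2) t01])
  have ty: "tri_map S f (spt i t) = EPoint e t" using tri_map_side[OF f(1,2) t01] f(3) pt by simp
  obtain k' where k': "\<forall>\<^sub>F z in nhds (spt i t). z : std --> ph (tri_map S f z) = k' + afn S c f z"
  proof -
   have "tri_map S f (spt i t) : U" using ty p(1) by simp
   then show ?thesis using that sl f(1) y unfolding has_slope_def by blast
  qed
  have aL: "affine_function (L (f, i))"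
   and "EX N. open N & spt i t : N & (ALL x:std Int N. ph (tri_map S f x) = L (f, i) x)"
   using L fi by auto
  then have "\<forall>\<^sub>F z in nhds (spt i t). z : std --> ph (tri_map S f z) = L (f, i) z"
   unfolding eventually_nhds by blast
  with k' have "\<forall>\<^sub>F z in nhds (spt i t). z : std --> L (f, i) z = k' + afn S c f z"
   by eventually_elim auto
  from affine_eq_on_triangle[OF aL afn_affine y this] have LL: "L (f, i) = (%z. k' + afn S c f z)" .
  have "ph (EPoint e t) = k' + afn S c f (spt i t)"
   using k' y ty eventually_nhds_x_imp_x by force
  moreover have "ph (EPoint e t) = K t" using K(2) pt eventually_nhds_x_imp_x by force
  ultimately have "k' + afn S c f (spt i 0) = K 0"
   using afn_side[OF c(1) f(1,2), of t] f(3) by (simp add: Ks)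
  then show ?thesis using afn_opp[OF f(2), of S c f] by (simp add: LL)
 qed
 have "(SUM (f, i):edge_link S e. L (f, i) (tri_vertex i)) = (SUM (f, i):edge_link S e. K 0 + outgoing c (opp_end S f i False))"
  using Lv by (intro sum.cong) auto
 also have "... = of_nat (card (edge_link S e)) * K 0 + (SUM (f, i):edge_link S e. outgoing c (opp_end S f i False))"
  by (simp add: case_prod_unfold sum.distrib)
 finally have "m = of_nat (card (edge_link S e)) * K 0 + (SUM (f, i):edge_link S e. outgoing c (opp_end S f i False))
   - of_int (alpha S e False) * K 0 - of_int (alpha S e True) * (K 0 + c e)"
  using Ks[of 0] Ks[of 1] by (simp add: m')
 moreover have "lap S (outgoing c) (e, False) = 0" using c(2) e by (simp add: harmonic_def)
 then have "(SUM (f, i):edge_link S e. outgoing c (opp_end S f i False)) = of_int (alpha S e True) * c e"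
  by (simp add: lap_def outgoing_def)
 moreover have "real (card (edge_link S e)) = of_int (alpha S e False) + of_int (alpha S e True)"
  using alpha_sum[OF e] by (metis of_int_add of_int_of_nat_eq)
 ultimately show ?thesis by (simp add: algebra_simps)
qed

lemma has_slope_div_mult_TPoint:
 assumes sl: "has_slope S c U ph"
  and p: "TPoint f z : U" "TPoint f z : points S" and m: "div_mult S ph (TPoint f z) m"
 shows "m = 0"
proof -
 note fz = points_TPoint[OF p(2)]
 have z: "z : std" using fz by (simp add: mem_std)
 have pz: "tri_map S f z = TPoint f z" using fz by (simp add: tri_map_def)
 obtain d1 d2 w1 w2 :: int and c0 a b b' where
  ev: "\<forall>\<^sub>F (x, y) in nhds (0, 0). ph (tri_map S f (z + x *R (of_int d1, of_int d2) + y *R (of_int w1, of_int w2)))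
       = c0 + a * x + (if 0 <= y then b * y else b' * (- y))" and m': "m = b + b'"
  using m by auto
 define w :: "real \<times> real" where "w = (of_int w1, of_int w2)"
 have "((%y::real. (0::real, y)) \<longlongrightarrow> (0, 0)) (nhds 0)" by (intro tendsto_intros filterlim_ident)
 then have "\<forall>\<^sub>F y in nhds 0. case (0, y) of (x, y) => ph (tri_map S f (z + x *R (of_int d1, of_int d2) + y *R (of_int w1, of_int w2)))
       = c0 + a * x + (if 0 <= y then b * y else b' * (- y))"
  by (rule nhds_compose[OF _ ev])
 then have e1: "\<forall>\<^sub>F y in nhds 0. ph (tri_map S f (z + y *R w)) = c0 + (if 0 <= y then b * y else b' * (- y))"
  by (simp add: w_def flip: zero_prod_def)
 obtain k where k: "\<forall>\<^sub>F x in nhds z. x : std --> ph (tri_map S f x) = k + afn S c f x"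
 proof -
  have "tri_map S f z : U" using pz p(1) by simp
  then show ?thesis using that sl fz(1) z unfolding has_slope_def by blast
 qed
 have lim: "((%y::real. z + y *R w) \<longlongrightarrow> z + 0 *R w) (nhds 0)" by (intro tendsto_intros filterlim_ident)
 have "\<forall>\<^sub>F x in nhds z. 0 < fst x" "\<forall>\<^sub>F x in nhds z. 0 < snd x" "\<forall>\<^sub>F x in nhds z. fst x + snd x < 1"
  using fz by (auto intro!: nhds_less continuous_intros)
 then have "\<forall>\<^sub>F x in nhds z. x : std" by eventually_elim (simp add: mem_std)
 then have "\<forall>\<^sub>F x in nhds z. ph (tri_map S f x) = k + afn S c f x" using k by eventually_elim simp
 then have "\<forall>\<^sub>F y in nhds 0. ph (tri_map S f (z + y *R w)) = k + afn S c f (z + y *R w)"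
  using nhds_compose[OF lim, of "%x. ph (tri_map S f x) = k + afn S c f x"] by simp
 with e1 have "\<forall>\<^sub>F y in nhds 0. c0 + (if 0 <= y then b * y else b' * (- y)) = k + afn S c f z + y * afn S c f w"
  by eventually_elim (simp add: afn_def algebra_simps)
 then obtain d where d: "d > 0" "!!y. \<bar>y\<bar> < d ==> c0 + (if 0 <= y then b * y else b' * (- y)) = k + afn S c f z + y * afn S c f w"
  unfolding eventually_nhds_metric dist_real_def by auto
 have "c0 = k + afn S c f z" "c0 + b * (d/2) = k + afn S c f z + d/2 * afn S c f w"
   "c0 + b' * (d/2) = k + afn S c f z - d/2 * afn S c f w"
  using d(1) d(2)[of 0] d(2)[of "d/2"] d(2)[of "-d/2"] by auto
 then have "b * (d/2) + b' * (d/2) = 0" by linarith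
 then have "(b + b') * d = 0" by (simp add: algebra_simps)
 then show ?thesis using d(1) m' by simp
qed

lemma has_slope_linear_functions:
 assumes h: "cocycle S (%e. of_int (h e))" "harmonic S (%e. of_int (h e))"
  and U: "openin (realization S) U" and sl: "has_slope S (%e. of_int (h e)) U ph"
 shows "ph : linear_functions S U"
 unfolding linear_functions_def
proof (intro CollectI conjI ballI allI impI)
 show "PL_on S U ph" by (rule has_slope_PL[OF h(1) U sl])
 fix p m assume p: "p : U" and m: "div_mult S ph p m"
 have pp: "p : points S" using U p by (auto simp: openin_charts)
 show "m = 0"
 proof (cases p)
  case (VPoint v)
  then show ?thesis using m by simp
 next
  case (EPoint e t)
  then show ?thesis using has_slope_div_mult_EPoint[OF h sl, of e t m] p pp m by simp
 next
  case (TPoint f z)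
  then show ?thesis using has_slope_div_mult_TPoint[OF sl, of f z m] p pp m by simp
 qed
qed

end

section \<open>The cover by open cells\<close>

context ct_surface
begin

lemma tri_map_cases:
 assumes f: "f : tris S" and z: "z : std"
 obtains (V0) "z = (0, 0)" "tri_map S f z = VPoint (endpt S (face S f 2) False)"
  | (V1) "z = (1, 0)" "tri_map S f z = VPoint (endpt S (face S f 2) True)"
  | (V2) "z = (0, 1)" "tri_map S f z = VPoint (endpt S (face S f 1) True)"
  | (E2) t where "0 < t" "t < 1" "z = (t, 0)" "tri_map S f z = EPoint (face S f 2) t"
  | (E1) t where "0 < t" "t < 1" "z = (0, t)" "tri_map S f z = EPoint (face S f 1) t"
  | (E0) t where "0 < t" "t < 1" "z = (1 - t, t)" "tri_map S f z = EPoint (face S f 0) t"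
  | (T) "0 < fst z" "0 < snd z" "fst z + snd z < 1" "tri_map S f z = TPoint f z"
proof -
 obtain s t where st: "z = (s, t)" by (cases z)
 have pos: "0 <= s" "0 <= t" "s + t <= 1" using z by (auto simp: st mem_std)
 consider "s = 0" "t = 0" | "s = 1" "t = 0" | "s = 0" "t = 1" | "0 < s" "s < 1" "t = 0"
  | "s = 0" "0 < t" "t < 1" | "s = 1 - t" "0 < t" "t < 1" | "0 < s" "0 < t" "s + t < 1"
  using pos by argo
 then show thesis
 proof cases
  case 1 then show thesis by (intro V0) (simp_all add: st tri_map_def edge_map_def)
 next
  case 2 then show thesis by (intro V1) (simp_all add: st tri_map_def edge_map_def)
 next
  case 3 then show thesis by (intro V2) (simp_all add: st tri_map_def edge_map_def)
 next
  case 4 then show thesis by (intro E2[of s]) (simp_all add: st tri_map_def edge_map_def)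
 next
  case 5 then show thesis by (intro E1[of t]) (simp_all add: st tri_map_def edge_map_def)
 next
  case 6 then show thesis by (intro E0[of t]) (simp_all add: st tri_map_def edge_map_def)
 next
  case 7 then show thesis by (intro T) (simp_all add: st tri_map_def edge_map_def)
 qed
qed

end

fun near_cell :: "('v,'e,'f) surface_data => ('v,'e,'f) point => ('v,'e,'f) point => bool" where
 "near_cell S (VPoint v) x = (case x of VPoint w => w = v
   | EPoint e t => (t < 1/2 & endpt S e False = v) \<or> (1/2 < t & endpt S e True = v)
   | TPoint f z => (fst z + snd z < 1/2 & endpt S (face S f 2) False = v)
     \<or> (1/2 < fst z & endpt S (face S f 2) True = v) \<or> (1/2 < snd z & endpt S (face S f 1) True = v))"
| "near_cell S (EPoint e t) x = (case x of VPoint w => False | EPoint e' t' => e' = e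
   | TPoint f z => (face S f 2 = e & snd z < fst z & snd z < 1 - fst z - snd z)
     \<or> (face S f 1 = e & fst z < snd z & fst z < 1 - fst z - snd z)
     \<or> (face S f 0 = e & 1 - fst z - snd z < fst z & 1 - fst z - snd z < snd z))"
| "near_cell S (TPoint f z) x = (case x of TPoint f' z' => f' = f | _ => False)"

definition cell_nbhd :: "('v,'e,'f) surface_data => ('v,'e,'f) point => ('v,'e,'f) point set" where
 "cell_nbhd S p = {x : points S. near_cell S p x}"

text \<open>The function of slope \<open>c\<close> near the cell of \<open>p\<close> that vanishes at the vertex, the tail of the
 edge or the vertex 0 of the triangle, respectively.\<close>

fun slope_lift ::
  "('v,'e,'f) surface_data => ('e => real) => ('v,'e,'f) point => ('v,'e,'f) point => real" where
 "slope_lift S c (VPoint v) x = (case x of VPoint w => 0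
   | EPoint e t => (if t < 1/2 then c e * t else c e * (t - 1))
   | TPoint f z => afn S c f z - (if 1/2 < fst z then c (face S f 2) else if 1/2 < snd z then c (face S f 1) else 0))"
| "slope_lift S c (EPoint e t) x = (case x of VPoint w => 0 | EPoint e' t' => c e' * t'
   | TPoint f z => afn S c f z - (if 1 - fst z - snd z < fst z & 1 - fst z - snd z < snd z then c (face S f 2) else 0))"
| "slope_lift S c (TPoint f z) x = (case x of TPoint f' z' => afn S c f' z' | _ => 0)"

lemma afn_cochain_linear: "afn S (%e. a * c e + b * d e) f z = a * afn S c f z + b * afn S d f z"
 by (simp add: afn_def algebra_simps)

lemma slope_lift_linear:
 "slope_lift S (%e. a * c e + b * d e) p x = a * slope_lift S c p x + b * slope_lift S d p x"
 by (cases p; cases x) (simp_all add: afn_cochain_linear algebra_simps)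

lemma slope_lift_cong:
 assumes "!!e. e : edges S ==> c e = d e" "x : points S"
  "!!f i. f : tris S ==> i < 3 ==> face S f i : edges S"
  "!!e t. x = EPoint e t ==> e : edges S" "!!f z. x = TPoint f z ==> f : tris S"
 shows "slope_lift S c p x = slope_lift S d p x"
 using assms by (cases p; cases x) (auto simp: afn_def)

context ct_surface
begin

lemma near_cell_VPoint_tri:
 assumes "f : tris S" "z : std"
 shows "near_cell S (VPoint v) (tri_map S f z) <->
  (fst z + snd z < 1/2 & endpt S (face S f 2) False = v)
  \<or> (1/2 < fst z & endpt S (face S f 2) True = v) \<or> (1/2 < snd z & endpt S (face S f 1) True = v)"
 using assms by (cases rule: tri_map_cases) (use face_ends[OF assms(1)] in auto)

lemma near_cell_EPoint_tri:
 assumes "f : tris S" "z : std"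
 shows "near_cell S (EPoint e t) (tri_map S f z) <->
  (face S f 2 = e & snd z < fst z & snd z < 1 - fst z - snd z)
  \<or> (face S f 1 = e & fst z < snd z & fst z < 1 - fst z - snd z)
  \<or> (face S f 0 = e & 1 - fst z - snd z < fst z & 1 - fst z - snd z < snd z)"
 using assms by (cases rule: tri_map_cases) auto

lemma near_cell_TPoint_tri:
 assumes "f : tris S" "z : std"
 shows "near_cell S (TPoint f' z') (tri_map S f z) <->
  f = f' & 0 < fst z & 0 < snd z & fst z + snd z < 1"
 using assms by (cases rule: tri_map_cases) auto

lemma slope_lift_VPoint_tri:
 assumes f: "f : tris S" "z : std" and c: "cocycle S c" and n: "near_cell S (VPoint v) (tri_map S f z)"
 shows "slope_lift S c (VPoint v) (tri_map S f z)
  = afn S c f z - (if 1/2 < fst z then c (face S f 2) else if 1/2 < snd z then c (face S f 1) else 0)"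
proof -
 have c1: "c (face S f (Suc 0)) = c (face S f 2) + c (face S f 0)" using c f(1) by (simp add: cocycle_def)
 show ?thesis using f n by (cases rule: tri_map_cases) (auto simp: afn_def c1 algebra_simps split: if_splits)
qed

lemma slope_lift_EPoint_tri:
 assumes f: "f : tris S" "z : std" and c: "cocycle S c" and n: "near_cell S (EPoint e t) (tri_map S f z)"
 shows "slope_lift S c (EPoint e t) (tri_map S f z)
  = afn S c f z - (if 1 - fst z - snd z < fst z & 1 - fst z - snd z < snd z then c (face S f 2) else 0)"
proof -
 have c1: "c (face S f (Suc 0)) = c (face S f 2) + c (face S f 0)" using c f(1) by (simp add: cocycle_def)
 show ?thesis using f n by (cases rule: tri_map_cases) (auto simp: afn_def c1 algebra_simps split: if_splits)
qed

lemma slope_lift_TPoint_tri: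
 assumes f: "f : tris S" "z : std" and n: "near_cell S (TPoint f' z') (tri_map S f z)"
 shows "slope_lift S c (TPoint f' z') (tri_map S f z) = afn S c f z"
 using f n by (cases rule: tri_map_cases) auto

lemma mem_cell_nbhd: "p : points S ==> p : cell_nbhd S p"
 using points_EPoint points_TPoint by (cases p) (auto simp: cell_nbhd_def)

lemma open_cell_nbhd: "openin (realization S) (cell_nbhd S p)"
 unfolding openin_charts
proof (intro conjI ballI impI)
 show "cell_nbhd S p <= points S" by (auto simp: cell_nbhd_def)
 fix f y assume f: "f : tris S" and y: "y : std" "tri_map S f y : cell_nbhd S p"
 have n: "near_cell S p (tri_map S f y)" using y(2) by (simp add: cell_nbhd_def)
 have "\<forall>\<^sub>F z in nhds y. z : std --> near_cell S p (tri_map S f z)"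
 proof (cases p)
  case (VPoint v)
  consider "fst y + snd y < 1/2" "endpt S (face S f 2) False = v"
   | "1/2 < fst y" "endpt S (face S f 2) True = v" | "1/2 < snd y" "endpt S (face S f 1) True = v"
   using n unfolding VPoint near_cell_VPoint_tri[OF f y(1)] by blast
  then show ?thesis
  proof cases
   case 1
   have "\<forall>\<^sub>F z in nhds y. fst z + snd z < 1/2" using 1 by (intro nhds_less continuous_intros)
   then show ?thesis by eventually_elim (use 1 in \<open>simp add: VPoint near_cell_VPoint_tri[OF f] del: near_cell.simps\<close>)
  next
   case 2
   have "\<forall>\<^sub>F z in nhds y. 1/2 < fst z" using 2 by (intro nhds_less continuous_intros)
   then show ?thesis by eventually_elim (use 2 in \<open>simp add: VPoint near_cell_VPoint_tri[OF f] del: near_cell.simps\<close>)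
  next
   case 3
   have "\<forall>\<^sub>F z in nhds y. 1/2 < snd z" using 3 by (intro nhds_less continuous_intros)
   then show ?thesis by eventually_elim (use 3 in \<open>simp add: VPoint near_cell_VPoint_tri[OF f] del: near_cell.simps\<close>)
  qed
 next
  case (EPoint e t)
  consider "face S f 2 = e" "snd y < fst y" "snd y < 1 - fst y - snd y"
   | "face S f 1 = e" "fst y < snd y" "fst y < 1 - fst y - snd y"
   | "face S f 0 = e" "1 - fst y - snd y < fst y" "1 - fst y - snd y < snd y"
   using n unfolding EPoint near_cell_EPoint_tri[OF f y(1)] by blast
  then show ?thesis
  proof cases
   case 1
   have "\<forall>\<^sub>F z in nhds y. snd z < fst z" "\<forall>\<^sub>F z in nhds y. snd z < 1 - fst z - snd z"
    using 1 by (intro nhds_less continuous_intros; simp)+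
   then show ?thesis by eventually_elim (use 1 in \<open>simp add: EPoint near_cell_EPoint_tri[OF f] del: near_cell.simps\<close>)
  next
   case 2
   have "\<forall>\<^sub>F z in nhds y. fst z < snd z" "\<forall>\<^sub>F z in nhds y. fst z < 1 - fst z - snd z"
    using 2 by (intro nhds_less continuous_intros; simp)+
   then show ?thesis by eventually_elim (use 2 in \<open>simp add: EPoint near_cell_EPoint_tri[OF f] del: near_cell.simps\<close>)
  next
   case 3
   have "\<forall>\<^sub>F z in nhds y. 1 - fst z - snd z < fst z" "\<forall>\<^sub>F z in nhds y. 1 - fst z - snd z < snd z"
    using 3 by (intro nhds_less continuous_intros; simp)+
   then show ?thesis by eventually_elim (use 3 in \<open>simp add: EPoint near_cell_EPoint_tri[OF f] del: near_cell.simps\<close>)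
  qed
 next
  case (TPoint f' z')
  have c: "f = f'" "0 < fst y" "0 < snd y" "fst y + snd y < 1"
   using n unfolding TPoint near_cell_TPoint_tri[OF f y(1)] by blast+
  have "\<forall>\<^sub>F z in nhds y. 0 < fst z" "\<forall>\<^sub>F z in nhds y. 0 < snd z" "\<forall>\<^sub>F z in nhds y. fst z + snd z < 1"
   using c by (intro nhds_less continuous_intros; simp)+
  then show ?thesis by eventually_elim (use c(1) f in \<open>simp add: TPoint near_cell_TPoint_tri del: near_cell.simps\<close>)
 qed
 then show "\<forall>\<^sub>F z in nhds y. z : std --> tri_map S f z : cell_nbhd S p"
  by eventually_elim (simp add: cell_nbhd_def tri_map_points[OF f])
qed

lemma has_slope_lift:
 assumes c: "cocycle S c"
 shows "has_slope S c (cell_nbhd S p) (slope_lift S c p)"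
 unfolding has_slope_def
proof (intro ballI impI)
 fix f y assume f: "f : tris S" and y: "y : std" "tri_map S f y : cell_nbhd S p"
 have n: "near_cell S p (tri_map S f y)" using y(2) by (simp add: cell_nbhd_def)
 have "\<forall>\<^sub>F z in nhds y. z : std --> tri_map S f z : cell_nbhd S p"
  using open_cell_nbhd[of p] f y unfolding openin_charts by blast
 then have near: "\<forall>\<^sub>F z in nhds y. z : std --> near_cell S p (tri_map S f z)"
  by eventually_elim (simp add: cell_nbhd_def)
 show "EX k. \<forall>\<^sub>F z in nhds y. z : std --> slope_lift S c p (tri_map S f z) = k + afn S c f z"
 proof (cases p)
  case (VPoint v)
  note ev = near[unfolded VPoint] and sl = slope_lift_VPoint_tri[OF f _ c]
  consider "fst y + snd y < 1/2" | "1/2 < fst y" | "1/2 < snd y"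
   using n unfolding VPoint near_cell_VPoint_tri[OF f y(1)] by blast
  then show ?thesis
  proof cases
   case 1
   have "\<forall>\<^sub>F z in nhds y. fst z + snd z < 1/2" using 1 by (intro nhds_less continuous_intros)
   with ev have "\<forall>\<^sub>F z in nhds y. z : std --> slope_lift S c p (tri_map S f z) = 0 + afn S c f z"
    by eventually_elim (auto simp: VPoint sl mem_std simp del: slope_lift.simps near_cell.simps)
   then show ?thesis by blast
  next
   case 2
   have "\<forall>\<^sub>F z in nhds y. 1/2 < fst z" using 2 by (intro nhds_less continuous_intros)
   with ev have "\<forall>\<^sub>F z in nhds y. z : std --> slope_lift S c p (tri_map S f z) = - c (face S f 2) + afn S c f z"
    by eventually_elim (auto simp: VPoint sl simp del: slope_lift.simps near_cell.simps)
   then show ?thesis by blast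
  next
   case 3
   have "\<forall>\<^sub>F z in nhds y. 1/2 < snd z" using 3 by (intro nhds_less continuous_intros)
   with ev have "\<forall>\<^sub>F z in nhds y. z : std --> slope_lift S c p (tri_map S f z) = - c (face S f 1) + afn S c f z"
    by eventually_elim (auto simp: VPoint sl mem_std simp del: slope_lift.simps near_cell.simps)
   then show ?thesis by blast
  qed
 next
  case (EPoint e t)
  note ev = near[unfolded EPoint] and sl = slope_lift_EPoint_tri[OF f _ c]
  consider "snd y < 1 - fst y - snd y" | "fst y < 1 - fst y - snd y"
   | "1 - fst y - snd y < fst y" "1 - fst y - snd y < snd y"
   using n unfolding EPoint near_cell_EPoint_tri[OF f y(1)] by blast
  then show ?thesis
  proof cases
   case 1
   have "\<forall>\<^sub>F z in nhds y. snd z < 1 - fst z - snd z" using 1 by (intro nhds_less continuous_intros)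
   with ev have "\<forall>\<^sub>F z in nhds y. z : std --> slope_lift S c p (tri_map S f z) = 0 + afn S c f z"
    by eventually_elim (auto simp: EPoint sl simp del: slope_lift.simps near_cell.simps)
   then show ?thesis by blast
  next
   case 2
   have "\<forall>\<^sub>F z in nhds y. fst z < 1 - fst z - snd z" using 2 by (intro nhds_less continuous_intros)
   with ev have "\<forall>\<^sub>F z in nhds y. z : std --> slope_lift S c p (tri_map S f z) = 0 + afn S c f z"
    by eventually_elim (auto simp: EPoint sl simp del: slope_lift.simps near_cell.simps)
   then show ?thesis by blast
  next
   case 3
   have "\<forall>\<^sub>F z in nhds y. 1 - fst z - snd z < fst z" "\<forall>\<^sub>F z in nhds y. 1 - fst z - snd z < snd z"
    using 3 by (intro nhds_less continuous_intros; simp)+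
   with ev have "\<forall>\<^sub>F z in nhds y. z : std --> slope_lift S c p (tri_map S f z) = - c (face S f 2) + afn S c f z"
    by eventually_elim (auto simp: EPoint sl simp del: slope_lift.simps near_cell.simps)
   then show ?thesis by blast
  qed
 next
  case (TPoint f' z')
  have "\<forall>\<^sub>F z in nhds y. z : std --> slope_lift S c p (tri_map S f z) = 0 + afn S c f z"
   using near by eventually_elim (auto simp: TPoint slope_lift_TPoint_tri[OF f] simp del: slope_lift.simps near_cell.simps)
  then show ?thesis by blast
 qed
qed

lemma pointed_cover_cells: "pointed_cover (realization S) (cell_nbhd S)"
 unfolding pointed_cover_def using open_cell_nbhd mem_cell_nbhd by simp

definition cochain_class :: "('e => real) => ('v,'e,'f) point => ('v,'e,'f) point => ('v,'e,'f) point => real" where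
 "cochain_class c = (%x y z. slope_lift S c y z - slope_lift S c x z)"

lemma cochain_class_linear:
 "cochain_class (%e. a * c e + b * d e) = a *R cochain_class c + b *R cochain_class d"
 by (intro ext) (simp add: cochain_class_def slope_lift_linear scaleR_fun_def algebra_simps)

lemma slope_lift_edges_cong:
 "(!!e. e : edges S ==> c e = d e) ==> x : points S ==> slope_lift S c p x = slope_lift S d p x"
 using points_EPoint points_TPoint face_edges by (intro slope_lift_cong) auto

lemma cochain_class_Z1:
 assumes c: "cocycle S c"
 shows "cochain_class c : cech_Z1 (realization S)"
proof (rule cech_Z1_I[OF pointed_cover_cells])
 fix x y
 show "locally_constant_on (realization S) (cell_nbhd S x Int cell_nbhd S y) (cochain_class c x y)"
  unfolding cochain_class_def
  by (rule has_slope_diff_locally_constant[OF open_cell_nbhd open_cell_nbhd has_slope_lift[OF c] has_slope_lift[OF c]])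
qed (simp add: cochain_class_def)

lemma has_slope_global_coboundary:
 assumes c: "cocycle S c" and G: "has_slope S c (points S) G"
 shows "cochain_class c : cech_B1 (realization S)"
proof (rule cech_B1_I[OF pointed_cover_cells, where b = "%x z. slope_lift S c x z - G z"])
 fix x assume "x : topspace (realization S)"
 have "locally_constant_on (realization S) (points S Int cell_nbhd S x) (%z. slope_lift S c x z - G z)"
  by (rule has_slope_diff_locally_constant[OF _ open_cell_nbhd G has_slope_lift[OF c]])
   (metis openin_topspace topspace_realization)
 then show "locally_constant_on (realization S) (cell_nbhd S x) (%z. slope_lift S c x z - G z)"
  by (rule locally_constant_on_subset) (auto simp: cell_nbhd_def)
qed (simp add: cochain_class_def)

lemma cochain_class_coboundary: "cochain_class (coboundary S g) : cech_B1 (realization S)"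
proof (rule has_slope_global_coboundary[OF closed_coboundary])
 define G :: "('v,'e,'f) point => real" where "G x = (case x of VPoint v => g v
   | EPoint e t => g (endpt S e False) + coboundary S g e * t
   | TPoint f z => g (endpt S (face S f 2) False) + afn S (coboundary S g) f z)" for x
 have "G (tri_map S f z) = g (endpt S (face S f 2) False) + afn S (coboundary S g) f z"
  if f: "f : tris S" "z : std" for f z
  using f by (cases rule: tri_map_cases)
   (use face_ends[OF f(1)] in \<open>auto simp: G_def afn_def coboundary_def algebra_simps\<close>)
 then show "has_slope S (coboundary S g) (points S) G"
  unfolding has_slope_def by (auto intro!: exI always_eventually)
qed

lemma quotient_germ_eq:
 assumes U: "openin X U" "openin X U'" "z : U" "z : U'" and lc: "locally_constant_on X (U Int U') (%y. f' y - f y)"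
 shows "quotient_germ X F U f z <= quotient_germ X F U' f' z"
proof
 fix p assume "p : quotient_germ X F U f z"
 then obtain V g W where p: "p = (V, g)" "openin X V" "z : V" "g : F V"
  and W: "openin X W" "z : W" "W <= U Int V" "locally_constant_on X W (%y. g y - f y)"
  unfolding quotient_germ_def by blast
 have "locally_constant_on X (W Int U') (%y. 1 * (g y - f y) + (-1) * (f' y - f y))"
  by (intro locally_constant_on_linear locally_constant_on_subset[OF W(4)] locally_constant_on_subset[OF lc])
   (use W(3) in auto)
 then have "locally_constant_on X (W Int U') (%y. g y - f' y)" by simp
 moreover have "openin X (W Int U')" "z : W Int U'" "W Int U' <= U' Int V" using W U by auto
 ultimately show "p : quotient_germ X F U' f' z"
  unfolding quotient_germ_def p(1) using p(2-4) by blast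
qed

lemma harmonic_class_in_image:
 assumes h: "cocycle S (%e. of_int (h e))" "harmonic S (%e. of_int (h e))"
 shows "cech_class (realization S) (cochain_class (%e. of_int (h e))) : D_connecting S ` D_sections S"
proof -
 let ?X = "realization S" and ?F = "linear_functions S" and ?c = "%e. real_of_int (h e)"
 define s where "s x = (if x : points S then quotient_germ ?X ?F (cell_nbhd S x) (slope_lift S ?c x) x else {})" for x
 have F: "slope_lift S ?c x : ?F (cell_nbhd S x)" for x
  by (rule has_slope_linear_functions[OF h open_cell_nbhd has_slope_lift[OF h(1)]])
 have g: "s y = quotient_germ ?X ?F (cell_nbhd S x) (slope_lift S ?c x) y" if y: "y : cell_nbhd S x" for x y
 proof -
  have yp: "y : points S" using y by (simp add: cell_nbhd_def)
  have lc: "locally_constant_on ?X (cell_nbhd S a Int cell_nbhd S b) (%z. slope_lift S ?c b z - slope_lift S ?c a z)" for a b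
   by (rule has_slope_diff_locally_constant[OF open_cell_nbhd open_cell_nbhd has_slope_lift[OF h(1)] has_slope_lift[OF h(1)]])
  have "quotient_germ ?X ?F (cell_nbhd S y) (slope_lift S ?c y) y = quotient_germ ?X ?F (cell_nbhd S x) (slope_lift S ?c x) y"
   by (intro subset_antisym quotient_germ_eq open_cell_nbhd lc y mem_cell_nbhd[OF yp])
  then show ?thesis using yp by (simp add: s_def)
 qed
 have "s : D_sections S"
  unfolding D_sections_def quotient_global_sections_def
 proof (intro CollectI conjI ballI allI impI)
  fix x assume "x : topspace ?X"
  then have x: "x : points S" by simp
  show "EX U f. openin ?X U & x : U & f : ?F U & (ALL y:U. s y = quotient_germ ?X ?F U f y)"
   by (intro exI[of _ "cell_nbhd S x"] exI[of _ "slope_lift S ?c x"] conjI open_cell_nbhd mem_cell_nbhd[OF x] F ballI g)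
 qed (simp add: s_def)
 moreover have "D_connecting S s = cech_class ?X (%x y z. slope_lift S ?c y z - slope_lift S ?c x z)"
  unfolding D_connecting_def
  by (rule connecting_map_eq(1)[OF pointed_cover_cells, of "slope_lift S ?c" ?F s]) (rule F, rule g)
 ultimately show ?thesis unfolding cochain_class_def by blast
qed

end

section \<open>Gluing local functions on the triangle\<close>

text \<open>\<open>\<L>\<close> is a space of functions with unique continuation, here the constants or the affine
 functions. Local functions on the triangle that agree up to \<open>\<L>\<close> are induced, up to \<open>\<L>\<close>, by a global
 function.\<close>

definition germ_equiv :: "(real \<times> real => real) set => (real \<times> real => real) => (real \<times> real => real)
  => real \<times> real => bool" where
 "germ_equiv \<L> u v q <-> (EX L:\<L>. \<forall>\<^sub>F x in nhds q. x : std --> u x = v x + L x)"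

locale unique_continuation =
 fixes \<L> :: "(real \<times> real => real) set"
 assumes zero: "(%_. 0) : \<L>"
  and diff: "!!L L'. L : \<L> ==> L' : \<L> ==> (%x. L x - L' x) : \<L>"
  and uc: "!!L L' N. L : \<L> ==> L' : \<L> ==> open N ==> N ~= {} ==> (!!x. x : N ==> L x = L' x) ==> L = L'"
begin

lemma add: "L : \<L> ==> L' : \<L> ==> (%x. L x + L' x) : \<L>"
 using diff[of L "%x. 0 - L' x"] diff[OF zero, of L'] by simp

lemma germ_equiv_sym:
 assumes "germ_equiv \<L> u v q"
 shows "germ_equiv \<L> v u q"
proof -
 obtain L where L: "L : \<L>" "\<forall>\<^sub>F x in nhds q. x : std --> u x = v x + L x"
  using assms unfolding germ_equiv_def by blast
 have "\<forall>\<^sub>F x in nhds q. x : std --> v x = u x + (0 - L x)"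
  using L(2) by eventually_elim simp
 then show ?thesis unfolding germ_equiv_def by (rule bexI[OF _ diff[OF zero L(1)]])
qed

lemma germ_equiv_trans:
 assumes "germ_equiv \<L> u v q" "germ_equiv \<L> v w q"
 shows "germ_equiv \<L> u w q"
proof -
 obtain L where L: "L : \<L>" "\<forall>\<^sub>F x in nhds q. x : std --> u x = v x + L x"
  using assms(1) unfolding germ_equiv_def by blast
 obtain L' where L': "L' : \<L>" "\<forall>\<^sub>F x in nhds q. x : std --> v x = w x + L' x"
  using assms(2) unfolding germ_equiv_def by blast
 have "\<forall>\<^sub>F x in nhds q. x : std --> u x = w x + (L x + L' x)"
  using L(2) L'(2) by eventually_elim simp
 then show ?thesis unfolding germ_equiv_def by (rule bexI[OF _ add[OF L(1) L'(1)]])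
qed

lemma germ_equiv_cong:
 assumes "germ_equiv \<L> u v q" "\<forall>\<^sub>F x in nhds q. x : std --> u' x = u x"
 shows "germ_equiv \<L> u' v q"
proof -
 obtain L where L: "L : \<L>" "\<forall>\<^sub>F x in nhds q. x : std --> u x = v x + L x"
  using assms(1) unfolding germ_equiv_def by blast
 have "\<forall>\<^sub>F x in nhds q. x : std --> u' x = v x + L x"
  using L(2) assms(2) by eventually_elim simp
 then show ?thesis unfolding germ_equiv_def using L(1) by blast
qed

end

lemma open_meets_interior:
 assumes "open N" "q : N" "q : std"
 shows "N Int interior std ~= {}"
proof -
 have sub: "{z. 0 < fst z} Int {z. 0 < snd z} Int {z::real \<times> real. fst z + snd z < 1} <= interior std"
  by (rule interior_maximal)
   (auto simp: mem_std intro!: open_Int open_Collect_less continuous_intros)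
 have "(1/4, 1/4) : {z. 0 < fst z} Int {z. 0 < snd z} Int {z::real \<times> real. fst z + snd z < 1}" by simp
 then have "interior std ~= {}" using sub by blast
 then have "closure (interior std) = closure std"
  by (rule convex_closure_interior[OF convex_std])
 then have "q : closure (interior std)" using assms(3) closure_subset by blast
 then show ?thesis using assms(1,2) by (metis Int_commute closure_iff_nhds_not_empty subset_refl)
qed

context unique_continuation
begin

lemma local_to_global:
 assumes A: "A = std Int O'" "open O'" "convex A"
  and eq: "!!q. q : A ==> germ_equiv \<L> u v q"
 shows "EX L:\<L>. ALL x:A. u x = v x + L x"
proof (cases "A = {}")
 case True
 then show ?thesis using zero by blast
next
 case False
 then obtain q0 where q0: "q0 : A" by blast
 obtain L0 where L0: "L0 : \<L>" "\<forall>\<^sub>F x in nhds q0. x : std --> u x = v x + L0 x"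
  using eq[OF q0] unfolding germ_equiv_def by blast
 define P where "P q <-> (\<forall>\<^sub>F x in nhds q. x : std --> u x = v x + L0 x)" for q
 have "P x" if x: "x : A" for x
 proof (rule connected_induction_simple[OF convex_connected[OF A(3)] q0 x])
  show "P q0" unfolding P_def by (rule L0(2))
  fix a assume a: "a : A"
  obtain L where L: "L : \<L>" "\<forall>\<^sub>F x in nhds a. x : std --> u x = v x + L x"
   using eq[OF a] unfolding germ_equiv_def by blast
  obtain N where N: "open N" "a : N" "!!x. x : N ==> x : std ==> u x = v x + L x"
   using L(2) unfolding eventually_nhds by blast
  have "P y" if x: "x : A Int N" "P x" and y: "y : A Int N" for x y
  proof -
   obtain M where M: "open M" "x : M" "!!z. z : M ==> z : std ==> u z = v z + L0 z"
    using x(2) unfolding P_def eventually_nhds by blast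
   have x': "x : std" using x(1) A(1) by blast
   have "L = L0"
   proof (rule uc[OF L(1) L0(1)])
    show "open ((N Int M) Int interior std)" using N(1) M(1) by auto
    show "(N Int M) Int interior std ~= {}"
     by (rule open_meets_interior[of _ x]) (use N M x x' in auto)
    fix z assume z: "z : (N Int M) Int interior std"
    then have "z : std" using interior_subset by blast
    then show "L z = L0 z" using N(3)[of z] M(3)[of z] z by simp
   qed
   then show ?thesis unfolding P_def eventually_nhds using N y by blast
  qed
  then have "ALL x:A Int N. ALL y:A Int N. P x --> P y" by blast
  moreover have "openin (top_of_set A) (A Int N)" by (rule openin_open_Int[OF N(1)])
  moreover have "a : A Int N" using a N(2) by blast
  ultimately show "EX T. openin (top_of_set A) T & a : T & (ALL x:T. ALL y:T. P x --> P y)" by blast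
 qed
 then have "u x = v x + L0 x" if "x : A" for x
  using that A(1) eventually_nhds_x_imp_x[of "%x. x : std --> u x = v x + L0 x" x] unfolding P_def by simp
 then show ?thesis using L0(1) by blast
qed

definition trivial_on :: "(real \<times> real => real \<times> real => real) => (real \<times> real) set => bool" where
 "trivial_on gx A <-> (EX G. ALL q:A. germ_equiv \<L> G (gx q) q)"

lemma trivial_on_Un:
 assumes A: "A = std Int O1" "open O1" "trivial_on gx A"
  and B: "B = std Int O2" "open O2" "trivial_on gx B"
  and conv: "convex (A Int B)"
 shows "trivial_on gx (A Un B)"
proof -
 obtain G where G: "ALL q:A. germ_equiv \<L> G (gx q) q" using A(3) unfolding trivial_on_def by blast
 obtain H where H: "ALL q:B. germ_equiv \<L> H (gx q) q" using B(3) unfolding trivial_on_def by blast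
 have AB: "A Int B = std Int (O1 Int O2)" using A B by blast
 have GH: "germ_equiv \<L> G H q" if "q : A Int B" for q
  using that by (intro germ_equiv_trans[OF bspec[OF G] germ_equiv_sym[OF bspec[OF H]]]) auto
 have "open (O1 Int O2)" using A(2) B(2) by (rule open_Int)
 from local_to_global[OF AB this conv GH]
 obtain L where L: "L : \<L>" "ALL x:A Int B. G x = H x + L x" by blast
 define K where "K x = (if x : O1 then G x else H x + L x)" for x
 have "germ_equiv \<L> K (gx q) q" if q: "q : A Un B" for q
 proof (cases "q : A")
  case True
  have "\<forall>\<^sub>F x in nhds q. x : O1" using A True by (intro eventually_nhds_in_open) auto
  then have "\<forall>\<^sub>F x in nhds q. x : std --> K x = G x" by eventually_elim (simp add: K_def)
  then show ?thesis by (rule germ_equiv_cong[OF bspec[OF G True]])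
 next
  case False
  then have qB: "q : B" using q by blast
  have "\<forall>\<^sub>F x in nhds q. x : O2" using B qB by (intro eventually_nhds_in_open) auto
  then have e: "\<forall>\<^sub>F x in nhds q. x : std --> K x = H x + L x"
   by eventually_elim (use L(2) A(1) B(1) in \<open>auto simp: K_def\<close>)
  then have "germ_equiv \<L> K H q" unfolding germ_equiv_def using L(1) by blast
  then show ?thesis by (rule germ_equiv_trans) (use H qB in blast)
 qed
 then show ?thesis unfolding trivial_on_def by blast
qed

lemma trivial_on_triangle:
 assumes compat: "!!p. p : std ==> \<forall>\<^sub>F q in nhds p. q : std --> germ_equiv \<L> (gx p) (gx q) q"
 shows "EX G. ALL q:std. germ_equiv \<L> G (gx q) q"
proof -
 have comp: "compact std"
 proof -
  have "std <= {0..1} \<times> {0..1}" by (auto simp: std_triangle_def)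
  then have "bounded std" by (rule bounded_subset[rotated]) (simp add: bounded_Times)
  moreover have "closed ({z. 0 <= fst z} Int {z. 0 <= snd z} Int {z::real \<times> real. fst z + snd z <= 1})"
   by (intro closed_Int closed_Collect_le continuous_intros)
  moreover have "{z. 0 <= fst z} Int {z. 0 <= snd z} Int {z::real \<times> real. fst z + snd z <= 1} = std"
   by (auto simp: mem_std)
  ultimately show ?thesis by (simp add: compact_eq_bounded_closed)
 qed
 define \<C> where "\<C> = {N. open N & (EX G. ALL q:N Int std. germ_equiv \<L> G (gx q) q)}"
 have "std <= \<Union>\<C>"
 proof
  fix p assume "p : std"
  from compat[OF this] obtain N where "open N" "p : N" "ALL q:N. q : std --> germ_equiv \<L> (gx p) (gx q) q"
   unfolding eventually_nhds by blast
  then show "p : \<Union>\<C>" unfolding \<C>_def by blast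
 qed
 moreover have "\<C> ~= {}" unfolding \<C>_def by (auto intro!: exI[of _ "{}"])
 moreover have "open B" if "B : \<C>" for B using that by (simp add: \<C>_def)
 ultimately have "EX de>0. ALL T. T <= std --> diameter T < de --> (EX B:\<C>. T <= B)"
  by (elim Lebesgue_number_lemma[OF comp, rotated 2]) blast+
 then obtain de where de: "0 < de" "!!T. T <= std ==> diameter T < de ==> EX B:\<C>. T <= B"
  by blast
 define et where "et = de / 8"
 have et: "et > 0" using de(1) by (simp add: et_def)
 define O' where "O' a b c d = {z::real \<times> real. a - et < fst z} Int {z. fst z < b + et} Int {z. c - et < snd z} Int {z. snd z < d + et}" for a b c d
 define X where "X a b c d = std Int O' a b c d" for a b c d
 have op: "open (O' a b c d)" for a b c d
  unfolding O'_def by (intro open_Int open_Collect_less continuous_intros)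
 have conv: "convex (X a b c d)" for a b c d
 proof -
  have "O' a b c d = {a - et<..<b + et} \<times> {c - et<..<d + et}" by (auto simp: O'_def)
  then show ?thesis unfolding X_def by (simp add: convex_Int convex_std convex_Times)
 qed
 have small: "trivial_on gx (X a b c d)" if "a <= b" "b - a < et" "c <= d" "d - c < et" for a b c d
 proof -
  have "diameter (X a b c d) <= 6 * et"
  proof (rule diameter_le)
   fix x y assume xy: "x : X a b c d" "y : X a b c d"
   have "norm (x - y) <= norm (fst (x - y)) + norm (snd (x - y))"
    by (metis norm_Pair_le prod.collapse)
   also have "... <= 6 * et" using xy that by (auto simp: X_def O'_def)
   finally show "norm (x - y) <= 6 * et" .
  qed (use et in simp)
  also have "... < de" using de(1) by (simp add: et_def)
  finally obtain B where "B : \<C>" "X a b c d <= B" using de(2)[of "X a b c d"] by (auto simp: X_def)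
  then show ?thesis unfolding trivial_on_def \<C>_def X_def by blast
 qed
 have strip: "trivial_on gx (X a b 0 1)" if ab: "a <= b" "b - a < et" for a b
 proof -
  have "(0::real) <= 1" by simp
  then show ?thesis
  proof (induction rule: Bolzano[where P = "%c d. trivial_on gx (X a b c d)"])
   case (trans c d e)
   have "trivial_on gx (X a b c d Un X a b d e)"
   proof (rule trivial_on_Un[OF X_def op trans(1) X_def op trans(2)])
    have "X a b c d Int X a b d e = X a b d d" using trans(3,4) by (auto simp: X_def O'_def)
    then show "convex (X a b c d Int X a b d e)" using conv by simp
   qed
   moreover have "X a b c d Un X a b d e = X a b c e" using trans(3,4) et by (auto simp: X_def O'_def)
   ultimately show ?case by simp
  next
   case (local x)
   show ?case using small[OF ab] et by (intro exI[of _ et]) auto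
  qed
 qed
 have "(0::real) <= 1" by simp
 then have "trivial_on gx (X 0 1 0 1)"
 proof (induction rule: Bolzano[where P = "%a b. trivial_on gx (X a b 0 1)"])
  case (trans a b c)
  have "trivial_on gx (X a b 0 1 Un X b c 0 1)"
  proof (rule trivial_on_Un[OF X_def op trans(1) X_def op trans(2)])
   have "X a b 0 1 Int X b c 0 1 = X b b 0 1" using trans(3,4) by (auto simp: X_def O'_def)
   then show "convex (X a b 0 1 Int X b c 0 1)" using conv by simp
  qed
  moreover have "X a b 0 1 Un X b c 0 1 = X a c 0 1" using trans(3,4) et by (auto simp: X_def O'_def)
  ultimately show ?case by simp
 next
  case (local x)
  show ?case using strip et by (intro exI[of _ et]) auto
 qed
 moreover have "X 0 1 0 1 = std" using et by (auto simp: X_def O'_def mem_std)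
 ultimately show ?thesis by (simp add: trivial_on_def)
qed

end

interpretation constants: unique_continuation "range (%k _. k)"
 by unfold_locales (auto simp: fun_eq_iff)

lemma affine_function_uc:
 fixes L L' :: "real \<times> real => real"
 assumes L: "affine_function L" "affine_function L'" and N: "open N" "x : N" "!!z. z : N ==> L z = L' z"
 shows "L = L'"
proof
 fix y
 have "((%s. x + s *R (y - x)) \<longlongrightarrow> x + 0 *R (y - x)) (at_right 0)" by (intro tendsto_intros)
 then have "((%s. x + s *R (y - x)) \<longlongrightarrow> x) (at_right 0)" by simp
 moreover have "\<forall>\<^sub>F z in nhds x. L z = L' z" using N unfolding eventually_nhds by blast
 ultimately have "\<forall>\<^sub>F s in at_right 0. L (x + s *R (y - x)) = L' (x + s *R (y - x))"
  by (rule nhds_compose)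
 then have "\<forall>\<^sub>F s in at_right (0::real). L y = L' y"
  using eventually_at_right_less[of 0]
 proof eventually_elim
  case (elim s)
  then show ?case using N(3)[OF N(2)] by (simp add: affine_function_line L)
 qed
 then show "L y = L' y" by (simp add: eventually_const_iff trivial_limit_at_right_real)
qed

lemma affine_function_diff:
 assumes "affine_function L" "affine_function L'"
 shows "affine_function (%x. L x - L' x)"
proof -
 obtain c g c' g' where "L = (%x. c + g \<bullet> x)" "L' = (%x. c' + g' \<bullet> x)"
  using assms by (auto simp: affine_function_def)
 then have "(%x. L x - L' x) = (%x. (c - c') + (g - g') \<bullet> x)" by (auto simp: inner_diff_left)
 then show ?thesis unfolding affine_function_def by blast
qed

interpretation affine: unique_continuation "Collect affine_function :: (real \<times> real => real) set"
proof
 show "(%_. 0) : Collect affine_function"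
  by (auto simp: affine_function_def intro!: exI[of _ 0])
 show "L = L'" if "L : Collect affine_function" "L' : Collect affine_function" "open N" "N ~= {}" "!!x. x : N ==> L x = L' x"
  for L L' :: "real \<times> real => real" and N
  using that affine_function_uc[of L L' N] by blast
qed (simp add: affine_function_diff)

section \<open>Cech classes come from cochains\<close>

definition vertex_interp :: "(real \<times> real => real) => real \<times> real => real" where
 "vertex_interp G z = G (0,0) + (G (1,0) - G (0,0)) * fst z + (G (0,1) - G (0,0)) * snd z"

lemma vertex_interp_vertices [simp]:
 "vertex_interp G (0,0) = G (0,0)" "vertex_interp G (1,0) = G (1,0)" "vertex_interp G (0,1) = G (0,1)"
 by (simp_all add: vertex_interp_def)

lemma affine_vertex_interp: "affine_function (vertex_interp G)"
 using affine_functionI[of "G (0,0)" "G (1,0) - G (0,0)" "G (0,1) - G (0,0)"]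
 by (simp add: vertex_interp_def[abs_def])

lemma vertex_interp_side:
 "i < 3 ==> vertex_interp G (spt i t) = (1 - t) * G (spt i 0) + t * G (spt i 1)"
 by (erule less_3_cases) (simp_all add: vertex_interp_def side_simps algebra_simps)

context ct_surface
begin

lemma glue_triangles:
 assumes G: "!!e f i f' i'. (f, i) : edge_link S e ==> (f', i') : edge_link S e ==>
   EX a b. ALL t:{0..1}. G f (spt i t) - G f' (spt i' t) = a + b * t"
 obtains Th where "!!f z. f : tris S ==> z : std ==> Th (tri_map S f z) = G f z - vertex_interp (G f) z"
proof -
 define \<theta> where "\<theta> f z = G f z - vertex_interp (G f) z" for f z
 have side: "\<theta> f (spt i t) = \<theta> f' (spt i' t)"
  if fi: "(f, i) : edge_link S e" "(f', i') : edge_link S e" and t: "t : {0..1}" for e f i f' i' t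
 proof -
  have i: "i < 3" "i' < 3" using fi by (auto simp: edge_link_def)
  obtain a b where ab: "!!t. t : {0..1} ==> G f (spt i t) = G f' (spt i' t) + a + b * t"
   using G[OF fi] by (metis add.assoc add.commute diff_add_cancel)
  show ?thesis using ab[OF t] ab[of 0] ab[of 1]
   by (simp add: \<theta>_def vertex_interp_side[OF i(1)] vertex_interp_side[OF i(2)] algebra_simps)
 qed
 define Th where "Th x = (case x of VPoint v => 0
  | EPoint e t => (let p = SOME p. p : edge_link S e in \<theta> (fst p) (spt (snd p) t))
  | TPoint f z => \<theta> f z)" for x :: "('v, 'e, 'f) point"
 have E: "Th (EPoint (face S f i) t) = \<theta> f (spt i t)" if "f : tris S" "i < 3" "t : {0..1}" for f i t
 proof -
  define p where "p = (SOME p. p : edge_link S (face S f i))"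
  have fi: "(f, i) : edge_link S (face S f i)" using that by (simp add: edge_link_def)
  then have "p : edge_link S (face S f i)" unfolding p_def by (rule someI)
  then have "(fst p, snd p) : edge_link S (face S f i)" by simp
  from side[OF this fi that(3)] show ?thesis by (simp add: Th_def p_def Let_def)
 qed
 show ?thesis
 proof (rule that)
  fix f z assume f: "f : tris S" "z : std"
  have "Th (tri_map S f z) = \<theta> f z"
   using f
  proof (cases rule: tri_map_cases)
   case (E2 t)
   then show ?thesis using E[OF f(1), of 2 t] by (simp add: side_simps)
  next
   case (E1 t)
   then show ?thesis using E[OF f(1), of 1 t] by (simp add: side_simps)
  next
   case (E0 t)
   then show ?thesis using E[OF f(1), of 0 t] by (simp add: side_simps)
  qed (simp_all add: Th_def \<theta>_def)
  then show "Th (tri_map S f z) = G f z - vertex_interp (G f) z" by (simp add: \<theta>_def)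
 qed
qed

lemma eventually_chart:
 assumes "openin (realization S) W" "f : tris S" "y : std" "tri_map S f y : W"
 shows "\<forall>\<^sub>F z in nhds y. z : std --> tri_map S f z : W"
 using assms unfolding openin_charts by blast

lemma locally_constant_chart:
 assumes "locally_constant_on (realization S) U b" "openin (realization S) U"
  and f: "f : tris S" "y : std" "tri_map S f y : U"
 shows "\<forall>\<^sub>F z in nhds y. z : std --> b (tri_map S f z) = b (tri_map S f y)"
proof -
 obtain V where V: "openin (realization S) V" "tri_map S f y : V" "ALL x:V Int U. b x = b (tri_map S f y)"
  using assms(1) f(3) unfolding locally_constant_on_def by blast
 have "openin (realization S) (V Int U)" using V(1) assms(2) by (rule openin_Int)
 from eventually_chart[OF this f(1,2)] V(2) f(3)
 have "\<forall>\<^sub>F z in nhds y. z : std --> tri_map S f z : V Int U" by blast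
 then show ?thesis by eventually_elim (use V(3) in blast)
qed

lemma cech_cocycle_cochain:
 assumes zt: "zt : cech_Z1 (realization S)"
 obtains c where "cocycle S c" "zt - cochain_class c : cech_B1 (realization S)"
proof -
 let ?X = "realization S"
 obtain U where U: "pointed_cover ?X U"
  and lc: "!!x y. x : points S ==> y : points S ==> locally_constant_on ?X (U x Int U y) (zt x y)"
  and coc: "!!x y w z. x : points S ==> y : points S ==> w : points S ==> z : U x Int U y Int U w ==>
    zt x y z + zt y w z = zt x w z"
  using zt unfolding cech_Z1_def topspace_realization by blast
 have Uo: "openin ?X (U x)" and Um: "x : U x" if "x : points S" for x
  using U that by (auto simp: pointed_cover_def)
 text \<open>\<open>zt\<close> becomes a coboundary over all, not necessarily continuous, functions.\<close>
 have split: "zt w y w = zt w x w + zt x y w"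
  if "x : points S" "y : points S" "w : U x" "w : U y" for x y w
 proof -
  have w: "w : points S" using Uo[OF that(1)] that(3) openin_subset by fastforce
  show ?thesis using coc[OF w that(1,2), of w] Um[OF w] that by simp
 qed
 have shift: "\<forall>\<^sub>F z in nhds q. z : std -->
   zt (tri_map S f z) y (tri_map S f z) = zt (tri_map S f z) x (tri_map S f z) + zt x y (tri_map S f q)"
  if f: "f : tris S" "q : std" and x: "x : points S" "tri_map S f q : U x"
   and y: "y : points S" "tri_map S f q : U y" for f q x y
 proof -
  have op: "openin ?X (U x Int U y)" using Uo x y by blast
  have "\<forall>\<^sub>F z in nhds q. z : std --> tri_map S f z : U x Int U y"
   using eventually_chart[OF op f] x y by blast
  moreover have "\<forall>\<^sub>F z in nhds q. z : std --> zt x y (tri_map S f z) = zt x y (tri_map S f q)"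
   using locally_constant_chart[OF lc[OF x(1) y(1)] op f] x y by blast
  ultimately show ?thesis
   by eventually_elim (use split[OF x(1) y(1)] in auto)
 qed
 define gx where "gx f y z = zt (tri_map S f z) (tri_map S f y) (tri_map S f z)" for f y z
 have "EX G. ALL q:std. germ_equiv (range (%k _. k)) G (gx f q) q" if f: "f : tris S" for f
 proof (rule constants.trivial_on_triangle)
  fix p assume p: "p : std"
  let ?x = "tri_map S f p"
  have x: "?x : points S" by (rule tri_map_points[OF f p])
  have "\<forall>\<^sub>F q in nhds p. q : std --> tri_map S f q : U ?x"
   by (rule eventually_chart[OF Uo[OF x] f p Um[OF x]])
  then show "\<forall>\<^sub>F q in nhds p. q : std --> germ_equiv (range (%k _. k)) (gx f p) (gx f q) q"
  proof eventually_elim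
   case (elim q)
   show ?case
   proof
    assume q: "q : std"
    let ?y = "tri_map S f q"
    have y: "?y : points S" by (rule tri_map_points[OF f q])
    have qx: "?y : U ?x" using elim q by blast
    have "\<forall>\<^sub>F z in nhds q. z : std --> gx f p z = gx f q z + (- zt ?x ?y ?y)"
     using shift[OF f q x qx y Um[OF y]] by eventually_elim (simp add: gx_def)
    then show "germ_equiv (range (%k _. k)) (gx f p) (gx f q) q"
     unfolding germ_equiv_def by (intro bexI[of _ "%_. - zt ?x ?y ?y"]) auto
   qed
  qed
 qed
 then obtain G where G: "!!f q. f : tris S ==> q : std ==> germ_equiv (range (%k _. k)) (G f) (gx f q) q"
  by metis
 have Gx: "EX k. \<forall>\<^sub>F z in nhds q. z : std --> zt (tri_map S f z) x (tri_map S f z) = G f z + k"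
  if f: "f : tris S" "q : std" and x: "x : points S" "tri_map S f q : U x" for f q x
 proof -
  let ?y = "tri_map S f q"
  have y: "?y : points S" by (rule tri_map_points[OF f])
  obtain k where k: "\<forall>\<^sub>F z in nhds q. z : std --> G f z = gx f q z + k"
   using G[OF f] unfolding germ_equiv_def by auto
  have "\<forall>\<^sub>F z in nhds q. z : std --> zt (tri_map S f z) x (tri_map S f z) = G f z + (zt ?y x ?y - k)"
   using k shift[OF f y Um[OF y] x] by eventually_elim (simp add: gx_def)
  then show ?thesis by blast
 qed
 have D: "G f (spt i t) - G f' (spt i' t) = G f (spt i 0) - G f' (spt i' 0)"
  if fi: "(f, i) : edge_link S e" "(f', i') : edge_link S e" and t: "t : {0..1}" for e f i f' i' t
 proof -
  have f: "f : tris S" "i < 3" "face S f i = e" and f': "f' : tris S" "i' < 3" "face S f' i' = e"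
   using fi by (auto simp: edge_link_def)
  define d where "d t = G f (spt i t) - G f' (spt i' t)" for t
  have loc: "ALL a:{0..1}. \<forall>\<^sub>F b in at a within {0..1}. d a = d b"
  proof
    fix a :: real assume a: "a : {0..1}"
    let ?x = "edge_map S e a"
    have x: "?x : points S" using edge_map_points[OF _ a] face_edges[OF f(1,2)] f(3) by simp
    have xa: "tri_map S f (spt i a) : U ?x" "tri_map S f' (spt i' a) : U ?x"
     using tri_map_side[OF f(1,2) a] tri_map_side[OF f'(1,2) a] f(3) f'(3) Um[OF x] by auto
    obtain k where k: "\<forall>\<^sub>F z in nhds (spt i a). z : std --> zt (tri_map S f z) ?x (tri_map S f z) = G f z + k"
     using Gx[OF f(1) side_point_std[OF f(2) a] x xa(1)] by blast
    obtain k' where k': "\<forall>\<^sub>F z in nhds (spt i' a). z : std --> zt (tri_map S f' z) ?x (tri_map S f' z) = G f' z + k'"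
     using Gx[OF f'(1) side_point_std[OF f'(2) a] x xa(2)] by blast
    have "\<forall>\<^sub>F b in nhds a. b : {0..1} --> d b = k' - k"
     using nhds_compose[OF tendsto_side_point k] nhds_compose[OF tendsto_side_point k']
    proof eventually_elim
     case (elim b)
     show ?case
     proof
      assume b: "b : {0..1}"
      show "d b = k' - k"
       using elim side_point_std[OF f(2) b] side_point_std[OF f'(2) b] tri_map_side[OF f(1,2) b] tri_map_side[OF f'(1,2) b] f(3) f'(3)
       by (simp add: d_def)
     qed
    qed
    moreover from this have "d a = k' - k" using a eventually_nhds_x_imp_x by blast
    ultimately show "\<forall>\<^sub>F b in at a within {0..1}. d a = d b"
     unfolding eventually_at_filter by (auto elim: eventually_mono)
   qed
  have "d t = d 0"
   by (rule connected_local_const[OF _ t _ loc]) auto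
  then show ?thesis by (simp add: d_def)
 qed
 define c where "c e = (let p = SOME p. p : edge_link S e in G (fst p) (spt (snd p) 1) - G (fst p) (spt (snd p) 0))" for e
 have c: "c (face S f i) = G f (spt i 1) - G f (spt i 0)" if "f : tris S" "i < 3" for f i
 proof -
  define p where "p = (SOME p. p : edge_link S (face S f i))"
  have fi: "(f, i) : edge_link S (face S f i)" using that by (simp add: edge_link_def)
  then have "p : edge_link S (face S f i)" unfolding p_def by (rule someI)
  then have "(fst p, snd p) : edge_link S (face S f i)" by simp
  from D[OF this fi, of 1] show ?thesis by (simp add: c_def p_def Let_def)
 qed
 have closed: "cocycle S c"
  unfolding cocycle_def using c[of _ 0] c[of _ 1] c[of _ 2] by (simp add: side_simps)
 have interp: "vertex_interp (G f) z = G f (0,0) + afn S c f z" if "f : tris S" for f z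
  using c[OF that, of 1] c[OF that, of 2] by (simp add: vertex_interp_def afn_def side_simps)
 obtain Th where Th: "!!f z. f : tris S ==> z : std ==> Th (tri_map S f z) = G f z - vertex_interp (G f) z"
 proof (rule glue_triangles)
  fix e f i f' i' assume fi: "(f, i) : edge_link S e" "(f', i') : edge_link S e"
  have "G f (spt i t) - G f' (spt i' t) = G f (spt i 0) - G f' (spt i' 0) + 0 * t"
   if "t : {0..1}" for t
   using D[OF fi that] by linarith
  then show "EX a b. ALL t:{0..1}. G f (spt i t) - G f' (spt i' t) = a + b * t" by blast
 qed blast
 define b where "b x w = zt w x w - Th w - slope_lift S c x w" for x w
 have "zt - cochain_class c : cech_B1 ?X"
 proof (rule cech_B1_I[OF pointed_cover_Int[OF U pointed_cover_cells], where b = b])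
  fix x assume "x : topspace ?X"
  then have x: "x : points S" by simp
  show "locally_constant_on ?X (U x Int cell_nbhd S x) (b x)"
  proof (rule locally_constant_on_charts)
   show "openin ?X (U x Int cell_nbhd S x)" using Uo[OF x] open_cell_nbhd by blast
   fix f y assume f: "f : tris S" "y : std" and y: "tri_map S f y : U x Int cell_nbhd S x"
   obtain k where k: "\<forall>\<^sub>F z in nhds y. z : std --> zt (tri_map S f z) x (tri_map S f z) = G f z + k"
    using Gx[OF f x] y by blast
   obtain l where l: "\<forall>\<^sub>F z in nhds y. z : std --> slope_lift S c x (tri_map S f z) = l + afn S c f z"
    using has_slope_lift[OF closed, of x] f y unfolding has_slope_def by blast
   have "\<forall>\<^sub>F z in nhds y. z : std --> b x (tri_map S f z) = k + G f (0,0) - l"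
    using k l by eventually_elim (simp add: b_def Th[OF f(1)] interp[OF f(1)])
   then show "EX k. \<forall>\<^sub>F z in nhds y. z : std --> b x (tri_map S f z) = k" by blast
  qed
 next
  fix x y z assume xy: "x : topspace ?X" "y : topspace ?X"
   and z: "z : U x Int cell_nbhd S x Int (U y Int cell_nbhd S y)"
  show "(zt - cochain_class c) x y z = b y z - b x z"
   using split[of x y z] xy z by (simp add: b_def cochain_class_def)
 qed
 then show ?thesis using closed that by blast
qed

lemma zero_on_points_B1:
 assumes "!!x y z. z : points S ==> c x y z = 0"
 shows "c : cech_B1 (realization S)"
 by (rule cech_B1_I[OF pointed_cover_cells, where b = "%_ _. 0"])
  (use assms in \<open>auto simp: locally_constant_on_def cell_nbhd_def intro: open_cell_nbhd\<close>)

lemma D_connecting_subset: "gx : D_connecting S ` D_sections S ==> gx <= cech_Z1 (realization S)"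
 unfolding D_connecting_def D_sections_def using connecting_map_subset_Z1 by blast

lemma harmonic_class_in_span:
 assumes c: "cocycle S c" "harmonic S c"
 obtains s where "s : span (\<Union>(D_connecting S ` D_sections S))" "cochain_class c - s : cech_B1 (realization S)"
proof -
 obtain I :: "real set" and r and h :: "real => 'e => int" where I: "finite I"
  and h: "!!i. i : I ==> cocycle S (%e. of_int (h i e))"
   "!!i. i : I ==> harmonic S (%e. of_int (h i e))"
  and ch: "!!e. e : edges S ==> c e = (SUM i:I. r i * of_int (h i e))"
  by (rule harmonic_span_integral[OF c]) blast
 define s where "s = (SUM i:I. r i *R cochain_class (%e. of_int (h i e)))"
 have "s : span (\<Union>(D_connecting S ` D_sections S))"
  unfolding s_def
 proof (intro span_sum span_scale span_base UnionI)
  fix i assume i: "i : I"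
  show "cech_class (realization S) (cochain_class (%e. of_int (h i e))) : D_connecting S ` D_sections S"
   by (rule harmonic_class_in_image[OF h[OF i]])
  show "cochain_class (%e. of_int (h i e)) : cech_class (realization S) (cochain_class (%e. of_int (h i e)))"
   by (rule cech_class_self[OF cochain_class_Z1[OF h(1)[OF i]]])
 qed
 moreover have "cochain_class c - s : cech_B1 (realization S)"
 proof (rule zero_on_points_B1)
  fix x y z assume z: "z : points S"
  have "cochain_class (%e. SUM i:J. r i * of_int (h i e)) = (SUM i:J. r i *R cochain_class (%e. of_int (h i e)))"
   if "finite J" for J
   using that
  proof (induction J rule: finite_induct)
   case empty
   show ?case using cochain_class_linear[of 0 "%_. 0" 0 "%_. 0"] by simp
  next
   case (insert j J)
   then show ?case
    using cochain_class_linear[of "r j" "%e. of_int (h j e)" 1 "%e. SUM i:J. r i * of_int (h i e)"] by simp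
  qed
  then have s: "s = cochain_class (%e. SUM i:I. r i * of_int (h i e))" using I by (simp add: s_def)
  have "slope_lift S c p z = slope_lift S (%e. SUM i:I. r i * of_int (h i e)) p z" for p
   by (rule slope_lift_edges_cong[OF ch z])
  then show "(cochain_class c - s) x y z = 0" unfolding s by (simp add: cochain_class_def)
 qed
 ultimately show ?thesis by (rule that)
qed

lemma cohomology_decomposition:
 assumes "cocycle S d"
  and h: "!!c. cocycle S c ==> EX g a. (a = 0 \<or> P) & harmonic S (%e. c e - coboundary S g e - a * d e)"
  and zt: "zt : cech_Z1 (realization S)"
 shows "EX s:span (\<Union>(D_connecting S ` D_sections S)). EX a. (a = 0 \<or> P) &
  zt - (s + a *R cochain_class d) : cech_B1 (realization S)"
proof -
 obtain c where c: "cocycle S c" "zt - cochain_class c : cech_B1 (realization S)"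
  by (rule cech_cocycle_cochain[OF zt])
 obtain g a where ga: "a = 0 \<or> P" "harmonic S (%e. c e - coboundary S g e - a * d e)" using h[OF c(1)] by blast
 define k where "k = (%e. c e - coboundary S g e - a * d e)"
 obtain s where s: "s : span (\<Union>(D_connecting S ` D_sections S))" "cochain_class k - s : cech_B1 (realization S)"
  by (rule harmonic_class_in_span[OF closed_combination[OF c(1) assms(1)] ga(2), folded k_def])
 have "cochain_class c = cochain_class k + cochain_class (coboundary S g) + a *R cochain_class d"
 proof -
  have "c = (%e. 1 * k e + 1 * (1 * coboundary S g e + a * d e))" by (auto simp: k_def)
  then have "cochain_class c = cochain_class (%e. 1 * k e + 1 * (1 * coboundary S g e + a * d e))" by simp
  then show ?thesis unfolding cochain_class_linear by (simp add: add.assoc)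
 qed
 then have "zt - (s + a *R cochain_class d) = (zt - cochain_class c) + (cochain_class k - s) + cochain_class (coboundary S g)"
  by (simp add: algebra_simps)
 also have "... : cech_B1 (realization S)"
  by (intro subspace_add[OF subspace_cech_B1] c(2) s(2) cochain_class_coboundary)
 finally show ?thesis using s(1) ga(1) by blast
qed

lemma connecting_span_codim:
 "H1_codim (realization S) (H1_span (realization S) (D_connecting S ` D_sections S)) <= 1"
proof -
 obtain d where d: "cocycle S d" "!!c. cocycle S c ==> EX g a. harmonic S (%e. c e - coboundary S g e - a * d e)"
  using harmonic_complement by blast
 show ?thesis
 proof (rule H1_codim_le_1[OF D_connecting_subset cochain_class_Z1[OF d(1)]])
  fix c assume "c : cech_Z1 (realization S)"
  then show "EX s:span (\<Union>(D_connecting S ` D_sections S)). EX a. c - (s + a *R cochain_class d) : cech_B1 (realization S)"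
   using cohomology_decomposition[OF d(1), of True c] d(2) by auto
 qed
qed

lemma connecting_span_full:
 assumes p: "!!e. e : edges S ==> lap S p (e, False) = lap S p (e, True)"
  and pos: "(SUM v:verts S. SUM x:link_verts S v. p x * lap S p x) > 0"
 shows "H1_span (realization S) (D_connecting S ` D_sections S) = H1 (realization S)"
proof (rule H1_span_full[OF D_connecting_subset])
 have z: "cocycle S (%_. 0)" by (simp add: cocycle_def)
 have h: "EX g a. (a = 0 \<or> False) & harmonic S (%e. c e - coboundary S g e - a * 0)" if "cocycle S c" for c
  using positive_no_complement[OF p pos that] by auto
 fix c assume "c : cech_Z1 (realization S)"
 from cohomology_decomposition[OF z h this]
 show "EX d:span (\<Union>(D_connecting S ` D_sections S)). c - d : cech_B1 (realization S)" by auto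
qed

end

section \<open>One-sided directional derivatives of piecewise linear functions\<close>

definition has_dir :: "('a::real_normed_vector => real) => 'a => 'a => real => bool" where
 "has_dir h y w s <-> (\<forall>\<^sub>F t in at_right 0. h (y + t *R w) = h y + t * s)"

definition dirder :: "('a::real_normed_vector => real) => 'a => 'a => real" where
 "dirder h y w = Lim (at_right 0) (%t. (h (y + t *R w) - h y) / t)"

definition tangent :: "'a::real_normed_vector set => 'a => 'a set" where
 "tangent A y = {v. EX de>0. y + de *R v : A}"

definition conic_radius :: "'a::real_normed_vector set => ('a => real) => 'a => real => bool" where
 "conic_radius A h y ro <-> ro > 0 & (ALL w. norm w < ro --> y + w : A -->
   (ALL t:{0..1}. h (y + t *R w) = h y + t * (h (y + w) - h y)))"

definition conic_at :: "'a::real_normed_vector set => ('a => real) => 'a => bool" where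
 "conic_at A h y <-> (EX ro. conic_radius A h y ro)"

lemma has_dir_iff: "has_dir h y w s <-> (EX de>0. ALL t. 0 < t --> t < de --> h (y + t *R w) = h y + t * s)"
 unfolding has_dir_def using eventually_at_right[of 0 1 "%t. h (y + t *R w) = h y + t * s"] by auto

lemma at_right_0_iff:
 "eventually P (at_right (0::real)) <-> (EX de>0. ALL t. 0 < t --> t < de --> P t)"
 using eventually_at_right[of 0 1 P] by auto

lemma has_dir_dirder:
 assumes "has_dir h y w s"
 shows "dirder h y w = s"
 unfolding dirder_def
proof (rule tendsto_Lim)
 have "\<forall>\<^sub>F t in at_right 0. (h (y + t *R w) - h y) / t = s"
  using assms[unfolded has_dir_def] eventually_at_right_less[of 0] by eventually_elim simp
 then show "((%t. (h (y + t *R w) - h y) / t) \<longlongrightarrow> s) (at_right 0)" by (rule tendsto_eventually)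
qed simp

lemma has_dir_self: "has_dir h y w s ==> has_dir h y w (dirder h y w)"
 using has_dir_dirder by metis

lemma has_dir_unique: "has_dir h y w s ==> has_dir h y w s' ==> s = s'"
 using has_dir_dirder by metis

lemma has_dir_linear:
 assumes "has_dir h y w s" "has_dir k y w s'"
 shows "has_dir (%x. a * h x + b * k x) y w (a * s + b * s')"
 using assms unfolding has_dir_def by eventually_elim (simp add: algebra_simps)

lemma has_dir_scale:
 assumes "has_dir h y w s" "c > 0"
 shows "has_dir h y (c *R w) (c * s)"
proof -
 obtain de where d: "de > 0" "!!t. 0 < t ==> t < de ==> h (y + t *R w) = h y + t * s"
  using assms(1) unfolding has_dir_iff by blast
 have "h (y + t *R c *R w) = h y + t * (c * s)" if "0 < t" "t < de / c" for t
  using d(2)[of "t * c"] that assms(2) by (simp add: field_simps)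
 then show ?thesis unfolding has_dir_iff using d(1) assms(2) by (intro exI[of _ "de / c"]) simp
qed

lemma has_dir_cong:
 assumes "has_dir h y w s" "\<forall>\<^sub>F t in at_right 0. k (y + t *R w) = h (y + t *R w)" "k y = h y"
 shows "has_dir k y w s"
 using assms(1,2) unfolding has_dir_def by eventually_elim (simp add: assms(3))

lemma has_dir_compose:
 assumes "!!t. L (x + t *R w) = L x + t *R v" "has_dir h (L x) v s"
 shows "has_dir (%x. h (L x)) x w s"
 using assms(2) unfolding has_dir_def assms(1) .

lemma tangentD:
 assumes A: "convex A" "y : A" and v: "v : tangent A y"
 obtains de where "de > 0" "!!t. 0 <= t ==> t <= de ==> y + t *R v : A"
proof -
 obtain de where d: "de > 0" "y + de *R v : A" using v by (auto simp: tangent_def)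
 have "y + t *R v : A" if "0 <= t" "t <= de" for t
 proof -
  have "(1 - t / de) *R y + (t / de) *R (y + de *R v) : A"
   using d that by (intro convexD[OF A(1) A(2) d(2)]) (auto simp: field_simps)
  moreover have "(1 - t / de) *R y + (t / de) *R (y + de *R v) = y + t *R v"
   using d by (simp add: algebra_simps)
  ultimately show ?thesis by simp
 qed
 then show ?thesis using d(1) that by blast
qed

lemma convex_tangent:
 assumes A: "convex A" "y : A" and v: "v : tangent A y" "w : tangent A y" and ab: "0 <= a" "0 <= b"
 shows "a *R v + b *R w : tangent A y"
proof -
 obtain de where d: "de > 0" "!!t. 0 <= t ==> t <= de ==> y + t *R v : A" by (rule tangentD[OF A v(1)]) blast
 obtain ep where e: "ep > 0" "!!t. 0 <= t ==> t <= ep ==> y + t *R w : A" by (rule tangentD[OF A v(2)]) blast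
 define t where "t = min (de / (2 * (a + 1))) (ep / (2 * (b + 1)))"
 have t: "t > 0" using d e ab by (simp add: t_def)
 have "t <= de / (2 * (a + 1))" "t <= ep / (2 * (b + 1))" by (auto simp: t_def)
 then have "t * (2 * (a + 1)) <= de" "t * (2 * (b + 1)) <= ep"
  using ab by (auto simp: pos_le_divide_eq)
 then have "2 * t * a + 2 * t <= de" "2 * t * b + 2 * t <= ep" by (auto simp: algebra_simps)
 then have "2 * t * a <= de" "2 * t * b <= ep" using t by linarith+
 then have "y + (2 * t * a) *R v : A" "y + (2 * t * b) *R w : A" using t ab by (auto intro!: d(2) e(2))
 then have "(1/2) *R (y + (2 * t * a) *R v) + (1/2) *R (y + (2 * t * b) *R w) : A"
  by (intro convexD[OF A(1)]) auto
 moreover have "(1/2) *R (y + (2 * t * a) *R v) + (1/2) *R (y + (2 * t * b) *R w)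
   = ((1/2) *R y + (1/2) *R y) + t *R (a *R v + b *R w)"
  by (simp add: algebra_simps)
 moreover have "(1/2) *R y + (1/2) *R y = y" by (simp flip: scaleR_add_left)
 ultimately show ?thesis using t by (auto simp: tangent_def)
qed

lemma conic_radius_has_dir:
 assumes A: "convex A" "y : A" and c: "conic_radius A h y ro" and v: "norm v < ro" "y + v : A"
 shows "has_dir h y v (h (y + v) - h y)"
 unfolding has_dir_iff
 by (rule exI[of _ 1]) (use c v in \<open>auto simp: conic_radius_def\<close>)

lemma conic_has_dir:
 assumes A: "convex A" "y : A" and c: "conic_at A h y" and v: "v : tangent A y"
 shows "has_dir h y v (dirder h y v)"
proof -
 obtain ro where r: "conic_radius A h y ro" using c by (auto simp: conic_at_def)
 then have r0: "ro > 0" by (simp add: conic_radius_def)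
 obtain de where d: "de > 0" "!!t. 0 <= t ==> t <= de ==> y + t *R v : A" by (rule tangentD[OF A v]) blast
 define t where "t = min de (ro / (norm v + 1))"
 have t: "t > 0" "t <= de" using d r0 by (auto simp: t_def add_nonneg_pos)
 have "t * norm v <= ro / (norm v + 1) * norm v" by (intro mult_right_mono) (auto simp: t_def)
 also have "... < ro / (norm v + 1) * (norm v + 1)"
  using r0 by (intro mult_strict_left_mono divide_pos_pos) (auto simp: add_nonneg_pos)
 also have "... = ro" using add_nonneg_pos[of "norm v" 1] by simp
 finally have "norm (t *R v) < ro" using t by simp
 from conic_radius_has_dir[OF A r this d(2)] t
 have "has_dir h y (t *R v) (h (y + t *R v) - h y)" by simp
 from has_dir_scale[OF this, of "1 / t"] t
 have "has_dir h y v ((1 / t) * (h (y + t *R v) - h y))" by simp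
 then show ?thesis by (rule has_dir_self)
qed

lemma dirder_scale:
 assumes A: "convex A" "y : A" and c: "conic_at A h y" and v: "v : tangent A y" and a: "a > 0"
 shows "dirder h y (a *R v) = a * dirder h y v"
 by (rule has_dir_dirder[OF has_dir_scale[OF conic_has_dir[OF A c v] a]])

lemma dirder_ray:
 assumes A: "convex A" "y : A" and c: "conic_radius A h y ro" and v: "norm (ep *R v) < ro" "y + ep *R v : A" "ep > 0"
 shows "h (y + ep *R v) = h y + ep * dirder h y v"
proof -
 have "has_dir h y (ep *R v) (h (y + ep *R v) - h y)" by (rule conic_radius_has_dir[OF A c v(1,2)])
 then have "dirder h y (ep *R v) = h (y + ep *R v) - h y" by (rule has_dir_dirder)
 moreover have "dirder h y (ep *R v) = ep * dirder h y v"
  using c v by (intro dirder_scale[OF A]) (auto simp: conic_at_def tangent_def)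
 ultimately show ?thesis by simp
qed

lemma conic_at_linear:
 assumes "conic_at A h y" "conic_at A k y"
 shows "conic_at A (%x. a * h x + b * k x) y"
proof -
 obtain r r' where r: "conic_radius A h y r" "conic_radius A k y r'" using assms by (auto simp: conic_at_def)
 have "conic_radius A (%x. a * h x + b * k x) y (min r r')"
  unfolding conic_radius_def
 proof (intro conjI allI impI ballI)
  show "min r r' > 0" using r by (simp add: conic_radius_def)
  fix w :: 'a and t :: real assume w: "norm w < min r r'" "y + w : A" and t: "t : {0..1}"
  have "h (y + t *R w) = h y + t * (h (y + w) - h y)" "k (y + t *R w) = k y + t * (k (y + w) - k y)"
   using r w t by (auto simp: conic_radius_def)
  then show "a * h (y + t *R w) + b * k (y + t *R w)
    = a * h y + b * k y + t * (a * h (y + w) + b * k (y + w) - (a * h y + b * k y))"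
   by (simp only:) (simp add: algebra_simps)
 qed
 then show ?thesis by (auto simp: conic_at_def)
qed

lemma conic_at_cong:
 assumes h: "conic_at A h y" and A: "convex A" "y : A" and e: "\<forall>\<^sub>F x in nhds y. x : A --> k x = h x"
 shows "conic_at A k y"
proof -
 obtain r where r: "conic_radius A h y r" using h by (auto simp: conic_at_def)
 obtain d where d: "d > 0" "!!x. dist x y < d ==> x : A ==> k x = h x"
  using e unfolding eventually_nhds_metric by blast
 have "conic_radius A k y (min r d)"
  unfolding conic_radius_def
 proof (intro conjI allI impI ballI)
  show "min r d > 0" using r d(1) by (simp add: conic_radius_def)
  fix w :: 'a and t :: real assume w: "norm w < min r d" "y + w : A" and t: "t : {0..1}"
  have "(1 - t) *R y + t *R (y + w) : A" using t by (intro convexD[OF A(1) A(2) w(2)]) auto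
  then have tA: "y + t *R w : A" by (simp add: algebra_simps)
  have "norm (t *R w) <= norm w" using t by (simp add: mult_left_le_one_le)
  then have "k (y + t *R w) = h (y + t *R w)" using w tA by (intro d(2)) (auto simp: dist_norm)
  moreover have "k (y + w) = h (y + w)" using w by (intro d(2)) (auto simp: dist_norm)
  moreover have "k y = h y" using A(2) d(1) by (intro d(2)) auto
  ultimately show "k (y + t *R w) = k y + t * (k (y + w) - k y)"
   using r w t by (auto simp: conic_radius_def)
 qed
 then show ?thesis by (auto simp: conic_at_def)
qed

lemma conic_at_affine: "affine_function L ==> conic_at A L y"
 unfolding conic_at_def conic_radius_def
 by (auto simp: affine_function_def inner_add_right algebra_simps intro!: exI[of _ 1])

lemma dirder_dirder:
 assumes A: "convex A" "y : A" and c: "\<forall>\<^sub>F z in nhds y. z : A --> conic_at A h z"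
  and r: "r : tangent A y" and w: "et > 0" "r + et *R w : tangent A y"
 shows "\<forall>\<^sub>F ep in at_right 0. y + ep *R r : A & w : tangent A (y + ep *R r) &
  has_dir h (y + ep *R r) w (dirder (dirder h y) r w)"
  "has_dir (dirder h y) r w (dirder (dirder h y) r w)"
proof -
 have cy: "conic_at A h y" using c A(2) eventually_nhds_x_imp_x by blast
 then obtain ro where ro: "conic_radius A h y ro" by (auto simp: conic_at_def)
 then have ro0: "ro > 0" by (simp add: conic_radius_def)
 obtain de1 where d1: "de1 > 0" "!!t. 0 <= t ==> t <= de1 ==> y + t *R r : A" by (rule tangentD[OF A r]) blast
 obtain de2 where d2: "de2 > 0" "!!t. 0 <= t ==> t <= de2 ==> y + t *R (r + et *R w) : A" by (rule tangentD[OF A w(2)]) blast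
 obtain d where d: "d > 0" "!!z. dist z y < d ==> z : A ==> conic_at A h z"
  using c unfolding eventually_nhds_metric by blast
 define M where "M = norm r + et * norm w + 1"
 have M: "M > 0" "norm r < M" using w(1) by (auto simp: M_def add_nonneg_pos)
 define de where "de = Min {de1, de2, ro / M, d / M}"
 have de: "de > 0" "de <= de1" "de <= de2" "de * M <= ro" "de * M <= d"
 proof -
  show "de > 0" "de <= de1" "de <= de2" using d1 d2 ro0 d(1) M by (auto simp: de_def)
  have "de <= ro / M" "de <= d / M" by (auto simp: de_def)
  then show "de * M <= ro" "de * M <= d" using M by (auto simp: pos_le_divide_eq)
 qed
 have key: "y + ep *R r : A & w : tangent A (y + ep *R r) & has_dir h (y + ep *R r) w (dirder h (y + ep *R r) w)
   & has_dir (dirder h y) r w (dirder h (y + ep *R r) w)" if e: "0 < ep" "ep < de" for ep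
 proof -
  define z where "z = y + ep *R r"
  have zA: "z : A" unfolding z_def using e de(2) by (intro d1(2)) auto
  have "z + (ep * et) *R w = y + ep *R (r + et *R w)" by (simp add: z_def algebra_simps)
  also have "... : A" using e de(3) by (intro d2(2)) auto
  finally have wz: "z + (ep * et) *R w : A" .
  then have wt: "w : tangent A z" using e w(1) by (auto simp: tangent_def intro!: exI[of _ "ep * et"])
  have small: "norm (ep *R (r + t *R w)) < de * M" if t: "0 <= t" "t <= et" for t
  proof -
   have "norm (r + t *R w) <= norm r + t * norm w" using t by (metis abs_of_nonneg norm_scaleR norm_triangle_ineq)
   also have "... <= norm r + et * norm w" using t by (intro add_left_mono mult_right_mono) auto
   also have "... < M" by (simp add: M_def)
   finally have "norm (r + t *R w) < M" .
   then have "ep * norm (r + t *R w) < de * M" using e by (intro mult_strict_mono) (auto simp: M)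
   then show ?thesis using e by simp
  qed
  have "dist z y < d" using small[of 0] w(1) de(5) by (simp add: z_def dist_norm)
  then have cz: "conic_at A h z" using d(2) zA by blast
  have hz: "has_dir h z w (dirder h z w)" by (rule conic_has_dir[OF A(1) zA cz wt])
  then obtain b where b: "b > 0" "!!t. 0 < t ==> t < b ==> h (z + t *R w) = h z + t * dirder h z w"
   unfolding has_dir_iff by blast
  have H: "h (y + ep *R (r + t *R w)) = h y + ep * dirder h y (r + t *R w)" if t: "0 <= t" "t <= et" for t
  proof (rule dirder_ray[OF A ro _ _ e(1)])
   show "norm (ep *R (r + t *R w)) < ro" using small[OF t] de(4) by linarith
   have "(1 - t / et) *R z + (t / et) *R (z + (ep * et) *R w) : A"
    using t w(1) by (intro convexD[OF A(1) zA wz]) auto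
   moreover have "(1 - t / et) *R z + (t / et) *R (z + (ep * et) *R w) = y + ep *R (r + t *R w)"
    using w(1) by (simp add: z_def algebra_simps)
   ultimately show "y + ep *R (r + t *R w) : A" by simp
  qed
  have "dirder h y (r + t *R w) = dirder h y r + t * dirder h z w" if t: "0 < t" "t < min et (b / ep)" for t
  proof -
   have "ep * t < b" using t e by (simp add: pos_less_divide_eq mult.commute)
   then have "h (z + (ep * t) *R w) = h z + (ep * t) * dirder h z w" using b(2) e t by simp
   moreover have "z + (ep * t) *R w = y + ep *R (r + t *R w)" by (simp add: z_def algebra_simps)
   ultimately have "ep * dirder h y (r + t *R w) = ep * (dirder h y r + t * dirder h z w)"
    using H[of t] H[of 0] t w(1) by (simp add: z_def algebra_simps)
   then show ?thesis using e by simp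
  qed
  then have "has_dir (dirder h y) r w (dirder h z w)"
   unfolding has_dir_iff using w(1) b(1) e by (intro exI[of _ "min et (b / ep)"]) auto
  then show ?thesis using zA wt hz by (simp add: z_def)
 qed
 have eq: "dirder h (y + ep *R r) w = dirder (dirder h y) r w" if "0 < ep" "ep < de" for ep
  using key[OF that] has_dir_dirder by metis
 show "\<forall>\<^sub>F ep in at_right 0. y + ep *R r : A & w : tangent A (y + ep *R r) &
  has_dir h (y + ep *R r) w (dirder (dirder h y) r w)"
  unfolding at_right_0_iff using key eq de(1) by (intro exI[of _ de]) auto
 have "0 < de / 2" "de / 2 < de" using de(1) by auto
 then show "has_dir (dirder h y) r w (dirder (dirder h y) r w)" using key[of "de / 2"] has_dir_self by blast
qed

text \<open>Homogeneity at both \<open>y\<close> and a point \<open>z\<close> on the ray from \<open>y\<close> in direction \<open>r\<close> makes \<open>h\<close> affine on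
 each side of the ray near \<open>z\<close>.\<close>

lemma half_plane_affine:
 assumes A: "convex A" "y : A" and c: "\<forall>\<^sub>F z in nhds y. z : A --> conic_at A h z"
  and r: "r : tangent A y" and w: "et > 0" "r + et *R w : tangent A y"
  and side: "!!ep. 0 < ep ==> ep < e0 ==> EX d>0. ALL x v. \<bar>x\<bar> < d --> 0 <= v --> v < d --> y + (ep + x) *R r + v *R w : A"
  and e0: "e0 > 0"
 shows "\<forall>\<^sub>F ep in at_right 0. EX d>0. ALL x v. \<bar>x\<bar> < d --> 0 <= v --> v < d -->
  h (y + (ep + x) *R r + v *R w) = h y + (ep + x) * dirder h y r + v * dirder (dirder h y) r w"
proof -
 define H where "H = dirder h y"
 have "conic_at A h y" using c A(2) eventually_nhds_x_imp_x by blast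
 then obtain ro where ro: "conic_radius A h y ro" by (auto simp: conic_at_def)
 then have ro0: "ro > 0" by (simp add: conic_radius_def)
 have hom: "h (y + l *R v) = h y + l * (h (y + v) - h y)"
  if l: "l > 0" and v: "y + v : A" "y + l *R v : A" "norm v < ro" "norm (l *R v) < ro" for l v
  using dirder_ray[OF A ro v(4,2) l] dirder_ray[OF A ro, of 1 v] v by simp
 have "has_dir H r w (dirder H r w)" unfolding H_def by (rule dirder_dirder(2)[OF A c r w])
 have e1: "\<forall>\<^sub>F ep in at_right 0. ep < e0" using e0 by (rule order_tendstoD(2)[OF tendsto_ident_at])
 have e2: "\<forall>\<^sub>F ep in at_right 0. ep * (norm r + 1) < ro"
  by (rule order_tendstoD(2)[where y = 0]) (auto intro!: tendsto_eq_intros ro0)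
 show ?thesis
  using dirder_dirder(1)[OF A c r w] e1 e2 eventually_at_right_less[of 0]
 proof eventually_elim
  case (elim ep)
  define z where "z = y + ep *R r"
  define s where "s = dirder (dirder h y) r w"
  have zA: "z : A" and zs: "has_dir h z w s" using elim by (auto simp: z_def s_def)
  then obtain b where b: "b > 0" "!!t. 0 < t ==> t < b ==> h (z + t *R w) = h z + t * s"
   unfolding has_dir_iff by blast
  obtain d where d: "d > 0" "!!x v. \<bar>x\<bar> < d ==> 0 <= v ==> v < d ==> y + (ep + x) *R r + v *R w : A"
   using side[of ep] elim by blast
  have zr: "norm (ep *R r) < ro"
  proof -
   have "norm (ep *R r) <= ep * (norm r + 1)" using elim by (simp add: algebra_simps)
   then show ?thesis using elim by linarith
  qed
  define mm where "mm = ro - norm (ep *R r)"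
  have mm: "mm > 0" using zr by (simp add: mm_def)
  define d' where "d' = Min {d / 2, b / 2, ep / 2, mm / (4 * (norm r + 1)), mm / (8 * (norm w + 1))}"
  have d': "d' > 0" "d' <= d / 2" "d' <= b / 2" "d' <= ep / 2" "d' * (4 * (norm r + 1)) <= mm" "d' * (8 * (norm w + 1)) <= mm"
  proof -
   show "d' > 0" using d(1) b(1) elim mm by (auto simp: d'_def add_nonneg_pos)
   show "d' <= d / 2" "d' <= b / 2" "d' <= ep / 2" unfolding d'_def by (rule Min_le; simp)+
   have "d' <= mm / (4 * (norm r + 1))" "d' <= mm / (8 * (norm w + 1))" unfolding d'_def by (rule Min_le; simp)+
   then show "d' * (4 * (norm r + 1)) <= mm" "d' * (8 * (norm w + 1)) <= mm"
    by (auto simp: pos_le_divide_eq add_nonneg_pos)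
  qed
  show ?case
  proof (intro exI[of _ d'] conjI allI impI d'(1))
   fix x v assume xv: "\<bar>x\<bar> < d'" "0 <= v" "v < d'"
   define l where "l = (ep + x) / ep"
   have l: "l > 1/2" "ep * l = ep + x" using xv d'(4) elim by (auto simp: l_def field_simps)
   define v' where "v' = v / l"
   have lv': "l * v' = v" using l by (simp add: v'_def)
   have v': "0 <= v'" "v' <= 2 * v"
   proof -
    show "0 <= v'" using l xv by (simp add: v'_def)
    have "v * 1 <= v * (2 * l)" using l xv by (intro mult_left_mono) auto
    then show "v' <= 2 * v" using l by (simp add: v'_def pos_divide_le_eq mult_ac)
   qed
   have v'd: "v' < d" "v' < b" using v' xv d'(2,3) by linarith+
   define u where "u = ep *R r + v' *R w"
   have lu: "l *R u = (ep + x) *R r + v *R w"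
    unfolding u_def scaleR_add_right scaleR_scaleR lv' using l(2) by (simp add: mult.commute)
   have yu: "y + u : A" using d(2)[of 0 v'] d(1) v'(1) v'd by (simp add: u_def add.assoc)
   have yl: "y + l *R u : A" unfolding lu using d(2)[of x v] xv d' by (simp add: add.assoc)
   have xr: "norm (x *R r) <= mm / 4"
   proof -
    have "norm (x *R r) <= d' * (norm r + 1)" using xv by (simp add: mult_mono)
    moreover have "d' * (4 * (norm r + 1)) = 4 * (d' * (norm r + 1))" by simp
    ultimately show ?thesis using d'(5) by linarith
   qed
   have vw: "norm (t *R w) <= mm / 4" if "0 <= t" "t <= 2 * v" for t
   proof -
    have "norm (t *R w) <= (2 * d') * (norm w + 1)" using xv that by (simp add: mult_mono)
    moreover have "d' * (8 * (norm w + 1)) = 4 * (2 * d' * (norm w + 1))" by simp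
    ultimately show ?thesis using d'(6) by linarith
   qed
   have "norm u <= norm (ep *R r) + norm (v' *R w)" unfolding u_def by (rule norm_triangle_ineq)
   then have nu: "norm u < ro" using vw[OF v'] mm by (simp add: mm_def)
   have "norm (l *R u) <= norm (ep *R r) + norm (x *R r) + norm (v *R w)"
    using norm_triangle_ineq[of "ep *R r + x *R r" "v *R w"] norm_triangle_ineq[of "ep *R r" "x *R r"]
    unfolding lu scaleR_add_left by linarith
   then have nl: "norm (l *R u) < ro" using xr vw[of v] xv mm by (simp add: mm_def)
   have hz: "h z = h y + ep * H r"
    unfolding z_def H_def by (rule dirder_ray[OF A ro zr]) (use zA elim in \<open>auto simp: z_def\<close>)
   have "h (z + v' *R w) = h z + v' * s"
    using b(2)[of v'] v'(1) v'd by (cases "v' = 0") auto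
   then have hu: "h (y + u) = h y + ep * H r + v' * s" using hz by (simp add: u_def z_def add.assoc)
   have "h (y + l *R u) = h y + l * (h (y + u) - h y)"
    using l by (intro hom yu yl nu nl) auto
   also have "... = h y + (ep * l) * H r + (l * v') * s" unfolding hu by (simp add: algebra_simps)
   also have "... = h y + (ep + x) * H r + v * s" unfolding l(2) lv' ..
   finally show "h (y + (ep + x) *R r + v *R w) = h y + (ep + x) * dirder h y r + v * dirder (dirder h y) r w"
    by (simp add: lu H_def s_def add.assoc)
  qed
 qed
qed

subsection \<open>Piecewise linear functions of one variable\<close>

lemma sum_jumps:
 fixes k :: "real => real"
 assumes ab: "a < b"
  and R: "!!x. a <= x ==> x < b ==> has_dir k x 1 (kp x)"
  and L: "!!x. a < x ==> x <= b ==> has_dir k x (-1) (km x)"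
 shows "finite {x. a < x & x < b & kp x + km x ~= 0} &
  (SUM x | a < x & x < b & kp x + km x ~= 0. (kp x + km x) * (l0 + l1 * x))
   = - ((l0 + l1 * b) * km b) - (l0 + l1 * a) * kp a - l1 * (k b - k a)"
proof -
 define J where "J u v = {x. u < x & x < v & kp x + km x ~= 0}" for u v
 define P where "P u v <-> (a <= u --> u < v --> v <= b --> finite (J u v) &
  (SUM x:J u v. (kp x + km x) * (l0 + l1 * x))
   = - ((l0 + l1 * v) * km v) - (l0 + l1 * u) * kp u - l1 * (k v - k u))" for u v
 have "a <= b" using ab by simp
 then have "P a b"
 proof (induction rule: Bolzano[where P = P])
  case (trans u v w)
  show ?case
  proof (cases "u = v \<or> v = w")
   case True
   then show ?thesis using trans by auto
  next
   case False
   then have uv: "u < v" "v < w" using trans by auto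
   show ?thesis unfolding P_def
   proof (intro impI)
    assume A: "a <= u" "u < w" "w <= b"
    have 1: "finite (J u v)" "(SUM x:J u v. (kp x + km x) * (l0 + l1 * x))
     = - ((l0 + l1 * v) * km v) - (l0 + l1 * u) * kp u - l1 * (k v - k u)"
     using trans(1) uv A by (auto simp: P_def)
    have 2: "finite (J v w)" "(SUM x:J v w. (kp x + km x) * (l0 + l1 * x))
     = - ((l0 + l1 * w) * km w) - (l0 + l1 * v) * kp v - l1 * (k w - k v)"
     using trans(2) uv A by (auto simp: P_def)
    define K where "K = {x. x = v & kp x + km x ~= 0}"
    have K: "finite K" "(SUM x:K. (kp x + km x) * (l0 + l1 * x)) = (kp v + km v) * (l0 + l1 * v)"
    proof -
     show "finite K" by (simp add: K_def)
     show "(SUM x:K. (kp x + km x) * (l0 + l1 * x)) = (kp v + km v) * (l0 + l1 * v)"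
     proof (cases "kp v + km v = 0")
      case True
      then have "K = {}" by (auto simp: K_def)
      then show ?thesis using True by simp
     next
      case False
      then have "K = {v}" by (auto simp: K_def)
      then show ?thesis by simp
     qed
    qed
    have J: "J u w = J u v Un (K Un J v w)" using uv by (auto simp: J_def K_def)
    have "(SUM x:J u w. (kp x + km x) * (l0 + l1 * x)) = (SUM x:J u v. (kp x + km x) * (l0 + l1 * x))
      + ((SUM x:K. (kp x + km x) * (l0 + l1 * x)) + (SUM x:J v w. (kp x + km x) * (l0 + l1 * x)))"
     unfolding J using 1(1) 2(1) K(1)
     by (subst sum.union_disjoint; (subst sum.union_disjoint)?) (auto simp: J_def K_def)
    then show "finite (J u w) & (SUM x:J u w. (kp x + km x) * (l0 + l1 * x))
     = - ((l0 + l1 * w) * km w) - (l0 + l1 * u) * kp u - l1 * (k w - k u)"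
     using 1 2 K J by (simp add: algebra_simps)
   qed
  qed
 next
  case (local x)
  have "EX d>0. ALL t. 0 < t --> t < d --> x < b --> k (x + t) = k x + t * kp x"
   using R[of x] local unfolding has_dir_iff by (cases "x < b") (auto intro: exI[of _ 1])
  then obtain d where d: "d > 0" "!!t. 0 < t ==> t < d ==> x < b ==> k (x + t) = k x + t * kp x" by blast
  have "EX d>0. ALL t. 0 < t --> t < d --> a < x --> k (x - t) = k x + t * km x"
   using L[of x] local unfolding has_dir_iff by (cases "a < x") (auto intro: exI[of _ 1])
  then obtain d' where d': "d' > 0" "!!t. 0 < t ==> t < d' ==> a < x ==> k (x - t) = k x + t * km x" by blast
  have right: "kp s = kp x" "km s = - kp x" if s: "x < s" "s < x + d" "s < b" for s
  proof -
   have "k (s + t) = k s + t * kp x" if t: "0 < t" "t < x + d - s" for t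
    using d(2)[of "s - x"] d(2)[of "s + t - x"] s t by (auto simp: algebra_simps)
   then have "has_dir k s 1 (kp x)" unfolding has_dir_iff using s by (intro exI[of _ "x + d - s"]) auto
   moreover have "has_dir k s 1 (kp s)"
   proof (cases "a <= s")
    case True then show ?thesis using R s by auto
   qed (use local s in auto)
   ultimately show "kp s = kp x" by (metis has_dir_unique)
   have "k (s - t) = k s + t * (- kp x)" if t: "0 < t" "t < s - x" for t
    using d(2)[of "s - x"] d(2)[of "s - t - x"] s t by (auto simp: algebra_simps)
   then have "has_dir k s (-1) (- kp x)" unfolding has_dir_iff using s by (intro exI[of _ "s - x"]) auto
   moreover have "has_dir k s (-1) (km s)" using L[of s] s local by auto
   ultimately show "km s = - kp x" by (metis has_dir_unique)
  qed
  have rightb: "km b = - kp x" if s: "x < b" "b < x + d"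
  proof -
   have "k (b - t) = k b + t * (- kp x)" if t: "0 < t" "t < b - x" for t
    using d(2)[of "b - x"] d(2)[of "b - t - x"] s t by (auto simp: algebra_simps)
   then have "has_dir k b (-1) (- kp x)" unfolding has_dir_iff using s by (intro exI[of _ "b - x"]) auto
   moreover have "has_dir k b (-1) (km b)" using L[of b] ab by auto
   ultimately show "km b = - kp x" by (metis has_dir_unique)
  qed
  have left: "kp s = - km x" "km s = km x" if s: "s < x" "x - d' < s" "a < s" for s
  proof -
   have "k (s + t) = k s + t * (- km x)" if t: "0 < t" "t < x - s" for t
    using d'(2)[of "x - s"] d'(2)[of "x - s - t"] s t by (auto simp: algebra_simps)
   then have "has_dir k s 1 (- km x)" unfolding has_dir_iff using s by (intro exI[of _ "x - s"]) auto
   moreover have "has_dir k s 1 (kp s)" using R[of s] s local by auto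
   ultimately show "kp s = - km x" by (metis has_dir_unique)
   have "k (s - t) = k s + t * km x" if t: "0 < t" "t < s - (x - d')" for t
    using d'(2)[of "x - s"] d'(2)[of "x - s + t"] s t by (auto simp: algebra_simps)
   then have "has_dir k s (-1) (km x)" unfolding has_dir_iff using s by (intro exI[of _ "s - (x - d')"]) auto
   moreover have "has_dir k s (-1) (km s)" using L[of s] s local by auto
   ultimately show "km s = km x" by (metis has_dir_unique)
  qed
  have lefta: "kp a = - km x" if s: "a < x" "x - d' < a"
  proof -
   have "k (a + t) = k a + t * (- km x)" if t: "0 < t" "t < x - a" for t
    using d'(2)[of "x - a"] d'(2)[of "x - a - t"] s t by (auto simp: algebra_simps)
   then have "has_dir k a 1 (- km x)" unfolding has_dir_iff using s by (intro exI[of _ "x - a"]) auto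
   moreover have "has_dir k a 1 (kp a)" using R[of a] ab by auto
   ultimately show "kp a = - km x" by (metis has_dir_unique)
  qed
  show ?case
  proof (intro exI[of _ "min d d'"] conjI allI impI)
   show "min d d' > 0" using d(1) d'(1) by simp
   fix u v assume uv: "u <= x & x <= v & v - u < min d d'"
   show "P u v" unfolding P_def
   proof (intro impI)
    assume A: "a <= u" "u < v" "v <= b"
    have sub: "J u v <= {x}"
    proof
     fix s assume s: "s : J u v"
     then have s': "u < s" "s < v" "kp s + km s ~= 0" by (auto simp: J_def)
     have "~ x < s" using right[of s] s' uv A by auto
     moreover have "~ s < x" using left[of s] s' uv A by auto
     ultimately show "s : {x}" by auto
    qed
    have kv: "km v = - kp x & k v = k x + (v - x) * kp x" if "x < v"
     using right(2)[of v] rightb d(2)[of "v - x"] that uv A by (cases "v = b") auto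
    have ku: "kp u = - km x & k u = k x + (x - u) * km x" if "u < x"
     using left(1)[of u] lefta d'(2)[of "x - u"] that uv A by (cases "u = a") auto
    show "finite (J u v) & (SUM x:J u v. (kp x + km x) * (l0 + l1 * x))
     = - ((l0 + l1 * v) * km v) - (l0 + l1 * u) * kp u - l1 * (k v - k u)"
    proof (cases "u < x & x < v")
     case True
     have "(SUM x:J u v. (kp x + km x) * (l0 + l1 * x)) = (SUM x:{x}. (kp x + km x) * (l0 + l1 * x))"
      using sub True by (intro sum.mono_neutral_left) (auto simp: J_def)
     moreover have "- ((l0 + l1 * v) * km v) - (l0 + l1 * u) * kp u - l1 * (k v - k u) = (kp x + km x) * (l0 + l1 * x)"
      unfolding conjunct1[OF kv[OF conjunct2[OF True]]] conjunct2[OF kv[OF conjunct2[OF True]]]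
       conjunct1[OF ku[OF conjunct1[OF True]]] conjunct2[OF ku[OF conjunct1[OF True]]]
      by (simp add: algebra_simps)
     ultimately show ?thesis using finite_subset[OF sub] by simp
    next
     case False
     then have em: "J u v = {}" using sub by (auto simp: J_def)
     consider "x = u" "x < v" | "x = v" "u < x" using False uv A by fastforce
     then show ?thesis
     proof cases
      case 1
      have "- ((l0 + l1 * v) * km v) - (l0 + l1 * x) * kp x - l1 * (k v - k x) = 0"
       unfolding conjunct1[OF kv[OF 1(2)]] conjunct2[OF kv[OF 1(2)]] by (simp add: algebra_simps)
      then show ?thesis using 1(1) em by simp
     next
      case 2
      have "- ((l0 + l1 * x) * km x) - (l0 + l1 * u) * kp u - l1 * (k x - k u) = 0"
       unfolding conjunct1[OF ku[OF 2(2)]] conjunct2[OF ku[OF 2(2)]] by (simp add: algebra_simps)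
      then show ?thesis using 2(1) em by simp
     qed
    qed
   qed
  qed
 qed
 then show ?thesis using ab by (simp add: P_def J_def)
qed

lemma no_kinks_affine:
 fixes k :: "real => real"
 assumes R: "!!x. a <= x ==> x < b ==> has_dir k x 1 (kp x)"
  and L: "!!x. a < x ==> x <= b ==> has_dir k x (-1) (km x)"
  and nk: "!!x. a < x ==> x < b ==> kp x + km x = 0" and s: "a <= s" "s <= b"
 shows "k s = k a + (s - a) * kp a"
proof (cases "s = a")
 case False
 then have as: "a < s" using s by simp
 have em: "{x. a < x & x < s & kp x + km x ~= 0} = {}" using nk s by auto
 have "has_dir k x 1 (kp x)" if "a <= x" "x < s" for x using R that s by auto
 moreover have "has_dir k x (-1) (km x)" if "a < x" "x <= s" for x using L that s by auto
 ultimately have j: "(SUM x | a < x & x < s & kp x + km x ~= 0. (kp x + km x) * (l0 + l1 * x))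
   = - ((l0 + l1 * s) * km s) - (l0 + l1 * a) * kp a - l1 * (k s - k a)" for l0 l1
  using sum_jumps[OF as, of k kp km l0 l1] by blast
 have "km s = - kp a" using j[of 1 0] unfolding em by simp
 then show ?thesis using j[of 0 1] unfolding em by (simp add: algebra_simps)
qed simp

section \<open>Divisors in a triangle\<close>

lemma integral_PL_conic:
 fixes h :: "'a::euclidean_space => real"
 assumes A: "convex A" "y : A" and pl: "integral_PL_at A h y"
 shows "conic_at A h y"
  "EX Ga. finite Ga & (ALL g:Ga. ALL b:Basis. g \<bullet> b : \<int>) & (ALL w:tangent A y. EX g:Ga. has_dir h y w (g \<bullet> w))"
proof -
 obtain N \<P> where N: "open N" "y : N" "finite \<P>" "A Int N <= \<Union>\<P>"
  and P: "!!P. P : \<P> ==> polyhedron P & (EX L. integral_affine_function L & (ALL y:P Int A Int N. h y = L y))"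
  using pl unfolding integral_PL_at_def by blast
 have "EX c g. (ALL b:Basis. g \<bullet> b : \<int>) & (ALL y:P Int A Int N. h y = c + g \<bullet> y)" if "P : \<P>" for P
  using P[OF that] unfolding integral_affine_function_def by blast
 then obtain c g where cg: "!!P. P : \<P> ==> (ALL b:Basis. g P \<bullet> b : \<int>) & (ALL y:P Int A Int N. h y = c P + g P \<bullet> y)"
  by metis
 define M where "M = N Int (\<Inter>P\<in>{P:\<P>. y ~: P}. - P)"
 have "open M" unfolding M_def using N(1,3) P polyhedron_imp_closed
  by (intro open_Int open_INT) (auto simp: open_Compl)
 moreover have "y : M" using N(2) by (simp add: M_def)
 ultimately obtain ro where ro: "ro > 0" "ball y ro <= M" using open_contains_ball by blast
 have key: "EX g':g ` \<P>. ALL t:{0..1}. h (y + t *R w) = h y + t * (g' \<bullet> w)" if w: "norm w < ro" "y + w : A" for w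
 proof -
  have wM: "y + w : M" using ro(2) w(1) by (auto simp: dist_norm)
  then obtain P0 where P0: "P0 : \<P>" "y + w : P0" using N(4) w(2) by (auto simp: M_def)
  have yP: "y : P0" using wM P0 by (auto simp: M_def)
  have conv: "convex P0" using P[OF P0(1)] polyhedron_imp_convex by blast
  have h: "h (y + t *R w) = c P0 + g P0 \<bullet> (y + t *R w)" if t: "t : {0..1}" for t
  proof -
   have eq: "y + t *R w = (1 - t) *R y + t *R (y + w)" by (simp add: algebra_simps)
   have "y + t *R w : P0" unfolding eq using t by (intro convexD[OF conv yP P0(2)]) auto
   moreover have "y + t *R w : A" unfolding eq using t by (intro convexD[OF A w(2)]) auto
   moreover have "norm (t *R w) <= norm w" using t by (simp add: mult_left_le_one_le)
   then have "y + t *R w : ball y ro" using w(1) by (simp add: dist_norm)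
   then have "y + t *R w : N" using ro(2) by (auto simp: M_def)
   ultimately show ?thesis using cg[OF P0(1)] by blast
  qed
  have "ALL t:{0..1}. h (y + t *R w) = h y + t * (g P0 \<bullet> w)"
   using h h[of 0] by (simp add: inner_add_right)
  then show ?thesis using P0(1) by blast
 qed
 have "conic_radius A h y ro"
  unfolding conic_radius_def
 proof (intro conjI allI impI ballI ro(1))
  fix w :: 'a and t :: real assume w: "norm w < ro" "y + w : A" and t: "t : {0..1}"
  obtain g' where "ALL t:{0..1}. h (y + t *R w) = h y + t * (g' \<bullet> w)" using key[OF w] by blast
  then have "h (y + t *R w) = h y + t * (g' \<bullet> w)" "h (y + 1 *R w) = h y + 1 * (g' \<bullet> w)"
   using t by (blast, metis atLeastAtMost_iff order_refl zero_le_one)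
  then show "h (y + t *R w) = h y + t * (h (y + w) - h y)" by simp
 qed
 then show "conic_at A h y" by (auto simp: conic_at_def)
 have "EX g':g ` \<P>. has_dir h y w (g' \<bullet> w)" if w: "w : tangent A y" for w
 proof -
  obtain de where d: "de > 0" "!!t. 0 <= t ==> t <= de ==> y + t *R w : A" by (rule tangentD[OF A w]) blast
  define t where "t = min de (ro / (norm w + 1))"
  have n1: "norm w + 1 > 0" by (simp add: add_nonneg_pos)
  have t: "t > 0" "t <= de" using d ro(1) n1 by (auto simp: t_def)
  have "t <= ro / (norm w + 1)" by (simp add: t_def)
  then have "t * (norm w + 1) <= ro" using n1 by (simp add: pos_le_divide_eq)
  then have "norm (t *R w) < ro" using t by (simp add: algebra_simps)
  from key[OF this d(2)] t obtain g' where g': "g' : g ` \<P>" "ALL l:{0..1}. h (y + l *R t *R w) = h y + l * (g' \<bullet> t *R w)" by auto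
  have "has_dir h y (t *R w) (g' \<bullet> t *R w)" unfolding has_dir_iff using g'(2) by (intro exI[of _ 1]) auto
  from has_dir_scale[OF this, of "1 / t"] t have "has_dir h y w (g' \<bullet> w)" by simp
  then show ?thesis using g'(1) by blast
 qed
 then show "EX Ga. finite Ga & (ALL g:Ga. ALL b:Basis. g \<bullet> b : \<int>) & (ALL w:tangent A y. EX g:Ga. has_dir h y w (g \<bullet> w))"
  using N(3) cg by (intro exI[of _ "g ` \<P>"]) auto
qed

definition conic_near :: "'a::real_normed_vector set => ('a => real) => 'a => bool" where
 "conic_near A h y <-> (\<forall>\<^sub>F z in nhds y. z : A --> conic_at A h z)"

lemma conic_near_at: "conic_near A h y ==> y : A ==> conic_at A h y"
 unfolding conic_near_def using eventually_nhds_x_imp_x by blast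

lemma conic_near_linear:
 "conic_near A h y ==> conic_near A k y ==> conic_near A (%x. a * h x + b * k x) y"
 unfolding conic_near_def by (drule (1) eventually_conj, erule eventually_mono) (auto intro: conic_at_linear)

lemma dirder_linear:
 assumes A: "convex A" "y : A" and h: "conic_at A h y" "conic_at A k y" and v: "v : tangent A y"
 shows "dirder (%x. a * h x + b * k x) y v = a * dirder h y v + b * dirder k y v"
 by (rule has_dir_dirder[OF has_dir_linear[OF conic_has_dir[OF A h(1) v] conic_has_dir[OF A h(2) v]]])

lemma tangent_between:
 assumes A: "convex A" "y : A" and r: "r : tangent A y" and w: "et > 0" "r + et *R w : tangent A y"
  and t: "0 <= t" "t <= et"
 shows "r + t *R w : tangent A y"
proof -
 have "(1 - t / et) *R r + (t / et) *R (r + et *R w) : tangent A y"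
  using w t by (intro convex_tangent[OF A r w(2)]) auto
 moreover have "(1 - t / et) *R r + (t / et) *R (r + et *R w) = r + t *R w" using w(1) by (simp add: algebra_simps)
 ultimately show ?thesis by simp
qed

lemma dirder_dirder_linear:
 assumes A: "convex A" "y : A" and h: "conic_near A h y" "conic_near A k y"
  and r: "r : tangent A y" and w: "et > 0" "r + et *R w : tangent A y"
 shows "dirder (dirder (%x. a * h x + b * k x) y) r w
  = a * dirder (dirder h y) r w + b * dirder (dirder k y) r w"
proof (rule has_dir_dirder, rule has_dir_cong)
 show "has_dir (%v. a * dirder h y v + b * dirder k y v) r w
   (a * dirder (dirder h y) r w + b * dirder (dirder k y) r w)"
  by (intro has_dir_linear dirder_dirder(2)[OF A _ r w] h[unfolded conic_near_def])
 have eq: "dirder (%x. a * h x + b * k x) y v = a * dirder h y v + b * dirder k y v" if "v : tangent A y" for v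
  by (rule dirder_linear[OF A conic_near_at[OF h(1) A(2)] conic_near_at[OF h(2) A(2)] that])
 show "dirder (%x. a * h x + b * k x) y r = a * dirder h y r + b * dirder k y r" by (rule eq[OF r])
 show "\<forall>\<^sub>F t in at_right 0. dirder (%x. a * h x + b * k x) y (r + t *R w)
   = a * dirder h y (r + t *R w) + b * dirder k y (r + t *R w)"
  unfolding at_right_0_iff using w(1) tangent_between[OF A r w] eq by (intro exI[of _ et]) auto
qed

lemma has_dir_homogeneous:
 assumes hom: "!!l v. l > 0 ==> v : K ==> H (l *R v) = l * H v"
  and K: "u : K" "et > 0" "!!t. 0 <= t ==> t <= et ==> u + t *R w : K"
  and s: "has_dir H u w s" and ac: "a > 0" "c > 0"
 shows "has_dir H (a *R u) (mm *R u + c *R w) (mm * H u + c * s)"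
proof -
 obtain b where b: "b > 0" "!!t. 0 < t ==> t < b ==> H (u + t *R w) = H u + t * s"
  using s unfolding has_dir_iff by blast
 have lim: "((%t. t * c / (a + t * mm)) \<longlongrightarrow> 0) (at_right 0)"
  using ac by (auto intro!: tendsto_eq_intros)
 have "min b et > 0" using b(1) K(2) by simp
 from order_tendstoD(2)[OF lim this] have e1: "\<forall>\<^sub>F t in at_right 0. t * c / (a + t * mm) < min b et" .
 have e2: "\<forall>\<^sub>F t in at_right 0. a + t * mm > 0"
  by (rule order_tendstoD(1)[where y = a]) (auto intro!: tendsto_eq_intros ac)
 show ?thesis unfolding has_dir_def
  using e1 e2 eventually_at_right_less[of 0]
 proof eventually_elim
  case (elim t)
  define l where "l = a + t * mm"
  define t' where "t' = t * c / l"
  have l: "l > 0" and t': "0 < t'" "t' < b" "t' < et" using elim ac by (auto simp: l_def t'_def)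
  have lt: "l * t' = t * c" using l by (simp add: t'_def)
  have "a *R u + t *R (mm *R u + c *R w) = l *R (u + t' *R w)"
   unfolding scaleR_add_right[of l] scaleR_scaleR[of l t'] lt by (simp add: l_def algebra_simps)
  then have "H (a *R u + t *R (mm *R u + c *R w)) = l * (H u + t' * s)"
   using hom[OF l K(3)[of t']] b(2)[of t'] t' by simp
  also have "... = l * H u + (l * t') * s" by (simp add: algebra_simps)
  also have "... = a * H u + t * (mm * H u + c * s)" unfolding lt by (simp add: l_def algebra_simps)
  finally show ?case using hom[OF ac(1) K(1)] by simp
 qed
qed

subsection \<open>Lattice vectors\<close>

definition det2 :: "real \<times> real => real \<times> real => real" where
 "det2 u w = fst u * snd w - snd u * fst w"

definition int_vec :: "(real \<times> real) set" where
 "int_vec = {u. EX m n::int. u = (of_int m, of_int n)}"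

definition primitive :: "(real \<times> real) set" where
 "primitive = {u. EX m n::int. coprime m n & u = (of_int m, of_int n)}"

lemma primitive_nonzero: "u : primitive ==> u ~= 0"
 by (auto simp: primitive_def zero_prod_def)

lemma primitive_lattice: "u : primitive ==> u : int_vec"
 by (auto simp: primitive_def int_vec_def)

lemma primitive_uminus: "u : primitive ==> - u : primitive"
proof -
 assume "u : primitive"
 then obtain m n :: int where "coprime m n" "u = (of_int m, of_int n)" by (auto simp: primitive_def)
 then have "coprime (- m) (- n)" "- u = (of_int (- m), of_int (- n))" by auto
 then show ?thesis unfolding primitive_def by blast
qed

lemma primitive_complement:
 assumes "u : primitive"
 obtains w where "w : int_vec" "det2 u w = 1"
proof -
 obtain m n :: int where mn: "coprime m n" "u = (of_int m, of_int n)" using assms by (auto simp: primitive_def)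
 obtain x y where "x * m + y * n = 1" using bezout_int[of m n] mn(1) by (auto simp: coprime_iff_gcd_eq_1)
 then have "real_of_int (x * m + y * n) = 1" by simp
 then have "det2 u (of_int (- y), of_int x) = 1" by (simp add: det2_def mn(2) algebra_simps)
 moreover have "(of_int (- y), of_int x) : int_vec" unfolding int_vec_def by blast
 ultimately show ?thesis using that by blast
qed

lemma lattice_primitive_multiple:
 assumes "u : int_vec" "u ~= 0"
 obtains c where "c > 0" "c *R u : primitive"
proof -
 obtain m n :: int where u: "u = (of_int m, of_int n)" using assms(1) by (auto simp: int_vec_def)
 define g where "g = gcd m n"
 have "m ~= 0 \<or> n ~= 0" using assms(2) u by (auto simp: zero_prod_def)
 then have g: "g > 0" by (auto simp: g_def)
 have cop: "coprime (m div g) (n div g)" unfolding g_def by (rule div_gcd_coprime) (use \<open>m ~= 0 \<or> n ~= 0\<close> in auto)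
 have "real_of_int (m div g) = of_int m / of_int g" "real_of_int (n div g) = of_int n / of_int g"
  by (auto simp: g_def real_of_int_div)
 then have "(1 / of_int g) *R u = (of_int (m div g), of_int (n div g))" by (simp add: u)
 then have "(1 / of_int g) *R u : primitive" using cop by (auto simp: primitive_def)
 then show ?thesis using that[of "1 / of_int g"] g by auto
qed

lemma primitive_multiple:
 assumes "u : primitive" "c *R u : primitive" "c > 0"
 shows "c = 1"
proof -
 obtain w where w: "w : int_vec" "det2 u w = 1" by (rule primitive_complement[OF assms(1)])
 obtain w' where w': "w' : int_vec" "det2 (c *R u) w' = 1" by (rule primitive_complement[OF assms(2)])
 have int: "EX k::int. det2 a b = of_int k" if ab: "a : int_vec" "b : int_vec" for a b
 proof -
  obtain m n :: int where a: "a = (of_int m, of_int n)" using ab(1) unfolding int_vec_def by blast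
  obtain m' n' :: int where b: "b = (of_int m', of_int n')" using ab(2) unfolding int_vec_def by blast
  have "det2 a b = of_int (m * n' - n * m')" unfolding a b by (simp add: det2_def)
  then show ?thesis by blast
 qed
 have hom: "det2 (c *R u) v = c * det2 u v" for v by (simp add: det2_def algebra_simps)
 obtain k :: int where k: "det2 (c *R u) w = of_int k" using int primitive_lattice[OF assms(2)] w(1) by blast
 obtain k' :: int where k': "det2 u w' = of_int k'" using int primitive_lattice[OF assms(1)] w'(1) by blast
 have c: "c = of_int k" using k w(2) hom by simp
 moreover have "c * of_int k' = 1" using w'(2) k' hom by simp
 ultimately have "of_int (k * k') = (1::real)" by simp
 then have "k * k' = 1" by linarith
 moreover have "k > 0" using c assms(3) by simp
 ultimately have "k = 1" by (simp add: zmult_eq_1_iff)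
 then show ?thesis using c by simp
qed

lemma parallel_primitive:
 assumes u: "u : primitive" and w: "w : primitive" "w = mm *R u"
 shows "w = u \<or> w = - u"
proof -
 have "mm ~= 0" using primitive_nonzero[OF w(1)] w(2) by auto
 then consider "mm > 0" | "- mm > 0" by linarith
 then show ?thesis
 proof cases
  case 1
  then have "mm = 1" using primitive_multiple[OF u] w by blast
  then show ?thesis using w(2) by simp
 next
  case 2
  have "(- mm) *R (- u) : primitive" using w by simp
  then have "- mm = 1" using primitive_multiple[OF primitive_uminus[OF u]] 2 by blast
  then have "mm = - 1" by simp
  then show ?thesis using w(2) by simp
 qed
qed

lemma det2_zero_parallel:
 assumes "det2 u x = 0" "u ~= 0"
 shows "EX mm. x = mm *R u"
proof (cases "fst u = 0")
 case True
 then have "snd u ~= 0" using assms(2) by (simp add: prod_eq_iff)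
 then have "x = (snd x / snd u) *R u" using assms(1) True by (simp add: det2_def prod_eq_iff)
 then show ?thesis by blast
next
 case False
 then have "x = (fst x / fst u) *R u" using assms(1) by (simp add: det2_def prod_eq_iff field_simps)
 then show ?thesis by blast
qed

subsection \<open>Kinks have rational slope\<close>

lemma two_points_affine:
 fixes de :: real
 assumes "finite Ga" "de > 0" "!!t. 0 < t ==> t < de ==> EX g:Ga. k + t * s = F g + t * G g"
 shows "EX g:Ga. k = F g & s = (G g :: real)"
proof -
 obtain gx where gx: "!!t. 0 < t ==> t < de ==> gx t : Ga & k + t * s = F (gx t) + t * G (gx t)"
  using assms(3) by metis
 have "infinite {0<..<de}" using assms(2) by (simp add: infinite_Ioo)
 moreover have "finite (gx ` {0<..<de})" by (rule finite_subset[OF _ assms(1)]) (use gx in auto)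
 ultimately obtain t0 where t0: "t0 : {0<..<de}" "infinite {t : {0<..<de}. gx t = gx t0}"
  using pigeonhole_infinite[of "{0<..<de}" gx] by blast
 have "~ {t : {0<..<de}. gx t = gx t0} <= {t0}" using t0(2) finite_subset by blast
 then obtain t1 where t1: "0 < t1" "t1 < de" "gx t1 = gx t0" "t1 ~= t0" by auto
 have e: "k + t0 * s = F (gx t0) + t0 * G (gx t0)" "k + t1 * s = F (gx t0) + t1 * G (gx t0)" "gx t0 : Ga"
  using gx[of t0] gx[of t1] t0(1) t1 by auto
 have "(t1 - t0) * (s - G (gx t0)) = 0" using e by (simp add: algebra_simps)
 then have "s = G (gx t0)" using t1(4) by simp
 then show ?thesis using e by auto
qed

lemma kink_rational:
 assumes A: "convex A" "y : A" and pl: "integral_PL_at A h y"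
  and cone: "!!a b. 0 <= a ==> 0 <= b ==> a *R q + b *R q' : tangent A y"
  and lat: "det2 q q' ~= 0" and s: "0 < s" "s < 1"
  and R: "has_dir (%s. dirder h y ((1 - s) *R q + s *R q')) s 1 kp"
  and L: "has_dir (%s. dirder h y ((1 - s) *R q + s *R q')) s (-1) km" and k: "kp + km ~= 0"
 obtains n where "n > 0" "n *R ((1 - s) *R q + s *R q') : primitive"
proof -
 define v where "v s = (1 - s) *R q + s *R q'" for s :: real
 obtain Ga where Ga: "finite Ga" "ALL g:Ga. ALL b:Basis. g \<bullet> b : \<int>" "ALL w:tangent A y. EX g:Ga. has_dir h y w (g \<bullet> w)"
  using integral_PL_conic(2)[OF A pl] by blast
 have g: "EX g:Ga. dirder h y (v s) = g \<bullet> v s" if "0 <= s" "s <= 1" for s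
  using Ga(3) cone[of "1 - s" s] that has_dir_dirder unfolding v_def by fastforce
 have vt: "v (s + t) = v s + t *R (q' - q)" for t by (simp add: v_def algebra_simps)
 obtain d where d: "d > 0" "!!t. 0 < t ==> t < d ==> dirder h y (v (s + t)) = dirder h y (v s) + t * kp"
  using R unfolding has_dir_iff v_def by auto
 have "EX g:Ga. dirder h y (v s) = g \<bullet> v s & kp = g \<bullet> (q' - q)"
 proof (rule two_points_affine[OF Ga(1)])
  show "min d (1 - s) > 0" using d(1) s by simp
  show "EX g:Ga. dirder h y (v s) + t * kp = g \<bullet> v s + t * (g \<bullet> (q' - q))" if "0 < t" "t < min d (1 - s)" for t
   using g[of "s + t"] d(2)[of t] that s unfolding vt by (auto simp: inner_add_right)
 qed
 then obtain g1 where g1: "g1 : Ga" "dirder h y (v s) = g1 \<bullet> v s" "kp = g1 \<bullet> (q' - q)" by blast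
 obtain d' where d': "d' > 0" "!!t. 0 < t ==> t < d' ==> dirder h y (v (s + (- t))) = dirder h y (v s) + t * km"
  using L unfolding has_dir_iff v_def by auto
 have "EX g:Ga. dirder h y (v s) = g \<bullet> v s & km = g \<bullet> (q - q')"
 proof (rule two_points_affine[OF Ga(1)])
  show "min d' s > 0" using d'(1) s by simp
  show "EX g:Ga. dirder h y (v s) + t * km = g \<bullet> v s + t * (g \<bullet> (q - q'))" if "0 < t" "t < min d' s" for t
   using g[of "s + (- t)"] d'(2)[of t] that s unfolding vt
   by (auto simp: inner_add_right inner_diff_right algebra_simps)
 qed
 then obtain g2 where g2: "g2 : Ga" "dirder h y (v s) = g2 \<bullet> v s" "km = g2 \<bullet> (q - q')" by blast
 define u where "u = g1 - g2"
 have ne: "u \<bullet> (q' - q) ~= 0" using k g1(3) g2(3) by (simp add: u_def inner_diff_left inner_diff_right)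
 have ort: "u \<bullet> v s = 0" using g1(2) g2(2) by (simp add: u_def inner_diff_left)
 have ui: "fst u : \<int>" "snd u : \<int>"
 proof -
  have B: "(1, 0) : (Basis :: (real \<times> real) set)" "(0, 1) : (Basis :: (real \<times> real) set)" by (auto simp: Basis_prod_def)
  have c: "a \<bullet> (1, 0) = fst a" "a \<bullet> (0, 1) = snd a" for a :: "real \<times> real" by (cases a; simp)+
  have "g1 \<bullet> (1, 0) : \<int>" "g2 \<bullet> (1, 0) : \<int>" "g1 \<bullet> (0, 1) : \<int>" "g2 \<bullet> (0, 1) : \<int>"
   using Ga(2) g1(1) g2(1) B by blast+
  then show "fst u : \<int>" "snd u : \<int>" unfolding c by (auto simp: u_def)
 qed
 define J :: "real \<times> real" where "J = (- snd u, fst u)"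
 have Jl: "J : int_vec" "- J : int_vec"
 proof -
  obtain m n :: int where "fst u = of_int m" "snd u = of_int n" using ui by (auto elim!: Ints_cases)
  then have "J = (of_int (- n), of_int m)" "- J = (of_int n, of_int (- m))" by (auto simp: J_def)
  then show "J : int_vec" "- J : int_vec" unfolding int_vec_def by blast+
 qed
 have v0: "v s ~= 0"
 proof
  assume "v s = 0"
  then have "det2 (v s) (q' - q) = 0" by (simp add: det2_def)
  moreover have "det2 (v s) (q' - q) = det2 q q'" by (simp add: v_def det2_def algebra_simps)
  ultimately show False using lat by simp
 qed
 have "u ~= 0" using ne by auto
 then have J0: "J ~= 0" by (cases u) (auto simp: J_def zero_prod_def)
 have "det2 (v s) J = 0" using ort by (cases u; cases "v s") (simp add: det2_def J_def algebra_simps)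
 then obtain mm where mm: "J = mm *R v s" using det2_zero_parallel v0 by blast
 have "mm ~= 0" using J0 mm by auto
 define J' where "J' = (if mm > 0 then J else - J)"
 have J': "J' : int_vec" "J' ~= 0" "J' = \<bar>mm\<bar> *R v s" using Jl J0 mm by (auto simp: J'_def)
 obtain c where c: "c > 0" "c *R J' : primitive" by (rule lattice_primitive_multiple[OF J'(1,2)])
 show ?thesis
  by (rule that[of "c * \<bar>mm\<bar>"]) (use c J'(3) \<open>mm ~= 0\<close> in \<open>auto simp: v_def\<close>)
qed

definition in_germ :: "'a::real_normed_vector set => 'a => 'a => bool" where
 "in_germ C y u <-> y : C & u : tangent C y"

lemma eventually_in_germ:
 assumes C: "closed C" "convex C"
 shows "\<forall>\<^sub>F ep in at_right 0. y + ep *R u : C <-> in_germ C y u"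
proof (cases "in_germ C y u")
 case True
 then obtain de where "de > 0" "!!t. 0 <= t ==> t <= de ==> y + t *R u : C"
  using tangentD[OF C(2)] unfolding in_germ_def by blast
 then show ?thesis using True unfolding at_right_0_iff by (intro exI[of _ de]) auto
next
 case False
 show ?thesis
 proof (cases "y : C")
  case True
  then have "y + ep *R u ~: C" if "ep > 0" for ep
   using False that by (auto simp: in_germ_def tangent_def)
  then show ?thesis using False unfolding at_right_0_iff by (intro exI[of _ 1]) auto
 next
  case out: False
  have "((%ep. y + ep *R u) \<longlongrightarrow> y) (at_right 0)" by (auto intro!: tendsto_eq_intros)
  moreover have "\<forall>\<^sub>F z in nhds y. z ~: C"
   unfolding eventually_nhds using C(1) out by (intro exI[of _ "- C"]) (auto simp: open_Compl)
  ultimately have "\<forall>\<^sub>F ep in at_right 0. y + ep *R u ~: C" by (rule nhds_compose)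
  then show ?thesis by (rule eventually_mono) (use False in simp)
 qed
qed

lemma eventually_notin_finite:
 fixes y u :: "'a::real_normed_vector"
 assumes "finite E" "u ~= 0"
 shows "\<forall>\<^sub>F ep in at_right 0. y + ep *R u ~: E"
proof -
 have "\<forall>\<^sub>F ep in at_right 0. y + ep *R u ~= x" for x
 proof (cases "EX ep0. x = y + ep0 *R u")
  case True
  then obtain ep0 where x: "x = y + ep0 *R u" by blast
  have "\<forall>\<^sub>F ep in at_right 0. ep ~= ep0" by (rule eventually_neq_at_within)
  then show ?thesis by eventually_elim (use assms(2) x in auto)
 next
  case False
  then show ?thesis by (intro always_eventually) metis
 qed
 then have "\<forall>\<^sub>F ep in at_right 0. ALL x:E. y + ep *R u ~= x" using assms(1) by (simp add: eventually_ball_finite)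
 then show ?thesis by eventually_elim blast
qed

subsection \<open>Weights along rays\<close>

definition bary :: "nat => real \<times> real => real" where
 "bary i z = (if i = 0 then 1 - fst z - snd z else if i = 1 then fst z else snd z)"

definition side_seg :: "real \<times> real => real \<times> real => bool" where
 "side_seg a b <-> (EX i<3. bary i a = 0 & bary i b = 0)"

definition int_tri :: "real \<times> real => bool" where
 "int_tri z <-> 0 < fst z & 0 < snd z & fst z + snd z < 1"

fun tri_seg :: "('e, 'f) segment => 'f => (real \<times> real) set" where
 "tri_seg (ESegment e a b) f = {}"
| "tri_seg (TSegment f' a b) f = (if f' = f & ~ side_seg a b then closed_segment a b else {})"

text \<open>Parametrized segments in a side of a triangle count as parts of the edge.\<close>

fun edge_seg :: "('v, 'e, 'f) surface_data => ('e, 'f) segment => 'e => real set" where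
 "edge_seg S (ESegment e' a b) e = (if e' = e then closed_segment a b else {})"
| "edge_seg S (TSegment f a b) e =
   {t. EX i<3. face S f i = e & bary i a = 0 & bary i b = 0 & spt i t : closed_segment a b}"

definition tri_weight :: "('e, 'f) segment_sum => 'f => real \<times> real => real \<times> real => real" where
 "tri_weight D f y u = (SUM sg | sg : keys D & in_germ (tri_seg sg f) y u. lookup D sg)"

definition edge_weight ::
  "('v, 'e, 'f) surface_data => ('e, 'f) segment_sum => 'e => real => real => real" where
 "edge_weight S D e t de =
   (SUM sg | sg : keys D & in_germ (edge_seg S sg e) t de. lookup D sg)"

lemma bary_affine: "bary i ((1 - ta) *R a + ta *R b) = (1 - ta) * bary i a + ta * bary i b"
 by (simp add: bary_def algebra_simps)

lemma bary_std: "z : std ==> bary i z >= 0"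
 by (auto simp: bary_def mem_std)

lemma int_tri_bary: "int_tri z <-> (ALL i<3. bary i z > 0)"
proof -
 have "(ALL i<3. bary i z > 0) <-> bary 0 z > 0 & bary 1 z > 0 & bary 2 z > 0"
  by (auto elim: less_3_cases)
 then show ?thesis by (auto simp: int_tri_def bary_def)
qed

lemma int_tri_std: "int_tri z ==> z : std"
 by (auto simp: int_tri_def mem_std)

lemma bary_side: "i < 3 ==> bary i z = 0 <-> (EX t. z = spt i t)"
 by (erule less_3_cases; cases z) (auto simp: bary_def side_simps)

lemma bary_zero_unique:
 assumes "i < 3" "j < 3" "bary i a = 0" "bary i b = 0" "bary j a = 0" "bary j b = 0" "a ~= b"
 shows "i = j"
 using assms by (elim less_3_cases; cases a; cases b) (auto simp: bary_def)

lemma side_point_inj: "i < 3 ==> spt i s = spt i t <-> s = t"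
 by (erule less_3_cases) (auto simp: side_simps)

lemma side_point_affine: "spt i ((1 - ta) * s + ta * t) = (1 - ta) *R spt i s + ta *R spt i t"
 by (simp add: side_point_def algebra_simps)

lemma side_point_std_iff: "i < 3 ==> spt i t : std <-> t : {0..1}"
 by (erule less_3_cases) (auto simp: side_simps mem_std)

lemma segment_image: "closed_segment a b = (%ta. (1 - ta) *R a + ta *R b) ` {0..1::real}"
 by (auto simp: closed_segment_def)

lemma path_TSegment: "segment_path S (TSegment f a b) ` {0..1} = tri_map S f ` closed_segment a b"
 by (simp add: segment_image image_image)

lemma segment_std: "a : std ==> b : std ==> closed_segment a b <= std"
 using convex_std by (simp add: closed_segment_subset)

lemma bary_segment_zero:
 assumes "bary i ((1 - ta) *R a + ta *R b) = 0" "bary i ((1 - ta') *R a + ta' *R b) = 0" "ta ~= ta'"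
 shows "bary i a = 0 & bary i b = 0"
proof -
 have e: "(1 - ta) * bary i a + ta * bary i b = 0" "(1 - ta') * bary i a + ta' * bary i b = 0"
  using assms by (simp_all add: bary_affine)
 then have "(ta - ta') * (bary i b - bary i a) = 0" by (simp add: algebra_simps)
 then have "bary i b = bary i a" using assms(3) by simp
 then show ?thesis using e by (simp add: algebra_simps)
qed

lemma tri_seg_closed_convex: "closed (tri_seg sg f)" "convex (tri_seg sg f)"
 by (cases sg; simp)+

lemma edge_seg_TSegment:
 assumes "i < 3" "a = spt i a'" "b = spt i b'" "a ~= b"
 shows "edge_seg S (TSegment f a b) e = (if face S f i = e then closed_segment a' b' else {})"
proof -
 have z: "bary i a = 0" "bary i b = 0" using assms bary_side by blast+
 have u: "j = i" if "j < 3" "bary j a = 0" "bary j b = 0" for j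
  using bary_zero_unique[OF that(1) assms(1) that(2,3) z assms(4)] .
 have m: "spt i t : closed_segment a b <-> t : closed_segment a' b'" for t
  unfolding segment_image assms(2,3) image_iff side_point_affine[symmetric] side_point_inj[OF assms(1)] by simp
 have "(EX j<3. face S f j = e & bary j a = 0 & bary j b = 0 & spt j t : closed_segment a b)
   <-> face S f i = e & t : closed_segment a' b'" for t
  using assms(1) z u m by blast
 then show ?thesis by simp
qed

lemma edge_seg_closed_convex:
 assumes "valid_segment S sg"
 shows "closed (edge_seg S sg e)" "convex (edge_seg S sg e)"
proof -
 have "closed (edge_seg S sg e) & convex (edge_seg S sg e)"
 proof (cases sg)
  case (TSegment f a b)
  show ?thesis
  proof (cases "side_seg a b")
   case True
   then obtain i where i: "i < 3" "bary i a = 0" "bary i b = 0" by (auto simp: side_seg_def)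
   obtain a' b' where ab: "a = spt i a'" "b = spt i b'" using i bary_side by blast
   have ne: "a ~= b" using assms TSegment by simp
   show ?thesis unfolding TSegment edge_seg_TSegment[OF i(1) ab ne] by simp
  next
   case False
   then have "edge_seg S (TSegment f a b) e = {}" by (auto simp: side_seg_def)
   then show ?thesis by (simp only: TSegment) simp
  qed
 qed simp
 then show "closed (edge_seg S sg e)" "convex (edge_seg S sg e)" by auto
qed

lemma eventually_sum_germ:
 assumes "finite K" "!!sg. sg : K ==> closed (C sg) & convex (C sg)"
 shows "\<forall>\<^sub>F ep in at_right 0. (SUM sg | sg : K & y + ep *R u : C sg. w sg) = (SUM sg | sg : K & in_germ (C sg) y u. w sg :: real)"
proof -
 have "ALL sg:K. \<forall>\<^sub>F ep in at_right 0. y + ep *R u : C sg <-> in_germ (C sg) y u"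
  using eventually_in_germ assms(2) by blast
 from eventually_ball_finite[OF assms(1) this] show ?thesis
 proof eventually_elim
  case (elim ep)
  then have "{sg. sg : K & y + ep *R u : C sg} = {sg. sg : K & in_germ (C sg) y u}" by blast
  then show ?case by simp
 qed
qed

context ct_surface
begin

lemma tri_map_TPoint:
 assumes "f : tris S" "z : std"
 shows "tri_map S f z = TPoint f' z' <-> f' = f & z' = z & int_tri z"
 by (rule tri_map_cases[OF assms]) (auto simp: int_tri_def)

lemma tri_map_EPoint:
 assumes f: "f : tris S" and z: "z : std"
 shows "tri_map S f z = EPoint e t <-> 0 < t & t < 1 & (EX i<3. face S f i = e & z = spt i t)"
proof
 assume "tri_map S f z = EPoint e t"
 then have "(0 < t & t < 1) & ((face S f 2 = e & z = spt 2 t) \<or> (face S f (Suc 0) = e & z = spt (Suc 0) t)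
   \<or> (face S f 0 = e & z = spt 0 t))"
  by (cases rule: tri_map_cases[OF f z]) (auto simp: side_simps)
 moreover have "(2::nat) < 3" "Suc 0 < 3" "(0::nat) < 3" by auto
 ultimately show "0 < t & t < 1 & (EX i<3. face S f i = e & z = spt i t)" by blast
next
 assume "0 < t & t < 1 & (EX i<3. face S f i = e & z = spt i t)"
 then show "tri_map S f z = EPoint e t" using tri_map_side[OF f] by (auto simp: edge_map_def)
qed

lemma weight_TPoint:
 assumes v: "!!sg. sg : keys D ==> valid_segment S sg" and z: "int_tri z"
 shows "weight S D (TPoint f z) = (SUM sg | sg : keys D & z : tri_seg sg f. lookup D sg)"
proof -
 have "TPoint f z : segment_path S sg ` {0..1} <-> z : tri_seg sg f" if "valid_segment S sg" for sg
 proof (cases sg)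
  case (ESegment e a b)
  then show ?thesis by (auto simp: edge_map_def)
 next
  case (TSegment f' a b)
  then have V: "f' : tris S" "a : std" "b : std" using that by auto
  have "TPoint f z : segment_path S sg ` {0..1} <-> (EX x:closed_segment a b. tri_map S f' x = TPoint f z)"
   unfolding TSegment path_TSegment by (simp add: image_iff eq_commute[of "TPoint f z"])
  also have "... <-> (EX x:closed_segment a b. f = f' & z = x & int_tri x)"
   by (rule bex_cong[OF refl tri_map_TPoint[OF V(1)]]) (use segment_std[OF V(2,3)] in blast)
  also have "... <-> f' = f & z : closed_segment a b" using z by metis
  also have "... <-> z : tri_seg sg f"
  proof -
   have "~ side_seg a b" if "z : closed_segment a b"
   proof
    assume "side_seg a b"
    then obtain i where "i < 3" "bary i a = 0" "bary i b = 0" by (auto simp: side_seg_def)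
    then show False using that z by (auto simp: segment_image bary_affine int_tri_bary)
   qed
   then show ?thesis by (auto simp: TSegment)
  qed
  finally show ?thesis .
 qed
 then have "{sg : keys D. TPoint f z : segment_path S sg ` {0..1}}
   = {sg. sg : keys D & z : tri_seg sg f}" using v by blast
 then show ?thesis by (simp add: weight_def)
qed

lemma eventually_weight_TPoint:
 assumes v: "!!sg. sg : keys D ==> valid_segment S sg"
  and int: "\<forall>\<^sub>F ep in at_right 0. int_tri (y + ep *R u)"
 shows "\<forall>\<^sub>F ep in at_right 0. weight S D (TPoint f (y + ep *R u)) = tri_weight D f y u"
proof -
 have "\<forall>\<^sub>F ep in at_right 0. (SUM sg | sg : keys D & y + ep *R u : tri_seg sg f. lookup D sg) = tri_weight D f y u"
  unfolding tri_weight_def by (rule eventually_sum_germ) (auto simp: tri_seg_closed_convex)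
 then show ?thesis using int by eventually_elim (simp add: weight_TPoint[OF v])
qed

lemma eventually_weight_EPoint:
 assumes v: "!!sg. sg : keys D ==> valid_segment S sg"
  and int: "\<forall>\<^sub>F ep in at_right 0. 0 < t + ep * de & t + ep * de < 1" and de: "de ~= 0"
 shows "\<forall>\<^sub>F ep in at_right 0. weight S D (EPoint e (t + ep * de)) = edge_weight S D e t de"
proof -
 define X where "X = (\<Union>sg\<in>keys D. case sg of ESegment _ _ _ => {}
  | TSegment f a b => if side_seg a b then {} else {s. EX i<3. spt i s : closed_segment a b})"
 have "finite {s. EX i<3. spt i s : closed_segment a b}" if ns: "~ side_seg a b" for a b
 proof -
  have "EX s0. {s. spt i s : closed_segment a b} <= {s0}" if i: "i < 3" for i
  proof -
   have "s = s'" if s: "spt i s : closed_segment a b" "spt i s' : closed_segment a b" for s s'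
   proof (rule ccontr)
    assume "s ~= s'"
    obtain ta where 1: "spt i s = (1 - ta) *R a + ta *R b" using s(1) by (auto simp: segment_image)
    obtain ta' where 2: "spt i s' = (1 - ta') *R a + ta' *R b" using s(2) by (auto simp: segment_image)
    have "ta ~= ta'" using 1 2 \<open>s ~= s'\<close> side_point_inj[OF i] by metis
    moreover have "bary i (spt i s) = 0" "bary i (spt i s') = 0" using bary_side[OF i] by blast+
    ultimately have "bary i a = 0 & bary i b = 0" unfolding 1 2 by (rule bary_segment_zero[rotated 2])
    then show False using ns i by (auto simp: side_seg_def)
   qed
   then show ?thesis by blast
  qed
  then have "finite (\<Union>i\<in>{..<3}. {s. spt i s : closed_segment a b})"
   by (intro finite_UN_I) (auto intro: finite_subset)
  moreover have "{s. EX i<3. spt i s : closed_segment a b} = (\<Union>i\<in>{..<3}. {s. spt i s : closed_segment a b})"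
   by auto
  ultimately show ?thesis by simp
 qed
 then have "finite X" unfolding X_def by (intro finite_UN_I) (auto split: segment.split)
 then have notX: "\<forall>\<^sub>F ep in at_right 0. t + ep *R de ~: X" using de by (rule eventually_notin_finite)
 have W: "weight S D (EPoint e s) = (SUM sg | sg : keys D & s : edge_seg S sg e. lookup D sg)"
  if s: "0 < s" "s < 1" "s ~: X" for s
 proof -
  have "EPoint e s : segment_path S sg ` {0..1} <-> s : edge_seg S sg e" if K: "sg : keys D" for sg
  proof (cases sg)
   case (ESegment e' a b)
   have "edge_map S e' x = EPoint e s <-> e' = e & x = s" for x
    using s by (auto simp: edge_map_def)
   moreover have "segment_path S sg ` {0..1} = edge_map S e' ` closed_segment a b"
    unfolding ESegment by (simp add: segment_image image_image)
   ultimately have "EPoint e s : segment_path S sg ` {0..1} <-> e' = e & s : closed_segment a b"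
    by (metis (no_types, lifting) image_iff)
   then show ?thesis unfolding ESegment by simp
  next
   case (TSegment f a b)
   then have V: "f : tris S" "a : std" "b : std" using v[OF K] by auto
   have "EPoint e s : segment_path S sg ` {0..1} <-> (EX x:closed_segment a b. tri_map S f x = EPoint e s)"
    unfolding TSegment path_TSegment by (simp add: image_iff eq_commute[of "EPoint e s"])
   also have "... <-> (EX x:closed_segment a b. 0 < s & s < 1 & (EX i<3. face S f i = e & x = spt i s))"
    by (rule bex_cong[OF refl tri_map_EPoint[OF V(1)]]) (use segment_std[OF V(2,3)] in blast)
   also have "... <-> (EX i<3. face S f i = e & spt i s : closed_segment a b)"
    using s(1,2) by metis
   also have "... <-> s : edge_seg S sg e"
   proof
    assume "EX i<3. face S f i = e & spt i s : closed_segment a b"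
    then obtain i where i: "i < 3" "face S f i = e" "spt i s : closed_segment a b" by blast
    have "side_seg a b"
    proof (rule ccontr)
     assume "~ side_seg a b"
     then have "s : X" unfolding X_def using K i by (intro UN_I[of sg]) (auto simp: TSegment)
     then show False using s(3) by simp
    qed
    then obtain j where j: "j < 3" "bary j a = 0" "bary j b = 0" by (auto simp: side_seg_def)
    obtain ta where ta: "spt i s = (1 - ta) *R a + ta *R b" using i(3) by (auto simp: segment_image)
    have "bary j (spt i s) = 0" using j unfolding ta by (simp add: bary_affine)
    then have "i = j" using i(1) j(1) s by (elim less_3_cases) (auto simp: bary_def side_simps)
    then show "s : edge_seg S sg e" using i j by (auto simp: TSegment)
   qed (auto simp: TSegment)
   finally show ?thesis .
  qed
  then have "{sg : keys D. EPoint e s : segment_path S sg ` {0..1}}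
    = {sg. sg : keys D & s : edge_seg S sg e}" by blast
  then show ?thesis by (simp add: weight_def)
 qed
 have "\<forall>\<^sub>F ep in at_right 0. (SUM sg | sg : keys D & t + ep *R de : edge_seg S sg e. lookup D sg)
   = edge_weight S D e t de"
  unfolding edge_weight_def by (rule eventually_sum_germ) (auto simp: edge_seg_closed_convex[OF v])
 then show ?thesis using int notX by eventually_elim (simp add: W)
qed

end

lemma open_interior_tri: "open {z. int_tri z}"
 unfolding int_tri_def by (intro open_Collect_conj open_Collect_less continuous_intros)

lemma int_tri_ball:
 assumes "int_tri z"
 obtains ro where "ro > 0" "!!v. norm v < ro ==> int_tri (z + v)"
proof -
 obtain ro where r: "ro > 0" "ball z ro <= {z. int_tri z}"
  using open_interior_tri assms open_contains_ball by blast
 have "int_tri (z + v)" if "norm v < ro" for v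
 proof -
  have "z + v : ball z ro" using that by (simp add: dist_norm)
  then show ?thesis using r(2) by blast
 qed
 then show ?thesis using r(1) that by blast
qed

lemma interior_ray:
 assumes y: "y : std" and r: "int_tri (y + de *R r)" and ep: "0 < ep" "ep <= de"
 shows "int_tri (y + ep *R r)"
proof -
 have de: "de > 0" using ep by linarith
 have eq: "y + ep *R r = (1 - ep / de) *R y + (ep / de) *R (y + de *R r)" using de by (simp add: algebra_simps)
 show ?thesis unfolding int_tri_bary
 proof (intro allI impI)
  fix i :: nat assume "i < 3"
  then have "bary i (y + de *R r) > 0" using r by (simp add: int_tri_bary)
  moreover have "bary i y >= 0" by (rule bary_std[OF y])
  moreover have "ep / de > 0" "1 - ep / de >= 0" using ep de by auto
  ultimately show "bary i (y + ep *R r) > 0" unfolding eq bary_affine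
   by (intro add_nonneg_pos mult_nonneg_nonneg mult_pos_pos)
 qed
qed

lemma interior_direction:
 assumes r: "int_tri (y + de *R r)" "de > 0"
 obtains et where "et > 0" "!!t. \<bar>t\<bar> <= et ==> r + t *R w : tangent std y"
proof -
 obtain ro where ro: "ro > 0" "!!v. norm v < ro ==> int_tri (y + de *R r + v)"
  by (rule int_tri_ball[OF r(1)]) blast
 define et where "et = ro / (de * (norm w + 1))"
 have n: "norm w + 1 > 0" by (simp add: add_nonneg_pos)
 then have et: "et > 0" using ro(1) r(2) by (simp add: et_def)
 have "et * (de * (norm w + 1)) = ro" using n r(2) by (simp add: et_def)
 then have e: "de * et * norm w + de * et = ro" by (simp add: algebra_simps)
 have "r + t *R w : tangent std y" if "\<bar>t\<bar> <= et" for t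
 proof -
  have "norm ((de * t) *R w) <= de * et * norm w" using that r(2) by (simp add: abs_mult mult_right_mono mult_left_mono)
  also have "... < ro" using e mult_pos_pos[OF r(2) et] by linarith
  finally have "int_tri (y + de *R r + (de * t) *R w)" by (rule ro(2))
  moreover have "y + de *R r + (de * t) *R w = y + de *R (r + t *R w)" by (simp add: algebra_simps)
  ultimately show ?thesis using r(2) int_tri_std unfolding tangent_def by fastforce
 qed
 then show ?thesis using et that by blast
qed

lemma interior_strip:
 assumes "int_tri z"
 shows "EX d>0. ALL x v. \<bar>x\<bar> < d --> 0 <= v --> v < d --> z + x *R r + v *R w : std"
proof -
 obtain ro where ro: "ro > 0" "!!v. norm v < ro ==> int_tri (z + v)" by (rule int_tri_ball[OF assms]) blast
 define d where "d = ro / (norm r + norm w + 1)"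
 have n: "norm r + norm w + 1 > 0" by (simp add: add_nonneg_pos)
 then have d: "d > 0" "d * (norm r + norm w + 1) = ro" using ro(1) by (auto simp: d_def)
 have "z + x *R r + v *R w : std" if xv: "\<bar>x\<bar> < d" "0 <= v" "v < d" for x v
 proof -
  have "norm (x *R r + v *R w) <= \<bar>x\<bar> * norm r + v * norm w" using norm_triangle_ineq[of "x *R r" "v *R w"] xv by simp
  also have "... <= d * norm r + d * norm w" using xv by (intro add_mono mult_right_mono) auto
  also have "... < ro" using d by (simp add: algebra_simps)
  finally have "int_tri (z + (x *R r + v *R w))" by (rule ro(2))
  then show ?thesis using int_tri_std by (simp add: add.assoc)
 qed
 then show ?thesis using d(1) by blast
qed

definition tri_cone :: "real \<times> real => real \<times> real => real \<times> real => bool" where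
 "tri_cone y q q' <-> q : int_vec & q' : int_vec & \<bar>det2 q q'\<bar> = 1 &
   q : tangent std y & q' : tangent std y &
   (ALL a>0. ALL b>0. EX de>0. int_tri (y + de *R (a *R q + b *R q')))"

definition chart_equation where
 "chart_equation S D f ph q E z <-> z : std --> integral_PL_at std (%x. ph (tri_map S f x)) z &
   (tri_map S f z ~: E --> (ALL m. div_mult S ph (tri_map S f z) m --> weight S D (tri_map S f z) = q * m))"

context ct_surface
begin

lemma local_equation_chart:
 assumes le: "local_equation S D (tri_map S f y) ps" and f: "f : tris S" "y : std"
 obtains ph q E where "ps = (%x. q * ph x)" "finite E"
  "\<forall>\<^sub>F z in nhds y. chart_equation S D f ph q E z"
proof -
 obtain U ph q E where U: "openin (realization S) U" "tri_map S f y : U" "PL_on S U ph" "ps = (%x. q * ph x)" "finite E"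
  "ALL x:U - E. ALL m. div_mult S ph x m --> weight S D x = q * m"
  using le unfolding local_equation_def by blast
 show ?thesis
 proof (rule that[OF U(4,5)])
  show "\<forall>\<^sub>F z in nhds y. chart_equation S D f ph q E z"
   using eventually_chart[OF U(1) f U(2)]
  proof eventually_elim
   case (elim z)
   show ?case unfolding chart_equation_def
   proof (intro impI conjI)
    assume z: "z : std"
    with elim have zU: "tri_map S f z : U" by blast
    then show "integral_PL_at std (%x. ph (tri_map S f x)) z" using U(3) f(1) z unfolding PL_on_def by blast
    show "ALL m. div_mult S ph (tri_map S f z) m --> weight S D (tri_map S f z) = q * m" if "tri_map S f z ~: E"
     using zU that U(6) by blast
   qed
  qed
 qed
qed

lemma local_equation_nearby:
 assumes le: "local_equation S D (tri_map S f y) ps" and f: "f : tris S" "y : std"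
 shows "\<forall>\<^sub>F z in nhds y. z : std --> local_equation S D (tri_map S f z) ps"
proof -
 obtain U ph q E where U: "openin (realization S) U" "tri_map S f y : U" "PL_on S U ph" "q : \<rat>" "ps = (%x. q * ph x)" "finite E"
  "ALL x:U - E. ALL m. div_mult S ph x m --> weight S D x = q * m"
  using le unfolding local_equation_def by blast
 show ?thesis using eventually_chart[OF U(1) f U(2)]
 proof eventually_elim
  case (elim z)
  then show ?case using U unfolding local_equation_def by blast
 qed
qed

lemma local_equation_conic:
 assumes le: "local_equation S D (tri_map S f y) ps" and f: "f : tris S" "y : std"
 shows "conic_near std (%z. ps (tri_map S f z)) y"
proof -
 obtain ph q E where c: "ps = (%x. q * ph x)" "finite E"
  "\<forall>\<^sub>F z in nhds y. chart_equation S D f ph q E z"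
  by (rule local_equation_chart[OF assms]) blast
 have "conic_near std (%x. ph (tri_map S f x)) y"
  unfolding conic_near_def using c(3)[unfolded chart_equation_def]
  by eventually_elim (use integral_PL_conic(1)[OF convex_std] in blast)
 from conic_near_linear[OF this this, of q 0] show ?thesis by (simp add: c(1))
qed

lemma bend_div_mult:
 assumes f: "f : tris S" "y : std" and c: "conic_near std (%x. ph (tri_map S f x)) y"
  and r: "r : primitive" and de: "de > 0" "int_tri (y + de *R r)" and w: "w : int_vec" "det2 r w = 1"
 defines "H \<equiv> dirder (%x. ph (tri_map S f x)) y"
 shows "\<forall>\<^sub>F ep in at_right 0. div_mult S ph (TPoint f (y + ep *R r)) (dirder H r w + dirder H r (- w))"
proof -
 have rt: "r : tangent std y" using de(1) int_tri_std[OF de(2)] unfolding tangent_def by blast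
 have HL: "\<forall>\<^sub>F ep in at_right 0. EX d>0. ALL x v. \<bar>x\<bar> < d --> 0 <= v --> v < d -->
  ph (tri_map S f (y + (ep + x) *R r + v *R w')) = ph (tri_map S f y) + (ep + x) * H r + v * dirder H r w'" for w'
 proof -
  obtain et where et: "et > 0" "!!t. \<bar>t\<bar> <= et ==> r + t *R w' : tangent std y"
   by (rule interior_direction[OF de(2,1)]) blast
  have "EX d>0. ALL x v. \<bar>x\<bar> < d --> 0 <= v --> v < d --> y + (ep + x) *R r + v *R w' : std"
   if "0 < ep" "ep < de" for ep
   using interior_strip[OF interior_ray[OF f(2) de(2) that(1)], of r w'] that by (simp add: scaleR_add_left add.assoc)
  from half_plane_affine[OF convex_std f(2) c[unfolded conic_near_def] rt et(1) et(2)[of et] this de(1)] et(1)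
  show ?thesis by (simp add: H_def)
 qed
 obtain m n :: int where mn: "r = (of_int m, of_int n)" using primitive_lattice[OF r] unfolding int_vec_def by blast
 obtain m' n' :: int where mn': "w = (of_int m', of_int n')" using w(1) unfolding int_vec_def by blast
 have "real_of_int (m * n' - n * m') = 1" using w(2) by (simp add: det2_def mn mn')
 then have det: "m * n' - n * m' = 1" by linarith
 show ?thesis using HL[of w] HL[of "- w"]
 proof eventually_elim
  case (elim ep)
  obtain d where d: "d > 0" "!!x v. \<bar>x\<bar> < d ==> 0 <= v ==> v < d ==>
   ph (tri_map S f (y + (ep + x) *R r + v *R w)) = ph (tri_map S f y) + (ep + x) * H r + v * dirder H r w"
   using elim(1) by blast
  obtain d' where d': "d' > 0" "!!x v. \<bar>x\<bar> < d' ==> 0 <= v ==> v < d' ==>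
   ph (tri_map S f (y + (ep + x) *R r + v *R (- w))) = ph (tri_map S f y) + (ep + x) * H r + v * dirder H r (- w)"
   using elim(2) by blast
  define e where "e = min d d'"
  have e: "e > 0" using d(1) d'(1) by (simp add: e_def)
  have ev: "\<forall>\<^sub>F (x, v) in nhds (0, 0). ph (tri_map S f (y + ep *R r + x *R r + v *R w))
   = (ph (tri_map S f y) + ep * H r) + H r * x + (if 0 <= v then dirder H r w * v else dirder H r (- w) * (- v))"
   unfolding eventually_nhds
  proof (intro exI[of _ "{- e<..<e} \<times> {- e<..<e}"] conjI ballI)
   show "open ({- e<..<e} \<times> {- e<..<e})" by (intro open_Times) auto
   show "(0, 0) : {- e<..<e} \<times> {- e<..<e}" using e by simp
   fix p assume p: "p : {- e<..<e} \<times> {- e<..<e}"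
   obtain x v where xv: "p = (x, v)" by fastforce
   have b: "\<bar>x\<bar> < d" "\<bar>x\<bar> < d'" "\<bar>v\<bar> < d" "\<bar>v\<bar> < d'" using p xv by (auto simp: e_def)
   have a: "y + ep *R r + x *R r = y + (ep + x) *R r" by (simp add: algebra_simps)
   have "v *R w = (- v) *R (- w)" by simp
   then show "case p of (x, v) => ph (tri_map S f (y + ep *R r + x *R r + v *R w))
    = (ph (tri_map S f y) + ep * H r) + H r * x + (if 0 <= v then dirder H r w * v else dirder H r (- w) * (- v))"
    using d(2)[of x v] d'(2)[of x "- v"] b unfolding xv a by (cases "0 <= v") (auto simp: algebra_simps)
  qed
  show ?case using det ev unfolding mn mn' by (simp only: div_mult.simps) blast
 qed
qed

lemma bend:
 assumes v: "ALL sg:keys D. valid_segment S sg"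
  and le: "local_equation S D (tri_map S f y) ps" and f: "f : tris S" "y : std"
  and r: "r : primitive" and de: "de > 0" "int_tri (y + de *R r)" and w: "w : int_vec" "det2 r w = 1"
 defines "H \<equiv> dirder (%x. ps (tri_map S f x)) y"
 shows "dirder H r w + dirder H r (- w) = tri_weight D f y r"
proof -
 obtain ph q E where c: "ps = (%x. q * ph x)" "finite E"
  "\<forall>\<^sub>F z in nhds y. chart_equation S D f ph q E z"
  by (rule local_equation_chart[OF le f]) blast
 have con: "conic_near std (%x. ph (tri_map S f x)) y"
  unfolding conic_near_def using c(3)[unfolded chart_equation_def]
  by eventually_elim (use integral_PL_conic(1)[OF convex_std] in blast)
 have int: "\<forall>\<^sub>F ep in at_right 0. int_tri (y + ep *R r)"
  unfolding at_right_0_iff using de interior_ray[OF f(2) de(2)] by (intro exI[of _ de]) auto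
 have lim: "((%ep. y + ep *R r) \<longlongrightarrow> y) (at_right 0)" by (auto intro!: tendsto_eq_intros)
 have wt: "\<forall>\<^sub>F ep in at_right 0. weight S D (TPoint f (y + ep *R r)) = tri_weight D f y r"
  by (rule eventually_weight_TPoint[OF _ int]) (use v in blast)
 have "finite {z. TPoint f z : E}" using finite_vimageI[OF c(2), of "TPoint f"] by (simp add: vimage_def inj_on_def)
 then have "\<forall>\<^sub>F ep in at_right 0. y + ep *R r ~: {z. TPoint f z : E}"
  by (rule eventually_notin_finite) (rule primitive_nonzero[OF r])
 then have "\<forall>\<^sub>F ep in at_right (0::real). tri_weight D f y r
   = q * (dirder (dirder (%x. ph (tri_map S f x)) y) r w + dirder (dirder (%x. ph (tri_map S f x)) y) r (- w))"
  using bend_div_mult[OF f con r de w] wt int nhds_compose[OF lim c(3)[unfolded chart_equation_def]]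
 proof eventually_elim
  case (elim ep)
  have z: "y + ep *R r : std" using elim(4) by (rule int_tri_std)
  have m: "tri_map S f (y + ep *R r) = TPoint f (y + ep *R r)" using tri_map_TPoint[OF f(1) z] elim(4) by blast
  show ?case using elim(1,2,3,5) z unfolding m by auto
 qed
 then have eq: "tri_weight D f y r
   = q * (dirder (dirder (%x. ph (tri_map S f x)) y) r w + dirder (dirder (%x. ph (tri_map S f x)) y) r (- w))"
  by simp
 have lin: "dirder H r w' = q * dirder (dirder (%x. ph (tri_map S f x)) y) r w'" for w'
 proof -
  obtain et where et: "et > 0" "!!t. \<bar>t\<bar> <= et ==> r + t *R w' : tangent std y"
   by (rule interior_direction[OF de(2,1)]) blast
  have "r : tangent std y" "r + et *R w' : tangent std y" using et(2)[of 0] et(2)[of et] et(1) by auto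
  from dirder_dirder_linear[OF convex_std f(2) con con this(1) et(1) this(2), of q 0]
  show ?thesis by (simp add: H_def c(1))
 qed
 show ?thesis unfolding lin eq by (simp add: algebra_simps)
qed

end

lemma det2_linear: "det2 u (a *R v + b *R w) = a * det2 u v + b * det2 u w"
 "det2 (a *R v + b *R w) u = a * det2 v u + b * det2 w u"
 by (simp_all add: det2_def algebra_simps)

lemma det2_self [simp]: "det2 u u = 0"
 by (simp add: det2_def)

lemma det2_commute: "det2 u w = - det2 w u"
 by (simp add: det2_def)

definition cpoint :: "real \<times> real => real \<times> real => real => real \<times> real" where
 "cpoint q q' s = (1 - s) *R q + s *R q'"

lemma cpoint_0 [simp]: "cpoint q q' 0 = q" and cpoint_1 [simp]: "cpoint q q' 1 = q'"
 by (simp_all add: cpoint_def)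

lemma cpoint_add: "cpoint q q' (s + t) = cpoint q q' s + t *R (q' - q)"
 by (simp add: cpoint_def algebra_simps)

lemma has_dir_cone_point:
 assumes "has_dir tslope (cpoint q q' s) (c *R (q' - q)) k"
 shows "has_dir (%s. tslope (cpoint q q' s)) s c k"
 by (rule has_dir_compose[where L = "cpoint q q'", OF _ assms]) (simp add: cpoint_add)

lemma cpoint_back: "cpoint q q' s + s *R (q - q') = q"
 by (simp add: cpoint_def algebra_simps)

definition open_cone :: "real \<times> real => real \<times> real => (real \<times> real) set" where
 "open_cone q q' = {a *R q + b *R q' | a b. a > 0 & b > 0}"

lemma tri_cone_tangent:
 assumes c: "tri_cone y q q'" and y: "y : std" and ab: "0 <= a" "0 <= b"
 shows "a *R q + b *R q' : tangent std y"
 using c unfolding tri_cone_def by (intro convex_tangent[OF convex_std y _ _ ab]) auto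

lemma cpoint_tangent:
 assumes "tri_cone y q q'" "y : std" "0 <= s" "s <= 1"
 shows "cpoint q q' s : tangent std y"
 unfolding cpoint_def using assms by (intro tri_cone_tangent) auto

context ct_surface
begin

definition tslope where "tslope f y ps = dirder (%x. ps (tri_map S f x)) y"

context
 fixes D :: "('e, 'f) segment_sum" and f y ps q q'
 assumes valid: "ALL sg:keys D. valid_segment S sg"
  and le: "local_equation S D (tri_map S f y) ps" and f: "f : tris S" and y: "y : std"
  and cone: "tri_cone y q q'"
begin

abbreviation pss where "pss \<equiv> tslope f y ps"

lemma tslope_scale: "v : tangent std y ==> l > 0 ==> pss (l *R v) = l * pss v"
 unfolding tslope_def
 by (rule dirder_scale[OF convex_std y conic_near_at[OF local_equation_conic[OF le f y] y]])

lemma tslope_has_dir: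
 assumes "r : tangent std y" "et > 0" "r + et *R w : tangent std y"
 shows "has_dir pss r w (dirder pss r w)"
 unfolding tslope_def
 by (rule dirder_dirder(2)[OF convex_std y local_equation_conic[OF le f y, unfolded conic_near_def] assms])

lemma tslope_cone_right: "0 <= s ==> s < 1 ==> has_dir pss (cpoint q q' s) (q' - q) (dirder pss (cpoint q q' s) (q' - q))"
 using cpoint_tangent[OF cone y, of s] cpoint_tangent[OF cone y, of 1]
 by (intro tslope_has_dir[of _ "1 - s"]) (auto simp flip: cpoint_add)

lemma tslope_cone_left: "0 < s ==> s <= 1 ==> has_dir pss (cpoint q q' s) (q - q') (dirder pss (cpoint q q' s) (q - q'))"
 using cpoint_tangent[OF cone y, of s] cpoint_tangent[OF cone y, of 0]
 by (intro tslope_has_dir[of _ s]) (auto simp: cpoint_back)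

lemma cpoint_interior:
 assumes "0 < s" "s < 1"
 obtains de where "de > 0" "int_tri (y + de *R cpoint q q' s)"
 using cone assms unfolding tri_cone_def cpoint_def by (meson diff_gt_0_iff_gt)

lemma kink_weight:
 assumes s: "0 < s" "s < 1" and n: "n > 0" "n *R cpoint q q' s : primitive"
 shows "dirder pss (cpoint q q' s) (q' - q) + dirder pss (cpoint q q' s) (q - q')
  = n * tri_weight D f y (n *R cpoint q q' s)"
proof -
 define v where "v = cpoint q q' s"
 define r where "r = n *R v"
 have r: "r : primitive" using n by (simp add: r_def v_def)
 obtain w where w: "w : int_vec" "det2 r w = 1" by (rule primitive_complement[OF r])
 obtain de where de: "de > 0" "int_tri (y + de *R v)" using cpoint_interior[OF s] by (auto simp: v_def)
 have der: "de / n > 0" "int_tri (y + (de / n) *R r)" using de n by (simp_all add: r_def)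
 have B: "dirder pss r w + dirder pss r (- w) = tri_weight D f y r"
  unfolding tslope_def by (rule bend[OF valid le f y r der w])
 define c where "c = det2 r (q' - q)"
 have "c = n * det2 q q'" unfolding c_def r_def v_def cpoint_def by (simp add: det2_def algebra_simps)
 then have c: "\<bar>c\<bar> = n" using cone n by (simp add: tri_cone_def abs_mult)
 have "det2 r ((q' - q) - c *R w) = 0" using w(2) det2_linear(1)[of r 1 "q' - q" "- c" w] by (simp add: c_def)
 then obtain mm where "(q' - q) - c *R w = mm *R r" using det2_zero_parallel primitive_nonzero[OF r] by blast
 then have dec: "q' - q = mm *R r + c *R w" by (simp add: algebra_simps)
 have kink: "dirder pss v (nuv *R r + n *R w') = nuv * pss r + n * dirder pss r w'" for nuv w'
 proof -
  obtain et where et: "et > 0" "!!t. \<bar>t\<bar> <= et ==> r + t *R w' : tangent std y"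
   by (rule interior_direction[OF der(2,1)]) blast
  have "has_dir pss ((1 / n) *R r) (nuv *R r + n *R w') (nuv * pss r + n * dirder pss r w')"
  proof (rule has_dir_homogeneous[where K = "tangent std y" and et = et])
   show "r : tangent std y" using et(2)[of 0] et(1) by simp
   then show "has_dir pss r w' (dirder pss r w')" using et by (intro tslope_has_dir[of _ et]) auto
  qed (use tslope_scale et n in auto)
  then show ?thesis using n by (simp add: r_def has_dir_dirder)
 qed
 show ?thesis
 proof (cases "c > 0")
  case True
  then have cn: "c = n" using c by simp
  have e: "q' - q = mm *R r + n *R w" "q - q' = (- mm) *R r + n *R (- w)"
   using dec cn by (simp, simp add: algebra_simps)
  have "dirder pss v (q' - q) + dirder pss v (q - q') = n * (dirder pss r w + dirder pss r (- w))"
   unfolding e kink by (simp add: algebra_simps)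
  then show ?thesis unfolding B v_def[symmetric] r_def[symmetric] .
 next
  case False
  then have cn: "c = - n" using c by simp
  have e: "q' - q = mm *R r + n *R (- w)" "q - q' = (- mm) *R r + n *R w" using dec cn by (simp_all add: algebra_simps)
  have "dirder pss v (q' - q) + dirder pss v (q - q') = n * (dirder pss r w + dirder pss r (- w))"
   unfolding e kink by (simp add: algebra_simps)
  then show ?thesis unfolding B v_def[symmetric] r_def[symmetric] .
 qed
qed

lemma kink_primitive:
 assumes s: "0 < s" "s < 1"
  and k: "dirder pss (cpoint q q' s) (q' - q) + dirder pss (cpoint q q' s) (q - q') ~= 0"
 obtains n where "n > 0" "n *R cpoint q q' s : primitive"
proof -
 obtain ph a E where c: "ps = (%x. a * ph x)" "finite E"
  "\<forall>\<^sub>F z in nhds y. chart_equation S D f ph a E z"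
  by (rule local_equation_chart[OF le f y]) blast
 let ?h = "%x. ph (tri_map S f x)"
 have pl: "integral_PL_at std ?h y" using eventually_nhds_x_imp_x[OF c(3)] y unfolding chart_equation_def by blast
 have con: "conic_near std ?h y"
  unfolding conic_near_def using c(3)[unfolded chart_equation_def]
  by eventually_elim (use integral_PL_conic(1)[OF convex_std] in blast)
 have dd: "has_dir (dirder ?h y) (cpoint q q' s) w (dirder (dirder ?h y) (cpoint q q' s) w) &
  dirder pss (cpoint q q' s) w = a * dirder (dirder ?h y) (cpoint q q' s) w"
  if w: "et > 0" "cpoint q q' s + et *R w : tangent std y" for w et
 proof -
  have t: "cpoint q q' s : tangent std y" using s by (intro cpoint_tangent[OF cone y]) auto
  from dirder_dirder_linear[OF convex_std y con con t w, of a 0]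
   dirder_dirder(2)[OF convex_std y con[unfolded conic_near_def] t w]
  show ?thesis unfolding tslope_def unfolding c(1) by simp
 qed
 have 1: "cpoint q q' s + (1 - s) *R (q' - q) : tangent std y"
  using cpoint_tangent[OF cone y, of 1] by (simp flip: cpoint_add)
 have 2: "cpoint q q' s + s *R (q - q') : tangent std y"
  using cpoint_tangent[OF cone y, of 0] by (simp add: cpoint_back)
 note d1 = dd[OF _ 1] and d2 = dd[OF s(1) 2]
 have ne: "dirder (dirder ?h y) (cpoint q q' s) (q' - q) + dirder (dirder ?h y) (cpoint q q' s) (q - q') ~= 0"
  using k d1 d2 s by (auto simp flip: distrib_left)
 have R: "has_dir (%s. dirder ?h y (cpoint q q' s)) s 1 (dirder (dirder ?h y) (cpoint q q' s) (q' - q))"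
  using d1 s by (intro has_dir_cone_point) simp
 have L: "has_dir (%s. dirder ?h y (cpoint q q' s)) s (-1) (dirder (dirder ?h y) (cpoint q q' s) (q - q'))"
  using d2 by (intro has_dir_cone_point) simp
 have det: "det2 q q' ~= 0" using cone by (auto simp: tri_cone_def)
 show ?thesis
  by (rule kink_rational[OF convex_std y pl tri_cone_tangent[OF cone y] det s
    R[unfolded cpoint_def] L[unfolded cpoint_def] ne[unfolded cpoint_def]])
   (auto intro: that simp: cpoint_def)
qed

lemma cone_ends:
 "dirder pss q (q' - q) = dirder pss q q' - pss q" "dirder pss q' (q - q') = dirder pss q' q - pss q'"
proof -
 have t: "q : tangent std y" "q' : tangent std y" using cone by (auto simp: tri_cone_def)
 have e: "dirder pss u (w - u) = dirder pss u w - pss u" if uw: "u : tangent std y" "w : tangent std y" for u w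
 proof -
  have tt: "u + t *R w : tangent std y" if "0 <= t" for t
   using convex_tangent[OF convex_std y uw, of 1 t] that by simp
  have "has_dir pss (1 *R u) ((-1) *R u + 1 *R w) ((-1) * pss u + 1 * dirder pss u w)"
  proof (rule has_dir_homogeneous[where K = "tangent std y" and et = 1])
   show "has_dir pss u w (dirder pss u w)" using uw(1) tt[of 1] by (intro tslope_has_dir[of _ 1]) auto
  qed (use tslope_scale uw tt in auto)
  from has_dir_dirder[OF this] show ?thesis by simp
 qed
 show "dirder pss q (q' - q) = dirder pss q q' - pss q" "dirder pss q' (q - q') = dirder pss q' q - pss q'"
  by (rule e[OF t(1,2)], rule e[OF t(2,1)])
qed

lemma cone_sum:
 assumes U: "finite \<U>" "\<U> <= primitive" "!!u. u : primitive ==> tri_weight D f y u ~= 0 ==> u : \<U>"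
 shows "(SUM u:\<U> Int open_cone q q'. tri_weight D f y u * (g \<bullet> u))
  = (g \<bullet> q) * (pss q' - dirder pss q q') + (g \<bullet> q') * (pss q - dirder pss q' q)"
proof -
 define ka where "ka s = dirder pss (cpoint q q' s) (q' - q) + dirder pss (cpoint q q' s) (q - q')" for s
 define J where "J = {s. 0 < s & s < 1 & ka s ~= 0}"
 define V where "V = {u : \<U> Int open_cone q q'. tri_weight D f y u ~= 0}"
 define De where "De = det2 q q'"
 have De: "De ~= 0" using cone by (auto simp: tri_cone_def De_def)
 define par where "par u = det2 q u / (det2 q u + det2 u q')" for u
 define ht where "ht u = (det2 q u + det2 u q') / De" for u
 have par: "par (n *R cpoint q q' s) = s" if "n > 0" for n s
 proof -
  have "det2 q (n *R cpoint q q' s) = n * De * s" "det2 (n *R cpoint q q' s) q' = n * De * (1 - s)"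
   by (simp_all add: cpoint_def det2_def De_def algebra_simps)
  then have "par (n *R cpoint q q' s) = (n * De * s) / (n * De)" by (simp add: par_def algebra_simps)
  then show ?thesis using that De by simp
 qed
 have ht: "u = ht u *R cpoint q q' (par u) & ht u > 0 & 0 < par u & par u < 1" if "u : open_cone q q'" for u
 proof -
  obtain a b where ab: "u = a *R q + b *R q'" "a > 0" "b > 0" using \<open>u : open_cone q q'\<close> by (auto simp: open_cone_def)
  have d: "det2 q u = b * De" "det2 u q' = a * De" unfolding ab(1) det2_linear by (simp_all add: De_def)
  have h: "ht u = a + b" using De by (simp add: ht_def d add_divide_distrib)
  have "par u = (b * De) / ((a + b) * De)" by (simp add: par_def d algebra_simps)
  then have p: "par u = b / (a + b)" using De by simp
  have pb: "(a + b) * par u = b" "(a + b) * (1 - par u) = a" unfolding p using ab(2,3) by (simp_all add: field_simps)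
  have "0 < par u & par u < 1" unfolding p using ab(2,3) by simp
  moreover have "ht u *R cpoint q q' (par u) = ((a + b) * (1 - par u)) *R q + ((a + b) * par u) *R q'"
   unfolding h cpoint_def by (simp add: scaleR_add_right)
  ultimately show ?thesis using ab(2,3) unfolding pb h ab(1)[symmetric] by simp
 qed
 have "EX n. s : J --> n > 0 & n *R cpoint q q' s : primitive" for s
  using kink_primitive[of s] unfolding J_def ka_def by blast
 then obtain nuv where nuv: "!!s. s : J ==> nuv s > 0 & nuv s *R cpoint q q' s : primitive" by metis
 have ka: "ka s = n * tri_weight D f y (n *R cpoint q q' s)" if "0 < s" "s < 1" "n > 0" "n *R cpoint q q' s : primitive" for s n
  unfolding ka_def by (rule kink_weight[OF that])
 have "(SUM u:\<U> Int open_cone q q'. tri_weight D f y u * (g \<bullet> u)) = (SUM u:V. tri_weight D f y u * (g \<bullet> u))"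
  unfolding V_def using U(1) by (intro sum.mono_neutral_right) auto
 also have "... = (SUM s:J. ka s * (g \<bullet> cpoint q q' s))"
 proof (rule sum.reindex_bij_witness[of _ "%s. nuv s *R cpoint q q' s" par])
  fix u assume u: "u : V"
  then have uo: "u : open_cone q q'" "tri_weight D f y u ~= 0" "u : primitive" using U(2) by (auto simp: V_def)
  note h = ht[OF uo(1)]
  have hp: "ht u *R cpoint q q' (par u) : primitive" using h uo(3) by simp
  have ku: "ka (par u) = ht u * tri_weight D f y u" using ka[OF _ _ _ hp] h by simp
  show J: "par u : J" using h ku uo(2) by (simp add: J_def)
  have e: "nuv (par u) *R cpoint q q' (par u) = (nuv (par u) / ht u) *R u"
   using h by (metis (no_types, opaque_lifting) less_irrefl nonzero_divide_eq_eq scaleR_scaleR)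
  then have "nuv (par u) / ht u = 1"
   using primitive_multiple[OF uo(3), of "nuv (par u) / ht u"] nuv[OF J] h by simp
  then show "nuv (par u) *R cpoint q q' (par u) = u" unfolding e by simp
  have "g \<bullet> u = ht u * (g \<bullet> cpoint q q' (par u))" using h by (metis inner_scaleR_right)
  then show "ka (par u) * (g \<bullet> cpoint q q' (par u)) = tri_weight D f y u * (g \<bullet> u)" unfolding ku by simp
 next
  fix s assume s: "s : J"
  then have s01: "0 < s" "s < 1" "ka s ~= 0" by (auto simp: J_def)
  note n = nuv[OF s]
  show "par (nuv s *R cpoint q q' s) = s" using par n by blast
  have w: "tri_weight D f y (nuv s *R cpoint q q' s) ~= 0" using ka[OF s01(1,2)] n s01(3) by auto
  have "nuv s *R cpoint q q' s = (nuv s * (1 - s)) *R q + (nuv s * s) *R q'" by (simp add: cpoint_def scaleR_add_right)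
  moreover have "nuv s * (1 - s) > 0" "nuv s * s > 0" using n s01 by auto
  ultimately have "nuv s *R cpoint q q' s : open_cone q q'" unfolding open_cone_def by blast
  then show "nuv s *R cpoint q q' s : V" using w U(3) n by (auto simp: V_def)
 qed
 also have "... = (SUM s:J. ka s * (g \<bullet> q + (g \<bullet> q' - g \<bullet> q) * s))"
  by (intro sum.cong refl) (simp add: cpoint_def inner_add_right algebra_simps)
 also have "... = - ((g \<bullet> q + (g \<bullet> q' - g \<bullet> q) * 1) * dirder pss q' (q - q')) - (g \<bullet> q + (g \<bullet> q' - g \<bullet> q) * 0) * dirder pss q (q' - q)
   - (g \<bullet> q' - g \<bullet> q) * (pss q' - pss q)"
 proof -
  have R: "has_dir (%s. pss (cpoint q q' s)) s 1 (dirder pss (cpoint q q' s) (q' - q))" if "0 <= s" "s < 1" for s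
   using tslope_cone_right[OF that] by (intro has_dir_cone_point) simp
  have L: "has_dir (%s. pss (cpoint q q' s)) s (-1) (dirder pss (cpoint q q' s) (q - q'))" if "0 < s" "s <= 1" for s
   using tslope_cone_left[OF that] by (intro has_dir_cone_point) simp
  have "(SUM s:J. ka s * (g \<bullet> q + (g \<bullet> q' - g \<bullet> q) * s))
   = - ((g \<bullet> q + (g \<bullet> q' - g \<bullet> q) * 1) * dirder pss (cpoint q q' 1) (q - q'))
    - (g \<bullet> q + (g \<bullet> q' - g \<bullet> q) * 0) * dirder pss (cpoint q q' 0) (q' - q)
    - (g \<bullet> q' - g \<bullet> q) * (pss (cpoint q q' 1) - pss (cpoint q q' 0))"
   unfolding J_def ka_def by (rule sum_jumps[THEN conjunct2]) (use R L in auto)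
  then show ?thesis by simp
 qed
 also have "... = (g \<bullet> q) * (pss q' - dirder pss q q') + (g \<bullet> q') * (pss q - dirder pss q' q)"
  unfolding cone_ends by (simp add: algebra_simps)
 finally show ?thesis .
qed

end

end

lemma tri_cone_interior:
 assumes "int_tri y" "q : int_vec" "q' : int_vec" "\<bar>det2 q q'\<bar> = 1"
 shows "tri_cone y q q'"
proof -
 have r: "EX de>0. int_tri (y + de *R v)" for v
 proof -
  obtain ro where ro: "ro > 0" "!!v. norm v < ro ==> int_tri (y + v)" by (rule int_tri_ball[OF assms(1)]) blast
  define de where "de = ro / (norm v + 1)"
  have n: "norm v + 1 > 0" by (simp add: add_nonneg_pos)
  then have d: "de > 0" "de * (norm v + 1) = ro" using ro(1) by (auto simp: de_def)
  then have "norm (de *R v) < ro" by (simp add: algebra_simps)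
  then show ?thesis using d(1) ro(2) by blast
 qed
 moreover have "v : tangent std y" for v
  using r[of v] int_tri_std unfolding tangent_def by blast
 ultimately show ?thesis using assms(2-4) by (simp add: tri_cone_def)
qed

lemma convex_interior_tri: "convex {z. int_tri z}"
proof -
 have "{z. int_tri z} = {z. (-1, 0) \<bullet> z < (0::real)} Int {z. (0, -1) \<bullet> z < (0::real)} Int {z. (1, 1) \<bullet> z < (1::real)}"
  by (auto simp: int_tri_def)
 then show ?thesis by (simp add: convex_Int convex_halfspace_lt)
qed

definition sdir :: "nat => real \<times> real" where
 "sdir i = spt i 1 - spt i 0"

lemma side_point_shift: "spt i (t + s) = spt i t + s *R sdir i"
 by (simp add: side_point_def sdir_def algebra_simps)

context ct_surface
begin

context
 fixes D :: "('e, 'f) segment_sum" and f y ps ps'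
 assumes valid: "ALL sg:keys D. valid_segment S sg"
  and le: "local_equation S D (tri_map S f y) ps" and le': "local_equation S D (tri_map S f y) ps'"
  and f: "f : tris S" and y: "y : std"
begin

lemma cone_difference:
 assumes cone: "tri_cone y q q'"
 defines "De \<equiv> %v. tslope f y ps v - tslope f y ps' v"
 shows "0 <= s ==> s <= 1 ==> De (cpoint q q' s) = (1 - s) * De q + s * De q'"
  "dirder (tslope f y ps) q q' - dirder (tslope f y ps') q q' = De q'"
proof -
 define kp where "kp s = dirder (tslope f y ps) (cpoint q q' s) (q' - q)
  - dirder (tslope f y ps') (cpoint q q' s) (q' - q)" for s
 define km where "km s = dirder (tslope f y ps) (cpoint q q' s) (q - q')
  - dirder (tslope f y ps') (cpoint q q' s) (q - q')" for s
 note c = valid le f y cone and c' = valid le' f y cone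
 have R: "has_dir (%s. De (cpoint q q' s)) s 1 (kp s)" if "0 <= s" "s < 1" for s
  using has_dir_linear[OF tslope_cone_right[OF c that] tslope_cone_right[OF c' that], of 1 "-1"]
  by (intro has_dir_cone_point) (simp add: kp_def De_def)
 have L: "has_dir (%s. De (cpoint q q' s)) s (-1) (km s)" if "0 < s" "s <= 1" for s
  using has_dir_linear[OF tslope_cone_left[OF c that] tslope_cone_left[OF c' that], of 1 "-1"]
  by (intro has_dir_cone_point) (simp add: km_def De_def)
 have K: "kp s + km s = 0" if s: "0 < s" "s < 1" for s
 proof (cases "EX n>0. n *R cpoint q q' s : primitive")
  case True
  then obtain n where n: "n > 0" "n *R cpoint q q' s : primitive" by blast
  show ?thesis using kink_weight[OF c s n] kink_weight[OF c' s n] by (simp add: kp_def km_def)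
 next
  case False
  have "dirder (tslope f y ps) (cpoint q q' s) (q' - q) + dirder (tslope f y ps) (cpoint q q' s) (q - q') = 0"
   by (rule ccontr, erule kink_primitive[OF c s]) (use False in blast)
  moreover have "dirder (tslope f y ps') (cpoint q q' s) (q' - q) + dirder (tslope f y ps') (cpoint q q' s) (q - q') = 0"
   by (rule ccontr, erule kink_primitive[OF c' s]) (use False in blast)
  ultimately show ?thesis by (simp add: kp_def km_def)
 qed
 have A: "De (cpoint q q' s) = De (cpoint q q' 0) + (s - 0) * kp 0" if "0 <= s" "s <= 1" for s
  by (rule no_kinks_affine[where k = "%s. De (cpoint q q' s)" and a = 0 and b = 1 and kp = kp and km = km])
   (use R L K that in \<open>blast+\<close>)
 have k0: "kp 0 = De q' - De q" using A[of 1] by simp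
 show "De (cpoint q q' s) = (1 - s) * De q + s * De q'" if "0 <= s" "s <= 1"
  using A[OF that] k0 by (simp add: algebra_simps)
 show "dirder (tslope f y ps) q q' - dirder (tslope f y ps') q q' = De q'"
  using k0 cone_ends(1)[OF c] cone_ends(1)[OF c'] by (simp add: kp_def De_def)
qed

lemma cone_difference_linear:
 assumes cone: "tri_cone y q q'" and ab: "0 <= a" "0 <= b" "a + b > 0"
 defines "De \<equiv> %v. tslope f y ps v - tslope f y ps' v"
 shows "De (a *R q + b *R q') = a * De q + b * De q'"
proof -
 define s where "s = b / (a + b)"
 have s: "0 <= s" "s <= 1" "(a + b) * s = b" "(a + b) * (1 - s) = a" using ab by (auto simp: s_def field_simps)
 have e: "a *R q + b *R q' = (a + b) *R cpoint q q' s"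
  unfolding cpoint_def scaleR_add_right scaleR_scaleR s(3,4) ..
 have t: "cpoint q q' s : tangent std y" by (rule cpoint_tangent[OF cone y s(1,2)])
 have "De (a *R q + b *R q') = (a + b) * De (cpoint q q' s)"
  unfolding e De_def using tslope_scale[OF valid le f y cone t ab(3)] tslope_scale[OF valid le' f y cone t ab(3)]
  by (simp add: algebra_simps)
 also have "... = ((a + b) * (1 - s)) * De q + ((a + b) * s) * De q'"
  unfolding De_def cone_difference(1)[OF cone s(1,2)] by (simp add: algebra_simps)
 finally show ?thesis unfolding s(3,4) .
qed

lemma local_equations_interior:
 assumes int: "int_tri y"
 shows "EX L. affine_function L & (\<forall>\<^sub>F z in nhds y. z : std --> ps (tri_map S f z) = ps' (tri_map S f z) + L z)"
proof -
 define De where "De v = tslope f y ps v - tslope f y ps' v" for v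
 have opp: "De q' + De (- q') = 0" if q: "q : primitive" "q' : int_vec" "- q' : int_vec" "det2 q q' = 1" for q q'
 proof -
  have d: "det2 q (- q') = -1" using q(4) by (simp add: det2_def)
  have c: "tri_cone y q q'" "tri_cone y q (- q')"
   using q(2-4) d primitive_lattice[OF q(1)] by (auto intro!: tri_cone_interior int)
  obtain de where de: "de > 0" "int_tri (y + de *R q)"
  proof -
   obtain ro where ro: "ro > 0" "!!v. norm v < ro ==> int_tri (y + v)" by (rule int_tri_ball[OF int]) blast
   have n: "norm q > 0" using primitive_nonzero[OF q(1)] by simp
   show ?thesis by (rule that[of "ro / (2 * norm q)"]) (use ro n in auto)
  qed
  show ?thesis
   using bend[OF valid le f y q(1) de q(2,4)] bend[OF valid le' f y q(1) de q(2,4)]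
    cone_difference(2)[OF c(1)] cone_difference(2)[OF c(2)]
   unfolding De_def tslope_def by linarith
 qed
 have l: "(1, 0) : primitive" "(0, 1) : primitive" "(1, 0) : int_vec" "(0, 1) : int_vec" "- (1, 0) : int_vec" "- (0, 1) : int_vec"
 proof -
  have p: "(of_int 1, of_int 0) : primitive" "(of_int 0, of_int 1) : primitive" unfolding primitive_def by force+
  then show "(1, 0) : primitive" "(0, 1) : primitive" by simp_all
  then show "(1, 0) : int_vec" "(0, 1) : int_vec" "- (1, 0) : int_vec" "- (0, 1) : int_vec"
   using primitive_lattice primitive_uminus by blast+
 qed
 have o: "De (- (0, 1)) = - De (0, 1)" "De (- (1, 0)) = - De (1, 0)"
  using opp[OF l(1) l(4) l(6)] opp[OF l(2) l(5)] l(3) by (auto simp: det2_def)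
 define g where "g = (De (1, 0), De (0, 1))"
 have lin: "De v = g \<bullet> v" if "v ~= 0" for v
 proof -
  define p where "p = (if fst v >= 0 then (1, 0) else - (1, 0) :: real \<times> real)"
  define q where "q = (if snd v >= 0 then (0, 1) else - (0, 1) :: real \<times> real)"
  have "tri_cone y p q" using l by (intro tri_cone_interior int) (auto simp: p_def q_def det2_def)
  moreover have "\<bar>fst v\<bar> + \<bar>snd v\<bar> > 0" using that by (cases v) (auto simp: zero_prod_def)
  ultimately have "De (\<bar>fst v\<bar> *R p + \<bar>snd v\<bar> *R q) = \<bar>fst v\<bar> * De p + \<bar>snd v\<bar> * De q"
   unfolding De_def by (intro cone_difference_linear) auto
  moreover have "\<bar>fst v\<bar> *R p + \<bar>snd v\<bar> *R q = v" by (cases v) (auto simp: p_def q_def)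
  moreover have "De p = (if fst v >= 0 then De (1, 0) else - De (1, 0))" "De q = (if snd v >= 0 then De (0, 1) else - De (0, 1))"
   using o by (simp_all add: p_def q_def)
  ultimately show ?thesis by (cases v) (auto simp: g_def)
 qed
 obtain ro1 where r1: "conic_radius std (%z. ps (tri_map S f z)) y ro1"
  using conic_near_at[OF local_equation_conic[OF le f y] y] unfolding conic_at_def by blast
 obtain ro2 where r2: "conic_radius std (%z. ps' (tri_map S f z)) y ro2"
  using conic_near_at[OF local_equation_conic[OF le' f y] y] unfolding conic_at_def by blast
 define L where "L z = (ps (tri_map S f y) - ps' (tri_map S f y) - g \<bullet> y) + g \<bullet> z" for z
 have "affine_function L" unfolding L_def affine_function_def by blast
 moreover have "\<forall>\<^sub>F z in nhds y. z : std --> ps (tri_map S f z) = ps' (tri_map S f z) + L z"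
  unfolding eventually_nhds_metric
 proof (intro exI[of _ "min ro1 ro2"] conjI allI impI)
  show "min ro1 ro2 > 0" using r1 r2 by (simp add: conic_radius_def)
  fix z assume z: "dist z y < min ro1 ro2" "z : std"
  show "ps (tri_map S f z) = ps' (tri_map S f z) + L z"
  proof (cases "z = y")
   case True then show ?thesis by (simp add: L_def)
  next
   case False
   have e: "y + 1 *R (z - y) = z" by simp
   have n: "norm (1 *R (z - y)) < ro1" "norm (1 *R (z - y)) < ro2" using z(1) by (simp_all add: dist_norm)
   have m: "y + 1 *R (z - y) : std" using z(2) by simp
   have "ps (tri_map S f z) = ps (tri_map S f y) + tslope f y ps (z - y)"
    using dirder_ray[OF convex_std y r1 n(1) m] by (simp add: tslope_def)
   moreover have "ps' (tri_map S f z) = ps' (tri_map S f y) + tslope f y ps' (z - y)"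
    using dirder_ray[OF convex_std y r2 n(2) m] by (simp add: tslope_def)
   ultimately show ?thesis using lin[of "z - y"] False by (simp add: De_def L_def inner_diff_right)
  qed
 qed
 ultimately show ?thesis by blast
qed

end

lemma local_equations_differ_affine:
 assumes valid: "ALL sg:keys D. valid_segment S sg"
  and le: "local_equation S D (tri_map S f y) ps" "local_equation S D (tri_map S f y) ps'"
  and f: "f : tris S" and y: "y : std"
 shows "EX L. affine_function L & (\<forall>\<^sub>F z in nhds y. z : std --> ps (tri_map S f z) = ps' (tri_map S f z) + L z)"
proof -
 let ?u = "%z. ps (tri_map S f z)" and ?v = "%z. ps' (tri_map S f z)"
 have "\<forall>\<^sub>F z in nhds y. z : std --> local_equation S D (tri_map S f z) ps & local_equation S D (tri_map S f z) ps'"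
  using local_equation_nearby[OF le(1) f y] local_equation_nearby[OF le(2) f y] by eventually_elim simp
 then obtain d where d: "d > 0" "!!z. dist z y < d ==> z : std ==>
   local_equation S D (tri_map S f z) ps & local_equation S D (tri_map S f z) ps'"
  unfolding eventually_nhds_metric by blast
 define A where "A = {z. int_tri z} Int ball y d"
 have A: "open A" "convex A" "A = std Int A"
  using open_interior_tri convex_interior_tri int_tri_std by (auto simp: A_def intro: convex_Int)
 have "EX L:Collect affine_function. ALL z:A. ?u z = ?v z + L z"
 proof (rule affine.local_to_global[OF A(3,1,2)])
  fix q assume q: "q : A"
  then have q': "int_tri q" "q : std" "dist q y < d"
   using int_tri_std by (auto simp: A_def dist_commute)
  have qe: "local_equation S D (tri_map S f q) ps" "local_equation S D (tri_map S f q) ps'" using d(2)[OF q'(3,2)] by auto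
  show "germ_equiv (Collect affine_function) ?u ?v q"
   unfolding germ_equiv_def using local_equations_interior[OF valid qe f q'(2,1)] by auto
 qed
 then obtain L where L: "affine_function L" "!!z. z : A ==> ?u z = ?v z + L z" by auto
 have "?u z = ?v z + L z" if z: "dist z y < d" "z : std" for z
 proof -
  have ze: "local_equation S D (tri_map S f z) ps" "local_equation S D (tri_map S f z) ps'" using d(2)[OF z] by auto
  obtain ro where ro: "conic_radius std (%x. 1 * ?u x + (-1) * ?v x) z ro"
   using conic_at_linear[OF conic_near_at[OF local_equation_conic[OF ze(1) f z(2)] z(2)]
     conic_near_at[OF local_equation_conic[OF ze(2) f z(2)] z(2)]] unfolding conic_at_def by blast
  then have ro0: "ro > 0" by (simp add: conic_radius_def)
  define c where "c = (1/3, 1/3) - z"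
  have ci: "int_tri (z + 1 *R c)" by (simp add: c_def int_tri_def)
  define ep where "ep = min 1 (min ro (d - dist z y) / (norm c + 1))"
  have n: "norm c + 1 > 0" by (simp add: add_nonneg_pos)
  have ep: "0 < ep" "ep <= 1" using ro0 z(1) n by (auto simp: ep_def)
  have "ep <= min ro (d - dist z y) / (norm c + 1)" by (simp add: ep_def)
  then have "ep * (norm c + 1) <= min ro (d - dist z y)" using n by (simp add: pos_le_divide_eq)
  then have nc: "ep * norm c < ro" "ep * norm c < d - dist z y" using ep(1) by (simp_all add: algebra_simps)
  have inA: "z + t *R c : A" if t: "0 < t" "t <= ep" for t
  proof -
   have "t * norm c <= ep * norm c" using t by (intro mult_right_mono) auto
   moreover have "dist (z + t *R c) y <= t * norm c + dist z y"
    using dist_triangle[of "z + t *R c" y z] t by (simp add: dist_norm)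
   ultimately have "dist y (z + t *R c) < d" using nc(2) by (simp add: dist_commute)
   then show ?thesis using interior_ray[OF z(2) ci t(1)] t ep by (simp add: A_def)
  qed
  define w where "w = ep *R c"
  have a1: "z + w : A" using inA[of ep] ep by (simp add: w_def)
  have a2: "z + (1/2) *R w : A" using inA[of "ep / 2"] ep by (simp add: w_def)
  have "norm w < ro" using nc(1) ep by (simp add: w_def)
  moreover have "z + w : std" using a1 int_tri_std by (simp add: A_def)
  ultimately have "1 * ?u (z + (1/2) *R w) + (-1) * ?v (z + (1/2) *R w) = 1 * ?u z + (-1) * ?v z
    + (1/2) * ((1 * ?u (z + w) + (-1) * ?v (z + w)) - (1 * ?u z + (-1) * ?v z))"
   using ro[unfolded conic_radius_def, THEN conjunct2, rule_format, of w "1/2"] by simp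
  then have "L (z + (1/2) *R w) = ?u z - ?v z + (1/2) * (L (z + w) - (?u z - ?v z))"
   using L(2)[OF a1] L(2)[OF a2] by simp
  moreover have "L (z + (1/2) *R w) = L z + (1/2) * (L (z + w) - L z)" by (rule affine_function_line[OF L(1)])
  ultimately show ?thesis by (simp add: algebra_simps)
 qed
 then show ?thesis using L(1) d(1) unfolding eventually_nhds_metric by blast
qed

lemma global_equation:
 assumes valid: "ALL sg:keys D. valid_segment S sg"
  and le: "!!p. p : points S ==> local_equation S D p (Ps p)"
 obtains Th where "!!f y. f : tris S ==> y : std ==> EX L. affine_function L &
  (\<forall>\<^sub>F z in nhds y. z : std --> Ps (tri_map S f y) (tri_map S f z) = Th (tri_map S f z) + L z)"
proof -
 define gx where "gx f q z = Ps (tri_map S f q) (tri_map S f z)" for f q z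
 have "EX G. ALL q:std. germ_equiv (Collect affine_function) G (gx f q) q" if f: "f : tris S" for f
 proof (rule affine.trivial_on_triangle)
  fix p assume p: "p : std"
  show "\<forall>\<^sub>F q in nhds p. q : std --> germ_equiv (Collect affine_function) (gx f p) (gx f q) q"
   using local_equation_nearby[OF le[OF tri_map_points[OF f p]] f p]
  proof eventually_elim
   case (elim q)
   show ?case
   proof
    assume q: "q : std"
    with elim have "local_equation S D (tri_map S f q) (Ps (tri_map S f p))" by blast
    from local_equations_differ_affine[OF valid this le[OF tri_map_points[OF f q]] f q]
    show "germ_equiv (Collect affine_function) (gx f p) (gx f q) q"
     unfolding germ_equiv_def gx_def by auto
   qed
  qed
 qed
 then obtain G where G: "!!f q. f : tris S ==> q : std ==> germ_equiv (Collect affine_function) (G f) (gx f q) q"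
  by metis
 have side: "EX m. \<forall>\<^sub>F s in nhds t. s : {0..1} --> G f (spt i s) = Ps (edge_map S e t) (edge_map S e s) + (k + (s - t) * m)"
  if l: "(f, i) : edge_link S e" and t: "t : {0..1}" and k: "k = G f (spt i t) - Ps (edge_map S e t) (edge_map S e t)" for f i e t k
 proof -
  have f: "f : tris S" "i < 3" "face S f i = e" using l by (auto simp: edge_link_def)
  have m: "tri_map S f (spt i s) = edge_map S e s" if "s : {0..1}" for s
   using tri_map_side[OF f(1,2) that] f(3) by simp
  obtain L where L: "affine_function L" "\<forall>\<^sub>F x in nhds (spt i t). x : std --> G f x = gx f (spt i t) x + L x"
   using G[OF f(1) side_point_std[OF f(2) t]] unfolding germ_equiv_def by auto
  have Lt: "L (spt i t) = k"
   using eventually_nhds_x_imp_x[OF L(2)] side_point_std[OF f(2) t] m[OF t] k by (simp add: gx_def)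
  have Ls: "L (spt i s) = k + (s - t) * (L (spt i t + sdir i) - k)" for s
  proof -
   have "spt i s = spt i t + (s - t) *R sdir i" using side_point_shift[of i t "s - t"] by simp
   then show ?thesis using affine_function_line[OF L(1), of "spt i t" "s - t" "sdir i"] unfolding Lt by simp
  qed
  have "\<forall>\<^sub>F s in nhds t. spt i s : std --> G f (spt i s) = gx f (spt i t) (spt i s) + L (spt i s)"
   by (rule nhds_compose[OF tendsto_side_point L(2)])
  then have "\<forall>\<^sub>F s in nhds t. s : {0..1} --> G f (spt i s) = Ps (edge_map S e t) (edge_map S e s)
    + (k + (s - t) * (L (spt i t + sdir i) - k))"
  proof eventually_elim
   case (elim s)
   then show ?case using side_point_std[OF f(2), of s] m[of s] m[OF t] Ls[of s] by (simp add: gx_def)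
  qed
  then show ?thesis by blast
 qed
 have glue: "EX a b. ALL t:{0..1}. G f (spt i t) - G f' (spt i' t) = a + b * t"
  if l: "(f, i) : edge_link S e" "(f', i') : edge_link S e" for e f i f' i'
 proof -
  define k where "k t = G f (spt i t) - G f' (spt i' t)" for t
  have "EX m. \<forall>\<^sub>F s in nhds t. s : {0..1} --> k s = k t + (s - t) * m" if t: "t : {0..1}" for t
  proof -
   obtain m where m: "\<forall>\<^sub>F s in nhds t. s : {0..1} --> G f (spt i s) = Ps (edge_map S e t) (edge_map S e s)
     + ((G f (spt i t) - Ps (edge_map S e t) (edge_map S e t)) + (s - t) * m)"
    using side[OF l(1) t refl] by blast
   obtain m' where m': "\<forall>\<^sub>F s in nhds t. s : {0..1} --> G f' (spt i' s) = Ps (edge_map S e t) (edge_map S e s)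
     + ((G f' (spt i' t) - Ps (edge_map S e t) (edge_map S e t)) + (s - t) * m')"
    using side[OF l(2) t refl] by blast
   have "\<forall>\<^sub>F s in nhds t. s : {0..1} --> k s = k t + (s - t) * (m - m')"
    using m m'
   proof eventually_elim
    case (elim s)
    show ?case
    proof
     assume "s : {0..1}"
     note e = elim(1)[rule_format, OF this] elim(2)[rule_format, OF this]
     show "k s = k t + (s - t) * (m - m')" unfolding k_def e by (simp add: algebra_simps)
    qed
   qed
   then show ?thesis by blast
  qed
  then obtain m where m: "!!t. t : {0..1} ==> \<forall>\<^sub>F s in nhds t. s : {0..1} --> k s = k t + (s - t) * m t" by metis
  have R: "has_dir k t 1 (m t)" if t: "0 <= t" "t < 1" for t
  proof -
   obtain d where d: "d > 0" "!!s. dist s t < d ==> s : {0..1} ==> k s = k t + (s - t) * m t"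
    using m[of t] t unfolding eventually_nhds_metric by auto
   show ?thesis unfolding has_dir_iff
   proof (intro exI[of _ "min d (1 - t)"] conjI allI impI)
    show "min d (1 - t) > 0" using d(1) t by simp
    show "k (t + x *R 1) = k t + x * m t" if "0 < x" "x < min d (1 - t)" for x
     using d(2)[of "t + x"] that t by (simp add: dist_real_def)
   qed
  qed
  have L: "has_dir k t (-1) (- m t)" if t: "0 < t" "t <= 1" for t
  proof -
   obtain d where d: "d > 0" "!!s. dist s t < d ==> s : {0..1} ==> k s = k t + (s - t) * m t"
    using m[of t] t unfolding eventually_nhds_metric by auto
   show ?thesis unfolding has_dir_iff
   proof (intro exI[of _ "min d t"] conjI allI impI)
    show "min d t > 0" using d(1) t by simp
    show "k (t + x *R (-1)) = k t + x * (- m t)" if "0 < x" "x < min d t" for x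
     using d(2)[of "t - x"] that t by (simp add: dist_real_def)
   qed
  qed
  have K: "k s = k 0 + (s - 0) * m 0" if "0 <= s" "s <= 1" for s
   by (rule no_kinks_affine[where b = 1 and kp = m and km = "%t. - m t"])
    (erule (1) R | erule (1) L | rule that | simp)+
  have "k s = k 0 + m 0 * s" if "s : {0..1}" for s
  proof -
   have "k s = k 0 + (s - 0) * m 0" by (rule K) (use that in auto)
   also have "... = k 0 + m 0 * s" by simp
   finally show ?thesis .
  qed
  then show ?thesis unfolding k_def[symmetric] by blast
 qed
 show ?thesis
 proof (rule glue_triangles[of G])
  fix e f i f' i' assume "(f, i) : edge_link S e" "(f', i') : edge_link S e"
  then show "EX a b. ALL t:{0..1}. G f (spt i t) - G f' (spt i' t) = a + b * t" by (rule glue)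
 next
 fix Th assume Th: "!!f z. f : tris S ==> z : std ==> Th (tri_map S f z) = G f z - vertex_interp (G f) z"
 show thesis
 proof (rule that[of Th])
  fix f y assume f: "f : tris S" and y: "y : std"
  obtain L where L: "affine_function L" "\<forall>\<^sub>F x in nhds y. x : std --> G f x = gx f y x + L x"
   using G[OF f y] unfolding germ_equiv_def by auto
  have "\<forall>\<^sub>F z in nhds y. z : std --> Ps (tri_map S f y) (tri_map S f z) = Th (tri_map S f z) + (vertex_interp (G f) z - L z)"
   using L(2) by eventually_elim (simp add: Th[OF f] gx_def)
  then show "EX L. affine_function L &
    (\<forall>\<^sub>F z in nhds y. z : std --> Ps (tri_map S f y) (tri_map S f z) = Th (tri_map S f z) + L z)"
   using affine_function_diff[OF affine_vertex_interp L(1)] by blast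
 qed
 qed
qed

end

section \<open>Divisors along an edge\<close>

definition inward :: "nat => real \<times> real" where
 "inward i = tri_vertex i - spt i 0"

definition side_par :: "nat => real \<times> real => real" where
 "side_par i z = (if i = 2 then fst z else snd z)"

lemma side_inward: "i < 3 ==> spt i s + v *R inward i =
  (if i = 0 then (1 - s - v, s) else if i = 1 then (v, s) else (s, v))"
 by (erule less_3_cases) (simp_all add: inward_def side_simps vertex_simps)

lemma side_inward_std: "i < 3 ==> spt i s + v *R inward i : std <-> 0 <= s & 0 <= v & s + v <= 1"
 unfolding side_inward by (erule less_3_cases) (auto simp: mem_std)

lemma side_inward_coords: "i < 3 ==> z = spt i (side_par i z) + bary i z *R inward i"
 unfolding side_inward by (erule less_3_cases; cases z) (auto simp: side_par_def bary_def)

lemma side_point_coords: "i < 3 ==> side_par i (spt i s) = s" "i < 3 ==> bary i (spt i s) = 0"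
 by (erule less_3_cases; simp add: side_par_def bary_def side_simps)+

lemma tri_vertex_coords: "i < 3 ==> side_par i (tri_vertex i) = 0" "i < 3 ==> bary i (tri_vertex i) = 1"
 by (erule less_3_cases; simp add: side_par_def bary_def vertex_simps)+

lemma continuous_side_par: "continuous_on A (side_par i)"
 unfolding side_par_def[abs_def] by (cases "i = 2") (auto intro!: continuous_intros)

lemma continuous_bary: "continuous_on A (bary i)"
 unfolding bary_def[abs_def] by (cases "i = 0"; cases "i = 1") (auto intro!: continuous_intros)

definition dir_ok :: "real => real => bool" where
 "dir_ok t de <-> (de = 1 & 0 <= t & t < 1) \<or> (de = -1 & 0 < t & t <= 1)"

definition room :: "real => real => real" where
 "room t de = (if de = 1 then 1 - t else t)"

lemma room:
 assumes "dir_ok t de"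
 shows "room t de > 0" "0 < x ==> x < room t de ==> 0 < t + x * de & t + x * de < 1" "t : {0..1}" "de * de = 1" "de ~= 0"
 using assms by (auto simp: dir_ok_def room_def)

lemma room_one: "(0::real) < 1"
 by simp

lemma sdir_tangent:
 assumes d: "dir_ok t de" and i: "i < 3"
 shows "de *R sdir i : tangent std (spt i t)"
  "de *R sdir i + 1 *R inward i : tangent std (spt i t)"
proof -
 define c where "c = room t de / 2"
 have c: "c > 0" "0 <= t + c * de" "t + c * de + c <= 1"
  using d by (auto simp: dir_ok_def room_def c_def)
 have e: "spt i t + c *R (de *R sdir i + v *R inward i) = spt i (t + c * de) + (c * v) *R inward i" for v
  by (simp add: side_point_shift algebra_simps)
 have "spt i t + c *R (de *R sdir i + v *R inward i) : std" if "0 <= v" "v <= 1" for v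
 proof -
  have "c * v <= c" using c(1) that by (simp add: mult_left_le)
  moreover have "0 <= c * v" using c(1) that by simp
  ultimately show ?thesis unfolding e side_inward_std[OF i] using c by (intro conjI) linarith+
 qed
 from this[of 0] this[of 1] c(1)
 show "de *R sdir i : tangent std (spt i t)"
  "de *R sdir i + 1 *R inward i : tangent std (spt i t)"
  unfolding tangent_def by auto
qed

lemma side_strip:
 assumes d: "dir_ok t de" and i: "i < 3" and ep: "0 < ep" "ep < room t de"
 shows "EX d>0. ALL x v. \<bar>x\<bar> < d --> 0 <= v --> v < d -->
  spt i t + (ep + x) *R (de *R sdir i) + v *R inward i : std"
proof -
 define z where "z = t + ep * de"
 have z: "0 < z" "z < 1" using room(2)[OF d ep] by (auto simp: z_def)
 have de: "de = 1 \<or> de = -1" using d by (auto simp: dir_ok_def)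
 have "spt i t + (ep + x) *R (de *R sdir i) + v *R inward i : std"
  if "\<bar>x\<bar> < min z ((1 - z) / 2)" "0 <= v" "v < min z ((1 - z) / 2)" for x v
 proof -
  have e: "spt i t + (ep + x) *R (de *R sdir i) = spt i (z + x * de)"
   unfolding z_def by (simp add: side_point_shift algebra_simps)
  show ?thesis unfolding e side_inward_std[OF i] using that de z by (auto simp: min_def split: if_splits)
 qed
 moreover have "min z ((1 - z) / 2) > 0" using z by simp
 ultimately show ?thesis by blast
qed

context ct_surface
begin

lemma PL_on_conic:
 assumes U: "openin (realization S) U" "PL_on S U ph" and f: "f : tris S" "y : std" "tri_map S f y : U"
 shows "conic_near std (%x. ph (tri_map S f x)) y"
 unfolding conic_near_def using eventually_chart[OF U(1) f]
proof eventually_elim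
 case (elim z)
 show ?case
 proof
  assume z: "z : std"
  with elim have "tri_map S f z : U" by blast
  then have "integral_PL_at std (%x. ph (tri_map S f x)) z" using U(2) f(1) z unfolding PL_on_def by blast
  then show "conic_at std (%x. ph (tri_map S f x)) z" by (rule integral_PL_conic(1)[OF convex_std z])
 qed
qed

lemma edge_linkD:
 assumes "(f, i) : edge_link S e"
 shows "f : tris S" "i < 3" "!!t. t : {0..1} ==> tri_map S f (spt i t) = edge_map S e t"
  "!!t. t : {0..1} ==> spt i t : std"
 using assms tri_map_side side_point_std by (auto simp: edge_link_def simp del: atLeastAtMost_iff)

lemma edge_has_dir:
 assumes l: "(f, i) : edge_link S e" and d: "dir_ok t de"
  and c: "conic_near std (%x. ph (tri_map S f x)) (spt i t)"
 shows "has_dir (%s. ph (edge_map S e s)) t de (tslope f (spt i t) ph (de *R sdir i))"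
proof -
 note L = edge_linkD[OF l]
 note t = room(3)[OF d]
 have "has_dir (%x. ph (tri_map S f x)) (spt i t) (de *R sdir i) (tslope f (spt i t) ph (de *R sdir i))"
  unfolding tslope_def
  by (rule conic_has_dir[OF convex_std L(4)[OF t] conic_near_at[OF c L(4)[OF t]] sdir_tangent(1)[OF d L(2)]])
 then have h: "has_dir (%s. ph (tri_map S f (spt i s))) t de (tslope f (spt i t) ph (de *R sdir i))"
  by (intro has_dir_compose[where L = "spt i" and h = "%x. ph (tri_map S f x)"]) (simp_all add: side_point_shift)
 show ?thesis
 proof (rule has_dir_cong[OF h])
  show "\<forall>\<^sub>F x in at_right 0. ph (edge_map S e (t + x *R de)) = ph (tri_map S f (spt i (t + x *R de)))"
   unfolding at_right_0_iff
   by (rule exI[of _ "room t de"]) (use room(1)[OF d] room(2)[OF d] L(3) in \<open>auto simp: less_imp_le\<close>)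
  show "ph (edge_map S e t) = ph (tri_map S f (spt i t))" using L(3)[OF t] by simp
 qed
qed

lemma edge_div_mult:
 assumes e: "e : edges S" and d: "dir_ok t de"
  and c: "!!f i. (f, i) : edge_link S e ==> conic_near std (%x. ph (tri_map S f x)) (spt i t)"
 shows "\<forall>\<^sub>F ep in at_right 0. div_mult S ph (EPoint e (t + ep * de))
  ((SUM (f, i):edge_link S e. dirder (tslope f (spt i t) ph) (de *R sdir i) (inward i))
   - of_int (alpha S e True) * (de * dirder (%s. ph (edge_map S e s)) t de))"
proof -
 note t = room(3)[OF d]
 define ka where "ka = dirder (%s. ph (edge_map S e s)) t de"
 define sg where "sg x = dirder (tslope (fst x) (spt (snd x) t) ph) (de *R sdir (snd x)) (inward (snd x))" for x
 have slope: "tslope f (spt i t) ph (de *R sdir i) = ka" if "(f, i) : edge_link S e" for f i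
  unfolding ka_def using has_dir_dirder[OF edge_has_dir[OF that d c[OF that]]] by simp
 have HL: "\<forall>\<^sub>F ep in at_right 0. EX d>0. ALL x v. \<bar>x\<bar> < d --> 0 <= v --> v < d -->
  ph (tri_map S (fst a) (spt (snd a) t + (ep + x) *R (de *R sdir (snd a)) + v *R inward (snd a)))
   = ph (edge_map S e t) + (ep + x) * ka + v * sg a" if a: "a : edge_link S e" for a
 proof -
  obtain f i where fi: "a = (f, i)" by fastforce
  have l: "(f, i) : edge_link S e" using a fi by simp
  note L = edge_linkD[OF l]
  from half_plane_affine[OF convex_std L(4)[OF t] c[OF l, unfolded conic_near_def] sdir_tangent(1)[OF d L(2)]
    room_one sdir_tangent(2)[OF d L(2)] side_strip[OF d L(2)] room(1)[OF d]]
  show ?thesis using slope[OF l] L(3)[OF t] by (simp add: fi sg_def tslope_def)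
 qed
 then have "\<forall>\<^sub>F ep in at_right 0. ALL a:edge_link S e. EX d>0. ALL x v. \<bar>x\<bar> < d --> 0 <= v --> v < d -->
  ph (tri_map S (fst a) (spt (snd a) t + (ep + x) *R (de *R sdir (snd a)) + v *R inward (snd a)))
   = ph (edge_map S e t) + (ep + x) * ka + v * sg a"
  by (intro eventually_ball_finite fin_link ballI)
 moreover have "\<forall>\<^sub>F ep in at_right 0. ep < room t de"
  using room(1)[OF d] unfolding at_right_0_iff by blast
 ultimately show ?thesis using eventually_at_right_less[of 0]
 proof eventually_elim
  case (elim ep)
  define t' where "t' = t + ep * de"
  have t': "0 < t'" "t' < 1" using room(2)[OF d elim(3,2)] by (auto simp: t'_def)
  define K where "K s = ph (edge_map S e t) + (de * (s - t)) * ka" for s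
  define L where "L a z = K (side_par (snd a) z) + bary (snd a) z * sg a" for a z
  have loc: "EX N. open N & spt i t' : N & (ALL x:std Int N. ph (tri_map S f x) = L (f, i) x)"
   if l: "(f, i) : edge_link S e" for f i
  proof -
   note E = edge_linkD[OF l]
   obtain d0 where d0: "d0 > 0" "!!x v. \<bar>x\<bar> < d0 ==> 0 <= v ==> v < d0 ==>
    ph (tri_map S f (spt i t + (ep + x) *R (de *R sdir i) + v *R inward i))
     = ph (edge_map S e t) + (ep + x) * ka + v * sg (f, i)"
    using elim(1) l by fastforce
   define N where "N = {z. \<bar>side_par i z - t'\<bar> < d0} Int {z. bary i z < d0}"
   have "open N" unfolding N_def
    by (intro open_Int open_Collect_less continuous_intros continuous_side_par continuous_bary)
   moreover have "spt i t' : N" using d0(1) side_point_coords[OF E(2)] by (simp add: N_def)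
   moreover have "ph (tri_map S f z) = L (f, i) z" if z: "z : std" "z : N" for z
   proof -
    define x where "x = de * (side_par i z - t')"
    have "\<bar>de\<bar> = 1" using d by (auto simp: dir_ok_def)
    then have "\<bar>x\<bar> < d0" using z(2) by (simp add: x_def N_def abs_mult)
    moreover have "0 <= bary i z" "bary i z < d0" using bary_std[OF z(1)] z(2) by (auto simp: N_def)
    ultimately have h: "ph (tri_map S f (spt i t + (ep + x) *R (de *R sdir i) + bary i z *R inward i))
     = ph (edge_map S e t) + (ep + x) * ka + bary i z * sg (f, i)" by (rule d0(2))
    have dx: "de * x = side_par i z - t'" using room(4)[OF d] unfolding x_def by (metis mult.assoc mult_1)
    have ex: "(ep + x) * de = side_par i z - t" using dx by (simp add: t'_def algebra_simps)
    have "ep + x = (ep + x) * (de * de)" using room(4)[OF d] by simp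
    also have "... = ((ep + x) * de) * de" by (rule mult.assoc[symmetric])
    finally have ex': "ep + x = de * (side_par i z - t)" unfolding ex by (simp only: mult.commute)
    have "spt i t + (ep + x) *R (de *R sdir i) = spt i (side_par i z)"
     unfolding scaleR_scaleR ex by (simp flip: side_point_shift)
    then have "spt i t + (ep + x) *R (de *R sdir i) + bary i z *R inward i = z"
     using side_inward_coords[OF E(2), of z] by simp
    then show ?thesis using h unfolding ex' by (simp add: L_def K_def)
   qed
   ultimately show ?thesis by blast
  qed
  have affK: "affine_function K"
  proof -
   have "K = (%s. (ph (edge_map S e t) - de * t * ka) + (de * ka) \<bullet> s)" by (rule ext) (simp add: K_def algebra_simps)
   then show ?thesis unfolding affine_function_def by blast
  qed
  have affL: "affine_function (L a)" if "snd a < 3" for a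
  proof -
   have "EX k x y. L a = (%z. k + x * fst z + y * snd z)"
   proof (cases rule: less_3_cases[OF that])
    case 1
    have "L a = (%z. (K 0 + sg a) + (- sg a) * fst z + (de * ka - sg a) * snd z)"
     by (rule ext) (simp add: L_def K_def side_par_def bary_def 1 algebra_simps)
    then show ?thesis by blast
   next
    case 2
    have "L a = (%z. K 0 + sg a * fst z + (de * ka) * snd z)"
     by (rule ext) (simp add: L_def K_def side_par_def bary_def 2 algebra_simps)
    then show ?thesis by blast
   next
    case 3
    have "L a = (%z. K 0 + (de * ka) * fst z + sg a * snd z)"
     by (rule ext) (simp add: L_def K_def side_par_def bary_def 3 algebra_simps)
    then show ?thesis by blast
   qed
   then show ?thesis using affine_functionI by metis
  qed
  have nearK: "\<forall>\<^sub>F s in nhds t'. ph (edge_map S e s) = K s"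
  proof -
   obtain f i where l: "(f, i) : edge_link S e" using edge_chart[OF e] by blast
   note E = edge_linkD[OF l]
   obtain N where N: "open N" "spt i t' : N" "ALL x:std Int N. ph (tri_map S f x) = L (f, i) x"
    using loc[OF l] by blast
   have "\<forall>\<^sub>F z in nhds (spt i t'). z : N" using N(1,2) unfolding eventually_nhds by blast
   from nhds_compose[OF tendsto_side_point this]
   have "\<forall>\<^sub>F s in nhds t'. spt i s : N" .
   moreover have "\<forall>\<^sub>F s in nhds t'. s : {0<..<1}" using t' by (intro eventually_nhds_in_open) auto
   ultimately show ?thesis
   proof eventually_elim
    case (elim s)
    then have s: "s : {0..1}" by simp
    have "ph (edge_map S e s) = L (f, i) (spt i s)"
     using N(3)[rule_format, of "spt i s"] elim(1) E(3,4)[OF s] by simp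
    then show ?case using side_point_coords[OF E(2)] by (simp add: L_def)
   qed
  qed
  have "(SUM a:edge_link S e. L a (tri_vertex (snd a))) - of_int (alpha S e False) * K 0 - of_int (alpha S e True) * K 1
   = (SUM a:edge_link S e. sg a) - of_int (alpha S e True) * (de * ka)"
  proof -
   have "L a (tri_vertex (snd a)) = K 0 + sg a" if "a : edge_link S e" for a
    using tri_vertex_coords[of "snd a"] edge_linkD(2)[of "fst a" "snd a" e] that by (simp add: L_def)
   then have "(SUM a:edge_link S e. L a (tri_vertex (snd a))) = (SUM a:edge_link S e. K 0 + sg a)" by (intro sum.cong) auto
   also have "... = of_int (int (card (edge_link S e))) * K 0 + (SUM a:edge_link S e. sg a)" by (simp add: sum.distrib)
   also have "... = (of_int (alpha S e False) + of_int (alpha S e True)) * K 0 + (SUM a:edge_link S e. sg a)"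
    unfolding alpha_sum[OF e, symmetric] by simp
   finally show ?thesis by (simp add: K_def algebra_simps)
  qed
  then show ?case
   unfolding div_mult.simps
   by (intro exI[of _ K] exI[of _ L])
    (use affK nearK loc affL edge_linkD(2) in \<open>auto simp: sg_def ka_def t'_def case_prod_unfold\<close>)
 qed
qed

lemma edge_relation:
 assumes valid: "ALL sg:keys D. valid_segment S sg"
  and le: "local_equation S D (edge_map S e t) ps" and e: "e : edges S" and d: "dir_ok t de"
 shows "edge_weight S D e t de
  = (SUM (f, i):edge_link S e. dirder (tslope f (spt i t) ps) (de *R sdir i) (inward i))
   - of_int (alpha S e True) * (de * dirder (%s. ps (edge_map S e s)) t de)"
proof -
 note t = room(3)[OF d]
 obtain U ph q E where U: "openin (realization S) U" "edge_map S e t : U" "PL_on S U ph" "ps = (%x. q * ph x)" "finite E"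
  and W: "ALL x:U - E. ALL m. div_mult S ph x m --> weight S D x = q * m"
  using le unfolding local_equation_def by blast
 have con: "conic_near std (%x. ph (tri_map S f x)) (spt i t)" if "(f, i) : edge_link S e" for f i
  using PL_on_conic[OF U(1,3) edge_linkD(1)[OF that] edge_linkD(4)[OF that t]] edge_linkD(3)[OF that t] U(2) by simp
 define mm where "mm = (SUM (f, i):edge_link S e. dirder (tslope f (spt i t) ph) (de *R sdir i) (inward i))
   - of_int (alpha S e True) * (de * dirder (%s. ph (edge_map S e s)) t de)"
 have dm: "\<forall>\<^sub>F ep in at_right 0. div_mult S ph (EPoint e (t + ep * de)) mm"
  unfolding mm_def by (rule edge_div_mult[OF e d con])
 have int: "\<forall>\<^sub>F ep in at_right 0. 0 < t + ep * de & t + ep * de < 1"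
  unfolding at_right_0_iff using room(1,2)[OF d] by blast
 have wt: "\<forall>\<^sub>F ep in at_right 0. weight S D (EPoint e (t + ep * de)) = edge_weight S D e t de"
  by (rule eventually_weight_EPoint[OF _ int room(5)[OF d]]) (use valid in blast)
 have "finite {s. EPoint e s : E}" using finite_vimageI[OF U(5), of "EPoint e"] by (simp add: vimage_def inj_on_def)
 then have notE: "\<forall>\<^sub>F ep in at_right 0. t + ep *R de ~: {s. EPoint e s : E}"
  by (rule eventually_notin_finite[OF _ room(5)[OF d]])
 obtain f i where l: "(f, i) : edge_link S e" using edge_chart[OF e] by blast
 note L = edge_linkD[OF l]
 have lim: "((%ep. spt i (t + ep * de)) \<longlongrightarrow> spt i t) (at_right 0)"
  unfolding side_point_def by (auto intro!: tendsto_eq_intros)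
 have "tri_map S f (spt i t) : U" using L(3)[OF t] U(2) by simp
 from nhds_compose[OF lim eventually_chart[OF U(1) L(1) L(4)[OF t] this]]
 have inU: "\<forall>\<^sub>F ep in at_right 0. spt i (t + ep * de) : std --> tri_map S f (spt i (t + ep * de)) : U" .
 have "\<forall>\<^sub>F ep in at_right (0::real). edge_weight S D e t de = q * mm"
  using dm int wt notE inU
 proof eventually_elim
  case (elim ep)
  then have s: "t + ep * de : {0..1}" by simp
  have "EPoint e (t + ep * de) : U" using elim(2,5) L(3)[OF s] L(4)[OF s] by (simp add: edge_map_def)
  then show ?case using W elim(1,3,4) by auto
 qed
 then have eq: "edge_weight S D e t de = q * mm" by simp
 have lin: "dirder (tslope f (spt i t) ps) (de *R sdir i) (inward i)
   = q * dirder (tslope f (spt i t) ph) (de *R sdir i) (inward i)" if l: "(f, i) : edge_link S e" for f i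
  using dirder_dirder_linear[OF convex_std edge_linkD(4)[OF l t] con[OF l] con[OF l]
    sdir_tangent(1)[OF d edge_linkD(2)[OF l]] room_one sdir_tangent(2)[OF d edge_linkD(2)[OF l]], of q 0]
  unfolding tslope_def U(4) by simp
 have "has_dir (%s. q * ph (edge_map S e s) + 0 * ph (edge_map S e s)) t de
   (q * dirder (%s. ph (edge_map S e s)) t de + 0 * dirder (%s. ph (edge_map S e s)) t de)"
  by (rule has_dir_linear[OF has_dir_self[OF edge_has_dir[OF l d con[OF l]]] has_dir_self[OF edge_has_dir[OF l d con[OF l]]]])
 then have lin': "dirder (%s. ps (edge_map S e s)) t de = q * dirder (%s. ph (edge_map S e s)) t de"
  unfolding U(4) using has_dir_dirder by fastforce
 have "(SUM (f, i):edge_link S e. dirder (tslope f (spt i t) ps) (de *R sdir i) (inward i))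
  = q * (SUM (f, i):edge_link S e. dirder (tslope f (spt i t) ph) (de *R sdir i) (inward i))"
  unfolding sum_distrib_left by (intro sum.cong) (use lin in auto)
 then show ?thesis unfolding eq mm_def lin' by (simp add: algebra_simps)
qed

end

section \<open>Self-intersection\<close>

locale divisor_splitting = ct_surface S for S :: "('v, 'e, 'f) surface_data" +
 fixes D :: "('e, 'f) segment_sum" and Ps :: "('v, 'e, 'f) point => ('v, 'e, 'f) point => real"
  and Th :: "('v, 'e, 'f) point => real" and g :: "'f => real \<times> real => real \<times> real" and c :: "'f => real \<times> real => real"
 assumes valid: "ALL sg:keys D. valid_segment S sg"
  and le: "!!p. p : points S ==> local_equation S D p (Ps p)"
  and split: "!!f y. f : tris S ==> y : std ==> \<forall>\<^sub>F z in nhds y. z : std -->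
   Ps (tri_map S f y) (tri_map S f z) = Th (tri_map S f z) + (c f y + g f y \<bullet> z)"
begin

lemma Psi_conic:
 assumes f: "f : tris S" and y: "y : std"
 shows "conic_near std (%x. Ps (tri_map S f y) (tri_map S f x)) y"
proof -
 have "tri_map S f y : points S" using f y by (rule tri_map_points)
 then have "local_equation S D (tri_map S f y) (Ps (tri_map S f y))" by (rule le)
 then show ?thesis using f y by (rule local_equation_conic)
qed

lemma Theta_conic:
 assumes f: "f : tris S" "y : std"
 shows "conic_near std (%x. Th (tri_map S f x)) y"
 unfolding conic_near_def
 using Psi_conic[OF f, unfolded conic_near_def] split[OF f, THEN eventually_eventually[THEN iffD2]]
proof eventually_elim
 case (elim z)
 show ?case
 proof
  assume z: "z : std"
  have aff: "affine_function (%x. c f y + g f y \<bullet> x)" unfolding affine_function_def by blast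
  have "conic_at std (%x. 1 * Ps (tri_map S f y) (tri_map S f x) + (-1) * (c f y + g f y \<bullet> x)) z"
   by (rule conic_at_linear[OF elim(1)[rule_format, OF z] conic_at_affine[OF aff]])
  then show "conic_at std (%x. Th (tri_map S f x)) z"
   by (rule conic_at_cong[OF _ convex_std z]) (use elim(2) in eventually_elim, simp)
 qed
qed

lemma slope_split:
 assumes f: "f : tris S" and y: "y : std"
  and germ: "\<forall>\<^sub>F z in nhds y. z : std --> ps (tri_map S f z) = Th (tri_map S f z) + (c0 + g0 \<bullet> z)"
  and r: "r : tangent std y"
 shows "tslope f y ps r = tslope f y Th r + g0 \<bullet> r"
  "et > 0 ==> r + et *R w : tangent std y ==>
   dirder (tslope f y ps) r w = dirder (tslope f y Th) r w + g0 \<bullet> w"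
proof -
 have s: "tslope f y ps v = tslope f y Th v + g0 \<bullet> v" if v: "v : tangent std y" for v
 proof -
  obtain de where d: "de > 0" "!!t. 0 <= t ==> t <= de ==> y + t *R v : std"
   by (rule tangentD[OF convex_std y v]) blast
  have lim: "((%t. y + t *R v) \<longlongrightarrow> y) (at_right 0)" by (auto intro!: tendsto_eq_intros)
  have h: "has_dir (%x. Th (tri_map S f x)) y v (tslope f y Th v)"
   unfolding tslope_def by (rule conic_has_dir[OF convex_std y conic_near_at[OF Theta_conic[OF f y] y] v])
  have y0: "ps (tri_map S f y) = Th (tri_map S f y) + (c0 + g0 \<bullet> y)" using eventually_nhds_x_imp_x[OF germ] y by blast
  have "\<forall>\<^sub>F t in at_right 0. t < de" using d(1) unfolding at_right_0_iff by blast
  then have "has_dir (%x. ps (tri_map S f x)) y v (tslope f y Th v + g0 \<bullet> v)"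
   unfolding has_dir_def using h[unfolded has_dir_def] nhds_compose[OF lim germ] eventually_at_right_less[of 0]
  proof eventually_elim
   case (elim t)
   have "y + t *R v : std" using d(2) elim by simp
   with elim(3) have "ps (tri_map S f (y + t *R v)) = Th (tri_map S f (y + t *R v)) + (c0 + g0 \<bullet> (y + t *R v))" by blast
   also have "... = ps (tri_map S f y) + t * (tslope f y Th v + g0 \<bullet> v)"
    unfolding elim(2) y0 by (simp add: inner_add_right algebra_simps)
   finally show ?case .
  qed
  then show ?thesis unfolding tslope_def[of f y ps] by (rule has_dir_dirder)
 qed
 show "tslope f y ps r = tslope f y Th r + g0 \<bullet> r" by (rule s[OF r])
 show "dirder (tslope f y ps) r w = dirder (tslope f y Th) r w + g0 \<bullet> w"
  if w: "et > 0" "r + et *R w : tangent std y"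
 proof (rule has_dir_dirder)
  have h: "has_dir (tslope f y Th) r w (dirder (tslope f y Th) r w)"
   using dirder_dirder(2)[OF convex_std y Theta_conic[OF f y, unfolded conic_near_def] r w] by (simp add: tslope_def)
  have "\<forall>\<^sub>F t in at_right 0. t < et" using w(1) unfolding at_right_0_iff by blast
  then show "has_dir (tslope f y ps) r w (dirder (tslope f y Th) r w + g0 \<bullet> w)"
   unfolding has_dir_def using h[unfolded has_dir_def] eventually_at_right_less[of 0]
  proof eventually_elim
   case (elim t)
   have "r + t *R w : tangent std y"
    by (rule tangent_between[OF convex_std y r w]) (use elim in auto)
   from s[OF this] show ?case unfolding elim(2) s[OF r] by (simp add: inner_add_right algebra_simps)
  qed
 qed
qed

definition edge_slope where "edge_slope e t de = dirder (%s. Th (edge_map S e s)) t de"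

definition edge_bend where
 "edge_bend e t de = (SUM (f, i):edge_link S e. dirder (tslope f (spt i t) Th) (de *R sdir i) (inward i))
  - of_int (alpha S e True) * (de * edge_slope e t de)"

lemma edge_split:
 assumes le': "local_equation S D (edge_map S e t) ps" and e: "e : edges S" and d: "dir_ok t de"
  and germ: "!!f i. (f, i) : edge_link S e ==> \<forall>\<^sub>F z in nhds (spt i t). z : std -->
   ps (tri_map S f z) = Th (tri_map S f z) + (c0 f i + g0 f i \<bullet> z)"
 shows "(f, i) : edge_link S e ==> dirder (%s. ps (edge_map S e s)) t de = edge_slope e t de + de * (g0 f i \<bullet> sdir i)"
  "(f, i) : edge_link S e ==> edge_weight S D e t de = edge_bend e t de
   + ((SUM (f, i):edge_link S e. g0 f i \<bullet> inward i) - of_int (alpha S e True) * (g0 f i \<bullet> sdir i))"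
proof -
 note t = room(3)[OF d]
 have A: "dirder (%s. ps (edge_map S e s)) t de = edge_slope e t de + de * (g0 f i \<bullet> sdir i)"
  if l: "(f, i) : edge_link S e" for f i
 proof -
  note L = edge_linkD[OF l]
  have c1: "conic_near std (%x. ps (tri_map S f x)) (spt i t)"
   by (rule local_equation_conic[where D = D, OF _ L(1) L(4)[OF t]]) (simp only: L(3)[OF t] le')
  show ?thesis
   using has_dir_dirder[OF edge_has_dir[OF l d c1]] has_dir_dirder[OF edge_has_dir[OF l d Theta_conic[OF L(1) L(4)[OF t]]]]
    slope_split(1)[OF L(1) L(4)[OF t] germ[OF l] sdir_tangent(1)[OF d L(2)]]
   by (simp add: edge_slope_def)
 qed
 show "(f, i) : edge_link S e ==> dirder (%s. ps (edge_map S e s)) t de = edge_slope e t de + de * (g0 f i \<bullet> sdir i)"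
  by (rule A)
 assume l: "(f, i) : edge_link S e"
 have B: "dirder (tslope f (spt i t) ps) (de *R sdir i) (inward i)
   = dirder (tslope f (spt i t) Th) (de *R sdir i) (inward i) + g0 f i \<bullet> inward i"
  if l: "(f, i) : edge_link S e" for f i
  by (rule slope_split(2)[OF edge_linkD(1)[OF l] edge_linkD(4)[OF l t] germ[OF l] sdir_tangent(1)[OF d edge_linkD(2)[OF l]]
     room_one sdir_tangent(2)[OF d edge_linkD(2)[OF l]]])
 have "(SUM (f, i):edge_link S e. dirder (tslope f (spt i t) ps) (de *R sdir i) (inward i))
  = (SUM (f, i):edge_link S e. dirder (tslope f (spt i t) Th) (de *R sdir i) (inward i))
   + (SUM (f, i):edge_link S e. g0 f i \<bullet> inward i)"
  unfolding sum.distrib[symmetric] by (intro sum.cong) (use B in auto)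
 moreover have "de * (edge_slope e t de + de * x) = de * edge_slope e t de + x" for x
  using room(4)[OF d] by (simp add: distrib_left flip: mult.assoc)
 ultimately show "edge_weight S D e t de = edge_bend e t de
   + ((SUM (f, i):edge_link S e. g0 f i \<bullet> inward i) - of_int (alpha S e True) * (g0 f i \<bullet> sdir i))"
  unfolding edge_relation[OF valid le' e d] A[OF l] edge_bend_def by (simp add: algebra_simps)
qed

definition chart where "chart e = (SOME x. x : edge_link S e)"

definition chi where "chi e t = g (fst (chart e)) (spt (snd (chart e)) t) \<bullet> sdir (snd (chart e))"

definition mult_edge where
 "mult_edge e t = (SUM (f, i):edge_link S e. g f (spt i t) \<bullet> inward i) - of_int (alpha S e True) * chi e t"

lemma chart: "e : edges S ==> (fst (chart e), snd (chart e)) : edge_link S e"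
 by (simp add: chart_def some_in_eq edge_link_nonempty)

lemma germ_side:
 assumes l: "(f, i) : edge_link S e" and t: "t : {0..1}"
 shows "\<forall>\<^sub>F z in nhds (spt i t). z : std -->
  Ps (edge_map S e t) (tri_map S f z) = Th (tri_map S f z) + (c f (spt i t) + g f (spt i t) \<bullet> z)"
 using split[OF edge_linkD(1)[OF l] edge_linkD(4)[OF l t]] unfolding edge_linkD(3)[OF l t] .

lemma dir_ok_exists: "t : {0..1} ==> EX de. dir_ok t de"
 unfolding dir_ok_def by (cases "t < 1") auto

lemma chi_eq:
 assumes e: "e : edges S" and l: "(f, i) : edge_link S e" and t: "t : {0..1}"
 shows "g f (spt i t) \<bullet> sdir i = chi e t"
proof -
 obtain de where d: "dir_ok t de" using dir_ok_exists[OF t] by blast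
 have s: "dirder (%s. Ps (edge_map S e t) (edge_map S e s)) t de = edge_slope e t de + de * (g f (spt i t) \<bullet> sdir i)"
  if l: "(f, i) : edge_link S e" for f i
  using edge_split(1)[OF le[OF edge_map_points[OF e t]] e d, where ?c0.0 = "%f i. c f (spt i t)" and ?g0.0 = "%f i. g f (spt i t)",
   OF germ_side[OF _ t] l] by simp
 show ?thesis using s[OF l] s[OF chart[OF e]] room(5)[OF d] by (simp add: chi_def)
qed

lemma edge_slope_split:
 assumes e: "e : edges S" and d: "dir_ok t de"
 shows "edge_weight S D e t de = edge_bend e t de + mult_edge e t"
 using edge_split(2)[OF le[OF edge_map_points[OF e room(3)[OF d]]] e d, where ?c0.0 = "%f i. c f (spt i t)" and ?g0.0 = "%f i. g f (spt i t)",
   OF germ_side[OF _ room(3)[OF d]] chart[OF e]]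
 by (simp add: mult_edge_def chi_def)

lemma mult_edge_const:
 assumes e: "e : edges S" and t: "t : {0..1}"
 shows "mult_edge e t = mult_edge e 0"
proof (rule connected_local_const[where f = "mult_edge e" and A = "{0..1}" and a = t and b = 0])
 show "ALL t:{0..1}. \<forall>\<^sub>F t' in at t within {0..1}. mult_edge e t = mult_edge e t'"
 proof
  fix t :: real assume t: "t : {0..1}"
  define ps where "ps = Ps (edge_map S e t)"
  have ev: "\<forall>\<^sub>F t' in nhds t. ALL a:edge_link S e. \<forall>\<^sub>F z in nhds (spt (snd a) t'). z : std -->
   ps (tri_map S (fst a) z) = Th (tri_map S (fst a) z) + (c (fst a) (spt (snd a) t) + g (fst a) (spt (snd a) t) \<bullet> z)"
   (is "\<forall>\<^sub>F t' in nhds t. ALL a:edge_link S e. ?P a t'")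
  proof (rule eventually_ball_finite[OF fin_link], rule ballI)
   fix a assume a: "a : edge_link S e"
   show "\<forall>\<^sub>F t' in nhds t. ?P a t'"
    using nhds_compose[OF tendsto_side_point germ_side[of "fst a" "snd a" e t, THEN eventually_eventually[THEN iffD2]]] a t
    unfolding ps_def by simp
  qed
  obtain f i where l: "(f, i) : edge_link S e" using chart[OF e] by blast
  note L = edge_linkD[OF l]
  have "local_equation S D (tri_map S f (spt i t)) ps"
   unfolding ps_def L(3)[OF t] by (rule le[OF edge_map_points[OF e t]])
  from nhds_compose[OF tendsto_side_point local_equation_nearby[OF this L(1) L(4)[OF t]]]
  have "\<forall>\<^sub>F t' in nhds t. spt i t' : std --> local_equation S D (tri_map S f (spt i t')) ps" .
  with ev have "\<forall>\<^sub>F t' in nhds t. t' : {0..1} --> mult_edge e t = mult_edge e t'"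
  proof eventually_elim
   case (elim t')
   show ?case
   proof
    assume t': "t' : {0..1}"
    have le': "local_equation S D (edge_map S e t') ps" using elim(2) L(3)[OF t'] L(4)[OF t'] by simp
    obtain de where d: "dir_ok t' de" using dir_ok_exists[OF t'] by blast
    have gm: "\<forall>\<^sub>F z in nhds (spt i t'). z : std --> ps (tri_map S f z) = Th (tri_map S f z)
      + (c f (spt i t) + g f (spt i t) \<bullet> z)" if "(f, i) : edge_link S e" for f i
     using bspec[OF elim(1) that] by simp
    have "edge_weight S D e t' de = edge_bend e t' de + mult_edge e t"
     using edge_split(2)[OF le' e d, where ?c0.0 = "%f i. c f (spt i t)" and ?g0.0 = "%f i. g f (spt i t)", OF gm chart[OF e]]
     by (simp add: mult_edge_def chi_def)
    then show "mult_edge e t = mult_edge e t'" using edge_slope_split[OF e d] by simp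
   qed
  qed
  then show "\<forall>\<^sub>F t' in at t within {0..1}. mult_edge e t = mult_edge e t'"
   unfolding eventually_at_filter by eventually_elim simp
 qed
qed (use t in auto)

end

lemma lattice_pair: "a : \<int> ==> b : \<int> ==> (a, b) : int_vec"
 unfolding int_vec_def by (auto elim!: Ints_cases)

lemma lattice_uminus: "u : int_vec ==> - u : int_vec"
proof -
 assume "u : int_vec"
 then obtain m n :: int where "u = (of_int m, of_int n)" by (auto simp: int_vec_def)
 then have "- u = (of_int (- m), of_int (- n))" by simp
 then show ?thesis unfolding int_vec_def by blast
qed

lemma primitiveI:
 assumes u: "u : int_vec" and w: "w : int_vec" and d: "\<bar>det2 u w\<bar> = 1"
 shows "u : primitive"
proof -
 obtain m n :: int where mn: "u = (of_int m, of_int n)" using u unfolding int_vec_def by blast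
 obtain m' n' :: int where mn': "w = (of_int m', of_int n')" using w unfolding int_vec_def by blast
 have "\<bar>real_of_int (m * n' - n * m')\<bar> = 1" using d by (simp add: det2_def mn mn')
 then have one: "\<bar>m * n' - n * m'\<bar> = 1" by linarith
 have "coprime m n"
 proof (rule coprimeI)
  fix k assume "k dvd m" "k dvd n"
  then have "k dvd m * n' - n * m'" by simp
  then have "k dvd \<bar>m * n' - n * m'\<bar>" by simp
  then show "is_unit k" unfolding one .
 qed
 then show ?thesis using mn unfolding primitive_def by blast
qed

lemma finite_parallel_primitive:
 assumes "x ~= 0"
 shows "finite {u : primitive. det2 u x = 0}"
proof (cases "EX u0:primitive. det2 u0 x = 0")
 case True
 then obtain u0 where u0: "u0 : primitive" "det2 u0 x = 0" by blast
 have "u = u0 \<or> u = - u0" if u: "u : primitive" "det2 u x = 0" for u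
 proof -
  obtain nuv where nuv: "x = nuv *R u0" using det2_zero_parallel[OF u0(2) primitive_nonzero[OF u0(1)]] by blast
  have "det2 u0 u = 0" using u(2) assms unfolding nuv by (auto simp: det2_def algebra_simps)
  then obtain mm where mm: "u = mm *R u0" using det2_zero_parallel primitive_nonzero[OF u0(1)] by blast
  show ?thesis by (rule parallel_primitive[OF u0(1) u(1) mm])
 qed
 then have "{u : primitive. det2 u x = 0} <= {u0, - u0}" by blast
 then show ?thesis by (rule finite_subset) simp
next
 case False
 then have "{u : primitive. det2 u x = 0} = {}" by blast
 then show ?thesis by (simp only: finite.emptyI)
qed

lemma det2_coords:
 assumes "det2 q w ~= 0"
 shows "u = (det2 u w / det2 q w) *R q + (det2 q u / det2 q w) *R w"
proof -
 have "det2 q w *R u = det2 u w *R q + det2 q u *R w"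
  by (simp add: det2_def prod_eq_iff algebra_simps)
 then have "(1 / det2 q w) *R (det2 q w *R u) = (1 / det2 q w) *R (det2 u w *R q + det2 q u *R w)" by simp
 then show ?thesis using assms by (simp add: scaleR_add_right)
qed

lemma open_cone_iff:
 assumes "det2 q w ~= 0"
 shows "u : open_cone q w <-> det2 u w / det2 q w > 0 & det2 q u / det2 q w > 0"
proof
 assume "u : open_cone q w"
 then obtain a b where ab: "u = a *R q + b *R w" "a > 0" "b > 0" by (auto simp: open_cone_def)
 have "det2 u w = a * det2 q w" "det2 q u = b * det2 q w" unfolding ab(1) det2_linear by simp_all
 then show "det2 u w / det2 q w > 0 & det2 q u / det2 q w > 0" using ab assms by simp
next
 assume "det2 u w / det2 q w > 0 & det2 q u / det2 q w > 0"
 then show "u : open_cone q w" unfolding open_cone_def using det2_coords[OF assms, of u] by blast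
qed

lemma half_plane_sum:
 assumes d: "det2 q w ~= 0" and w: "w : primitive" and U: "finite \<U>" "\<U> <= primitive" "w ~: \<U> ==> F w = 0"
 shows "(SUM u:{u : \<U>. det2 q u / det2 q w > 0}. F u :: real)
  = (SUM u:\<U> Int open_cone q w. F u) + (SUM u:\<U> Int open_cone w (- q). F u) + F w"
proof -
 have d': "det2 w (- q) = det2 q w" "!!u. det2 u (- q) = det2 q u" by (simp_all add: det2_def)
 have d0: "det2 w (- q) ~= 0" using d d' by simp
 have c1: "u : open_cone q w <-> det2 u w / det2 q w > 0 & det2 q u / det2 q w > 0" for u by (rule open_cone_iff[OF d])
 have c2: "u : open_cone w (- q) <-> det2 q u / det2 q w > 0 & det2 u w / det2 q w < 0" for u
  unfolding open_cone_iff[OF d0] d' using det2_commute[of u w] by simp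
 have ray: "u = w" if u: "u : \<U>" "det2 q u / det2 q w > 0" "det2 u w / det2 q w = 0" for u
 proof -
  have e: "u = (det2 q u / det2 q w) *R w" using det2_coords[OF d, of u] u(3) by simp
  then have "(det2 q u / det2 q w) *R w : primitive" using u(1) U(2) by auto
  then have "det2 q u / det2 q w = 1" using primitive_multiple[OF w] u(2) by blast
  then show ?thesis using e by simp
 qed
 have ww: "det2 q w / det2 q w > 0" "det2 w w / det2 q w = 0" using d by simp_all
 have "u : \<U> & det2 q u / det2 q w > 0 <-> u : \<U> & (u : open_cone q w \<or> u : open_cone w (- q) \<or> u = w)" for u
 proof (cases "u = w")
  case False
  then have "u : \<U> ==> det2 q u / det2 q w > 0 ==> det2 u w / det2 q w ~= 0" using ray by blast
  then show ?thesis unfolding c1 c2 using False linorder_neqE_linordered_idom by blast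
 qed (use ww(1) in blast)
 then have "{u : \<U>. det2 q u / det2 q w > 0} = (\<U> Int open_cone q w Un \<U> Int open_cone w (- q)) Un \<U> Int {w}" by blast
 moreover have "(\<U> Int open_cone q w) Int (\<U> Int open_cone w (- q)) = {}" using c1 c2 by fastforce
 moreover have "(\<U> Int open_cone q w Un \<U> Int open_cone w (- q)) Int (\<U> Int {w}) = {}" using c1[of w] c2[of w] ww(2) by auto
 moreover have "(SUM u:\<U> Int {w}. F u) = F w" using U(3) by (cases "w : \<U>") auto
 ultimately show ?thesis using U(1) by (simp add: sum.union_disjoint)
qed

lemma interior_side_inward: "i < 3 ==> int_tri (spt i s + v *R inward i) <-> 0 < s & 0 < v & s + v < 1"
 unfolding side_inward by (erule less_3_cases) (auto simp: int_tri_def)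

lemma side_vectors:
 assumes "i < 3"
 shows "sdir i : int_vec" "inward i : int_vec" "\<bar>det2 (sdir i) (inward i)\<bar> = 1"
 using assms
 by (auto elim!: less_3_cases simp: sdir_def inward_def side_simps vertex_simps det2_def intro!: lattice_pair)

lemma tri_cone_side:
 assumes i: "i < 3" and t: "0 < t" "t < 1"
 shows "tri_cone (spt i t) (sdir i) (inward i)" "tri_cone (spt i t) (inward i) (- sdir i)"
  "int_tri (spt i t + ((1 - t) / 2) *R inward i)"
proof -
 note v = side_vectors[OF i]
 have int: "EX de>0. int_tri (spt i t + de *R (a *R sdir i + b *R inward i))" if b: "b > 0" for a b
 proof -
  define de where "de = min t (1 - t) / (2 * (\<bar>a\<bar> + b))"
  have de: "de > 0" using t b by (simp add: de_def)
  have m: "de * (2 * (\<bar>a\<bar> + b)) = min t (1 - t)" using b by (simp add: de_def)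
  have "\<bar>de * a\<bar> = de * \<bar>a\<bar>" using de by (simp add: abs_mult)
  moreover have "2 * (de * \<bar>a\<bar>) + 2 * (de * b) = min t (1 - t)" using m by (simp add: algebra_simps)
  moreover have "de * b > 0" using de b by simp
  ultimately have "0 < t + de * a" "t + de * a + de * b < 1" "0 < de * b" using t by linarith+
  moreover have "spt i t + de *R (a *R sdir i + b *R inward i) = spt i (t + de * a) + (de * b) *R inward i"
   by (simp add: side_point_shift scaleR_add_right)
  ultimately show ?thesis using de interior_side_inward[OF i] by (intro exI[of _ de]) simp
 qed
 have "dir_ok t 1" "dir_ok t (-1)" using t by (auto simp: dir_ok_def)
 then have tan: "sdir i : tangent std (spt i t)" "- sdir i : tangent std (spt i t)"
  using sdir_tangent(1)[OF _ i, of t 1] sdir_tangent(1)[OF _ i, of t "-1"] by simp_all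
 have "spt i t + (1 - t) *R inward i : std" unfolding side_inward_std[OF i] using t by simp
 then have tw: "inward i : tangent std (spt i t)" using t unfolding tangent_def by (intro CollectI exI[of _ "1 - t"]) simp
 show "tri_cone (spt i t) (sdir i) (inward i)"
  unfolding tri_cone_def using v tan tw int by blast
 have "\<bar>det2 (inward i) (- sdir i)\<bar> = 1" using v(3) by (simp add: det2_def algebra_simps)
 moreover have "EX de>0. int_tri (spt i t + de *R (a *R inward i + b *R (- sdir i)))" if "a > 0" for a b
  using int[OF that, of "- b"] by (simp add: algebra_simps)
 ultimately show "tri_cone (spt i t) (inward i) (- sdir i)"
  unfolding tri_cone_def using v tan tw lattice_uminus by blast
 show "int_tri (spt i t + ((1 - t) / 2) *R inward i)"
  unfolding interior_side_inward[OF i] using t by (auto simp: field_simps)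
qed

lemma tri_cone_corner:
 "tri_cone (0, 0) (1, 0) (0, 1)" "tri_cone (1, 0) (-1, 0) (-1, 1)" "tri_cone (0, 1) (0, -1) (1, -1)"
proof -
 have e: "EX de>0. int_tri (0 + de * a, 0 + de * b)" "EX de>0. int_tri (1 - de * (a + b), de * b)"
  "EX de>0. int_tri (de * b, 1 - de * (a + b))" if "a > 0" "b > 0" for a b :: real
 proof -
  define de where "de = 1 / (2 * (a + b))"
  have de: "de > 0" "de * (a + b) = 1/2" using that by (simp_all add: de_def)
  have p: "de * a > 0" "de * b > 0" "de * a + de * b = 1/2" using de that by (simp_all add: algebra_simps)
  have q: "de * b < 1/2" "0 < de * b" using p by linarith+
  have i: "int_tri (1 - de * (a + b), de * b)" "int_tri (de * b, 1 - de * (a + b))"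
   unfolding int_tri_def fst_conv snd_conv de(2) using q by (intro conjI; linarith)+
  show "EX de>0. int_tri (0 + de * a, 0 + de * b)"
   unfolding int_tri_def using de(1) p by (intro exI[of _ de] conjI) (simp_all only: fst_conv snd_conv add_0)
  show "EX de>0. int_tri (1 - de * (a + b), de * b)"
   using de(1) i(1) by blast
  show "EX de>0. int_tri (de * b, 1 - de * (a + b))"
   using de(1) i(2) by blast
 qed
 have T: "y + v : std ==> v : tangent std y" for y v :: "real \<times> real"
  unfolding tangent_def by (intro CollectI exI[of _ 1]) simp
 show "tri_cone (0, 0) (1, 0) (0, 1)" "tri_cone (1, 0) (-1, 0) (-1, 1)" "tri_cone (0, 1) (0, -1) (1, -1)"
  unfolding tri_cone_def using e
  by (auto simp: det2_def mem_std algebra_simps intro!: lattice_pair T)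
qed

context divisor_splitting
begin

definition dirs where
 "dirs = {u : primitive. EX f a b. TSegment f a b : keys D & det2 u (b - a) = 0}"

lemma finite_dirs: "finite dirs" and dirs_primitive: "dirs <= primitive"
proof -
 show "dirs <= primitive" by (auto simp: dirs_def)
 have "dirs <= (\<Union>sg\<in>keys D. case sg of ESegment _ _ _ => {} | TSegment f a b => {u : primitive. det2 u (b - a) = 0})"
  unfolding dirs_def by fastforce
 moreover have "finite ..."
 proof (rule finite_UN_I)
  fix sg assume "sg : keys D"
  then have "valid_segment S sg" using valid by blast
  then show "finite (case sg of ESegment _ _ _ => {} | TSegment f a b => {u : primitive. det2 u (b - a) = 0})"
  proof (cases sg)
   case (TSegment f a b)
   then have "b - a ~= 0" using \<open>valid_segment S sg\<close> by (auto simp only: valid_segment.simps right_minus_eq)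
   then show ?thesis unfolding TSegment segment.case by (rule finite_parallel_primitive)
  qed simp
 qed simp
 ultimately show "finite dirs" by (rule finite_subset)
qed

lemma germ_parallel:
 assumes "y : closed_segment a b" "u : tangent (closed_segment a b) y"
 obtains ta ta' de where "ta : {0..1}" "ta' : {0..1}" "de > 0" "y = (1 - ta) *R a + ta *R b"
  "y + de *R u = (1 - ta') *R a + ta' *R b" "de *R u = (ta' - ta) *R (b - a)"
proof -
 obtain ta where 1: "ta : {0..1}" "y = (1 - ta) *R a + ta *R b" using assms(1) by (auto simp: segment_image)
 obtain de where "de > 0" "y + de *R u : closed_segment a b" using assms(2) by (auto simp: tangent_def)
 then obtain ta' where 2: "de > 0" "ta' : {0..1}" "y + de *R u = (1 - ta') *R a + ta' *R b" by (auto simp: segment_image)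
 have "de *R u = (y + de *R u) - y" by simp
 also have "... = (ta' - ta) *R (b - a)" unfolding 2(3) unfolding 1(2) by (simp add: algebra_simps)
 finally show ?thesis using that 1 2 by blast
qed

lemma weight_nonzero:
 assumes W: "tri_weight D f y u ~= 0" and u: "u : primitive"
 shows "u : dirs" "EX de>0. y + de *R u : std & (ALL i<3. bary i y = 0 --> bary i (y + de *R u) > 0)"
proof -
 have "{sg. sg : keys D & in_germ (tri_seg sg f) y u} ~= {}" using W unfolding tri_weight_def by force
 then obtain sg where sg: "sg : keys D" "y : tri_seg sg f" "u : tangent (tri_seg sg f) y" by (auto simp: in_germ_def)
 then obtain a b where ab: "sg = TSegment f a b" "~ side_seg a b" "tri_seg sg f = closed_segment a b"
  by (cases sg) (auto split: if_splits)
 obtain ta ta' de where p: "ta : {0..1}" "ta' : {0..1}" "de > 0" "y = (1 - ta) *R a + ta *R b"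
  "y + de *R u = (1 - ta') *R a + ta' *R b" "de *R u = (ta' - ta) *R (b - a)"
  using germ_parallel[of y a b u] sg(2,3) ab(3) by metis
 have V: "a : std" "b : std" using valid sg(1) ab(1) by auto
 have "de *R u ~= 0" using p(3) primitive_nonzero[OF u] by simp
 then have ne: "ta ~= ta'" unfolding p(6) by auto
 have "de * det2 u (b - a) = det2 (de *R u) (b - a)" by (simp add: det2_def algebra_simps)
 also have "... = 0" unfolding p(6) by (simp add: det2_def algebra_simps)
 finally have "det2 u (b - a) = 0" using p(3) by simp
 then show "u : dirs" unfolding dirs_def using u sg(1) ab(1) by blast
 have std: "y + de *R u : std" unfolding p(5) using p(2) by (intro convexD[OF convex_std V]) auto
 have "bary i (y + de *R u) > 0" if i: "i < 3" "bary i y = 0" for i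
 proof (rule ccontr)
  assume "~ bary i (y + de *R u) > 0"
  then have "bary i (y + de *R u) = 0" using bary_std[OF std, of i] by linarith
  then have "bary i a = 0 & bary i b = 0" using bary_segment_zero[OF _ _ ne] i(2) unfolding p(4,5)[symmetric] by (metis p(4) p(5))
  then show False using ab(2) i(1) by (auto simp: side_seg_def)
 qed
 then show "EX de>0. y + de *R u : std & (ALL i<3. bary i y = 0 --> bary i (y + de *R u) > 0)"
  using p(3) std by blast
qed

definition tri_sum where "tri_sum f y = (SUM u:dirs. tri_weight D f y u * (g f y \<bullet> u))"

abbreviation Ths where "Ths f y \<equiv> tslope f y Th"

context
 fixes f y
 assumes f: "f : tris S" and y: "y : std"
begin

lemma le_chart: "local_equation S D (tri_map S f y) (Ps (tri_map S f y))"
 by (rule le[OF tri_map_points[OF f y]])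

lemma cone_sum_split:
 assumes cone: "tri_cone y q q'"
 shows "(SUM u:dirs Int open_cone q q'. tri_weight D f y u * (g f y \<bullet> u))
  = (g f y \<bullet> q) * (Ths f y q' - dirder (Ths f y) q q') + (g f y \<bullet> q') * (Ths f y q - dirder (Ths f y) q' q)"
proof -
 have t: "q : tangent std y" "q' : tangent std y" using cone by (auto simp: tri_cone_def)
 have tt: "q + 1 *R q' : tangent std y" "q' + 1 *R q : tangent std y"
  using tri_cone_tangent[OF cone y, of 1 1] by (simp_all add: add.commute)
 note s = slope_split[OF f y split[OF f y]]
 have CS: "(SUM u:dirs Int open_cone q q'. tri_weight D f y u * (g f y \<bullet> u))
  = (g f y \<bullet> q) * (tslope f y (Ps (tri_map S f y)) q' - dirder (tslope f y (Ps (tri_map S f y))) q q')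
   + (g f y \<bullet> q') * (tslope f y (Ps (tri_map S f y)) q - dirder (tslope f y (Ps (tri_map S f y))) q' q)"
  by (rule cone_sum[OF valid le_chart f y cone finite_dirs dirs_primitive]) (rule weight_nonzero(1))
 show ?thesis
  unfolding CS s(1)[OF t(1)] s(1)[OF t(2)] s(2)[OF t(1) room_one tt(1)] s(2)[OF t(2) room_one tt(2)]
  by simp
qed

lemma bend_split:
 assumes r: "r : primitive" "de > 0" "int_tri (y + de *R r)" and w: "w : int_vec" "\<bar>det2 r w\<bar> = 1"
 shows "tri_weight D f y r = dirder (Ths f y) r w + dirder (Ths f y) r (- w)"
proof -
 have s: "dirder (tslope f y (Ps (tri_map S f y))) r v = dirder (Ths f y) r v + g f y \<bullet> v" for v
 proof -
  obtain et where et: "et > 0" "!!t. \<bar>t\<bar> <= et ==> r + t *R v : tangent std y"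
   by (rule interior_direction[OF r(3,2)]) blast
  show ?thesis using slope_split(2)[OF f y split[OF f y], of r et v] et(2)[of 0] et(2)[of et] et(1) by simp
 qed
 have B: "tri_weight D f y r = dirder (Ths f y) r v + dirder (Ths f y) r (- v)" if "v : int_vec" "det2 r v = 1" for v
  using bend[OF valid le_chart f y r that] s[of v] s[of "- v"] by (simp add: tslope_def)
 show ?thesis
 proof (cases "det2 r w = 1")
  case False
  then have "det2 r (- w) = 1" using w(2) by (simp add: det2_def abs_if split: if_splits)
  then show ?thesis using B[OF lattice_uminus[OF w(1)]] by simp
 qed (use B w in simp)
qed

lemma half_plane_value:
 assumes c: "tri_cone y q w" "tri_cone y w (- q)" and int: "de > 0" "int_tri (y + de *R w)"
 shows "(SUM u:{u : dirs. det2 q u / det2 q w > 0}. tri_weight D f y u * (g f y \<bullet> u))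
  = (g f y \<bullet> q) * (dirder (Ths f y) (- q) w - dirder (Ths f y) q w) + (g f y \<bullet> w) * (Ths f y q + Ths f y (- q))"
proof -
 have l: "q : int_vec" "w : int_vec" "\<bar>det2 q w\<bar> = 1" using c(1) by (auto simp: tri_cone_def)
 have d: "det2 q w ~= 0" "\<bar>det2 w q\<bar> = 1" using l(3) det2_commute[of w q] by auto
 have w: "w : primitive" by (rule primitiveI[OF l(2,1) d(2)])
 have "(SUM u:{u : dirs. det2 q u / det2 q w > 0}. tri_weight D f y u * (g f y \<bullet> u))
  = (SUM u:dirs Int open_cone q w. tri_weight D f y u * (g f y \<bullet> u))
   + (SUM u:dirs Int open_cone w (- q). tri_weight D f y u * (g f y \<bullet> u)) + tri_weight D f y w * (g f y \<bullet> w)"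
  by (rule half_plane_sum[OF d(1) w finite_dirs dirs_primitive]) (use weight_nonzero(1)[of f y w, OF _ w] in \<open>cases "tri_weight D f y w = 0"; simp\<close>)
 then show ?thesis
  unfolding cone_sum_split[OF c(1)] cone_sum_split[OF c(2)] bend_split[OF w int l(1) d(2)]
  by (simp add: algebra_simps)
qed

lemma tri_sum_interior:
 assumes int: "int_tri y"
 shows "tri_sum f y = 0"
proof -
 define p where "p = ((1, 0) :: real \<times> real)"
 define w where "w = ((0, 1) :: real \<times> real)"
 have l: "p : int_vec" "w : int_vec" "- p : int_vec" "- w : int_vec"
  by (auto simp: p_def w_def intro!: lattice_pair)
 have P: "p : primitive" "- p : primitive"
  using l by (auto intro!: primitiveI[OF _ l(2)] simp: p_def w_def det2_def)
 have ray: "EX de>0. int_tri (y + de *R v)" if v: "v : int_vec" "v' : int_vec" "\<bar>det2 v v'\<bar> = 1" for v v'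
 proof -
  obtain ro where ro: "ro > 0" "!!v. norm v < ro ==> int_tri (y + v)" by (rule int_tri_ball[OF int]) blast
  have "norm v > 0" using primitive_nonzero[OF primitiveI[OF v]] by simp
  then show ?thesis using ro by (intro exI[of _ "ro / (2 * norm v)"]) auto
 qed
 obtain de1 where d1: "de1 > 0" "int_tri (y + de1 *R w)" using ray[OF l(2,1)] by (auto simp: p_def w_def det2_def)
 obtain de2 where d2: "de2 > 0" "int_tri (y + de2 *R (- w))" using ray[OF l(4,1)] by (auto simp: p_def w_def det2_def)
 obtain de3 where d3: "de3 > 0" "int_tri (y + de3 *R p)" using ray[OF l(1,2)] by (auto simp: p_def w_def det2_def)
 obtain de4 where d4: "de4 > 0" "int_tri (y + de4 *R (- p))" using ray[OF l(3,2)] by (auto simp: p_def w_def det2_def)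
 have C: "tri_cone y p w" "tri_cone y w (- p)" "tri_cone y p (- w)" "tri_cone y (- w) (- p)"
  using l by (auto intro!: tri_cone_interior int simp: p_def w_def det2_def)
 have det: "\<bar>det2 p w\<bar> = 1" "\<bar>det2 (- p) w\<bar> = 1" by (auto simp: p_def w_def det2_def)
 let ?F = "%u. tri_weight D f y u * (g f y \<bullet> u)"
 have axis: "u = p \<or> u = - p" if "u : dirs" "snd u = 0" for u
 proof -
  have u: "u = fst u *R p" using that(2) by (auto simp: p_def prod_eq_iff)
  show ?thesis by (rule parallel_primitive[OF P(1) _ u]) (use that(1) dirs_primitive in blast)
 qed
 have s: "det2 p u / det2 p w = snd u" "det2 p u / det2 p (- w) = - snd u" for u by (simp_all add: p_def w_def det2_def)
 have pn: "p ~= - p" "snd p = 0" by (auto simp: p_def)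
 have "(SUM u:{u : dirs. snd u = 0}. ?F u) = (SUM u:{p, - p}. ?F u)"
 proof (rule sum.mono_neutral_left)
  show "ALL u:{p, - p} - {u : dirs. snd u = 0}. ?F u = 0"
  proof
   fix u assume u: "u : {p, - p} - {u : dirs. snd u = 0}"
   then have "u : primitive" "u ~: dirs" using P pn by auto
   then have "tri_weight D f y u = 0" using weight_nonzero(1)[of f y u] by blast
   then show "?F u = 0" by simp
  qed
  show "{u : dirs. snd u = 0} <= {p, - p}" using axis by blast
 qed simp
 then have ax: "(SUM u:{u : dirs. snd u = 0}. ?F u) = (tri_weight D f y p - tri_weight D f y (- p)) * (g f y \<bullet> p)"
  using pn by (simp add: algebra_simps)
 have "dirs = ({u : dirs. snd u > 0} Un {u : dirs. - snd u > 0}) Un {u : dirs. snd u = 0}" by auto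
 then have "tri_sum f y = sum ?F (({u : dirs. snd u > 0} Un {u : dirs. - snd u > 0}) Un {u : dirs. snd u = 0})"
  unfolding tri_sum_def by simp
 also have "... = (SUM u:{u : dirs. snd u > 0}. ?F u) + (SUM u:{u : dirs. - snd u > 0}. ?F u) + (SUM u:{u : dirs. snd u = 0}. ?F u)"
  using finite_dirs by (subst sum.union_disjoint; (subst sum.union_disjoint)?) auto
 also have "... = 0"
  unfolding ax half_plane_value[OF C(1,2) d1, unfolded s] half_plane_value[OF C(3,4) d2, unfolded s]
   bend_split[OF P(1) d3 l(2) det(1)] bend_split[OF P(2) d4 l(2) det(2)]
  by (simp add: algebra_simps)
 finally show ?thesis .
qed

end

lemma tri_sum_side:
 assumes f: "f : tris S" and i: "i < 3" and t: "0 < t" "t < 1"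
 defines "y \<equiv> spt i t"
 shows "tri_sum f y = (g f y \<bullet> sdir i) * (dirder (Ths f y) (- sdir i) (inward i) - dirder (Ths f y) (sdir i) (inward i))
  + (g f y \<bullet> inward i) * (Ths f y (sdir i) + Ths f y (- sdir i))"
proof -
 have y: "y : std" unfolding y_def using side_point_std[OF i] t by simp
 note c = tri_cone_side[OF i t, folded y_def]
 have h: "(1 - t) / 2 > 0" using t by simp
 let ?bt = "%u. det2 (sdir i) u / det2 (sdir i) (inward i)"
 have bt: "bary i (y + de *R u) = de * ?bt u" for de u
  unfolding y_def using i by (elim less_3_cases)
   (simp_all add: bary_def det2_def sdir_def inward_def side_simps vertex_simps algebra_simps)
 have "tri_sum f y = (SUM u:{u : dirs. ?bt u > 0}. tri_weight D f y u * (g f y \<bullet> u))"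
  unfolding tri_sum_def
 proof (rule sum.mono_neutral_right[OF finite_dirs])
  show "ALL u:dirs - {u : dirs. ?bt u > 0}. tri_weight D f y u * (g f y \<bullet> u) = 0"
  proof
   fix u assume u: "u : dirs - {u : dirs. ?bt u > 0}"
   have "tri_weight D f y u = 0"
   proof (rule ccontr)
    assume W: "tri_weight D f y u ~= 0"
    have "u : primitive" using u dirs_primitive by blast
    from weight_nonzero(2)[OF W this] obtain de where "de > 0" "bary i y = 0 --> bary i (y + de *R u) > 0" using i by blast
    moreover have "bary i y = 0" unfolding y_def by (rule side_point_coords(2)[OF i])
    ultimately have "?bt u > 0" using bt[of de u] zero_less_mult_pos[of de "?bt u"] by metis
    then show False using u by simp
   qed
   then show "tri_weight D f y u * (g f y \<bullet> u) = 0" by simp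
  qed
 qed auto
 also have "... = (g f y \<bullet> sdir i) * (dirder (Ths f y) (- sdir i) (inward i) - dirder (Ths f y) (sdir i) (inward i))
  + (g f y \<bullet> inward i) * (Ths f y (sdir i) + Ths f y (- sdir i))"
  by (rule half_plane_value[OF f y c(1,2) h c(3)])
 finally show ?thesis .
qed

definition cone_term where
 "cone_term f y q q' = (g f y \<bullet> q) * (Ths f y q' - dirder (Ths f y) q q')"

definition corner_terms where
 "corner_terms f i = cone_term f (spt i 0) (sdir i) (inward i)
  + cone_term f (spt i 1) (- sdir i) (inward i - sdir i)"

lemma tri_sum_corner:
 assumes f: "f : tris S"
 shows "tri_sum f (0, 0) = cone_term f (0, 0) (1, 0) (0, 1) + cone_term f (0, 0) (0, 1) (1, 0)"
  "tri_sum f (1, 0) = cone_term f (1, 0) (-1, 0) (-1, 1) + cone_term f (1, 0) (-1, 1) (-1, 0)"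
  "tri_sum f (0, 1) = cone_term f (0, 1) (0, -1) (1, -1) + cone_term f (0, 1) (1, -1) (0, -1)"
proof -
 have E: "tri_sum f y = cone_term f y q q' + cone_term f y q' q"
  if c: "tri_cone y q q'" and y: "y : std"
   and in_cone: "!!u de. de > 0 ==> (ALL i<3. bary i y = 0 --> bary i (y + de *R u) > 0) ==> u : open_cone q q'" for y q q'
 proof -
  have "tri_sum f y = (SUM u:dirs Int open_cone q q'. tri_weight D f y u * (g f y \<bullet> u))"
   unfolding tri_sum_def
  proof (rule sum.mono_neutral_right[OF finite_dirs])
   show "ALL u:dirs - dirs Int open_cone q q'. tri_weight D f y u * (g f y \<bullet> u) = 0"
   proof
    fix u assume u: "u : dirs - dirs Int open_cone q q'"
    have "tri_weight D f y u = 0"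
    proof (rule ccontr)
     assume W: "tri_weight D f y u ~= 0"
     have "u : primitive" using u dirs_primitive by blast
     from weight_nonzero(2)[OF W this] show False using in_cone u by blast
    qed
    then show "tri_weight D f y u * (g f y \<bullet> u) = 0" by simp
   qed
  qed auto
  then show ?thesis unfolding cone_sum_split[OF f y c] by (simp add: cone_term_def)
 qed
 have b: "(0::nat) < 3" "(1::nat) < 3" "(2::nat) < 3" by auto
 have m: "(0, 0) : std" "(1, 0) : std" "(0, 1) : std" by (auto simp: mem_std)
 show "tri_sum f (0, 0) = cone_term f (0, 0) (1, 0) (0, 1) + cone_term f (0, 0) (0, 1) (1, 0)"
 proof (rule E[OF tri_cone_corner(1) m(1)])
  fix u :: "real \<times> real" and de :: real assume d: "de > 0" and B: "ALL i<3. bary i (0, 0) = 0 --> bary i ((0, 0) + de *R u) > 0"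
  have "fst u > 0" "snd u > 0" using B[rule_format, OF b(2)] B[rule_format, OF b(3)] d by (auto simp: bary_def zero_less_mult_iff)
  then show "u : open_cone (1, 0) (0, 1)" by (subst open_cone_iff) (auto simp: det2_def)
 qed
 show "tri_sum f (1, 0) = cone_term f (1, 0) (-1, 0) (-1, 1) + cone_term f (1, 0) (-1, 1) (-1, 0)"
 proof (rule E[OF tri_cone_corner(2) m(2)])
  fix u :: "real \<times> real" and de :: real assume d: "de > 0" and B: "ALL i<3. bary i (1, 0) = 0 --> bary i ((1, 0) + de *R u) > 0"
  have "de * (- fst u - snd u) > 0" "snd u > 0" using B[rule_format, OF b(1)] B[rule_format, OF b(3)] d
   by (auto simp: bary_def zero_less_mult_iff algebra_simps)
  then have "- fst u - snd u > 0" "snd u > 0" using d by (auto simp only: zero_less_mult_iff)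
  then show "u : open_cone (-1, 0) (-1, 1)" by (subst open_cone_iff) (auto simp: det2_def)
 qed
 show "tri_sum f (0, 1) = cone_term f (0, 1) (0, -1) (1, -1) + cone_term f (0, 1) (1, -1) (0, -1)"
 proof (rule E[OF tri_cone_corner(3) m(3)])
  fix u :: "real \<times> real" and de :: real assume d: "de > 0" and B: "ALL i<3. bary i (0, 1) = 0 --> bary i ((0, 1) + de *R u) > 0"
  have "de * (- fst u - snd u) > 0" "fst u > 0" using B[rule_format, OF b(1)] B[rule_format, OF b(2)] d
   by (auto simp: bary_def zero_less_mult_iff algebra_simps)
  then have "- fst u - snd u > 0" "fst u > 0" using d by (auto simp only: zero_less_mult_iff)
  then show "u : open_cone (0, -1) (1, -1)" by (subst open_cone_iff) (auto simp: det2_def)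
 qed
qed

end

lemma lattice_length_eq:
 assumes "l > 0" "u : primitive"
 shows "lattice_length (l *R u) = l"
 unfolding lattice_length_def
proof (rule the_equality)
 show "l > 0 & (EX m n::int. coprime m n & l *R u = l *R (of_int m, of_int n))"
  using assms unfolding primitive_def by blast
 fix k assume k: "k > 0 & (EX m n::int. coprime m n & l *R u = k *R (of_int m, of_int n))"
 then obtain u' where u': "u' : primitive" "l *R u = k *R u'" unfolding primitive_def by blast
 then have "(1 / k) *R (l *R u) = u'" using k by simp
 then have "(l / k) *R u : primitive" using u'(1) by simp
 moreover have "k > 0" using k by blast
 moreover then have "l / k > 0" using assms(1) by simp
 ultimately have "l / k = 1" using primitive_multiple[OF assms(2)] by blast
 then show "k = l" using \<open>k > 0\<close> by simp
qed

lemma rational_direction: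
 assumes "x ~= 0" "x = l *R (of_int m, of_int n)"
 obtains k u where "k > 0" "u : primitive" "x = k *R u"
proof -
 define v where "v = (if l > 0 then (of_int m, of_int n) else - (of_int m, of_int n) :: real \<times> real)"
 have mn: "(of_int m, of_int n) : int_vec" unfolding int_vec_def by blast
 have v: "v : int_vec" "v ~= 0" "x = \<bar>l\<bar> *R v" "l ~= 0"
  using mn lattice_uminus[OF mn] assms by (auto simp: v_def zero_prod_def)
 obtain c where c: "c > 0" "c *R v : primitive" by (rule lattice_primitive_multiple[OF v(1,2)])
 show ?thesis by (rule that[of "\<bar>l\<bar> / c" "c *R v"]) (use c v(3,4) in auto)
qed

lemma segment_point_eq:
 fixes a b :: "'a::real_vector"
 assumes "a ~= b"
 shows "(1 - ta) *R a + ta *R b = (1 - ta') *R a + ta' *R b <-> ta = ta'"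
proof
 assume "(1 - ta) *R a + ta *R b = (1 - ta') *R a + ta' *R b"
 then have "(ta - ta') *R (b - a) = 0" by (simp add: algebra_simps)
 then show "ta = ta'" using assms by simp
qed simp

lemma segment_germ_iff:
 fixes a b :: "'a::real_normed_vector"
 assumes ab: "a ~= b" and ta: "ta : {0..1}" and k: "k > 0" "b - a = k *R u"
 defines "y \<equiv> (1 - ta) *R a + ta *R b"
 shows "in_germ (closed_segment a b) y u <-> ta < 1" "in_germ (closed_segment a b) y (- u) <-> ta > 0"
proof -
 have y: "y : closed_segment a b" using ta by (auto simp: y_def segment_image)
 have shift: "y + x *R (b - a) = (1 - (ta + x)) *R a + (ta + x) *R b" for x by (simp add: y_def algebra_simps)
 have mem: "y + x *R (b - a) : closed_segment a b <-> ta + x : {0..1}" for x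
  unfolding shift segment_image image_iff segment_point_eq[OF ab] by simp
 have u: "de *R u = (de / k) *R (b - a)" "de *R (- u) = (- de / k) *R (b - a)" for de using k by simp_all
 have "u : tangent (closed_segment a b) y <-> (EX de>0. y + de *R u : closed_segment a b)" by (simp add: tangent_def)
 also have "... <-> (EX de>0. ta + de / k : {0..1})" unfolding u(1) mem ..
 also have "... <-> ta < 1"
 proof
  assume "EX de>0. ta + de / k : {0..1}"
  then obtain de where "de > 0" "ta + de / k <= 1" by auto
  moreover then have "de / k > 0" using k by simp
  ultimately show "ta < 1" by linarith
 next
  assume "ta < 1" then show "EX de>0. ta + de / k : {0..1}" using k ta by (intro exI[of _ "k * (1 - ta)"]) auto
 qed
 finally show "in_germ (closed_segment a b) y u <-> ta < 1" using y by (simp add: in_germ_def)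
 have "- u : tangent (closed_segment a b) y <-> (EX de>0. y + de *R (- u) : closed_segment a b)" by (simp add: tangent_def)
 also have "... <-> (EX de>0. ta + (- de / k) : {0..1})" unfolding u(2) mem ..
 also have "... <-> ta > 0"
 proof
  assume "EX de>0. ta + (- de / k) : {0..1}"
  then obtain de where "de > 0" "ta + (- de / k) >= 0" by auto
  moreover then have "de / k > 0" using k by simp
  ultimately show "ta > 0" by simp
 next
  assume "ta > 0" then show "EX de>0. ta + (- de / k) : {0..1}" using k ta by (intro exI[of _ "k * ta"]) auto
 qed
 finally show "in_germ (closed_segment a b) y (- u) <-> ta > 0" using y by (simp add: in_germ_def)
qed

context ct_surface
begin

lemma finite_tri_map_fiber:
 assumes f: "f : tris S" and B: "finite B"
 shows "finite {y : std. tri_map S f y : B}"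
proof -
 have "{y : std. tri_map S f y : B} <= {(0,0), (1,0), (0,1)} Un (\<Union>p\<in>B. case p of VPoint v => {}
   | EPoint e t => {(t, 0), (0, t), (1 - t, t)} | TPoint f' z => {z})"
 proof
  fix y assume y: "y : {y : std. tri_map S f y : B}"
  then have y': "y : std" "tri_map S f y : B" by auto
  show "y : {(0,0), (1,0), (0,1)} Un (\<Union>p\<in>B. case p of VPoint v => {}
   | EPoint e t => {(t, 0), (0, t), (1 - t, t)} | TPoint f' z => {z})"
   by (rule tri_map_cases[OF f y'(1)]) (use y'(2) in \<open>auto intro!: bexI[of _ "tri_map S f y"]\<close>)
 qed
 then show ?thesis by (rule finite_subset) (use B in \<open>auto split: point.split\<close>)
qed

lemma finite_edge_map_fiber:
 assumes B: "finite B"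
 shows "finite {t : {0..1}. edge_map S e t : B}"
proof -
 have "{t : {0..1}. edge_map S e t : B} <= {0, 1} Un (\<Union>p\<in>B. case p of EPoint e' t => {t} | _ => {})"
 proof
  fix t assume "t : {t : {0..1}. edge_map S e t : B}"
  then show "t : {0, 1} Un (\<Union>p\<in>B. case p of EPoint e' t => {t} | _ => {})"
   by (cases "t = 0 \<or> t = 1") (auto simp: edge_map_def intro!: bexI[of _ "EPoint e t"])
 qed
 then show ?thesis by (rule finite_subset) (use B in \<open>auto split: point.split\<close>)
qed

end

context divisor_splitting
begin

fun lift :: "('e, 'f) segment => 'f \<times> (real \<times> real) \<times> (real \<times> real)" where
 "lift (TSegment f a b) = (f, a, b)"
| "lift (ESegment e a b) = (fst (chart e), spt (snd (chart e)) a, spt (snd (chart e)) b)"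

lemma lift:
 assumes "valid_segment S sg" "lift sg = (f, a, b)"
 shows "f : tris S" "a : std" "b : std" "a ~= b"
  "ta : {0..1} ==> segment_path S sg ta = tri_map S f ((1 - ta) *R a + ta *R b)"
  "ta : {0..1} ==> (1 - ta) *R a + ta *R b : std"
proof -
 have *: "f : tris S & a : std & b : std & a ~= b &
  (ALL ta:{0..1}. segment_path S sg ta = tri_map S f ((1 - ta) *R a + ta *R b))"
 proof (cases sg)
  case (ESegment e a' b')
  then have v: "e : edges S" "a' : {0..1}" "b' : {0..1}" "a' ~= b'" using assms(1) by auto
  note L = edge_linkD[OF chart[OF v(1)]]
  have e: "f = fst (chart e)" "a = spt (snd (chart e)) a'" "b = spt (snd (chart e)) b'"
   using assms(2) ESegment by auto
  have "(1 - ta) * a' + ta * b' : {0..1}" if "ta : {0..1}" for ta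
   using convexD[OF convex_real_interval(5)[of 0 1] v(2,3), of "1 - ta" ta] that by simp
  then show ?thesis unfolding e side_point_affine[symmetric]
   using L v side_point_inj[OF L(2)] by (simp add: ESegment del: atLeastAtMost_iff)
 next
  case (TSegment f' a' b')
  then show ?thesis using assms by auto
 qed
 then show "f : tris S" "a : std" "b : std" "a ~= b"
  "ta : {0..1} ==> segment_path S sg ta = tri_map S f ((1 - ta) *R a + ta *R b)" by blast+
 show "ta : {0..1} ==> (1 - ta) *R a + ta *R b : std"
  using * by (intro convexD[OF convex_std]) auto
qed

lemma path_slope:
 assumes sg: "valid_segment S sg" "lift sg = (f, a, b)" and d: "dir_ok ta ep"
 defines "y \<equiv> (1 - ta) *R a + ta *R b"
 assumes c: "conic_near std (%x. ps (tri_map S f x)) y"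
 shows "has_dir (%ta. ps (segment_path S sg ta)) ta ep (tslope f y ps (ep *R (b - a)))"
  "outgoing_slope S ps sg ta ep = tslope f y ps (ep *R (b - a)) / segment_length sg"
  "ep *R (b - a) : tangent std y"
proof -
 note L = lift[OF sg] and ta = room(3)[OF d]
 define k where "k t = (1 - t) *R a + t *R b" for t :: real
 have y: "y = k ta" "y : std" using L(6)[OF ta] by (simp_all add: y_def k_def)
 have ks: "k (t + x *R ep) = k t + x *R (ep *R (b - a))" for t x by (simp add: k_def algebra_simps)
 have "ta + room ta ep * ep : {0..1}" using d by (auto simp: dir_ok_def room_def)
 then have "k (ta + room ta ep *R ep) : std" using L(6) by (simp add: k_def)
 then show t: "ep *R (b - a) : tangent std y"
  unfolding ks y(1) tangent_def using room(1)[OF d] by blast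
 have "has_dir (%x. ps (tri_map S f x)) (k ta) (ep *R (b - a)) (tslope f y ps (ep *R (b - a)))"
  unfolding tslope_def y(1)[symmetric] by (rule conic_has_dir[OF convex_std y(2) conic_near_at[OF c y(2)] t])
 then have h: "has_dir (%t. ps (tri_map S f (k t))) ta ep (tslope f y ps (ep *R (b - a)))"
  by (rule has_dir_compose[where L = k and h = "%x. ps (tri_map S f x)", OF ks])
 show H: "has_dir (%ta. ps (segment_path S sg ta)) ta ep (tslope f y ps (ep *R (b - a)))"
 proof (rule has_dir_cong[OF h])
  show "\<forall>\<^sub>F x in at_right 0. ps (segment_path S sg (ta + x *R ep)) = ps (tri_map S f (k (ta + x *R ep)))"
   unfolding at_right_0_iff
  proof (intro exI[of _ "room ta ep"] conjI allI impI room(1)[OF d])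
   fix x assume "0 < x" "x < room ta ep"
   then have "ta + x *R ep : {0..1}" using room(2)[OF d] by (simp add: less_imp_le)
   then show "ps (segment_path S sg (ta + x *R ep)) = ps (tri_map S f (k (ta + x *R ep)))" using L(5) by (simp add: k_def)
  qed
  show "ps (segment_path S sg ta) = ps (tri_map S f (k ta))" using L(5)[OF ta] by (simp add: k_def)
 qed
 show "outgoing_slope S ps sg ta ep = tslope f y ps (ep *R (b - a)) / segment_length sg"
  unfolding outgoing_slope_def
 proof (rule tendsto_Lim)
  have "\<forall>\<^sub>F h in at_right 0. (ps (segment_path S sg (ta + ep * h)) - ps (segment_path S sg ta)) / (h * segment_length sg)
    = tslope f y ps (ep *R (b - a)) / segment_length sg"
   using H[unfolded has_dir_def] eventually_at_right_less[of 0] by eventually_elim (simp add: mult.commute[of ep])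
  then show "((%h. (ps (segment_path S sg (ta + ep * h)) - ps (segment_path S sg ta)) / (h * segment_length sg))
   \<longlongrightarrow> tslope f y ps (ep *R (b - a)) / segment_length sg) (at_right 0)" by (rule tendsto_eventually)
 qed simp
qed

definition end_sum :: "(real => real => real) => real => real" where
 "end_sum F ta = (if ta < 1 then F ta 1 else 0) + (if ta > 0 then F ta (-1) else 0)"

lemma path_split:
 assumes sg: "valid_segment S sg" "lift sg = (f, a, b)" and ta: "ta : {0..1}"
 shows "end_sum (outgoing_slope S (Ps (segment_path S sg ta)) sg) ta = end_sum (outgoing_slope S Th sg) ta
  + end_sum (%ta ep. ep * (g f ((1 - ta) *R a + ta *R b) \<bullet> (b - a)) / segment_length sg) ta"
proof -
 note L = lift[OF sg]
 define y where "y = (1 - ta) *R a + ta *R b"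
 have y: "y : std" "segment_path S sg ta = tri_map S f y" using L(5,6)[OF ta] by (simp_all add: y_def)
 have "outgoing_slope S (Ps (segment_path S sg ta)) sg ta ep = outgoing_slope S Th sg ta ep + ep * (g f y \<bullet> (b - a)) / segment_length sg"
  if d: "dir_ok ta ep" for ep
  unfolding y(2) path_slope(2)[OF sg d Psi_conic[OF L(1) y(1), unfolded y_def], folded y_def]
   path_slope(2)[OF sg d Theta_conic[OF L(1) y(1), unfolded y_def], folded y_def]
   slope_split(1)[OF L(1) y(1) split[OF L(1) y(1)] path_slope(3)[OF sg d Theta_conic[OF L(1) y(1), unfolded y_def], folded y_def]]
  by (simp add: add_divide_distrib)
 from this[of 1] this[of "-1"] ta show ?thesis by (auto simp: end_sum_def dir_ok_def y_def)
qed

lemma telescoping: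
 assumes sg: "valid_segment S sg"
 obtains K where "finite K" "K <= {0..1}"
  "!!T. finite T ==> K <= T ==> T <= {0..1} ==> (SUM ta:T. end_sum (outgoing_slope S Th sg) ta) = 0"
proof -
 obtain f a b where l: "lift sg = (f, a, b)" by (cases "lift sg") auto
 note L = lift[OF sg l]
 define k where "k ta = Th (segment_path S sg ta)" for ta
 define s where "s ta ep = tslope f ((1 - ta) *R a + ta *R b) Th (ep *R (b - a))" for ta ep
 have P: "has_dir k ta ep (s ta ep)" "outgoing_slope S Th sg ta ep = s ta ep / segment_length sg" if d: "dir_ok ta ep" for ta ep
  using path_slope(1,2)[OF sg l d Theta_conic[OF L(1) L(6)[OF room(3)[OF d]]]] by (simp_all add: k_def[abs_def] s_def)
 define J where "J = {ta. 0 < ta & ta < 1 & s ta 1 + s ta (-1) ~= 0}"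
 have "has_dir k x 1 (s x 1)" if "0 <= x" "x < 1" for x using P(1)[of x 1] that by (simp add: dir_ok_def)
 moreover have "has_dir k x (-1) (s x (-1))" if "0 < x" "x <= 1" for x using P(1)[of x "-1"] that by (simp add: dir_ok_def)
 ultimately have "finite J & (SUM x:J. (s x 1 + s x (-1)) * (1 + 0 * x))
   = - ((1 + 0 * 1) * s 1 (-1)) - (1 + 0 * 0) * s 0 1 - 0 * (k 1 - k 0)"
  unfolding J_def by (intro sum_jumps[OF room_one]) auto
 then have J: "finite J" "(SUM x:J. s x 1 + s x (-1)) = - s 1 (-1) - s 0 1" by auto
 show ?thesis
 proof (rule that[of "{0, 1} Un J"])
  show "finite ({0, 1} Un J)" "{0, 1} Un J <= {0..1}" using J(1) by (auto simp: J_def)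
  fix T assume T: "finite T" "{0, 1} Un J <= T" "T <= {0..1}"
  have e: "end_sum (outgoing_slope S Th sg) ta = end_sum s ta / segment_length sg" if "ta : {0..1}" for ta
   using P(2)[of ta 1] P(2)[of ta "-1"] that by (auto simp: end_sum_def dir_ok_def add_divide_distrib)
  have "(SUM ta:T. end_sum s ta) = (SUM ta:{0, 1} Un J. end_sum s ta)"
   using T by (intro sum.mono_neutral_right) (auto simp: end_sum_def J_def)
  also have "... = (SUM ta:{0, 1}. end_sum s ta) + (SUM ta:J. end_sum s ta)"
   using J(1) by (intro sum.union_disjoint) (auto simp: J_def)
  also have "(SUM ta:J. end_sum s ta) = (SUM x:J. s x 1 + s x (-1))"
   by (intro sum.cong) (auto simp: J_def end_sum_def)
  finally have "(SUM ta:T. end_sum s ta) = 0" unfolding J(2) by (simp add: end_sum_def)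
  moreover have "(SUM ta:T. end_sum (outgoing_slope S Th sg) ta) = (SUM ta:T. end_sum s ta) / segment_length sg"
   unfolding sum_divide_distrib using e T(3) by (intro sum.cong) auto
  ultimately show "(SUM ta:T. end_sum (outgoing_slope S Th sg) ta) = 0" by simp
 qed
qed

lemma segment_kinds:
 assumes sg: "valid_segment S sg"
 obtains (edge) e f i a b where "e : edges S" "(f, i) : edge_link S e" "a : {0..1}" "b : {0..1}" "a ~= b"
   "lift sg = (f, spt i a, spt i b)" "segment_length sg = \<bar>b - a\<bar>"
   "!!e'. edge_seg S sg e' = (if e' = e then closed_segment a b else {})" "!!f'. tri_seg sg f' = {}"
  | (tri) f a b where "sg = TSegment f a b" "~ side_seg a b" "!!e'. edge_seg S sg e' = {}"
proof (cases sg)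
 case (ESegment e a b)
 then have v: "e : edges S" "a : {0..1}" "b : {0..1}" "a ~= b" using sg by auto
 show ?thesis by (rule edge[OF v(1) chart[OF v(1)] v(2-4)]) (use ESegment in auto)
next
 case (TSegment f a b)
 then have v: "f : tris S" "a : std" "b : std" "a ~= b" using sg by auto
 show ?thesis
 proof (cases "side_seg a b")
  case True
  then obtain i where i: "i < 3" "bary i a = 0" "bary i b = 0" by (auto simp: side_seg_def)
  obtain a' where a': "a = spt i a'" using i bary_side by blast
  obtain b' where b': "b = spt i b'" using i bary_side by blast
  note ab = a' b'
  have ab': "a' : {0..1}" "b' : {0..1}" "a' ~= b'" using v(2-4) side_point_std_iff[OF i(1)] unfolding ab by auto
  have l: "(f, i) : edge_link S (face S f i)" using v(1) i(1) by (simp add: edge_link_def)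
  show ?thesis
  proof (rule edge[OF face_edges[OF v(1) i(1)] l ab'])
   show "lift sg = (f, spt i a', spt i b')" using TSegment ab by simp
   show "edge_seg S sg e' = (if e' = face S f i then closed_segment a' b' else {})" for e'
    unfolding TSegment edge_seg_TSegment[OF i(1) ab v(4)] by (simp add: eq_commute)
   show "tri_seg sg f' = {}" for f' using True by (simp add: TSegment)
   have "b - a = (b' - a') *R sdir i" using side_point_shift[of i a' "b' - a'"] by (simp add: ab)
   also have "... = \<bar>b' - a'\<bar> *R (if b' > a' then sdir i else - sdir i)"
    by (cases "b' > a'") (simp_all add: algebra_simps)
   finally have e: "b - a = \<bar>b' - a'\<bar> *R (if b' > a' then sdir i else - sdir i)" .
   have "sdir i : primitive" using side_vectors[OF i(1)] primitiveI by blast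
   then have "(if b' > a' then sdir i else - sdir i) : primitive" using primitive_uminus by simp
   from lattice_length_eq[OF _ this, of "\<bar>b' - a'\<bar>"] ab'(3)
   show "segment_length sg = \<bar>b' - a'\<bar>" unfolding TSegment segment_length.simps e by simp
  qed
 next
  case False
  then have "edge_seg S sg e' = {}" for e' by (auto simp: TSegment side_seg_def)
  then show ?thesis using tri TSegment False by blast
 qed
qed

lemma segment_resum:
 assumes sg: "sg : keys D" and l: "lift sg = (f, a, b)" and B: "finite B"
 shows "(SUM ta:{ta : {0..1}. segment_path S sg ta : B}.
   end_sum (%ta ep. ep * (g f ((1 - ta) *R a + ta *R b) \<bullet> (b - a)) / segment_length sg) ta)
  = (SUM f:tris S. SUM y:{y : std. tri_map S f y : B}. SUM u:dirs. if in_germ (tri_seg sg f) y u then g f y \<bullet> u else 0)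
   + (SUM e:edges S. SUM t:{t : {0..1}. edge_map S e t : B}. SUM de:{1, -1}. if in_germ (edge_seg S sg e) t de then de * chi e t else 0)"
proof -
 have v: "valid_segment S sg" using valid sg by blast
 note L = lift[OF v l]
 define T where "T = {ta : {0..1}. segment_path S sg ta : B}"
 define k where "k ta = (1 - ta) *R a + ta *R b" for ta :: real
 let ?X = "%ta ep. ep * (g f (k ta) \<bullet> (b - a)) / segment_length sg"
 have inj: "inj_on k T" by (rule inj_onI) (simp add: k_def segment_point_eq[OF L(4)])
 have kT: "k ta : std" "segment_path S sg ta = tri_map S f (k ta)" if "ta : {0..1}" for ta
  using L(5,6)[OF that] by (simp_all add: k_def)
 show ?thesis using v
 proof (cases rule: segment_kinds)
  case (tri f' a' b')
  then have ff: "f' = f" "a' = a" "b' = b" using l by auto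
  let ?W = "%y. SUM w:dirs. if in_germ (closed_segment a b) y w then g f y \<bullet> w else 0"
  have seg: "tri_seg sg f'' = (if f'' = f then closed_segment a b else {})" for f'' using tri(1,2) ff by simp
  obtain m0 m n where "b - a = m0 *R (of_int m, of_int n)" using v tri(1) ff by auto
  moreover have "b - a ~= 0" using L(4) by simp
  ultimately obtain c u where u: "c > 0" "u : primitive" "b - a = c *R u" using rational_direction by metis
  have len: "segment_length sg = c" using tri(1) ff u(3) lattice_length_eq[OF u(1,2)] by simp
  have par: "det2 u (b - a) = 0" "det2 (- u) (b - a) = 0" unfolding u(3) by (simp_all add: det2_def)
  then have ud: "u : dirs" "- u : dirs" unfolding dirs_def using u(2) primitive_uminus sg tri(1) ff by blast+
  have un: "u ~= - u"
  proof
   assume "u = - u"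
   then have "u + u = 0" by (metis add.right_inverse)
   then have "2 *R u = 0" by (simp add: scaleR_2)
   then show False using primitive_nonzero[OF u(2)] by simp
  qed
  have germ: "in_germ (closed_segment a b) (k ta) w <-> (w = u & ta < 1) \<or> (w = - u & ta > 0)"
   if ta: "ta : {0..1}" and w: "w : dirs" for ta w
  proof -
   have "w = u \<or> w = - u" if g: "in_germ (closed_segment a b) (k ta) w"
   proof -
    obtain x x' de where x: "de > 0" "de *R w = (x' - x) *R (b - a)"
     using germ_parallel[of "k ta" a b w] g unfolding in_germ_def by metis
    define mm where "mm = (x' - x) * c / de"
    have "(1 / de) *R (de *R w) = (1 / de) *R ((x' - x) *R (b - a))" unfolding x(2) ..
    then have mm: "w = mm *R u" using x(1) by (simp add: u(3) mm_def)
    have wp: "w : primitive" using w dirs_primitive by blast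
    then show ?thesis by (rule parallel_primitive[OF u(2) _ mm])
   qed
   then show ?thesis using segment_germ_iff[OF L(4) ta u(1,3), folded k_def] by blast
  qed
  have E: "(SUM w:dirs. if in_germ (closed_segment a b) (k ta) w then g f (k ta) \<bullet> w else 0)
    = end_sum ?X ta" if ta: "ta : {0..1}" for ta
  proof -
   have "(SUM w:dirs. if in_germ (closed_segment a b) (k ta) w then g f (k ta) \<bullet> w else 0)
    = (SUM w:{u, - u}. if in_germ (closed_segment a b) (k ta) w then g f (k ta) \<bullet> w else 0)"
    using germ[OF ta] ud finite_dirs by (intro sum.mono_neutral_right) auto
   also have "... = end_sum ?X ta"
    using un germ[OF ta ud(1)] germ[OF ta ud(2)] u(1) unfolding len u(3) by (auto simp: end_sum_def)
   finally show ?thesis .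
  qed
  have "(SUM f:tris S. SUM y:{y : std. tri_map S f y : B}. SUM u:dirs. if in_germ (tri_seg sg f) y u then g f y \<bullet> u else 0)
   = (SUM f':{f}. SUM y:{y : std. tri_map S f' y : B}. SUM u:dirs. if in_germ (tri_seg sg f') y u then g f' y \<bullet> u else 0)"
   using fin(3) L(1) seg by (intro sum.mono_neutral_right) (auto simp: in_germ_def)
  also have "... = (SUM y:{y : std. tri_map S f y : B}. ?W y)"
   by (simp add: seg)
  also have "... = (SUM y:k ` T. ?W y)"
  proof (rule sum.mono_neutral_right[OF finite_tri_map_fiber[OF L(1) B]])
   show "k ` T <= {y : std. tri_map S f y : B}" using kT by (auto simp: T_def simp del: atLeastAtMost_iff)
   show "ALL y:{y : std. tri_map S f y : B} - k ` T. ?W y = 0"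
   proof
    fix y assume y: "y : {y : std. tri_map S f y : B} - k ` T"
    have "y ~: closed_segment a b"
    proof
     assume "y : closed_segment a b"
     then obtain ta where ta: "ta : {0..1}" "y = k ta" by (auto simp: segment_image k_def)
     then have "ta : T" using y kT(2)[OF ta(1)] by (simp add: T_def)
     then show False using y ta(2) by blast
    qed
    then show "?W y = 0" by (simp add: in_germ_def)
   qed
  qed
  also have "... = (SUM ta:T. end_sum ?X ta)"
   unfolding sum.reindex[OF inj] o_def using E by (intro sum.cong) (auto simp: T_def)
  finally show ?thesis by (simp add: T_def k_def tri(3) in_germ_def)
 next
  case (edge e f' i a' b')
  then have ff: "f' = f" "a = spt i a'" "b = spt i b'" using l by auto
  have li: "(f, i) : edge_link S e" using edge(2) ff by simp
  let ?E = "%t. SUM de:{1, -1}. if in_germ (closed_segment a' b') t de then de * chi e t else 0"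
  define h where "h ta = (1 - ta) *R a' + ta *R b'" for ta :: real
  have kh: "k ta = spt i (h ta)" for ta by (simp add: k_def h_def ff side_point_affine)
  have h01: "h ta : {0..1}" if "ta : {0..1}" for ta
   using convexD[OF convex_real_interval(5)[of 0 1] edge(3,4), of "1 - ta" ta] that by (simp add: h_def)
  have path: "segment_path S sg ta = edge_map S e (h ta)" if "ta : {0..1}" for ta
   using kT(2)[OF that] edge_linkD(3)[OF li h01[OF that]] kh by simp
  have injh: "inj_on h T" by (rule inj_onI) (simp only: h_def segment_point_eq[OF edge(5)])
  have ba: "b - a = (b' - a') *R sdir i" using side_point_shift[of i a' "b' - a'"] by (simp add: ff)
  have gs: "g f (k ta) \<bullet> (b - a) = (b' - a') * chi e (h ta)" if "ta : {0..1}" for ta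
   unfolding ba kh using chi_eq[OF edge(1) li h01[OF that]] by simp
  define s where "s = sgn (b' - a')"
  have s: "s = 1 \<or> s = -1" "b' - a' = \<bar>b' - a'\<bar> *R s" using edge(5) by (auto simp: s_def sgn_if)
  have ba0: "\<bar>b' - a'\<bar> > 0" using edge(5) by simp
  have germ: "in_germ (closed_segment a' b') (h ta) s <-> ta < 1" "in_germ (closed_segment a' b') (h ta) (- s) <-> ta > 0"
   if "ta : {0..1}" for ta
   using segment_germ_iff[OF edge(5) that ba0 s(2), folded h_def] by auto
  have E: "(SUM de:{1, -1}. if in_germ (closed_segment a' b') (h ta) de then de * chi e (h ta) else 0)
    = end_sum ?X ta" if ta: "ta : {0..1}" for ta
  proof -
   have q: "(b' - a') / \<bar>b' - a'\<bar> = s" unfolding s_def by (simp only: sgn_real_def) (use edge(5) in \<open>auto simp: field_simps\<close>)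
   have X: "(ep * (g f (k ta) \<bullet> (b - a)) / segment_length sg) = ep * s * chi e (h ta)" for ep
    unfolding gs[OF ta] edge(7) q[symmetric] by simp
   have r: "end_sum ?X ta
    = (if ta < 1 then s * chi e (h ta) else 0) + (if ta > 0 then - s * chi e (h ta) else 0)"
    unfolding end_sum_def X by simp
   show ?thesis unfolding r using s(1) germ[OF ta] by auto
  qed
  have "(SUM e':edges S. SUM t:{t : {0..1}. edge_map S e' t : B}. SUM de:{1, -1}. if in_germ (edge_seg S sg e') t de then de * chi e' t else 0)
   = (SUM e':{e}. SUM t:{t : {0..1}. edge_map S e' t : B}. SUM de:{1, -1}. if in_germ (edge_seg S sg e') t de then de * chi e' t else 0)"
   using fin(2) edge(1,8) by (intro sum.mono_neutral_right) (auto simp: in_germ_def)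
  also have "... = (SUM t:{t : {0..1}. edge_map S e t : B}. ?E t)"
   by (simp add: edge(8))
  also have "... = (SUM t:h ` T. ?E t)"
  proof (rule sum.mono_neutral_right[OF finite_edge_map_fiber[OF B]])
   show "h ` T <= {t : {0..1}. edge_map S e t : B}" using h01 path by (auto simp: T_def simp del: atLeastAtMost_iff)
   show "ALL t:{t : {0..1}. edge_map S e t : B} - h ` T. ?E t = 0"
   proof
    fix t assume t: "t : {t : {0..1}. edge_map S e t : B} - h ` T"
    have "t ~: closed_segment a' b'"
    proof
     assume "t : closed_segment a' b'"
     then obtain ta where ta: "ta : {0..1}" "t = h ta" unfolding segment_image h_def by blast
     then have "ta : T" using t path[OF ta(1)] by (simp add: T_def)
     then show False using t ta(2) by blast
    qed
    then show "?E t = 0" by (simp add: in_germ_def)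
   qed
  qed
  also have "... = (SUM ta:T. end_sum ?X ta)"
   unfolding sum.reindex[OF injh] o_def by (rule sum.cong[OF refl E]) (simp add: T_def)
  finally show ?thesis by (simp add: T_def k_def edge(9) in_germ_def)
 qed
qed

end

lemma tri_cone_commute: "tri_cone y q q' ==> tri_cone y q' q"
 unfolding tri_cone_def using det2_commute[of q q'] by (metis abs_minus_cancel add.commute)

lemma tri_cone_side_end: "i < 3 ==> tri_cone (spt i 1) (- sdir i) (inward i - sdir i)"
 using tri_cone_corner(2,3) tri_cone_commute[OF tri_cone_corner(3)]
 by (elim less_3_cases) (simp_all add: sdir_def inward_def side_simps vertex_simps)

context divisor_splitting
begin

lemma finite_path_fiber:
 assumes sg: "valid_segment S sg" and B: "finite B"
 shows "finite {ta : {0..1}. segment_path S sg ta : B}" (is "finite ?T")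
proof -
 obtain f a b where l: "lift sg = (f, a, b)" by (cases "lift sg") auto
 note L = lift[OF sg l]
 define k where "k ta = (1 - ta) *R a + ta *R b" for ta :: real
 have "inj_on k ?T" by (rule inj_onI) (simp only: k_def segment_point_eq[OF L(4)])
 moreover have "k ` ?T <= {y : std. tri_map S f y : B}"
  using L(5,6) by (auto simp: k_def simp del: atLeastAtMost_iff)
 then have "finite (k ` ?T)" by (rule finite_subset[OF _ finite_tri_map_fiber[OF L(1) B]])
 ultimately show ?thesis using finite_imageD by blast
qed

lemma tri_weight_mult:
 "tri_weight D f y u * x = (SUM sg:keys D. lookup D sg * (if in_germ (tri_seg sg f) y u then x else 0))"
proof -
 have "tri_weight D f y u = (SUM sg:keys D. if in_germ (tri_seg sg f) y u then lookup D sg else 0)"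
  unfolding tri_weight_def by (rule sum.inter_filter) simp
 then show ?thesis by (simp add: sum_distrib_right if_distrib[of "%a. a * x"] if_distrib[of "%a. _ * a"] cong: if_cong)
qed

lemma edge_weight_mult:
 "edge_weight S D e t de * x = (SUM sg:keys D. lookup D sg * (if in_germ (edge_seg S sg e) t de then x else 0))"
proof -
 have "edge_weight S D e t de = (SUM sg:keys D. if in_germ (edge_seg S sg e) t de then lookup D sg else 0)"
  unfolding edge_weight_def by (rule sum.inter_filter) simp
 then show ?thesis by (simp add: sum_distrib_right if_distrib[of "%a. a * x"] if_distrib[of "%a. _ * a"] cong: if_cong)
qed

lemma degree_sum:
 assumes B: "finite B"
  and tel: "!!sg. sg : keys D ==>
   (SUM ta:{ta : {0..1}. segment_path S sg ta : B}. end_sum (outgoing_slope S Th sg) ta) = 0"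
 shows "(SUM p:B. local_intersection_degree S D (Ps p) p)
  = (SUM f:tris S. SUM y:{y : std. tri_map S f y : B}. tri_sum f y)
   + (SUM e:edges S. SUM t:{t : {0..1}. edge_map S e t : B}. SUM de:{1, -1}. edge_weight S D e t de * (de * chi e t))"
proof -
 let ?A = "%sg. SUM f:tris S. SUM y:{y : std. tri_map S f y : B}. SUM u:dirs. if in_germ (tri_seg sg f) y u then g f y \<bullet> u else 0"
 let ?E = "%sg. SUM e:edges S. SUM t:{t : {0..1}. edge_map S e t : B}. SUM de:{1, -1}. if in_germ (edge_seg S sg e) t de then de * chi e t else 0"
 have per: "(SUM p:B. SUM ta:{ta : {0..1}. segment_path S sg ta = p}. end_sum (outgoing_slope S (Ps p) sg) ta) = ?A sg + ?E sg"
  if K: "sg : keys D" for sg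
 proof -
  have v: "valid_segment S sg" using valid K by blast
  obtain f a b where l: "lift sg = (f, a, b)" by (cases "lift sg") auto
  let ?T = "{ta : {0..1}. segment_path S sg ta : B}"
  have "(SUM p:B. SUM ta:{ta : {0..1}. segment_path S sg ta = p}. end_sum (outgoing_slope S (Ps p) sg) ta)
   = (SUM p:B. SUM ta:{ta : ?T. segment_path S sg ta = p}. end_sum (outgoing_slope S (Ps (segment_path S sg ta)) sg) ta)"
   by (intro sum.cong refl) auto
  also have "... = (SUM ta:?T. end_sum (outgoing_slope S (Ps (segment_path S sg ta)) sg) ta)"
   by (rule sum.group[OF finite_path_fiber[OF v B] B]) blast
  also have "... = (SUM ta:?T. end_sum (outgoing_slope S Th sg) ta)
   + (SUM ta:?T. end_sum (%ta ep. ep * (g f ((1 - ta) *R a + ta *R b) \<bullet> (b - a)) / segment_length sg) ta)"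
   unfolding sum.distrib[symmetric] by (rule sum.cong[OF refl path_split[OF v l]]) blast
  finally show ?thesis unfolding tel[OF K] segment_resum[OF K l B] by simp
 qed
 have "(SUM p:B. local_intersection_degree S D (Ps p) p) = (SUM sg:keys D. lookup D sg *
   (SUM p:B. SUM ta:{ta : {0..1}. segment_path S sg ta = p}. end_sum (outgoing_slope S (Ps p) sg) ta))"
  unfolding local_intersection_degree_def end_sum_def[symmetric] sum_distrib_left by (rule sum.swap)
 also have "... = (SUM sg:keys D. lookup D sg * ?A sg) + (SUM sg:keys D. lookup D sg * ?E sg)"
  unfolding sum.distrib[symmetric] distrib_left[symmetric] by (intro sum.cong refl) (simp only: per)
 also have "(SUM sg:keys D. lookup D sg * ?A sg)
   = (SUM f:tris S. SUM y:{y : std. tri_map S f y : B}. tri_sum f y)"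
  unfolding tri_sum_def tri_weight_mult sum_distrib_left
  by (subst sum.swap, intro sum.cong refl, subst sum.swap, intro sum.cong refl, rule sum.swap)
 also have "(SUM sg:keys D. lookup D sg * ?E sg)
   = (SUM e:edges S. SUM t:{t : {0..1}. edge_map S e t : B}. SUM de:{1, -1}. edge_weight S D e t de * (de * chi e t))"
  unfolding edge_weight_mult sum_distrib_left
  by (subst sum.swap, intro sum.cong refl, subst sum.swap, intro sum.cong refl, rule sum.swap)
 finally show ?thesis .
qed

lemma sum_triangle_points:
 assumes f: "f : tris S" and B: "finite B" "VPoint ` verts S <= B"
 shows "(SUM y:{y : std. tri_map S f y : B}. tri_sum f y)
  = (SUM i<3. (SUM t:{t : {0<..<1}. edge_map S (face S f i) t : B}. tri_sum f (spt i t))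
    + corner_terms f i)"
proof -
 define C where "C = {(0, 0), (1, 0), (0, 1 :: real) :: real \<times> real}"
 define T where "T i = {t : {0<..<1}. edge_map S (face S f i) t : B}" for i
 have T: "finite (T i)" for i
  by (rule finite_subset[OF _ finite_edge_map_fiber[OF B(1), of "face S f i"]]) (auto simp: T_def)
 have CB: "y : std & tri_map S f y : B" if "y : C" for y
 proof -
  have e: "endpt S (face S f i) b : verts S" if "i < 3" for i b by (rule endpt_verts[OF face_edges[OF f that]])
  have y: "y : std" using that by (auto simp: C_def mem_std)
  have "tri_map S f y : VPoint ` verts S"
   by (rule tri_map_cases[OF f y]) (use that e in \<open>auto simp: C_def\<close>)
  then show ?thesis using y B(2) by blast
 qed
 have "(SUM y:{y : std. tri_map S f y : B}. tri_sum f y) = (SUM y:C Un (\<Union>i\<in>{..<3}. spt i ` T i). tri_sum f y)"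
 proof (rule sum.mono_neutral_right[OF finite_tri_map_fiber[OF f B(1)]])
  show "C Un (\<Union>i\<in>{..<3}. spt i ` T i) <= {y : std. tri_map S f y : B}"
   using CB tri_map_side[OF f] side_point_std by (auto simp: T_def)
  show "ALL y:{y : std. tri_map S f y : B} - (C Un (\<Union>i\<in>{..<3}. spt i ` T i)). tri_sum f y = 0"
  proof
   fix y assume y: "y : {y : std. tri_map S f y : B} - (C Un (\<Union>i\<in>{..<3}. spt i ` T i))"
   have "int_tri y"
   proof (rule ccontr)
    assume "~ int_tri y"
    then obtain i where i: "i < 3" "bary i y = 0" using bary_std[of y] y unfolding int_tri_bary by (metis (no_types, lifting) DiffD1 less_eq_real_def mem_Collect_eq)
    then obtain t where t: "y = spt i t" using bary_side by blast
    then have t01: "t : {0..1}" using y side_point_std_iff[OF i(1)] by auto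
    have "t ~= 0 & t ~= 1" using y i(1) unfolding t C_def by (elim less_3_cases) (auto simp: side_simps)
    then have "t : T i" using t01 y tri_map_side[OF f i(1) t01] by (auto simp: T_def t)
    then show False using y t i(1) by blast
   qed
   then show "tri_sum f y = 0" using tri_sum_interior[OF f] y by blast
  qed
 qed
 also have "... = (SUM y:C. tri_sum f y) + (SUM y:(\<Union>i\<in>{..<3}. spt i ` T i). tri_sum f y)"
 proof (rule sum.union_disjoint)
  show "C Int (\<Union>i\<in>{..<3}. spt i ` T i) = {}"
   by (auto simp: C_def T_def side_simps elim!: less_3_cases)
 qed (use T in \<open>auto simp: C_def\<close>)
 also have "(SUM y:(\<Union>i\<in>{..<3}. spt i ` T i). tri_sum f y) = (SUM i<3. SUM y:spt i ` T i. tri_sum f y)"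
 proof (rule sum.UNION_disjoint)
  show "ALL i:{..<3}. ALL j:{..<3}. i ~= j --> spt i ` T i Int spt j ` T j = {}"
   by (auto simp: T_def side_simps elim!: less_3_cases)
 qed (use T in auto)
 also have "... = (SUM i<3. SUM t:T i. tri_sum f (spt i t))"
  by (intro sum.cong refl) (simp add: sum.reindex inj_on_def side_point_inj)
 also have "(SUM y:C. tri_sum f y) = (SUM i<3. cone_term f (spt i 0) (sdir i) (inward i)
   + cone_term f (spt i 1) (- sdir i) (inward i - sdir i))"
 proof -
  have three: "sum h {..<3} = h 0 + h (Suc 0) + h 2" for h :: "nat => real" by (simp add: eval_nat_numeral)
  show ?thesis unfolding three corner_terms_def[symmetric]
   by (simp add: C_def corner_terms_def tri_sum_corner[OF f] sdir_def inward_def side_simps vertex_simps)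
 qed
 finally show ?thesis unfolding T_def by (simp add: sum.distrib add.commute corner_terms_def)
qed

lemma opp_end_values:
 assumes V: "!!i. i < 3 ==> V (spt i 0) (sdir i) = z (face S f i, False)"
  "!!i. i < 3 ==> V (spt i 1) (- sdir i) = z (face S f i, True)" and i: "i < 3"
 shows "V (spt i 0) (inward i) = z (opp_end S f i False)"
  "V (spt i 1) (inward i - sdir i) = z (opp_end S f i True)"
proof -
 have "V (spt i 0) (inward i) = z (opp_end S f i False) & V (spt i 1) (inward i - sdir i) = z (opp_end S f i True)"
  using V(1)[of 0] V(1)[of "Suc 0"] V(1)[of 2] V(2)[of 0] V(2)[of "Suc 0"] V(2)[of 2] i
  by (elim less_3_cases) (simp_all add: opp_end_def sdir_def inward_def side_simps vertex_simps)
 then show "V (spt i 0) (inward i) = z (opp_end S f i False)"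
  "V (spt i 1) (inward i - sdir i) = z (opp_end S f i True)" by auto
qed

definition half_slope :: "'e \<times> bool => real" where
 "half_slope x = (if snd x then edge_slope (fst x) 1 (-1) else edge_slope (fst x) 0 1)"

definition half_chi :: "'e \<times> bool => real" where
 "half_chi x = (if snd x then - chi (fst x) 1 else chi (fst x) 0)"

lemma side_slope:
 assumes l: "(f, i) : edge_link S e" and d: "dir_ok t de"
 shows "Ths f (spt i t) (de *R sdir i) = edge_slope e t de"
 unfolding edge_slope_def
 by (rule has_dir_dirder[OF edge_has_dir[OF l d Theta_conic[OF edge_linkD(1)[OF l] edge_linkD(4)[OF l room(3)[OF d]]]], symmetric])

lemma dir_ok_ends: "dir_ok 0 1" "dir_ok 1 (-1)"
 by (auto simp: dir_ok_def)

lemma opp_slopes: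
 assumes f: "f : tris S" and i: "i < 3"
 shows "Ths f (spt i 0) (inward i) = half_slope (opp_end S f i False)"
  "Ths f (spt i 1) (inward i - sdir i) = half_slope (opp_end S f i True)"
  "g f (spt i 0) \<bullet> inward i = half_chi (opp_end S f i False)"
  "g f (spt i 1) \<bullet> (inward i - sdir i) = half_chi (opp_end S f i True)"
proof -
 have l: "(f, j) : edge_link S (face S f j)" if "j < 3" for j using f that by (simp add: edge_link_def)
 note s = side_slope[OF l dir_ok_ends(1)] side_slope[OF l dir_ok_ends(2)]
 show "Ths f (spt i 0) (inward i) = half_slope (opp_end S f i False)"
  by (rule opp_end_values(1)[OF _ _ i]) (use s in \<open>simp_all add: half_slope_def\<close>)
 show "Ths f (spt i 1) (inward i - sdir i) = half_slope (opp_end S f i True)"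
  by (rule opp_end_values(2)[OF _ _ i]) (use s in \<open>simp_all add: half_slope_def\<close>)
 have c: "g f (spt j t) \<bullet> sdir j = chi (face S f j) t" if "j < 3" "t : {0..1}" for j t
  by (rule chi_eq[OF face_edges[OF f that(1)] l[OF that(1)] that(2)])
 show "g f (spt i 0) \<bullet> inward i = half_chi (opp_end S f i False)"
  by (rule opp_end_values(1)[where V = "%y v. g f y \<bullet> v", OF _ _ i]) (use c in \<open>simp_all add: half_chi_def\<close>)
 show "g f (spt i 1) \<bullet> (inward i - sdir i) = half_chi (opp_end S f i True)"
  by (rule opp_end_values(2)[where V = "%y v. g f y \<bullet> v", OF _ _ i]) (use c in \<open>simp_all add: half_chi_def\<close>)
qed

lemma lap_half_chi:
 assumes e: "e : edges S"
 shows "lap S half_chi (e, b) = mult_edge e 0"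
proof -
 have L: "(SUM (f, i):edge_link S e. half_chi (opp_end S f i False)) = (SUM (f, i):edge_link S e. g f (spt i 0) \<bullet> inward i)"
  by (intro sum.cong refl) (use opp_slopes(3) edge_linkD(1,2) in fastforce)
 have R: "(SUM (f, i):edge_link S e. half_chi (opp_end S f i True)) = (SUM (f, i):edge_link S e. g f (spt i 1) \<bullet> inward i - chi e 1)"
 proof (intro sum.cong refl, clarify)
  fix f i assume l: "(f, i) : edge_link S e"
  show "half_chi (opp_end S f i True) = g f (spt i 1) \<bullet> inward i - chi e 1"
   using opp_slopes(4)[OF edge_linkD(1,2)[OF l]] chi_eq[OF e l, of 1] by (simp add: inner_diff_right)
 qed
 have hc: "half_chi (e, True) = - chi e 1" "half_chi (e, False) = chi e 0" by (simp_all add: half_chi_def)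
 have "(SUM (f, i):edge_link S e. g f (spt i 1) \<bullet> inward i - chi e 1)
  = (SUM (f, i):edge_link S e. g f (spt i 1) \<bullet> inward i) - of_int (int (card (edge_link S e))) * chi e 1"
  by (simp add: case_prod_unfold sum_subtractf)
 also have "of_int (int (card (edge_link S e))) = (of_int (alpha S e False) + of_int (alpha S e True) :: real)"
  unfolding alpha_sum[OF e, symmetric] by simp
 finally have "lap S half_chi (e, True) = mult_edge e 1"
  by (simp add: lap_def R mult_edge_def hc algebra_simps)
 moreover have "lap S half_chi (e, False) = mult_edge e 0"
  by (simp add: lap_def L mult_edge_def hc)
 ultimately show ?thesis using mult_edge_const[OF e, of 1] by (cases b) auto
qed

lemma edge_weight_outside:
 assumes t: "t : {0..1}" and de: "de = 1 \<or> de = -1" "~ dir_ok t de"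
 shows "edge_weight S D e t de = 0"
proof -
 have sub: "edge_seg S sg e <= {0..1}" if "valid_segment S sg" for sg
 proof (cases sg)
  case (ESegment e' a b)
  then show ?thesis using that closed_segment_subset[of a "{0..1}" b] by (auto simp: convex_real_interval)
 next
  case (TSegment f a b)
  then have "closed_segment a b <= std" using that segment_std by auto
  moreover have "t : {0..1}" if "i < 3" "spt i t : std" for i t
   using side_point_std_iff[OF that(1)] that(2) by blast
  ultimately show ?thesis unfolding TSegment edge_seg.simps by blast
 qed
 have "~ in_germ (edge_seg S sg e) t de" if K: "sg : keys D" for sg
 proof
  assume "in_germ (edge_seg S sg e) t de"
  then obtain x where "x > 0" "t + x *R de : edge_seg S sg e" by (auto simp: in_germ_def tangent_def)
  moreover then have "t + x *R de : {0..1}" using sub valid K by blast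
  ultimately show False using t de by (auto simp: dir_ok_def)
 qed
 then have "{sg : keys D. in_germ (edge_seg S sg e) t de} = {}" by blast
 then show ?thesis unfolding edge_weight_def by (simp only: sum.empty)
qed

lemma edge_slope_has_dir:
 assumes e: "e : edges S" and d: "dir_ok t de"
 shows "has_dir (%s. Th (edge_map S e s)) t de (edge_slope e t de)"
proof -
 note l = chart[OF e]
 show ?thesis
  unfolding edge_slope_def
  by (rule has_dir_self[OF edge_has_dir[OF l d Theta_conic[OF edge_linkD(1)[OF l] edge_linkD(4)[OF l room(3)[OF d]]]]])
qed

lemma edge_contribution:
 assumes e: "e : edges S" and B: "finite B" "VPoint ` verts S <= B"
  and kinks: "!!t. 0 < t ==> t < 1 ==> edge_slope e t 1 + edge_slope e t (-1) ~= 0 ==> edge_map S e t : B"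
 shows "(SUM (f, i):edge_link S e. (SUM t:{t : {0<..<1}. edge_map S e t : B}. tri_sum f (spt i t))
    + corner_terms f i)
   + (SUM t:{t : {0..1}. edge_map S e t : B}. SUM de:{1, -1}. edge_weight S D e t de * (de * chi e t))
  = half_chi (e, False) * (mult_edge e 0 + lap S half_slope (e, False)) + half_chi (e, True) * (mult_edge e 0 + lap S half_slope (e, True))
   - mult_edge e 0 * (half_slope (e, False) + half_slope (e, True))"
proof -
 define T where "T = {t : {0<..<1}. edge_map S e t : B}"
 define W where "W t = (SUM de:{1, -1}. edge_weight S D e t de * (de * chi e t))" for t
 have fT: "finite T" by (rule finite_subset[OF _ finite_edge_map_fiber[OF B(1), of e]]) (auto simp: T_def)
 have "edge_map S e 0 : B" "edge_map S e 1 : B" using B(2) endpt_verts[OF e] by (auto simp: edge_map_def)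
 then have "{t : {0..1}. edge_map S e t : B} = {0, 1} Un T" by (auto simp: T_def less_le)
 then have "(SUM t:{t : {0..1}. edge_map S e t : B}. W t) = (SUM t:{0, 1} Un T. W t)" by simp
 also have "... = (SUM t:{0, 1}. W t) + (SUM t:T. W t)" using fT by (intro sum.union_disjoint) (auto simp: T_def)
 finally have WB: "(SUM t:{t : {0..1}. edge_map S e t : B}. W t) = W 0 + W 1 + (SUM t:T. W t)" by simp
 let ?s = "%f i t de. dirder (Ths f (spt i t)) (de *R sdir i) (inward i)"
 have interior: "(SUM (f, i):edge_link S e. tri_sum f (spt i t)) + W t
   = (edge_slope e t 1 + edge_slope e t (-1)) * mult_edge e 0" if t: "t : T" for t
 proof -
  have t': "0 < t" "t < 1" "t : {0..1}" using t by (auto simp: T_def)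
  then have d: "dir_ok t 1" "dir_ok t (-1)" by (auto simp: dir_ok_def)
  have "(SUM (f, i):edge_link S e. tri_sum f (spt i t))
   = (SUM (f, i):edge_link S e. chi e t * (?s f i t (-1) - ?s f i t 1) + (edge_slope e t 1 + edge_slope e t (-1)) * (g f (spt i t) \<bullet> inward i))"
  proof (intro sum.cong refl, clarify)
   fix f i assume l: "(f, i) : edge_link S e"
   show "tri_sum f (spt i t) = chi e t * (?s f i t (-1) - ?s f i t 1) + (edge_slope e t 1 + edge_slope e t (-1)) * (g f (spt i t) \<bullet> inward i)"
    using tri_sum_side[OF edge_linkD(1,2)[OF l] t'(1,2)] chi_eq[OF e l t'(3)] side_slope[OF l d(1)] side_slope[OF l d(2)]
    by (simp add: mult.commute)
  qed
  also have "... = chi e t * ((SUM (f, i):edge_link S e. ?s f i t (-1)) - (SUM (f, i):edge_link S e. ?s f i t 1))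
    + (edge_slope e t 1 + edge_slope e t (-1)) * (SUM (f, i):edge_link S e. g f (spt i t) \<bullet> inward i)"
   by (simp only: case_prod_unfold sum.distrib sum_subtractf sum_distrib_left[symmetric])
  finally have 1: "(SUM (f, i):edge_link S e. tri_sum f (spt i t))
   = chi e t * ((SUM (f, i):edge_link S e. ?s f i t (-1)) - (SUM (f, i):edge_link S e. ?s f i t 1))
    + (edge_slope e t 1 + edge_slope e t (-1)) * (SUM (f, i):edge_link S e. g f (spt i t) \<bullet> inward i)" .
  have 2: "W t = chi e t * (edge_bend e t 1 - edge_bend e t (-1))"
   by (simp add: W_def edge_slope_split[OF e d(1)] edge_slope_split[OF e d(2)] algebra_simps)
  have "(SUM (f, i):edge_link S e. tri_sum f (spt i t)) + W t = (edge_slope e t 1 + edge_slope e t (-1)) * mult_edge e t"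
   unfolding 1 2 edge_bend_def mult_edge_def by (simp add: algebra_simps)
  then show ?thesis unfolding mult_edge_const[OF e t'(3)] .
 qed
 have tail: "(SUM (f, i):edge_link S e. cone_term f (spt i 0) (sdir i) (inward i)) + W 0
   = half_chi (e, False) * (mult_edge e 0 + lap S half_slope (e, False))"
 proof -
  have "(SUM (f, i):edge_link S e. cone_term f (spt i 0) (sdir i) (inward i))
   = (SUM (f, i):edge_link S e. chi e 0 * (half_slope (opp_end S f i False) - ?s f i 0 1))"
  proof (intro sum.cong refl, clarify)
   fix f i assume l: "(f, i) : edge_link S e"
   show "cone_term f (spt i 0) (sdir i) (inward i) = chi e 0 * (half_slope (opp_end S f i False) - ?s f i 0 1)"
    using opp_slopes(1)[OF edge_linkD(1,2)[OF l]] chi_eq[OF e l, of 0] by (simp add: cone_term_def)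
  qed
  also have "... = chi e 0 * ((SUM (f, i):edge_link S e. half_slope (opp_end S f i False)) - (SUM (f, i):edge_link S e. ?s f i 0 1))"
   by (simp only: case_prod_unfold sum_subtractf sum_distrib_left[symmetric])
  finally have 1: "(SUM (f, i):edge_link S e. cone_term f (spt i 0) (sdir i) (inward i)) = ..." .
  have "edge_weight S D e 0 (-1) = 0" by (rule edge_weight_outside) (auto simp: dir_ok_def)
  then have 2: "W 0 = chi e 0 * (edge_bend e 0 1 + mult_edge e 0)"
   by (simp add: W_def edge_slope_split[OF e dir_ok_ends(1)])
  show ?thesis unfolding 1 2 edge_bend_def lap_def by (simp add: half_chi_def half_slope_def algebra_simps)
 qed
 have head: "(SUM (f, i):edge_link S e. cone_term f (spt i 1) (- sdir i) (inward i - sdir i)) + W 1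
   = half_chi (e, True) * (mult_edge e 0 + lap S half_slope (e, True))"
 proof -
  have shift: "dirder (Ths f (spt i 1)) (- sdir i) (inward i - sdir i) = ?s f i 1 (-1) + edge_slope e 1 (-1)"
   if l: "(f, i) : edge_link S e" for f i
  proof -
   note L = edge_linkD[OF l]
   have y: "spt i 1 : std" using L(4)[of 1] by simp
   have c: "tri_cone (spt i 1) (- sdir i) (inward i - sdir i)" by (rule tri_cone_side_end[OF L(2)])
   let ?Ps = "Ps (tri_map S f (spt i 1))" and ?y = "spt i 1"
   have E: "dirder (tslope f ?y ?Ps) (- sdir i) (inward i)
     = dirder (tslope f ?y ?Ps) (- sdir i) (inward i - sdir i) - tslope f ?y ?Ps (- sdir i)"
    using cone_ends(1)[OF valid le_chart[OF L(1) y] L(1) y c] by simp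
   have t: "- sdir i : tangent std ?y" "- sdir i + 1 *R inward i : tangent std ?y"
    using sdir_tangent[OF dir_ok_ends(2) L(2)] by simp_all
   have t': "- sdir i + 1 *R (inward i - sdir i) : tangent std ?y"
    using tri_cone_tangent[OF c y, of 1 1] by simp
   note s = slope_split[OF L(1) y split[OF L(1) y] t(1)]
   show ?thesis using E side_slope[OF l dir_ok_ends(2)] unfolding s(1) s(2)[OF room_one t(2)] s(2)[OF room_one t']
    by (simp add: inner_diff_right)
  qed
  have "(SUM (f, i):edge_link S e. cone_term f (spt i 1) (- sdir i) (inward i - sdir i))
   = (SUM (f, i):edge_link S e. - chi e 1 * (half_slope (opp_end S f i True) - ?s f i 1 (-1) - edge_slope e 1 (-1)))"
  proof (intro sum.cong refl, clarify)
   fix f i assume l: "(f, i) : edge_link S e"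
   show "cone_term f (spt i 1) (- sdir i) (inward i - sdir i) = - chi e 1 * (half_slope (opp_end S f i True) - ?s f i 1 (-1) - edge_slope e 1 (-1))"
    using opp_slopes(2)[OF edge_linkD(1,2)[OF l]] chi_eq[OF e l, of 1] shift[OF l] by (simp add: cone_term_def)
  qed
  also have "... = - chi e 1 * ((SUM (f, i):edge_link S e. half_slope (opp_end S f i True)) - (SUM (f, i):edge_link S e. ?s f i 1 (-1))
    - of_int (int (card (edge_link S e))) * edge_slope e 1 (-1))"
   by (simp only: case_prod_unfold sum_subtractf sum_distrib_left[symmetric] sum_constant of_int_of_nat_eq)
  finally have 1: "(SUM (f, i):edge_link S e. cone_term f (spt i 1) (- sdir i) (inward i - sdir i))
   = - chi e 1 * ((SUM (f, i):edge_link S e. half_slope (opp_end S f i True)) - (SUM (f, i):edge_link S e. ?s f i 1 (-1))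
    - (of_int (alpha S e False) + of_int (alpha S e True)) * edge_slope e 1 (-1))"
   unfolding alpha_sum[OF e, symmetric] by simp
  have "edge_weight S D e 1 1 = 0" by (rule edge_weight_outside) (auto simp: dir_ok_def)
  then have 2: "W 1 = - chi e 1 * (edge_bend e 1 (-1) + mult_edge e 0)"
   using mult_edge_const[OF e, of 1] by (simp add: W_def edge_slope_split[OF e dir_ok_ends(2)])
  show ?thesis unfolding 1 2 edge_bend_def lap_def by (simp add: half_chi_def half_slope_def algebra_simps)
 qed
 have jumps: "(SUM t:T. edge_slope e t 1 + edge_slope e t (-1)) = - half_slope (e, True) - half_slope (e, False)"
 proof -
  let ?k = "%s. Th (edge_map S e s)"
  note hd = edge_slope_has_dir[OF e]
  define J where "J = {t. 0 < t & t < 1 & edge_slope e t 1 + edge_slope e t (-1) ~= 0}"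
  have R: "has_dir ?k x 1 (edge_slope e x 1)" if "0 <= x" "x < 1" for x using hd[of x 1] that by (simp add: dir_ok_def)
  have L: "has_dir ?k x (-1) (edge_slope e x (-1))" if "0 < x" "x <= 1" for x using hd[of x "-1"] that by (simp add: dir_ok_def)
  have "finite J & (SUM x:J. (edge_slope e x 1 + edge_slope e x (-1)) * (1 + 0 * x))
   = - ((1 + 0 * 1) * edge_slope e 1 (-1)) - (1 + 0 * 0) * edge_slope e 0 1 - 0 * (?k 1 - ?k 0)"
   unfolding J_def by (rule sum_jumps) (use R L in auto)
  moreover have "(SUM t:T. edge_slope e t 1 + edge_slope e t (-1)) = (SUM x:J. edge_slope e x 1 + edge_slope e x (-1))"
   using fT kinks by (intro sum.mono_neutral_right) (auto simp: J_def T_def)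
  ultimately show ?thesis by (simp add: half_slope_def)
 qed
 have "(SUM (f, i):edge_link S e. (SUM t:T. tri_sum f (spt i t))
    + corner_terms f i)
   + (W 0 + W 1 + (SUM t:T. W t))
  = (SUM t:T. (SUM (f, i):edge_link S e. tri_sum f (spt i t)) + W t)
   + ((SUM (f, i):edge_link S e. cone_term f (spt i 0) (sdir i) (inward i)) + W 0)
   + ((SUM (f, i):edge_link S e. cone_term f (spt i 1) (- sdir i) (inward i - sdir i)) + W 1)"
  unfolding case_prod_unfold corner_terms_def sum.distrib sum.swap[of _ T] by simp
 also have "(SUM t:T. (SUM (f, i):edge_link S e. tri_sum f (spt i t)) + W t)
   = (SUM t:T. edge_slope e t 1 + edge_slope e t (-1)) * mult_edge e 0"
  unfolding sum_distrib_right by (rule sum.cong[OF refl interior])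
 finally show ?thesis unfolding jumps tail head T_def[symmetric] W_def[symmetric] WB by (simp add: algebra_simps)
qed

end

context divisor_splitting
begin

lemma finite_edge_kinks:
 assumes e: "e : edges S"
 shows "finite {t. 0 < t & t < 1 & edge_slope e t 1 + edge_slope e t (-1) ~= 0}"
proof -
 let ?k = "%s. Th (edge_map S e s)"
 note hd = edge_slope_has_dir[OF e]
 have R: "has_dir ?k x 1 (edge_slope e x 1)" if "0 <= x" "x < 1" for x using hd[of x 1] that by (simp add: dir_ok_def)
 have L: "has_dir ?k x (-1) (edge_slope e x (-1))" if "0 < x" "x <= 1" for x using hd[of x "-1"] that by (simp add: dir_ok_def)
 show ?thesis by (rule sum_jumps[where k = ?k, THEN conjunct1]) (use R L in auto)
qed

lemma degree_half_chi:
 assumes B: "finite B" "VPoint ` verts S <= B"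
  and tel: "!!sg. sg : keys D ==>
   (SUM ta:{ta : {0..1}. segment_path S sg ta : B}. end_sum (outgoing_slope S Th sg) ta) = 0"
  and kinks: "!!e t. e : edges S ==> 0 < t ==> t < 1 ==> edge_slope e t 1 + edge_slope e t (-1) ~= 0 ==> edge_map S e t : B"
 shows "(SUM p:B. local_intersection_degree S D (Ps p) p) = (SUM v:verts S. SUM x:link_verts S v. half_chi x * lap S half_chi x)"
proof -
 define Q where "Q e f i = (SUM t:{t : {0<..<1}. edge_map S e t : B}. tri_sum f (spt i t))
    + corner_terms f i" for e f i
 define W where "W e = (SUM t:{t : {0..1}. edge_map S e t : B}. SUM de:{1, -1}. edge_weight S D e t de * (de * chi e t))" for e
 have "(SUM f:tris S. SUM y:{y : std. tri_map S f y : B}. tri_sum f y) = (SUM f:tris S. SUM i<3. Q (face S f i) f i)"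
  unfolding Q_def by (rule sum.cong[OF refl sum_triangle_points[OF _ B]])
 also have "... = (SUM f:tris S. SUM i<3. SUM e:edges S. if face S f i = e then Q e f i else 0)"
  using fin(2) face_edges by (intro sum.cong refl) simp
 also have "... = (SUM f:tris S. SUM e:edges S. SUM i<3. if face S f i = e then Q e f i else 0)"
  by (intro sum.cong refl sum.swap)
 also have "... = (SUM e:edges S. SUM f:tris S. SUM i<3. if face S f i = e then Q e f i else 0)"
  by (rule sum.swap)
 also have "... = (SUM e:edges S. SUM (f, i):edge_link S e. Q e f i)"
  unfolding sum_edge_link[OF fin(3)] ..
 finally have tris_eq: "(SUM f:tris S. SUM y:{y : std. tri_map S f y : B}. tri_sum f y)
  = (SUM e:edges S. SUM (f, i):edge_link S e. Q e f i)" .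
 have "(SUM p:B. local_intersection_degree S D (Ps p) p)
  = (SUM f:tris S. SUM y:{y : std. tri_map S f y : B}. tri_sum f y) + (SUM e:edges S. W e)"
  unfolding W_def by (rule degree_sum[OF B(1)]) (erule tel)
 also have "... = (SUM e:edges S. (SUM (f, i):edge_link S e. Q e f i) + W e)"
  unfolding tris_eq sum.distrib ..
 also have "... = (SUM e:edges S. half_chi (e, False) * (mult_edge e 0 + lap S half_slope (e, False))
   + half_chi (e, True) * (mult_edge e 0 + lap S half_slope (e, True))
   - mult_edge e 0 * (half_slope (e, False) + half_slope (e, True)))"
 proof (rule sum.cong[OF refl])
  fix e assume e: "e : edges S"
  show "(SUM (f, i):edge_link S e. Q e f i) + W e = half_chi (e, False) * (mult_edge e 0 + lap S half_slope (e, False))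
   + half_chi (e, True) * (mult_edge e 0 + lap S half_slope (e, True))
   - mult_edge e 0 * (half_slope (e, False) + half_slope (e, True))"
   unfolding Q_def W_def by (rule edge_contribution[OF e B]) (rule kinks[OF e])
 qed
 also have "... = (SUM e:edges S. half_chi (e, False) * lap S half_chi (e, False) + half_chi (e, True) * lap S half_chi (e, True))
   + (SUM e:edges S. half_chi (e, False) * lap S half_slope (e, False) + half_chi (e, True) * lap S half_slope (e, True))
   - (SUM e:edges S. half_slope (e, False) * lap S half_chi (e, False) + half_slope (e, True) * lap S half_chi (e, True))"
  unfolding sum.distrib[symmetric] sum_subtractf[symmetric]
  by (rule sum.cong[OF refl]) (simp add: lap_half_chi algebra_simps)
 also have "... = (SUM v:verts S. SUM x:link_verts S v. half_chi x * lap S half_chi x)"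
  unfolding sum_link_verts[symmetric, of "%x. half_chi x * lap S half_chi x"]
   sum_link_verts[symmetric, of "%x. half_chi x * lap S half_slope x"]
   sum_link_verts[symmetric, of "%x. half_slope x * lap S half_chi x"]
   lap_selfadjoint[of half_chi half_slope] by simp
 finally show ?thesis .
qed

end

context ct_surface
begin

lemma connecting_span_full_of_divisor:
 assumes D: "is_divisor S D" and pos: "self_intersection S D > 0"
 shows "H1_span (realization S) (D_connecting S ` D_sections S) = H1 (realization S)"
proof -
 define Ps where "Ps p = (SOME ps. local_equation S D p ps)" for p
 have valid: "ALL sg:keys D. valid_segment S sg" using D by (simp add: is_divisor_def)
 have le: "local_equation S D p (Ps p)" if "p : points S" for p
  unfolding Ps_def using D that by (intro someI_ex[of "local_equation S D p"]) (auto simp: is_divisor_def)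
 have "EX Th. ALL f:tris S. ALL y:std. EX L. affine_function L &
  (\<forall>\<^sub>F z in nhds y. z : std --> Ps (tri_map S f y) (tri_map S f z) = Th (tri_map S f z) + L z)"
 proof (rule global_equation[OF valid le])
  fix Th assume "!!f y. f : tris S ==> y : std ==> EX L. affine_function L &
   (\<forall>\<^sub>F z in nhds y. z : std --> Ps (tri_map S f y) (tri_map S f z) = Th (tri_map S f z) + L z)"
  then show ?thesis by (intro exI[of _ Th] ballI)
 qed
 then obtain Th where Th: "ALL f:tris S. ALL y:std. EX L. affine_function L &
  (\<forall>\<^sub>F z in nhds y. z : std --> Ps (tri_map S f y) (tri_map S f z) = Th (tri_map S f z) + L z)" ..
 define germ where "germ f y x <-> (\<forall>\<^sub>F z in nhds y. z : std -->
  Ps (tri_map S f y) (tri_map S f z) = Th (tri_map S f z) + (fst x + snd x \<bullet> z))" for f y and x :: "real \<times> real \<times> real"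
 have ex: "EX x. germ f y x" if fy: "f : tris S" "y : std" for f y
 proof -
  obtain L where L: "affine_function L"
   "\<forall>\<^sub>F z in nhds y. z : std --> Ps (tri_map S f y) (tri_map S f z) = Th (tri_map S f z) + L z"
   using Th fy by blast
  obtain c g where "L = (%z. c + g \<bullet> z)" using L(1) unfolding affine_function_def by blast
  then show ?thesis using L(2) by (intro exI[of _ "(c, g)"]) (simp add: germ_def)
 qed
 define c where "c f y = fst (SOME x. germ f y x)" for f y
 define g where "g f y = snd (SOME x. germ f y x)" for f y
 have cg: "\<forall>\<^sub>F z in nhds y. z : std --> Ps (tri_map S f y) (tri_map S f z) = Th (tri_map S f z) + (c f y + g f y \<bullet> z)"
  if "f : tris S" "y : std" for f y
  using someI_ex[OF ex[OF that]] unfolding germ_def c_def g_def .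
 interpret divisor_splitting S D Ps Th g c
  by unfold_locales (rule valid, erule le, erule (1) cg)
 define deg where "deg p = local_intersection_degree S D (Ps p) p" for p
 define P where "P = {p : points S. deg p ~= 0}"
 have si: "self_intersection S D = (SUM p:P. deg p)" by (simp add: self_intersection_def P_def deg_def Ps_def)
 have fP: "finite P" using pos unfolding si by (rule contrapos_pp) simp
 have "EX K. finite K & K <= {0..1} & (ALL T. finite T --> K <= T --> T <= {0..1} -->
   (SUM ta:T. end_sum (outgoing_slope S Th sg) ta) = 0)" if "sg : keys D" for sg
  using telescoping[of sg] valid that by metis
 then obtain K where K: "!!sg. sg : keys D ==> finite (K sg) & K sg <= {0..1} &
   (ALL T. finite T --> K sg <= T --> T <= {0..1} --> (SUM ta:T. end_sum (outgoing_slope S Th sg) ta) = 0)"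
  by metis
 define J where "J e = {t. 0 < t & t < 1 & edge_slope e t 1 + edge_slope e t (-1) ~= 0}" for e
 define B where "B = P Un VPoint ` verts S Un (\<Union>sg\<in>keys D. segment_path S sg ` K sg) Un (\<Union>e\<in>edges S. edge_map S e ` J e)"
 have fB: "finite B" unfolding B_def J_def using fP fin K finite_edge_kinks by auto
 have path: "segment_path S sg ta : points S" if "sg : keys D" "ta : {0..1}" for sg ta
 proof -
  obtain f a b where l: "lift sg = (f, a, b)" by (cases "lift sg") auto
  have "valid_segment S sg" using valid that(1) by blast
  from lift(1,5,6)[OF this l] that(2) show ?thesis by (simp only: tri_map_points)
 qed
 have Bp: "B <= points S"
 proof -
  have "segment_path S sg ` K sg <= points S" if "sg : keys D" for sg using path[OF that] K[OF that] by blast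
  moreover have "edge_map S e ` J e <= points S" if "e : edges S" for e
   using edge_map_points[OF that] by (auto simp: J_def)
  moreover have "VPoint ` verts S <= points S" by (auto simp: points_def)
  ultimately show ?thesis unfolding B_def P_def by blast
 qed
 have "(SUM p:B. deg p) = (SUM p:P. deg p)"
 proof (rule sum.mono_neutral_right[OF fB])
  show "P <= B" unfolding B_def by blast
  show "ALL p:B - P. deg p = 0" using Bp unfolding P_def by blast
 qed
 moreover have "(SUM p:B. deg p) = (SUM v:verts S. SUM x:link_verts S v. half_chi x * lap S half_chi x)"
  unfolding deg_def
 proof (rule degree_half_chi[OF fB])
  show "VPoint ` verts S <= B" by (auto simp: B_def)
  show "(SUM ta:{ta : {0..1}. segment_path S sg ta : B}. end_sum (outgoing_slope S Th sg) ta) = 0"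
   if k: "sg : keys D" for sg
  proof -
   have "K sg <= {ta : {0..1}. segment_path S sg ta : B}" using K[OF k] k unfolding B_def by blast
   moreover have "finite {ta : {0..1}. segment_path S sg ta : B}" using finite_path_fiber valid k fB by blast
   ultimately show ?thesis using K[OF k] by blast
  qed
  show "edge_map S e t : B" if "e : edges S" "0 < t" "t < 1" "edge_slope e t 1 + edge_slope e t (-1) ~= 0" for e t
   using that unfolding B_def J_def by blast
 qed
 ultimately have "(SUM v:verts S. SUM x:link_verts S v. half_chi x * lap S half_chi x) > 0" using pos si by simp
 then show ?thesis by (intro connecting_span_full[of half_chi]) (simp_all add: lap_half_chi)
qed

end

theorem theorem4p7:
 fixes \<Delta> :: "('v, 'e, 'f) surface_data"
 assumes "tropical_surface \<Delta>"
  and "locally_connected_through_codim_1 \<Delta>"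
 shows "H1_codim (realization \<Delta>) (H1_span (realization \<Delta>) (D_connecting \<Delta> ` D_sections \<Delta>)) \<le> 1 \<and>
  ((\<exists>D. is_divisor \<Delta> D \<and> self_intersection \<Delta> D > 0) \<longrightarrow>
   H1_span (realization \<Delta>) (D_connecting \<Delta> ` D_sections \<Delta>) = H1 (realization \<Delta>))"
proof -
 interpret ct_surface \<Delta> using assms by unfold_locales
 show ?thesis using connecting_span_codim connecting_span_full_of_divisor by blast
qed

end
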